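(* Let $f$ be a Hecke-Maass cusp form for $SL_2(\mathbb{Z})$ and let $q$ be an odd prime. For any integer $N\ge 1$ we have \[ \mathop{{\sum}^{+}}_{\chi\bmod q } \frac{\tau(\chi)}{q^{1/2}} L(\tfrac{1}{2}, f\times \overline{\chi}) = 2 L(\tfrac{1}{2}, f)\, q^{1/2} - \lambda_f(q) L(\tfrac{1}{2}, f) + \sum_{n=1 }^{N} c_{n,f}\, q^{-n/2}+O_{N,f}\Big(q^{-(N+1)/2}\Big), \] \[ \mathop{{\sum}^{-}}_{\chi\bmod q } \frac{\tau(\chi)}{q^{1/2}} L(\tfrac{1}{2}, f\times \overline{\chi}) = \sum_{n=1 }^{N} c_{n,f}'\, q^{-n/2}+O_{N,f}\Big(q^{-(N+1)/2}\Big), \] for some constants $c_{n,f}, c_{n,f}'$ (independent of $q$).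
   Context: $f$ is a Hecke-Maass cusp form for $SL_2(\mathbb{Z})$ with Hecke eigenvalues $\lambda_f(n)$ (normalized with $\lambda_f(1)=1$), and $L(s,f)=\sum_{n\ge1}\lambda_f(n)n^{-s}$ is its $L$-function (analytically continued). For a primitive Dirichlet character $\chi$ mod $q$, $L(s,f\times\chi)$ is defined for $\Re(s)>1$ by $\sum_{n\ge 1}\lambda_f(n)\chi(n)n^{-s}$ and elsewhere by analytic continuation. $\tau(\chi)=\sum_{k=1}^{q-1}e^{2\pi i k/q}\chi(k)$ is the Gauss sum. $\mathop{{\sum}^{+}}_{\chi\bmod q}$ denotes the sum over even primitive Dirichlet characters mod $q$ (those with $\chi(-1)=1$), and $\mathop{{\sum}^{-}}_{\chi\bmod q}$ the sum over odd primitive Dirichlet characters mod $q$ (those with $\chi(-1)=-1$). *)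

theory Defs
  imports "HOL-Complex_Analysis.Complex_Analysis" "HOL-Number_Theory.Number_Theory"
begin

section \<open>Hecke-Maass cusp forms for the full modular group\<close>

text \<open>
  A form is a function on all of \<^typ>\<open>complex\<close>, of which only the values on the upper half
  plane matter.
\<close>

definition upper_half_plane :: "complex set" where
  "upper_half_plane = {z. Im z > 0}"

definition partial_x :: "(complex \<Rightarrow> complex) \<Rightarrow> complex \<Rightarrow> complex" where
  "partial_x f z = vector_derivative (\<lambda>t. f (z + of_real t)) (at 0)"

definition partial_y :: "(complex \<Rightarrow> complex) \<Rightarrow> complex \<Rightarrow> complex" where
  "partial_y f z = vector_derivative (\<lambda>t. f (z + \<i> * of_real t)) (at 0)"

text \<open>
  Differentiability is meant in the real sense here (\<^const>\<open>differentiable_on\<close> refers to the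
  Frechet derivative over the reals); the set is intended to be open.
\<close>

primrec C_k_on :: "nat \<Rightarrow> complex set \<Rightarrow> (complex \<Rightarrow> complex) \<Rightarrow> bool" where
  "C_k_on 0 S f \<longleftrightarrow> continuous_on S f"
| "C_k_on (Suc k) S f \<longleftrightarrow>
     f differentiable_on S \<and> C_k_on k S (partial_x f) \<and> C_k_on k S (partial_y f)"

definition smooth_on :: "complex set \<Rightarrow> (complex \<Rightarrow> complex) \<Rightarrow> bool" where
  "smooth_on S f \<longleftrightarrow> (\<forall>k. C_k_on k S f)"

definition hyperbolic_laplacian :: "(complex \<Rightarrow> complex) \<Rightarrow> complex \<Rightarrow> complex" where
  "hyperbolic_laplacian f z =
     - of_real ((Im z)\<^sup>2) * (partial_x (partial_x f) z + partial_y (partial_y f) z)"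

definition SL2Z_invariant :: "(complex \<Rightarrow> complex) \<Rightarrow> bool" where
  "SL2Z_invariant f \<longleftrightarrow>
     (\<forall>a b c d :: int. a * d - b * c = 1 \<longrightarrow>
       (\<forall>z\<in>upper_half_plane.
          f ((of_int a * z + of_int b) / (of_int c * z + of_int d)) = f z))"

definition maass_cusp_form :: "(complex \<Rightarrow> complex) \<Rightarrow> bool" where
  "maass_cusp_form f \<longleftrightarrow>
     smooth_on upper_half_plane f \<and>
     (\<exists>z\<in>upper_half_plane. f z \<noteq> 0) \<and>
     SL2Z_invariant f \<and>
     (\<exists>\<mu>. \<forall>z\<in>upper_half_plane. hyperbolic_laplacian f z = \<mu> * f z) \<and>
     (\<exists>C A. \<forall>z. Im z \<ge> 1 \<longrightarrow> norm (f z) \<le> C * Im z powr A) \<and>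
     (\<forall>y>0. integral {0..1} (\<lambda>x. f (Complex x y)) = 0)"

text \<open>
  The Hecke operator $T_n f(z) = n^{-1/2} \sum_{ad = n} \sum_{b \bmod d} f((az+b)/d)$.
\<close>

definition hecke_operator :: "nat \<Rightarrow> (complex \<Rightarrow> complex) \<Rightarrow> complex \<Rightarrow> complex" where
  "hecke_operator n f z =
     (\<Sum>d | d dvd n. \<Sum>b<d. f ((of_nat (n div d) * z + of_nat b) / of_nat d)) / of_real (sqrt (real n))"

definition hecke_maass_cusp_form :: "(complex \<Rightarrow> complex) \<Rightarrow> bool" where
  "hecke_maass_cusp_form f \<longleftrightarrow>
     maass_cusp_form f \<and>
     (\<forall>n\<ge>1. \<exists>l. \<forall>z\<in>upper_half_plane. hecke_operator n f z = l * f z)"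

definition hecke_eigenvalue :: "(complex \<Rightarrow> complex) \<Rightarrow> nat \<Rightarrow> complex" where
  "hecke_eigenvalue f n = (THE l. \<forall>z\<in>upper_half_plane. hecke_operator n f z = l * f z)"

lemma hecke_operator_eigenvalue:
  assumes "hecke_maass_cusp_form f" "n \<ge> 1" "z \<in> upper_half_plane"
  shows "hecke_operator n f z = hecke_eigenvalue f n * f z"
proof -
  obtain w where w: "w \<in> upper_half_plane" "f w \<noteq> 0"
    using assms(1) by (auto simp: hecke_maass_cusp_form_def maass_cusp_form_def)
  obtain l where l: "\<forall>z\<in>upper_half_plane. hecke_operator n f z = l * f z"
    using assms by (auto simp: hecke_maass_cusp_form_def)
  have "hecke_eigenvalue f n = l"
    unfolding hecke_eigenvalue_def
  proof (rule the_equality)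
    show "m = l" if "\<forall>z\<in>upper_half_plane. hecke_operator n f z = m * f z" for m
      using that l w by (metis mult_right_cancel)
  qed (use l in blast)
  thus ?thesis using l assms(3) by simp
qed

lemma hecke_eigenvalue_1:
  assumes "hecke_maass_cusp_form f"
  shows "hecke_eigenvalue f 1 = 1"
proof -
  obtain w where w: "w \<in> upper_half_plane" "f w \<noteq> 0"
    using assms by (auto simp: hecke_maass_cusp_form_def maass_cusp_form_def)
  have "hecke_operator 1 f w = f w"
    by (simp add: hecke_operator_def)
  thus ?thesis using hecke_operator_eigenvalue[OF assms, of 1 w] w by simp
qed


section \<open>Dirichlet characters and Gauss sums\<close>

definition dirichlet_char :: "nat \<Rightarrow> (int \<Rightarrow> complex) \<Rightarrow> bool" where
  "dirichlet_char q \<xi> \<longleftrightarrow>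
     (\<forall>m n. \<xi> (m * n) = \<xi> m * \<xi> n) \<and>
     (\<forall>n. \<xi> (n + int q) = \<xi> n) \<and>
     (\<forall>n. \<xi> n \<noteq> 0 \<longleftrightarrow> coprime n (int q))"

text \<open>Primitive: not induced from a character modulo a proper divisor of the modulus.\<close>

definition primitive_char :: "nat \<Rightarrow> (int \<Rightarrow> complex) \<Rightarrow> bool" where
  "primitive_char q \<xi> \<longleftrightarrow>
     dirichlet_char q \<xi> \<and>
     (\<forall>d. d dvd q \<and> d < q \<longrightarrow>
        \<not> (\<exists>\<psi>. dirichlet_char d \<psi> \<and> (\<forall>n. coprime n (int q) \<longrightarrow> \<xi> n = \<psi> n)))"

definition even_primitive_chars :: "nat \<Rightarrow> (int \<Rightarrow> complex) set" where
  "even_primitive_chars q = {\<xi>. primitive_char q \<xi> \<and> \<xi> (- 1) = 1}"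

definition odd_primitive_chars :: "nat \<Rightarrow> (int \<Rightarrow> complex) set" where
  "odd_primitive_chars q = {\<xi>. primitive_char q \<xi> \<and> \<xi> (- 1) = - 1}"

definition gauss_sum :: "nat \<Rightarrow> (int \<Rightarrow> complex) \<Rightarrow> complex" where
  "gauss_sum q \<xi> =
     (\<Sum>k = 1..q - 1. exp (2 * of_real pi * \<i> * of_nat k / of_nat q) * \<xi> (int k))"

text \<open>Finiteness ensures that sums over sets of characters have their usual meaning.\<close>

lemma finite_dirichlet_chars:
  assumes "q > 0"
  shows "finite {\<xi>. dirichlet_char q \<xi>}"
proof -
  define R where "R = insert 0 {z :: complex. z ^ totient q = 1}"
  have tot: "totient q > 0" using assms by simp
  have "finite R"
    unfolding R_def using finite_roots_unity[of "totient q"] tot by auto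
  have mod: "\<xi> n = \<xi> (n mod int q)" if "dirichlet_char q \<xi>" for \<xi> n
  proof -
    have per: "\<xi> (m + int q) = \<xi> m" for m using that by (simp add: dirichlet_char_def)
    have nat: "\<xi> (m + int k * int q) = \<xi> m" for m k
    proof (induction k)
      case (Suc k)
      have "\<xi> (m + int (Suc k) * int q) = \<xi> ((m + int k * int q) + int q)"
        by (simp add: algebra_simps)
      thus ?case using Suc per by simp
    qed simp
    show ?thesis
    proof (cases "n div int q \<ge> 0")
      case True
      thus ?thesis using nat[of "n mod int q" "nat (n div int q)"] by simp
    next
      case False
      have "n + int (nat (- (n div int q))) * int q = n mod int q"
        using False by (simp add: minus_div_mult_eq_mod [symmetric])
      thus ?thesis using nat[of n "nat (- (n div int q))"] by simp
    qed
  qed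
  have range: "\<xi> n \<in> R" if \<xi>: "dirichlet_char q \<xi>" for \<xi> n
  proof (cases "coprime n (int q)")
    case True
    have mult: "\<xi> (a * b) = \<xi> a * \<xi> b" for a b using \<xi> by (simp add: dirichlet_char_def)
    have "\<xi> 1 \<noteq> 0" using \<xi> by (simp add: dirichlet_char_def)
    hence one: "\<xi> 1 = 1" using mult[of 1 1] by simp
    have pow: "\<xi> (n ^ k) = \<xi> n ^ k" for k by (induction k) (simp_all add: one mult)
    define m where "m = nat (n mod int q)"
    have m: "int m = n mod int q" using assms by (simp add: m_def)
    have "coprime (int m) (int q)" using True assms m by simp
    hence "coprime m q" by simp
    hence "[m ^ totient q = 1] (mod q)" by (rule euler_theorem)
    hence "[int m ^ totient q = 1] (mod int q)"
      by (metis cong_int_iff of_nat_1 of_nat_power)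
    hence "[n ^ totient q = 1] (mod int q)"
      unfolding m by (simp add: cong_def power_mod)
    hence "\<xi> (n ^ totient q) = \<xi> 1"
      using mod[OF \<xi>, of "n ^ totient q"] mod[OF \<xi>, of 1] by (simp add: cong_def)
    thus ?thesis using pow one by (simp add: R_def)
  next
    case False
    thus ?thesis using \<xi> by (auto simp: dirichlet_char_def R_def)
  qed
  define F where "F = (\<lambda>\<xi> :: int \<Rightarrow> complex. restrict \<xi> {0..<int q})"
  have "inj_on F {\<xi>. dirichlet_char q \<xi>}"
  proof (rule inj_onI, rule ext)
    fix \<xi> \<psi> n
    assume "\<xi> \<in> {\<xi>. dirichlet_char q \<xi>}" "\<psi> \<in> {\<xi>. dirichlet_char q \<xi>}" and eq: "F \<xi> = F \<psi>"
    moreover have "\<xi> (n mod int q) = \<psi> (n mod int q)"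
      using fun_cong[OF eq, of "n mod int q"] assms by (simp add: F_def)
    ultimately show "\<xi> n = \<psi> n" using mod[of \<xi> n] mod[of \<psi> n] by simp
  qed
  moreover have "F ` {\<xi>. dirichlet_char q \<xi>} \<subseteq> {0..<int q} \<rightarrow>\<^sub>E R"
    using range by (auto simp: F_def)
  moreover have "finite ({0..<int q} \<rightarrow>\<^sub>E R)"
    using \<open>finite R\<close> by (intro finite_PiE) auto
  ultimately show ?thesis by (meson finite_imageD finite_subset)
qed


section \<open>\<open>L\<close>-functions\<close>

definition entire_continuation :: "(nat \<Rightarrow> complex) \<Rightarrow> (complex \<Rightarrow> complex) \<Rightarrow> bool" where
  "entire_continuation a F \<longleftrightarrow>
     F holomorphic_on UNIV \<and>
     (\<forall>s. Re s > 1 \<longrightarrow> (\<lambda>n. a (Suc n) / of_nat (Suc n) powr s) sums F s)"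

lemma entire_continuation_unique:
  assumes "entire_continuation a F" "entire_continuation a G"
  shows "F = G"
proof
  fix s
  have "F z = G z" if "Re z > 1" for z
    using assms that sums_unique2 unfolding entire_continuation_def by blast
  moreover have "open {z. Re z > 1}" by (simp add: open_halfspace_Re_gt)
  moreover have "{z. Re z > 1} \<noteq> {}"
    using exI[of "\<lambda>z. Re z > 1" 2] by simp
  ultimately show "F s = G s"
    using assms
    by (intro analytic_continuation_open[of "{z. Re z > 1}" UNIV F G s])
       (auto simp: entire_continuation_def)
qed

text \<open>
  The \<open>L\<close>-functions of cusp forms and of their twists by primitive characters are entire, so the
  analytic continuation is taken to the whole plane.
\<close>

definition L_series :: "(nat \<Rightarrow> complex) \<Rightarrow> complex \<Rightarrow> complex" where
  "L_series a = (THE F. entire_continuation a F)"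

definition L_form :: "(complex \<Rightarrow> complex) \<Rightarrow> complex \<Rightarrow> complex" where
  "L_form f s = L_series (hecke_eigenvalue f) s"

definition L_twist :: "(complex \<Rightarrow> complex) \<Rightarrow> (int \<Rightarrow> complex) \<Rightarrow> complex \<Rightarrow> complex" where
  "L_twist f \<xi> s = L_series (\<lambda>n. hecke_eigenvalue f n * \<xi> (int n)) s"

definition conj_char :: "(int \<Rightarrow> complex) \<Rightarrow> int \<Rightarrow> complex" where
  "conj_char \<xi> n = cnj (\<xi> n)"

end

theory Submission
  imports Defs
begin

text \<open>
  Orthogonality of characters turns the even (odd) moment into the value at \<open>1/2\<close> of the Dirichlet
  series of \<open>\<lambda>(n)\<close> twisted by \<open>(q - 1) cos(2 \<pi> n / q)\<close> (by \<open>(q - 1) i sin(2 \<pi> n / q)\<close>), up to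
  correction terms from the principal character and from the \<open>n\<close> divisible by \<open>q\<close>, which the Hecke
  relations express through \<open>L(1/2, f)\<close> and \<open>\<lambda>(q)\<close>.

  The additive twist at \<open>x = 1/q\<close> is, up to an archimedean factor, the integral of \<open>f\<close> (or of its
  \<open>x\<close>-derivative) along the vertical line over \<open>x\<close>. Modularity maps this line over \<open>1/q\<close> to the line
  over \<open>- 1/q\<close> and exchanges its two halves, so only the part \<open>y \<ge> 1/q\<close> matters. There \<open>f(x + i y)\<close> can be
  expanded by Taylor's theorem around \<open>x = 0\<close>: in the cone \<open>\<bar>x\<bar> \<le> y\<close> all derivatives of \<open>f\<close> decay
  rapidly towards the cusp \<open>0\<close>. This gives an expansion in powers of \<open>1/q\<close>.

  No Bessel functions are needed for the archimedean factor: it is the Mellin transform of a rapidly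
  decaying solution \<open>W\<close> of \<open>W'' = ((2 \<pi>)\<^sup>2 - \<mu> / y\<^sup>2) W\<close>, which satisfies a two-step recurrence and has no
  zeros to the right, so its reciprocal is entire.
\<close>

section \<open>Fourier coefficients on the circle\<close>

text \<open>A form is not assumed to have a parity. The Hecke operators express every Fourier
  coefficient of index n through the one of index 1 or -1, so a sign e = 1 or -1 is fixed for which
  W = a_1 + e a_{-1} does not vanish identically, and the lines over x and -x are combined with that
  sign. For e = -1 inversion makes the two lines cancel, and the values at 1/2 of L(s, f) and of
  both additive twists are zero. Absolute convergence for Re s > 1 does not come from a pointwise
  bound on the eigenvalues but from a mean square: Bessel's inequality on horizontal lines, used at
  a height adapted to the size of n. Each half of the line over 1/q resembles the whole line over 0.
  The cosine twist therefore tends to 4 L(1/2, f), twice its value at x = 0. The factor (q - 1) / (2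
  q^(1/2)) turns this into 2 L(1/2, f) q^(1/2) - 2 L(1/2, f) q^(-1/2), and the last term cancels
  against the correction terms.\<close>

definition fourier_coeff :: "(real \<Rightarrow> complex) \<Rightarrow> int \<Rightarrow> complex" where
  "fourier_coeff g n = integral {0..1} (\<lambda>x. g x * cis (- 2 * pi * of_int n * x))"

lemma cis_2pi_eq_1_iff: "cis (2 * pi * x) = 1 \<longleftrightarrow> x \<in> \<int>"
proof -
  have "cis (2 * pi * x) = exp (\<i> * of_real (2 * pi * x))"
    by (simp add: cis_conv_exp)
  also have "\<dots> = 1 \<longleftrightarrow> (\<exists>n::int. 2 * pi * x = of_int (2 * n) * pi)"
    by (subst exp_eq_1) (auto simp: mult_ac)
  also have "\<dots> \<longleftrightarrow> x \<in> \<int>"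
    by (auto simp: Ints_def)
  finally show ?thesis .
qed

lemma has_vector_derivative_cis_mult:
  "((\<lambda>x. cis (c * x)) has_vector_derivative (\<i> * of_real c * cis (c * x))) (at x within S)"
proof -
  have "((\<lambda>z. exp (\<i> * of_real c * z)) has_field_derivative (\<i> * of_real c * exp (\<i> * of_real c * of_real x)))
          (at (of_real x))"
    by (rule derivative_eq_intros refl | simp)+
  from has_vector_derivative_real_field[OF this, of S] show ?thesis
    by (simp add: cis_conv_exp mult_ac)
qed

lemma integral_cis_2pi:
  fixes m :: int
  shows "integral {0..1} (\<lambda>x. cis (2 * pi * of_int m * x)) = (if m = 0 then 1 else 0)"
proof (cases "m = 0")
  case False
  define c where "c = 2 * pi * of_int m"
  have c: "c \<noteq> 0" using False by (simp add: c_def)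
  have "((\<lambda>x. cis (c * x)) has_integral
          (cis (c * 1) / (\<i> * of_real c) - cis (c * 0) / (\<i> * of_real c))) {0..1}"
  proof (rule fundamental_theorem_of_calculus)
    show "((\<lambda>x. cis (c * x) / (\<i> * of_real c)) has_vector_derivative cis (c * x)) (at x within {0..1})" for x
      using has_vector_derivative_divide[OF has_vector_derivative_cis_mult[of c x "{0..1}"], of "\<i> * of_real c"] c
      by simp
  qed simp
  moreover have "cis (c * 1) = 1"
    using cis_2pi_eq_1_iff[of "of_int m"] by (simp add: c_def)
  ultimately show ?thesis using False by (simp add: integral_unique c_def)
qed simp

lemma integrable_fourier [intro]:
  fixes g :: "real \<Rightarrow> complex"
  assumes "continuous_on {0..1} g"
  shows "(\<lambda>x. g x * cis (c * x)) integrable_on {0..1}"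
  by (intro integrable_continuous_interval continuous_intros assms)

text \<open>Expand the nonnegative integral of |g - P|^2 for the partial Fourier sum P: the cross
  term and the norm of P both equal the left-hand side. Besides Riemann-Lebesgue, this is the source
  of the mean square bound for the Hecke eigenvalues.\<close>

lemma bessel_inequality:
  fixes g :: "real \<Rightarrow> complex"
  assumes g: "continuous_on {0..1} g" and S: "finite S"
  shows "(\<Sum>n\<in>S. (norm (fourier_coeff g n))\<^sup>2) \<le> integral {0..1} (\<lambda>x. (norm (g x))\<^sup>2)"
proof -
  define c where "c = fourier_coeff g"
  define P where "P = (\<lambda>x. \<Sum>n\<in>S. c n * cis (2 * pi * of_int n * x))"
  have contP: "continuous_on {0..1} P"
    unfolding P_def by (intro continuous_intros)
  have gP: "integral {0..1} (\<lambda>x. g x * cnj (P x)) = (\<Sum>n\<in>S. of_real ((norm (c n))\<^sup>2))"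
  proof -
    have "integral {0..1} (\<lambda>x. g x * cnj (P x)) =
            integral {0..1} (\<lambda>x. \<Sum>n\<in>S. cnj (c n) * (g x * cis (- 2 * pi * of_int n * x)))"
      by (simp add: P_def sum_distrib_left mult_ac cis_cnj)
    also have "\<dots> = (\<Sum>n\<in>S. integral {0..1} (\<lambda>x. cnj (c n) * (g x * cis (- 2 * pi * of_int n * x))))"
      using S g by (intro integral_sum integrable_on_mult_right integrable_fourier)
    also have "\<dots> = (\<Sum>n\<in>S. cnj (c n) * c n)"
      by (simp add: c_def fourier_coeff_def)
    finally show ?thesis unfolding complex_norm_square by (simp add: mult_ac)
  qed
  have PP: "integral {0..1} (\<lambda>x. P x * cnj (P x)) = (\<Sum>n\<in>S. of_real ((norm (c n))\<^sup>2))"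
  proof -
    have "integral {0..1} (\<lambda>x. P x * cnj (P x)) =
            integral {0..1} (\<lambda>x. \<Sum>n\<in>S. \<Sum>m\<in>S. c n * cnj (c m) * cis (2 * pi * of_int (n - m) * x))"
    proof (rule integral_cong)
      fix x
      have "c n * cis (2 * pi * of_int n * x) * (cnj (c m) * cnj (cis (2 * pi * of_int m * x))) =
            c n * cnj (c m) * cis (2 * pi * of_int (n - m) * x)" for n m
        by (simp add: cis_cnj cis_mult algebra_simps)
      hence "(\<Sum>n\<in>S. \<Sum>m\<in>S. c n * cis (2 * pi * of_int n * x) * (cnj (c m) * cnj (cis (2 * pi * of_int m * x)))) =
             (\<Sum>n\<in>S. \<Sum>m\<in>S. c n * cnj (c m) * cis (2 * pi * of_int (n - m) * x))"
        by (intro sum.cong refl)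
      thus "P x * cnj (P x) = (\<Sum>n\<in>S. \<Sum>m\<in>S. c n * cnj (c m) * cis (2 * pi * of_int (n - m) * x))"
        by (simp add: P_def sum_product)
    qed
    also have "\<dots> = (\<Sum>n\<in>S. \<Sum>m\<in>S. integral {0..1} (\<lambda>x. c n * cnj (c m) * cis (2 * pi * of_int (n - m) * x)))"
      using S by (subst integral_sum, simp, intro integrable_continuous_interval continuous_intros,
          intro sum.cong refl, subst integral_sum, simp, intro integrable_continuous_interval continuous_intros, simp)
    also have "\<dots> = (\<Sum>n\<in>S. \<Sum>m\<in>S. c n * cnj (c m) * (if n - m = 0 then 1 else 0))"
      unfolding integral_mult_right integral_cis_2pi ..
    also have "\<dots> = (\<Sum>n\<in>S. c n * cnj (c n))"
      using S by (intro sum.cong refl) (simp add: if_distrib sum.delta cong: if_cong)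
    finally show ?thesis unfolding complex_norm_square .
  qed
  have ptw: "(norm (g x - P x))\<^sup>2 = (norm (g x))\<^sup>2 - 2 * Re (g x * cnj (P x)) + Re (P x * cnj (P x))" for x
    unfolding cmod_power2 by (simp add: power2_eq_square algebra_simps)
  have i1: "(\<lambda>x. (norm (g x))\<^sup>2) integrable_on {0..1}"
    by (intro integrable_continuous_interval continuous_intros g)
  have i2: "(\<lambda>x. g x * cnj (P x)) integrable_on {0..1}" "(\<lambda>x. P x * cnj (P x)) integrable_on {0..1}"
    by (intro integrable_continuous_interval continuous_intros g contP)+
  have i3: "(\<lambda>x. Re (g x * cnj (P x))) integrable_on {0..1}" "(\<lambda>x. Re (P x * cnj (P x))) integrable_on {0..1}"
    by (intro integrable_continuous_interval continuous_intros g contP)+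
  have "0 \<le> integral {0..1} (\<lambda>x. (norm (g x - P x))\<^sup>2)"
    by (intro integral_nonneg integrable_continuous_interval continuous_intros g contP) auto
  also have "\<dots> = integral {0..1} (\<lambda>x. (norm (g x))\<^sup>2) - 2 * integral {0..1} (\<lambda>x. Re (g x * cnj (P x)))
                   + integral {0..1} (\<lambda>x. Re (P x * cnj (P x)))"
    unfolding ptw
    by (intro integral_unique has_integral_add has_integral_diff has_integral_mult_right integrable_integral i1 i3)
  also have "integral {0..1} (\<lambda>x. Re (g x * cnj (P x))) = (\<Sum>n\<in>S. (norm (c n))\<^sup>2)"
    using integral_linear[OF i2(1) bounded_linear_Re] gP by (simp add: o_def)
  also have "integral {0..1} (\<lambda>x. Re (P x * cnj (P x))) = (\<Sum>n\<in>S. (norm (c n))\<^sup>2)"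
    using integral_linear[OF i2(2) bounded_linear_Re] PP by (simp add: o_def)
  finally show ?thesis by (simp add: c_def)
qed

text \<open>By Bessel the squares are summable along any injective sequence of frequencies. Allowing
  an arbitrary \<open>\<phi>\<close> covers both ends of the frequency line at once.\<close>

lemma riemann_lebesgue:
  fixes h :: "real \<Rightarrow> complex" and \<phi> :: "nat \<Rightarrow> int"
  assumes h: "continuous_on {0..1} h" and "inj \<phi>"
  shows "(\<lambda>N. fourier_coeff h (\<phi> N)) \<longlonglongrightarrow> 0"
proof -
  have "summable (\<lambda>N. (norm (fourier_coeff h (\<phi> N)))\<^sup>2)"
  proof (rule bounded_imp_summable)
    fix n
    have "(\<Sum>N\<le>n. (norm (fourier_coeff h (\<phi> N)))\<^sup>2) = (\<Sum>k\<in>\<phi> ` {..n}. (norm (fourier_coeff h k))\<^sup>2)"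
      using assms(2) by (subst sum.reindex) (auto intro: inj_on_subset)
    also have "\<dots> \<le> integral {0..1} (\<lambda>x. (norm (h x))\<^sup>2)"
      by (intro bessel_inequality h) auto
    finally show "(\<Sum>N\<le>n. (norm (fourier_coeff h (\<phi> N)))\<^sup>2) \<le> integral {0..1} (\<lambda>x. (norm (h x))\<^sup>2)" .
  qed auto
  hence "(\<lambda>N. (norm (fourier_coeff h (\<phi> N)))\<^sup>2) \<longlonglongrightarrow> 0"
    by (rule summable_LIMSEQ_zero)
  hence "(\<lambda>N. sqrt ((norm (fourier_coeff h (\<phi> N)))\<^sup>2)) \<longlonglongrightarrow> sqrt 0"
    by (rule tendsto_real_sqrt)
  thus ?thesis by (simp add: tendsto_norm_zero_iff)
qed

section \<open>Periodic functions and integrals over a period\<close>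

lemma periodic_add_int:
  fixes g :: "real \<Rightarrow> complex"
  assumes "\<And>x. g (x + 1) = g x"
  shows "g (x + of_int k) = g x"
proof (induction k rule: int_induct[where k = 0])
  case (step1 i)
  thus ?case using assms[of "x + of_int i"] by (simp add: add_ac)
next
  case (step2 i)
  thus ?case using assms[of "x + of_int i - 1"] by (simp add: algebra_simps)
qed simp

lemma periodic_Ints:
  fixes g :: "real \<Rightarrow> complex"
  assumes "\<And>x. g (x + 1) = g x" "k \<in> \<int>"
  shows "g (x + k) = g x"
  using assms(2) periodic_add_int[of g x, OF assms(1)] by (auto elim!: Ints_cases)

text \<open>Each summand is d times the increment of an antiderivative over the interval from b/d to
  (b + 1)/d, so the sum telescopes.\<close>

lemma integral_average:
  fixes \<psi> :: "real \<Rightarrow> complex"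
  assumes \<psi>: "continuous_on {0..1} \<psi>" and d: "d > 0"
  shows "(\<Sum>b<d. integral {0..1} (\<lambda>t. \<psi> ((t + real b) / real d))) = of_nat d * integral {0..1} \<psi>"
proof -
  define F where "F = (\<lambda>u. integral {0..u} \<psi>)"
  have F: "(F has_vector_derivative \<psi> x) (at x within {0..1})" if "x \<in> {0..1}" for x
    unfolding F_def using \<psi> that by (rule integral_has_vector_derivative)
  have *: "((\<lambda>t. \<psi> ((t + real b) / real d)) has_integral
          (of_nat d * F ((1 + real b) / real d) - of_nat d * F ((0 + real b) / real d))) {0..1}" if b: "b < d" for b
  proof (rule fundamental_theorem_of_calculus)
    fix x :: real assume x: "x \<in> {0..1}"
    have sub: "(\<lambda>t. (t + real b) / real d) ` {0..1} \<subseteq> {0..1}"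
    proof (rule image_subsetI)
      fix t :: real assume t: "t \<in> {0..1}"
      have "t + real b \<le> real d" using t b by auto
      thus "(t + real b) / real d \<in> {0..1}" using t d by simp
    qed
    have in01: "(x + real b) / real d \<in> {0..1}" using sub x by blast
    have "((\<lambda>t. (t + real b) / real d) has_vector_derivative (1 / real d)) (at x within {0..1})"
      by (rule derivative_eq_intros refl | use d in simp)+
    hence "(F \<circ> (\<lambda>t. (t + real b) / real d) has_vector_derivative (1 / real d) *\<^sub>R \<psi> ((x + real b) / real d))
             (at x within {0..1})"
      by (rule vector_diff_chain_within)
         (rule has_vector_derivative_within_subset[OF F[OF in01] sub])
    from has_vector_derivative_mult_right[OF this, of "of_nat d"]
    show "((\<lambda>t. of_nat d * F ((t + real b) / real d)) has_vector_derivative \<psi> ((x + real b) / real d)) (at x within {0..1})"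
      using d by (simp add: o_def scaleR_conv_of_real)
  qed simp
  have "(\<Sum>b<d. integral {0..1} (\<lambda>t. \<psi> ((t + real b) / real d))) =
        (\<Sum>b<d. of_nat d * F (real (Suc b) / real d) - of_nat d * F (real b / real d))"
    by (rule sum.cong) (use * in \<open>auto simp: integral_unique add_ac\<close>)
  also have "\<dots> = of_nat d * F 1 - of_nat d * F 0"
    using d sum_lessThan_telescope[of "\<lambda>b. of_nat d * F (real b / real d)" d] by simp
  finally show ?thesis by (simp add: F_def)
qed

lemma integral_periodic_shift:
  fixes g :: "real \<Rightarrow> complex"
  assumes g: "continuous_on UNIV g" and per: "\<And>x. g (x + 1) = g x"
  shows "integral {0..1} (\<lambda>u. g (u + a)) = integral {0..1} g"
proof -
  have cont: "continuous_on A g" for A using g continuous_on_subset by blast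
  have sh: "integral {c..d} (\<lambda>u. g (u + a)) = integral {c+a..d+a} g" for c d a
    using integral_shift[of c a d g] cont by (simp add: o_def)
  define k where "k = \<lfloor>a\<rfloor>"
  have k: "of_int k \<le> a" "a \<le> of_int k + 1" unfolding k_def by linarith+
  have "integral {0..1} (\<lambda>u. g (u + a)) = integral {a..a+1} g"
    using sh[of 0 1 a] by (simp add: add_ac)
  also have "\<dots> = integral {a..of_int k + 1} g + integral {of_int k + 1..a+1} g"
    using k by (intro Henstock_Kurzweil_Integration.integral_combine[symmetric] integrable_continuous_interval cont) auto
  also have "integral {of_int k + 1..a+1} g = integral {of_int k..a} g"
    using sh[of "of_int k" a 1] by (simp add: per)
  also have "integral {a..of_int k + 1} g + integral {of_int k..a} g = integral {of_int k..of_int k + 1} g"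
    using k by (subst add.commute, intro Henstock_Kurzweil_Integration.integral_combine integrable_continuous_interval cont) auto
  also have "\<dots> = integral {0..1} g"
    using sh[of 0 1 "of_int k"] periodic_add_int[of g, OF per] by (simp add: add_ac)
  finally show ?thesis .
qed

lemma fourier_coeff_shift:
  fixes g :: "real \<Rightarrow> complex"
  assumes g: "continuous_on UNIV g" and per: "\<And>x. g (x + 1) = g x"
  shows "fourier_coeff (\<lambda>u. g (u + a)) n = cis (2 * pi * of_int n * a) * fourier_coeff g n"
proof -
  define \<psi> where "\<psi> = (\<lambda>x. g x * cis (- 2 * pi * of_int n * x))"
  have "cis (- 2 * pi * of_int n) = 1"
    using cis_2pi_eq_1_iff[of "- of_int n"] by (simp add: Ints_minus)
  hence per': "\<psi> (x + 1) = \<psi> x" for x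
    by (simp only: \<psi>_def per distrib_left mult_1_right cis_mult[symmetric])
  have cont: "continuous_on UNIV \<psi>"
    unfolding \<psi>_def by (intro continuous_intros g)
  have "fourier_coeff (\<lambda>u. g (u + a)) n =
        integral {0..1} (\<lambda>u. cis (2 * pi * of_int n * a) * \<psi> (u + a))"
    unfolding fourier_coeff_def
    by (rule integral_cong) (simp add: \<psi>_def cis_mult algebra_simps)
  also have "\<dots> = cis (2 * pi * of_int n * a) * integral {0..1} \<psi>"
    using integral_periodic_shift[OF cont per', of a] by simp
  finally show ?thesis by (simp add: \<psi>_def fourier_coeff_def)
qed

section \<open>Pointwise convergence of Fourier series\<close>

lemma has_vector_derivative_quotient_tendsto:
  fixes g :: "real \<Rightarrow> 'a :: real_normed_vector"
  shows "(g has_vector_derivative d) (at x) \<longleftrightarrow> ((\<lambda>y. (g y - g x) /\<^sub>R (y - x)) \<longlongrightarrow> d) (at x)"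
proof -
  have "(g has_vector_derivative d) (at x) \<longleftrightarrow>
          ((\<lambda>y. norm ((g y - g x) - (y - x) *\<^sub>R d) / norm (y - x)) \<longlongrightarrow> 0) (at x)"
    unfolding has_vector_derivative_def has_derivative_iff_norm
    by (simp add: bounded_linear_scaleR_left)
  also have "\<dots> \<longleftrightarrow> ((\<lambda>y. norm ((g y - g x) /\<^sub>R (y - x) - d)) \<longlongrightarrow> 0) (at x)"
  proof (rule filterlim_cong[OF refl refl])
    show "eventually (\<lambda>y. norm ((g y - g x) - (y - x) *\<^sub>R d) / norm (y - x) =
            norm ((g y - g x) /\<^sub>R (y - x) - d)) (at x)"
    proof (rule eventually_at_filter[THEN iffD2], rule always_eventually, safe)
      fix y assume "y \<noteq> x"
      hence "(g y - g x) - (y - x) *\<^sub>R d = (y - x) *\<^sub>R ((g y - g x) /\<^sub>R (y - x) - d)"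
        by (simp add: scaleR_diff_right)
      hence "norm ((g y - g x) - (y - x) *\<^sub>R d) = \<bar>y - x\<bar> * norm ((g y - g x) /\<^sub>R (y - x) - d)"
        by (simp only: norm_scaleR)
      thus "norm ((g y - g x) - (y - x) *\<^sub>R d) / norm (y - x) =
            norm ((g y - g x) /\<^sub>R (y - x) - d)" using \<open>y \<noteq> x\<close> by simp
    qed
  qed
  also have "\<dots> \<longleftrightarrow> ((\<lambda>y. (g y - g x) /\<^sub>R (y - x)) \<longlongrightarrow> d) (at x)"
    by (simp add: tendsto_norm_zero_iff LIM_zero_iff)
  finally show ?thesis .
qed

text \<open>
  Chernoff's argument: if \<open>g 0 = 0\<close>, then \<open>g x = (e(x) - 1) h x\<close> with \<open>h\<close> continuous, so that
  the Fourier series of \<open>g\<close> at \<open>0\<close> telescopes.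
\<close>

lemma fourier_series_zero:
  fixes g :: "real \<Rightarrow> complex"
  assumes g: "continuous_on UNIV g" and per: "\<And>x. g (x + 1) = g x"
    and d: "(g has_vector_derivative d) (at 0)" and 0: "g 0 = 0"
  shows "(\<lambda>N. \<Sum>n=-int N..int N. fourier_coeff g n) \<longlonglongrightarrow> 0"
proof -
  \<comment> \<open>The value at the integers is the limit of the quotient: near 0 the numerator is
    about d x and the denominator about 2 pi i x.\<close>
  define h where "h = (\<lambda>x. if x \<in> \<int> then d / (2 * of_real pi * \<i>) else g x / (cis (2 * pi * x) - 1))"
  have lim0: "((\<lambda>x. g x / (cis (2 * pi * x) - 1)) \<longlongrightarrow> d / (2 * of_real pi * \<i>)) (at 0)"
  proof -
    have "((\<lambda>x. (g x - g 0) /\<^sub>R (x - 0)) \<longlongrightarrow> d) (at 0)"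
      using d by (simp add: has_vector_derivative_quotient_tendsto)
    moreover have "((\<lambda>x. (cis (2 * pi * x) - cis (2 * pi * 0)) /\<^sub>R (x - 0)) \<longlongrightarrow> 2 * of_real pi * \<i>) (at 0)"
      using has_vector_derivative_cis_mult[of "2*pi" 0 UNIV]
      unfolding has_vector_derivative_quotient_tendsto by (simp add: mult_ac)
    ultimately have "((\<lambda>x. ((g x - g 0) /\<^sub>R (x - 0)) / ((cis (2 * pi * x) - cis (2 * pi * 0)) /\<^sub>R (x - 0)))
              \<longlongrightarrow> d / (2 * of_real pi * \<i>)) (at 0)"
      by (rule tendsto_divide) simp
    thus ?thesis
      by (rule Lim_transform_eventually)
         (auto simp: eventually_at_filter 0 scaleR_conv_of_real)
  qed
  have ev: "eventually (\<lambda>x. x \<notin> \<int>) (at (0::real))"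
  proof -
    have "eventually (\<lambda>x. dist x 0 < 1) (at (0::real))"
      using eventually_at_ball[of 1 "0::real" UNIV] by (simp add: dist_commute)
    moreover have "eventually (\<lambda>x. x \<noteq> 0) (at (0::real))"
      by (simp add: eventually_at_filter)
    ultimately show ?thesis
    proof eventually_elim
      case (elim x)
      thus ?case by (auto elim!: Ints_cases)
    qed
  qed
  have h0: "isCont h 0"
    unfolding isCont_def
    by (rule Lim_transform_eventually[of _ _ _ h])
       (use lim0 ev in \<open>auto simp: h_def elim: eventually_mono\<close>)
  have perh: "h (x + 1) = h x" for x
  proof -
    have "x + 1 \<in> \<int> \<longleftrightarrow> x \<in> \<int>" by (metis Ints_1 Ints_add Ints_diff add_diff_cancel)
    moreover have "cis (2 * pi * (x + 1)) = cis (2 * pi * x)"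
      by (simp add: ring_distribs flip: cis_mult)
    ultimately show ?thesis by (simp add: h_def per)
  qed
  have "isCont h x" for x
  proof (cases "x \<in> \<int>")
    case True
    have "isCont (\<lambda>u. h (u + (- x))) x"
      using h0 by (intro isCont_o2[of x "\<lambda>u. u + (-x)" h]) auto
    moreover have "(\<lambda>u. h (u + (- x))) = h"
      using periodic_Ints[of h "-x", OF perh] True by auto
    ultimately show ?thesis by simp
  next
    case False
    have "open (- (\<int> :: real set))" using closed_Ints by (simp add: open_Compl)
    hence "eventually (\<lambda>u. u \<in> - \<int>) (nhds x)"
      using False by (intro eventually_nhds_in_open) auto
    hence "eventually (\<lambda>u. h u = g u / (cis (2 * pi * u) - 1)) (nhds x)"
      by eventually_elim (simp add: h_def)
    moreover have "isCont (\<lambda>u. g u / (cis (2 * pi * u) - 1)) x"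
      using g False cis_2pi_eq_1_iff[of x]
        has_vector_derivative_continuous[OF has_vector_derivative_cis_mult[of "2 * pi" x UNIV]]
      by (intro continuous_intros) (auto simp: continuous_on_eq_continuous_at)
    ultimately show ?thesis by (simp add: isCont_cong)
  qed
  hence h: "continuous_on {0..1} h"
    by (intro continuous_at_imp_continuous_on) auto
  have gh: "g x = (cis (2 * pi * x) - 1) * h x" for x
  proof (cases "x \<in> \<int>")
    case True
    thus ?thesis using periodic_Ints[of g x 0, OF per] 0 cis_2pi_eq_1_iff[of x] by simp
  next
    case False
    thus ?thesis using cis_2pi_eq_1_iff[of x] by (simp add: h_def)
  qed
  have coeff: "fourier_coeff g n = fourier_coeff h (n - 1) - fourier_coeff h n" for n
  proof -
    have "fourier_coeff g n = integral {0..1} (\<lambda>x. h x * cis (- 2 * pi * of_int (n - 1) * x)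
            - h x * cis (- 2 * pi * of_int n * x))"
      unfolding fourier_coeff_def
    proof (rule integral_cong)
      fix x
      have "cis (2 * pi * x) * cis (- 2 * pi * of_int n * x) = cis (- 2 * pi * of_int (n - 1) * x)"
        by (simp add: cis_mult algebra_simps)
      hence "h x * cis (- 2 * pi * of_int (n - 1) * x) - h x * cis (- 2 * pi * of_int n * x) =
            h x * (cis (2 * pi * x) * cis (- 2 * pi * of_int n * x)) - h x * cis (- 2 * pi * of_int n * x)"
        by simp
      also have "\<dots> = g x * cis (- 2 * pi * of_int n * x)"
        by (subst gh) (simp only: left_diff_distrib right_diff_distrib mult_ac mult_1)
      finally show "g x * cis (- 2 * pi * of_int n * x) =
            h x * cis (- 2 * pi * of_int (n - 1) * x) - h x * cis (- 2 * pi * of_int n * x)" ..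
    qed
    also have "\<dots> = fourier_coeff h (n - 1) - fourier_coeff h n"
      unfolding fourier_coeff_def by (intro integral_diff integrable_fourier h)
    finally show ?thesis .
  qed
  have telescope: "(\<Sum>n=-int N..int N. fourier_coeff g n) =
      fourier_coeff h (- int (Suc N)) - fourier_coeff h (int N)" for N
  proof (induction N)
    case 0
    thus ?case by (simp add: coeff)
  next
    case (Suc N)
    have "{-int (Suc N)..int (Suc N)} = insert (-int (Suc N)) (insert (int (Suc N)) {-int N..int N})"
      by auto
    thus ?case using Suc by (simp add: coeff algebra_simps)
  qed
  have "(\<lambda>N. fourier_coeff h (- int (Suc N)) - fourier_coeff h (int N)) \<longlonglongrightarrow> 0 - 0"
    by (intro tendsto_diff riemann_lebesgue h) (auto simp: inj_def)
  thus ?thesis by (simp only: telescope diff_self)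
qed

text \<open>Translating x to 0 and subtracting the constant g x reduces this to the previous lemma;
  the constant only affects the coefficient of index 0.\<close>

lemma fourier_series:
  fixes g :: "real \<Rightarrow> complex"
  assumes g: "continuous_on UNIV g" and per: "\<And>x. g (x + 1) = g x"
    and d: "(g has_vector_derivative d) (at x)"
  shows "(\<lambda>N. \<Sum>n=-int N..int N. fourier_coeff g n * cis (2 * pi * of_int n * x)) \<longlonglongrightarrow> g x"
proof -
  define k where "k = (\<lambda>u. g (u + x) - g x)"
  have cg: "continuous_on UNIV (\<lambda>u. g (u + x))"
    by (intro continuous_on_compose2[OF g] continuous_intros) auto
  hence cg': "continuous_on {0..1} (\<lambda>u. g (u + x))" using continuous_on_subset by blast
  have "(\<lambda>N. \<Sum>n=-int N..int N. fourier_coeff k n) \<longlonglongrightarrow> 0"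
  proof (rule fourier_series_zero)
    show "continuous_on UNIV k" unfolding k_def by (intro continuous_intros cg)
    show "k (u + 1) = k u" for u using per[of "u + x"] by (simp add: k_def add_ac)
    have "(g \<circ> (\<lambda>u. u + x) has_vector_derivative 1 *\<^sub>R d) (at 0)"
      using d by (intro vector_diff_chain_at) (auto intro!: derivative_eq_intros)
    thus "(k has_vector_derivative d) (at 0)"
      unfolding k_def by (auto intro!: derivative_eq_intros simp: o_def)
  qed (simp add: k_def)
  moreover have "fourier_coeff k n = fourier_coeff g n * cis (2 * pi * of_int n * x) - (if n = 0 then g x else 0)" for n
  proof -
    have "fourier_coeff k n = fourier_coeff (\<lambda>u. g (u + x)) n - integral {0..1} (\<lambda>u. g x * cis (2 * pi * of_int (- n) * u))"
      unfolding fourier_coeff_def k_def left_diff_distrib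
      by (subst integral_diff; (intro integrable_fourier cg' continuous_intros)?) simp
    thus ?thesis
      unfolding integral_mult_right integral_cis_2pi by (simp add: fourier_coeff_shift[OF g per] mult.commute)
  qed
  ultimately have "(\<lambda>N. (\<Sum>n=-int N..int N. fourier_coeff g n * cis (2 * pi * of_int n * x)) - g x) \<longlonglongrightarrow> 0"
    by (simp add: sum_subtractf sum.delta)
  thus ?thesis by (simp add: LIM_zero_iff)
qed

section \<open>Averaging and dilation on the Fourier side\<close>

lemma sum_cis_roots:
  fixes m :: int
  assumes a: "a > 0"
  shows "(\<Sum>b<a. cis (2 * pi * (of_int m * real b / real a))) = (if int a dvd m then of_nat a else 0)"
proof -
  define z where "z = cis (2 * pi * (of_int m / real a))"
  have pow: "cis (2 * pi * (of_int m * real b / real a)) = z ^ b" for b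
    by (simp add: z_def Complex.DeMoivre field_simps)
  have z1: "z = 1 \<longleftrightarrow> int a dvd m"
  proof -
    have "z = 1 \<longleftrightarrow> of_int m / real a \<in> \<int>" unfolding z_def by (rule cis_2pi_eq_1_iff)
    also have "\<dots> \<longleftrightarrow> int a dvd m"
    proof
      assume "of_int m / real a \<in> \<int>"
      then obtain k where "of_int m / real a = of_int k" by (elim Ints_cases)
      hence "of_int m = (of_int (int a * k) :: real)" using a by (simp add: field_simps)
      thus "int a dvd m" by (metis dvd_triv_left of_int_eq_iff)
    qed (use a in \<open>auto simp: dvd_def\<close>)
    finally show ?thesis .
  qed
  have "z ^ a = 1"
    using a cis_2pi_eq_1_iff[of "of_int m"] by (simp add: z_def Complex.DeMoivre)
  thus ?thesis unfolding pow using z1 a by (auto simp: geometric_sum)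
qed

text \<open>This and the next lemma are the Fourier-side effect of the two ingredients of a Hecke
  operator. Summation over b mod d retains the frequencies divisible by d, because at frequency k d
  the shift by b/d only produces the phase e(k b) = 1.\<close>

lemma fourier_coeff_average:
  fixes g :: "real \<Rightarrow> complex"
  assumes g: "continuous_on UNIV g" and d: "d > 0"
  shows "fourier_coeff (\<lambda>t. \<Sum>b<d. g ((t + real b) / real d)) k = of_nat d * fourier_coeff g (k * int d)"
proof -
  define \<psi> where "\<psi> = (\<lambda>u. g u * cis (- 2 * pi * of_int (k * int d) * u))"
  have cont: "continuous_on {0..1} \<psi>"
    unfolding \<psi>_def by (intro continuous_intros continuous_on_subset[OF g]) auto
  have *: "\<psi> ((t + real b) / real d) = g ((t + real b) / real d) * cis (- 2 * pi * of_int k * t)" for t b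
  proof -
    have "cis (- 2 * pi * of_int (k * int d) * ((t + real b) / real d)) =
          cis (- 2 * pi * of_int k * t) * cis (2 * pi * of_int (- k * int b))"
      unfolding cis_mult by (rule arg_cong[of _ _ cis]) (use d in \<open>simp add: field_simps\<close>)
    also have "cis (2 * pi * of_int (- k * int b)) = 1"
      by (subst cis_2pi_eq_1_iff) (rule Ints_of_int)
    finally show ?thesis by (simp add: \<psi>_def)
  qed
  have "fourier_coeff (\<lambda>t. \<Sum>b<d. g ((t + real b) / real d)) k =
        integral {0..1} (\<lambda>t. \<Sum>b<d. \<psi> ((t + real b) / real d))"
    unfolding fourier_coeff_def * by (simp add: sum_distrib_right)
  also have "\<dots> = (\<Sum>b<d. integral {0..1} (\<lambda>t. \<psi> ((t + real b) / real d)))"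
    unfolding *
    by (intro integral_sum integrable_fourier continuous_on_compose2[OF g] continuous_intros) (use d in auto)
  also have "\<dots> = of_nat d * integral {0..1} \<psi>"
    by (rule integral_average[OF cont d])
  finally show ?thesis by (simp add: \<psi>_def fourier_coeff_def)
qed

text \<open>After cutting the period into a pieces, the phases of the pieces form a full sum over
  roots of unity, which vanishes unless a divides the frequency.\<close>

lemma fourier_coeff_dilate:
  fixes g :: "real \<Rightarrow> complex"
  assumes g: "continuous_on UNIV g" and per: "\<And>x. g (x + 1) = g x" and a: "a > 0"
  shows "fourier_coeff (\<lambda>x. g (real a * x)) m = (if int a dvd m then fourier_coeff g (m div int a) else 0)"
proof -
  define \<psi> where "\<psi> = (\<lambda>u. g (real a * u) * cis (- 2 * pi * of_int m * u))"
  have cont: "continuous_on {0..1} \<psi>"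
    unfolding \<psi>_def by (intro continuous_intros continuous_on_compose2[OF g]) auto
  define I where "I = integral {0..1} (\<lambda>t. g t * cis (- 2 * pi * of_int m / real a * t))"
  have *: "\<psi> ((t + real b) / real a) =
      cis (2 * pi * (of_int (- m) * real b / real a)) * (g t * cis (- 2 * pi * of_int m / real a * t))" for t b
  proof -
    have "g (real a * ((t + real b) / real a)) = g t"
      using a periodic_add_int[of g t "int b", OF per] by simp
    moreover have "cis (- 2 * pi * of_int m * ((t + real b) / real a)) =
       cis (2 * pi * (of_int (- m) * real b / real a)) * cis (- 2 * pi * of_int m / real a * t)"
      unfolding cis_mult by (rule arg_cong[of _ _ cis]) (use a in \<open>simp add: field_simps\<close>)
    ultimately show ?thesis by (simp add: \<psi>_def)
  qed
  have "of_nat a * integral {0..1} \<psi> = (\<Sum>b<a. integral {0..1} (\<lambda>t. \<psi> ((t + real b) / real a)))"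
    by (rule integral_average[OF cont a, symmetric])
  also have "\<dots> = (\<Sum>b<a. cis (2 * pi * (of_int (- m) * real b / real a))) * I"
    unfolding * integral_mult_right I_def sum_distrib_right ..
  also have "(\<Sum>b<a. cis (2 * pi * (of_int (- m) * real b / real a))) = (if int a dvd m then of_nat a else 0)"
    using sum_cis_roots[OF a, of "-m"] by simp
  finally have **: "of_nat a * integral {0..1} \<psi> = (if int a dvd m then of_nat a else 0) * I" .
  have "I = fourier_coeff g (m div int a)" if "int a dvd m"
    using that a unfolding I_def fourier_coeff_def by (auto simp: dvd_def mult_ac)
  moreover have "fourier_coeff (\<lambda>x. g (real a * x)) m = integral {0..1} \<psi>"
    by (simp add: fourier_coeff_def \<psi>_def)
  ultimately show ?thesis using ** a by (cases "int a dvd m") simp_all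
qed

section \<open>Recessive solutions of the radial equation\<close>

text \<open>The hypothesis says that n exp(-g) is nonincreasing. The sign of n is left free, so that
  the lemma also yields lower bounds when applied to the negative of a square.\<close>

lemma gronwall_forward:
  fixes n :: "real \<Rightarrow> real"
  assumes "a \<le> b"
    and n: "\<And>y. a \<le> y \<Longrightarrow> y \<le> b \<Longrightarrow> (n has_real_derivative n' y) (at y)"
    and g: "\<And>y. a \<le> y \<Longrightarrow> y \<le> b \<Longrightarrow> (g has_real_derivative g' y) (at y)"
    and le: "\<And>y. a \<le> y \<Longrightarrow> y \<le> b \<Longrightarrow> n' y \<le> g' y * n y"
  shows "n b \<le> n a * exp (g b - g a)"
proof -
  have "n b * exp (- g b) \<le> n a * exp (- g a)"
  proof (rule DERIV_nonpos_imp_nonincreasing[OF \<open>a \<le> b\<close>])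
    fix y assume y: "a \<le> y" "y \<le> b"
    have "((\<lambda>y. n y * exp (- g y)) has_real_derivative (n' y - g' y * n y) * exp (- g y)) (at y)"
      by (rule derivative_eq_intros n[OF y] g[OF y] refl)+ (simp add: algebra_simps)
    moreover have "(n' y - g' y * n y) * exp (- g y) \<le> 0"
      using le[OF y] by (simp add: mult_nonpos_nonneg)
    ultimately show "\<exists>z. ((\<lambda>y. n y * exp (- g y)) has_real_derivative z) (at y) \<and> z \<le> 0" by blast
  qed
  hence "n b * exp (- g b) * exp (g b) \<le> n a * exp (- g a) * exp (g b)"
    by (rule mult_right_mono) simp
  thus ?thesis by (simp add: exp_minus exp_diff field_simps)
qed

lemma inner_mult_self_complex: "z \<bullet> (c * z) = Re c * (z \<bullet> (z::complex))"
  by (simp add: inner_complex_def algebra_simps)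

lemma has_real_derivative_inner_self:
  assumes "(W has_vector_derivative W') (at y)"
  shows "((\<lambda>y. W y \<bullet> W y) has_real_derivative (2 * (W y \<bullet> W'))) (at (y::real))"
  using bounded_bilinear.has_vector_derivative[OF bounded_bilinear_inner assms assms]
  by (simp add: has_real_derivative_iff_has_vector_derivative inner_commute)

text \<open>Divide both bounds by exp(\<omega> y) and let y tend to infinity.\<close>

lemma not_eventually_poly_above_exp:
  fixes u :: "real \<Rightarrow> real" and m :: nat
  assumes "\<omega> > 0" "c > 0"
    and up: "\<And>y. y \<ge> y1 \<Longrightarrow> u y \<le> C * y ^ m"
    and low: "\<And>y. y \<ge> y1 \<Longrightarrow> u y \<ge> c * exp (\<omega> * y) - K * exp (- \<omega> * y)"
  shows False
proof -
  have l1: "((\<lambda>y. C * y ^ m / exp (\<omega> * y)) \<longlongrightarrow> 0) at_top"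
  proof -
    have "((\<lambda>y. y ^ m / exp y) \<longlongrightarrow> (0::real)) at_top" by (rule tendsto_power_div_exp_0)
    hence "((\<lambda>y. (\<omega> * y) ^ m / exp (\<omega> * y)) \<longlongrightarrow> (0::real)) at_top"
      by (rule filterlim_compose) (use \<open>\<omega> > 0\<close> in \<open>intro filterlim_tendsto_pos_mult_at_top[OF tendsto_const] filterlim_ident\<close>)
    hence "((\<lambda>y. (C / \<omega> ^ m) * ((\<omega> * y) ^ m / exp (\<omega> * y))) \<longlongrightarrow> (C / \<omega> ^ m) * 0) at_top"
      by (rule tendsto_mult_left)
    thus ?thesis using \<open>\<omega> > 0\<close> by (simp add: power_mult_distrib)
  qed
  have l2: "((\<lambda>y. c - K * exp (- (2 * \<omega>) * y)) \<longlongrightarrow> c - K * 0) at_top"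
  proof (intro tendsto_intros filterlim_compose[OF exp_at_bot])
    have "filterlim (\<lambda>y. (2 * \<omega>) * y) at_top at_top"
      using \<open>\<omega> > 0\<close> by (intro filterlim_tendsto_pos_mult_at_top[OF tendsto_const] filterlim_ident) auto
    thus "filterlim (\<lambda>y. - (2 * \<omega>) * y) at_bot at_top"
      by (simp add: filterlim_uminus_at_bot)
  qed
  have "c - K * 0 \<le> 0"
  proof (rule tendsto_le[OF _ l1 l2])
    have "eventually (\<lambda>y. y \<ge> y1) at_top" by (rule eventually_ge_at_top)
    thus "eventually (\<lambda>y. c - K * exp (- (2 * \<omega>) * y) \<le> C * y ^ m / exp (\<omega> * y)) at_top"
    proof eventually_elim
      case (elim y)
      have "(c - K * exp (- (2 * \<omega>) * y)) * exp (\<omega> * y) = c * exp (\<omega> * y) - K * exp (- \<omega> * y)"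
        by (simp add: algebra_simps flip: exp_add)
      also have "\<dots> \<le> C * y ^ m" using up[OF elim] low[OF elim] by linarith
      finally show ?case by (simp add: field_simps)
    qed
  qed auto
  thus False using \<open>c > 0\<close> by simp
qed

text \<open>The equation W'' = (\<omega>^2 - \<mu> / y^2) W of a Fourier coefficient. Polynomial
  growth excludes the solutions that behave like exp(\<omega> y) and leaves the recessive
  ones.\<close>

locale radial_ode =
  fixes W W1 :: "real \<Rightarrow> complex" and \<omega> :: real and \<mu> :: complex and C :: real and m :: nat
  assumes omega_pos: "\<omega> > 0"
    and W: "\<And>y. y > 0 \<Longrightarrow> (W has_vector_derivative W1 y) (at y)"
    and W1: "\<And>y. y > 0 \<Longrightarrow> (W1 has_vector_derivative ((of_real (\<omega>\<^sup>2) - \<mu> / of_real (y\<^sup>2)) * W y)) (at y)"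
    and growth: "\<And>y. y \<ge> 1 \<Longrightarrow> norm (W y) \<le> C * y ^ m"
begin

text \<open>Beyond T the perturbation |\<mu>| / y^2 is at most \<omega>^2 / 2, so the equation
  behaves like the one with constant coefficients; T is at least 1 so that the growth bound applies
  there.\<close>

definition "T = max 1 (sqrt (2 * norm \<mu>) / \<omega>)"

lemma T_ge_1: "T \<ge> 1" by (simp add: T_def)

lemma mu_le: "y \<ge> T \<Longrightarrow> norm \<mu> / y\<^sup>2 \<le> \<omega>\<^sup>2 / 2"
proof -
  assume "y \<ge> T"
  hence y: "y \<ge> 1" "y \<ge> sqrt (2 * norm \<mu>) / \<omega>" by (auto simp: T_def)
  hence "sqrt (2 * norm \<mu>) \<le> \<omega> * y" using omega_pos by (simp add: field_simps)
  hence "(sqrt (2 * norm \<mu>))\<^sup>2 \<le> (\<omega> * y)\<^sup>2" by (intro power_mono) auto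
  thus ?thesis using y by (simp add: field_simps power_mult_distrib)
qed

text \<open>The solution is complex and so may be \<mu>; comparison arguments are therefore made
  with the real function u = |W|^2 and its derivative v.\<close>

definition "u y = W y \<bullet> W y"
definition "v y = 2 * (W y \<bullet> W1 y)"

lemma u_eq: "u y = (norm (W y))\<^sup>2" by (simp add: u_def power2_norm_eq_inner)

lemma u_deriv: "y > 0 \<Longrightarrow> (u has_real_derivative v y) (at y)"
  using has_real_derivative_inner_self[OF W] unfolding u_def[abs_def] v_def by simp

lemma v_deriv:
  assumes "y > 0"
  shows "(v has_real_derivative (2 * (norm (W1 y))\<^sup>2 + 2 * (\<omega>\<^sup>2 - Re \<mu> / y\<^sup>2) * u y)) (at y)"
proof -
  have *: "W y \<bullet> ((of_real (\<omega>\<^sup>2) - \<mu> / of_real (y\<^sup>2)) * W y) = (\<omega>\<^sup>2 - Re \<mu> / y\<^sup>2) * u y"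
    unfolding inner_mult_self_complex u_def by (simp add: Re_divide_of_real flip: of_real_power)
  have "((\<lambda>y. W y \<bullet> W1 y) has_vector_derivative
          (W y \<bullet> ((of_real (\<omega>\<^sup>2) - \<mu> / of_real (y\<^sup>2)) * W y) + W1 y \<bullet> W1 y)) (at y)"
    by (rule bounded_bilinear.has_vector_derivative[OF bounded_bilinear_inner W[OF assms] W1[OF assms]])
  hence "((\<lambda>y. W y \<bullet> W1 y) has_real_derivative ((\<omega>\<^sup>2 - Re \<mu> / y\<^sup>2) * u y + (norm (W1 y))\<^sup>2)) (at y)"
    unfolding * by (simp add: has_real_derivative_iff_has_vector_derivative power2_norm_eq_inner)
  from DERIV_cmult[OF this, of 2] show ?thesis unfolding v_def[abs_def] by (simp add: algebra_simps)
qed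

lemma v_deriv_ge:
  assumes "y \<ge> T"
  shows "2 * (norm (W1 y))\<^sup>2 + 2 * (\<omega>\<^sup>2 - Re \<mu> / y\<^sup>2) * u y \<ge> \<omega>\<^sup>2 * u y"
proof -
  have "Re \<mu> / y\<^sup>2 \<le> norm \<mu> / y\<^sup>2" by (intro divide_right_mono complex_Re_le_cmod) auto
  moreover have "w \<le> 2 * (w - a)" if "a \<le> b" "b \<le> w / 2" for a b w :: real using that by simp
  ultimately have "\<omega>\<^sup>2 \<le> 2 * (\<omega>\<^sup>2 - Re \<mu> / y\<^sup>2)" using mu_le[OF assms] by blast
  hence "\<omega>\<^sup>2 * u y \<le> 2 * (\<omega>\<^sup>2 - Re \<mu> / y\<^sup>2) * u y" by (intro mult_right_mono) (auto simp: u_eq)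
  thus ?thesis by (smt (verit) zero_le_power2)
qed

text \<open>
  Far out \<open>u'' \<ge> \<omega>\<^sup>2 u\<close>, so a positive slope would make \<open>u\<close> grow exponentially.
\<close>

lemma v_nonpos:
  assumes "y1 \<ge> T"
  shows "v y1 \<le> 0"
proof (rule ccontr)
  assume "\<not> v y1 \<le> 0"
  \<comment> \<open>A first-order factor of u'' - \<omega>^2 u: one has p' - \<omega> p = u'' -
    \<omega>^2 u \<ge> 0, hence p exp(-\<omega> y) is nondecreasing, and p is positive at
    y1.\<close>
  define p where "p = (\<lambda>y. v y + \<omega> * u y)"
  define c where "c = p y1 * exp (- \<omega> * y1)"
  have u0: "u y \<ge> 0" for y by (simp add: u_eq)
  have "p y1 > 0" using \<open>\<not> v y1 \<le> 0\<close> u0[of y1] omega_pos by (simp add: p_def add_pos_nonneg)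
  hence c: "c > 0" by (simp add: c_def)
  have p: "p y \<ge> c * exp (\<omega> * y)" if y: "y \<ge> y1" for y
  proof -
    have "p y1 * exp (- \<omega> * y1) \<le> p y * exp (- \<omega> * y)"
    proof (rule DERIV_nonneg_imp_nondecreasing[where f = "\<lambda>y. p y * exp (- \<omega> * y)", OF y])
      fix z assume z: "y1 \<le> z" "z \<le> y"
      have z0: "z > 0" "z \<ge> T" using z assms T_ge_1 by auto
      define D where "D = 2 * (norm (W1 z))\<^sup>2 + 2 * (\<omega>\<^sup>2 - Re \<mu> / z\<^sup>2) * u z"
      have "((\<lambda>y. p y * exp (- \<omega> * y)) has_real_derivative (D + \<omega> * v z - \<omega> * p z) * exp (- \<omega> * z)) (at z)"
        unfolding p_def D_def
        by (rule derivative_eq_intros u_deriv[OF z0(1)] v_deriv[OF z0(1)] refl)+ (simp add: algebra_simps)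
      moreover have "(D + \<omega> * v z - \<omega> * p z) * exp (- \<omega> * z) \<ge> 0"
      proof -
        have "D + \<omega> * v z - \<omega> * p z = D - \<omega>\<^sup>2 * u z" by (simp add: p_def algebra_simps power2_eq_square)
        moreover have "D - \<omega>\<^sup>2 * u z \<ge> 0" using v_deriv_ge[OF z0(2)] by (simp add: D_def)
        ultimately show ?thesis by simp
      qed
      ultimately show "\<exists>d. ((\<lambda>y. p y * exp (- \<omega> * y)) has_real_derivative d) (at z) \<and> 0 \<le> d" by blast
    qed
    hence "c * exp (\<omega> * y) \<le> p y * exp (- \<omega> * y) * exp (\<omega> * y)"
      unfolding c_def by (rule mult_right_mono) simp
    thus ?thesis by (simp add: mult.assoc flip: exp_add)
  qed
  \<comment> \<open>Now (u exp(\<omega> y))' = p exp(\<omega> y) \<ge> c exp(2 \<omega> y).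
    Integrating from y1 produces K as the contribution of the lower end.\<close>
  define K where "K = c / (2 * \<omega>) * exp (2 * \<omega> * y1)"
  have low: "u y \<ge> c / (2 * \<omega>) * exp (\<omega> * y) - K * exp (- \<omega> * y)" if y: "y \<ge> y1" for y
  proof -
    have "u y1 * exp (\<omega> * y1) - c / (2 * \<omega>) * exp (2 * \<omega> * y1) \<le> u y * exp (\<omega> * y) - c / (2 * \<omega>) * exp (2 * \<omega> * y)"
    proof (rule DERIV_nonneg_imp_nondecreasing[where f = "\<lambda>y. u y * exp (\<omega> * y) - c / (2 * \<omega>) * exp (2 * \<omega> * y)", OF y])
      fix z assume z: "y1 \<le> z" "z \<le> y"
      have z0: "z > 0" using z assms T_ge_1 by auto
      have "((\<lambda>y. u y * exp (\<omega> * y) - c / (2 * \<omega>) * exp (2 * \<omega> * y)) has_real_derivative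
              (p z * exp (\<omega> * z) - c * exp (2 * \<omega> * z))) (at z)"
        unfolding p_def
        by (rule derivative_eq_intros u_deriv[OF z0] refl)+ (use omega_pos in \<open>simp add: field_simps\<close>)
      moreover have "c * exp (2 * \<omega> * z) \<le> p z * exp (\<omega> * z)"
      proof -
        have "c * exp (2 * \<omega> * z) = c * exp (\<omega> * z) * exp (\<omega> * z)"
          by (simp add: mult.assoc algebra_simps flip: exp_add)
        also have "\<dots> \<le> p z * exp (\<omega> * z)" by (intro mult_right_mono p z) auto
        finally show ?thesis .
      qed
      ultimately show "\<exists>d. ((\<lambda>y. u y * exp (\<omega> * y) - c / (2 * \<omega>) * exp (2 * \<omega> * y)) has_real_derivative d) (at z) \<and> 0 \<le> d"
        by force
    qed
    moreover have "u y1 * exp (\<omega> * y1) \<ge> 0" by (simp add: u0)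
    ultimately have "c / (2 * \<omega>) * exp (2 * \<omega> * y) - K \<le> u y * exp (\<omega> * y)"
      unfolding K_def by linarith
    hence "(c / (2 * \<omega>) * exp (2 * \<omega> * y) - K) * exp (- \<omega> * y) \<le> u y * exp (\<omega> * y) * exp (- \<omega> * y)"
      by (rule mult_right_mono) simp
    thus ?thesis by (simp add: algebra_simps flip: exp_add)
  qed
  show False
  proof (rule not_eventually_poly_above_exp[where C = "C\<^sup>2" and m = "2 * m", OF omega_pos _ _ low])
    show "c / (2 * \<omega>) > 0" using c omega_pos by simp
    fix y assume "y \<ge> y1"
    hence "y \<ge> 1" using assms T_ge_1 by simp
    hence "(norm (W y))\<^sup>2 \<le> (C * y ^ m)\<^sup>2" by (intro power_mono growth) auto
    thus "u y \<le> C\<^sup>2 * y ^ (2 * m)" by (simp add: u_eq power_mult_distrib mult.commute flip: power_mult)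
  qed
qed

text \<open>The two first-order factors of the equation. For \<mu> = 0 and W = exp(-\<omega> y) one
  has Z = 0 and V constant; in general Z measures the growing component, and V is the decaying one
  with its exponential removed.\<close>

definition "X y = W1 y - of_real \<omega> * W y"
definition "Z y = W1 y + of_real \<omega> * W y"
definition "V y = of_real (exp (\<omega> * y)) * X y"

text \<open>The identity |Z|^2 - |X|^2 = 2 \<omega> v converts the sign of the slope v into a bound.
  Since W and W1 are combinations of X and Z, everything is then controlled by X.\<close>

lemma norm_Z_le: "y \<ge> T \<Longrightarrow> norm (Z y) \<le> norm (X y)"
proof -
  assume "y \<ge> T"
  have "(norm (Z y))\<^sup>2 - (norm (X y))\<^sup>2 = 2 * \<omega> * v y"
    unfolding power2_norm_eq_inner Z_def X_def v_def
    by (simp add: inner_complex_def algebra_simps)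
  also have "\<dots> \<le> 0" using v_nonpos[OF \<open>y \<ge> T\<close>] omega_pos by (simp add: mult_nonneg_nonpos)
  finally have "(norm (Z y))\<^sup>2 \<le> (norm (X y))\<^sup>2" by simp
  thus ?thesis by (rule power2_le_imp_le) simp
qed

lemma norm_W_le: "y \<ge> T \<Longrightarrow> norm (W y) \<le> norm (X y) / \<omega>"
proof -
  assume y: "y \<ge> T"
  have "2 * \<omega> * norm (W y) = norm (2 * of_real \<omega> * W y)" using omega_pos by (simp add: norm_mult)
  also have "2 * of_real \<omega> * W y = Z y - X y" by (simp add: Z_def X_def)
  also have "norm (Z y - X y) \<le> norm (Z y) + norm (X y)" by (rule norm_triangle_ineq4)
  also have "\<dots> \<le> 2 * norm (X y)" using norm_Z_le[OF y] by simp
  finally show ?thesis using omega_pos by (simp add: field_simps)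
qed

lemma norm_W1_le: "y \<ge> T \<Longrightarrow> norm (W1 y) \<le> norm (X y)"
proof -
  assume y: "y \<ge> T"
  have "2 * norm (W1 y) = norm (2 * W1 y)" by (simp add: norm_mult)
  also have "2 * W1 y = Z y + X y" by (simp add: Z_def X_def)
  also have "norm (Z y + X y) \<le> norm (Z y) + norm (X y)" by (rule norm_triangle_ineq)
  also have "\<dots> \<le> 2 * norm (X y)" using norm_Z_le[OF y] by simp
  finally show ?thesis by simp
qed

lemma has_vector_derivative_exp_real:
  "((\<lambda>y. complex_of_real (exp (c * y))) has_vector_derivative of_real (c * exp (c * y))) (at y)"
  by (rule has_vector_derivative_of_real) (auto intro!: derivative_eq_intros)

text \<open>The constant-coefficient part cancels, leaving only the perturbation, which is
  integrable at infinity.\<close>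

lemma V_deriv:
  assumes "y > 0"
  shows "(V has_vector_derivative (- \<mu> / of_real (y\<^sup>2) * W y * of_real (exp (\<omega> * y)))) (at y)"
proof -
  have "(X has_vector_derivative ((of_real (\<omega>\<^sup>2) - \<mu> / of_real (y\<^sup>2)) * W y - of_real \<omega> * W1 y)) (at y)"
    unfolding X_def[abs_def]
    by (intro has_vector_derivative_diff has_vector_derivative_mult_right W W1 assms)
  from has_vector_derivative_mult[OF has_vector_derivative_exp_real[of \<omega> y] this]
  show ?thesis unfolding V_def[abs_def]
    by (rule back_subst) (simp add: X_def algebra_simps power2_eq_square)
qed

text \<open>Chosen so that |V'| \<le> (cc / y^2) |V| beyond T.\<close>

definition "cc = norm \<mu> / \<omega>"

lemma norm_V_deriv_le:
  assumes "y \<ge> T"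
  shows "norm (- \<mu> / of_real (y\<^sup>2) * W y * of_real (exp (\<omega> * y))) \<le> cc / y\<^sup>2 * norm (V y)"
proof -
  have "norm (- \<mu> / of_real (y\<^sup>2) * W y * of_real (exp (\<omega> * y))) = norm \<mu> / y\<^sup>2 * norm (W y) * exp (\<omega> * y)"
    by (simp add: norm_mult norm_divide norm_power)
  also have "\<dots> \<le> norm \<mu> / y\<^sup>2 * (norm (X y) / \<omega>) * exp (\<omega> * y)"
    by (intro mult_right_mono mult_left_mono norm_W_le assms) auto
  also have "\<dots> = cc / y\<^sup>2 * norm (V y)" by (simp add: V_def cc_def norm_mult mult_ac)
  finally show ?thesis .
qed

lemma VV_deriv_le:
  assumes "y \<ge> T"
  shows "\<bar>2 * (V y \<bullet> (- \<mu> / of_real (y\<^sup>2) * W y * of_real (exp (\<omega> * y))))\<bar> \<le> 2 * cc / y\<^sup>2 * (V y \<bullet> V y)"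
proof -
  have "\<bar>2 * (V y \<bullet> (- \<mu> / of_real (y\<^sup>2) * W y * of_real (exp (\<omega> * y))))\<bar> \<le>
        2 * (norm (V y) * (cc / y\<^sup>2 * norm (V y)))"
    unfolding abs_mult
    by (intro mult_mono order.trans[OF Cauchy_Schwarz_ineq2] mult_left_mono norm_V_deriv_le assms) auto
  thus ?thesis by (simp add: dot_square_norm power2_eq_square mult_ac)
qed

lemma norm_V_le:
  assumes "y \<ge> T"
  shows "V y \<bullet> V y \<le> (V T \<bullet> V T) * exp (2 * cc / T)"
proof -
  have cc: "cc \<ge> 0" using omega_pos by (simp add: cc_def)
  have "V y \<bullet> V y \<le> (V T \<bullet> V T) * exp ((- 2 * cc / y) - (- 2 * cc / T))"
  proof (rule gronwall_forward[OF assms])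
    fix z assume z: "T \<le> z" "z \<le> y"
    have z0: "z > 0" using z T_ge_1 by simp
    show "((\<lambda>y. V y \<bullet> V y) has_real_derivative 2 * (V z \<bullet> (- \<mu> / of_real (z\<^sup>2) * W z * of_real (exp (\<omega> * z))))) (at z)"
      by (intro has_real_derivative_inner_self V_deriv z0)
    show "((\<lambda>y. - 2 * cc / y) has_real_derivative 2 * cc / z\<^sup>2) (at z)"
      by (rule derivative_eq_intros refl)+ (use z0 in \<open>auto simp: power2_eq_square\<close>)
    show "2 * (V z \<bullet> (- \<mu> / of_real (z\<^sup>2) * W z * of_real (exp (\<omega> * z)))) \<le> 2 * cc / z\<^sup>2 * (V z \<bullet> V z)"
      using VV_deriv_le[OF z(1)] by linarith
  qed
  also have "\<dots> \<le> (V T \<bullet> V T) * exp (2 * cc / T)"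
    using cc assms T_ge_1 by (intro mult_left_mono) auto
  finally show ?thesis .
qed

text \<open>Gronwall for the negative of |V|^2. This direction shows that V cannot tend to 0 unless
  it already vanishes at T.\<close>

lemma norm_V_ge:
  assumes "y \<ge> T"
  shows "V T \<bullet> V T \<le> (V y \<bullet> V y) * exp (2 * cc / T)"
proof -
  have cc: "cc \<ge> 0" using omega_pos by (simp add: cc_def)
  have "- (V y \<bullet> V y) \<le> - (V T \<bullet> V T) * exp (2 * cc / y - 2 * cc / T)"
  proof (rule gronwall_forward[OF assms])
    fix z assume z: "T \<le> z" "z \<le> y"
    have z0: "z > 0" using z T_ge_1 by simp
    show "((\<lambda>y. - (V y \<bullet> V y)) has_real_derivative - (2 * (V z \<bullet> (- \<mu> / of_real (z\<^sup>2) * W z * of_real (exp (\<omega> * z)))))) (at z)"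
      by (intro DERIV_minus has_real_derivative_inner_self V_deriv z0)
    show "((\<lambda>y. 2 * cc / y) has_real_derivative - 2 * cc / z\<^sup>2) (at z)"
      by (rule derivative_eq_intros refl)+ (use z0 in \<open>auto simp: power2_eq_square\<close>)
    show "- (2 * (V z \<bullet> (- \<mu> / of_real (z\<^sup>2) * W z * of_real (exp (\<omega> * z))))) \<le> - 2 * cc / z\<^sup>2 * - (V z \<bullet> V z)"
      using VV_deriv_le[OF z(1)] by simp
  qed
  hence "(V T \<bullet> V T) * exp (2 * cc / y - 2 * cc / T) \<le> V y \<bullet> V y" by simp
  hence "(V T \<bullet> V T) * exp (2 * cc / y) \<le> (V y \<bullet> V y) * exp (2 * cc / T)"
    by (simp add: exp_diff field_simps)
  moreover have "(V T \<bullet> V T) * 1 \<le> (V T \<bullet> V T) * exp (2 * cc / y)"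
    using cc assms T_ge_1 by (intro mult_left_mono) auto
  ultimately show ?thesis by simp
qed

definition "MV = sqrt ((V T \<bullet> V T) * exp (2 * cc / T))"

lemma norm_V_le_MV: "y \<ge> T \<Longrightarrow> norm (V y) \<le> MV"
  unfolding MV_def using norm_V_le[of y]
  by (intro real_le_rsqrt) (simp add: power2_norm_eq_inner)

lemma norm_X_le: "y \<ge> T \<Longrightarrow> norm (X y) \<le> MV * exp (- \<omega> * y)"
  using norm_V_le_MV[of y] by (simp add: V_def norm_mult exp_minus field_simps)

lemma V_diff_le:
  assumes "T \<le> a" "a \<le> b"
  shows "norm (V b - V a) \<le> cc * MV / a"
proof (cases "a = b")
  case False
  hence ab: "a < b" using assms by simp
  have nn: "cc \<ge> 0" "MV \<ge> 0" using omega_pos by (auto simp: cc_def MV_def)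
  have "norm (V b - V a) \<le> (- cc * MV / b) - (- cc * MV / a)"
  proof (rule differentiable_bound_general[OF ab])
    have "V differentiable (at x)" if "x \<in> {a..b}" for x
      using V_deriv[of x] that assms T_ge_1 by (auto simp: has_vector_derivative_def differentiable_def)
    thus "continuous_on {a..b} V"
      by (intro differentiable_imp_continuous_on) (auto simp: differentiable_on_def intro: differentiable_at_withinI)
    show "continuous_on {a..b} (\<lambda>y. - cc * MV / y)"
      using assms T_ge_1 by (intro continuous_intros) auto
    fix x assume x: "a < x" "x < b"
    have x0: "x > 0" "x \<ge> T" using x assms T_ge_1 by auto
    show "(V has_vector_derivative (- \<mu> / of_real (x\<^sup>2) * W x * of_real (exp (\<omega> * x)))) (at x)"
      by (rule V_deriv[OF x0(1)])
    show "((\<lambda>y. - cc * MV / y) has_vector_derivative (cc * MV / x\<^sup>2)) (at x)"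
      unfolding has_real_derivative_iff_has_vector_derivative[symmetric]
      by (rule derivative_eq_intros refl)+ (use x0 in \<open>auto simp: power2_eq_square\<close>)
    have "cc / x\<^sup>2 * norm (V x) \<le> cc / x\<^sup>2 * MV"
      using nn by (intro mult_left_mono norm_V_le_MV x0) auto
    thus "norm (- \<mu> / of_real (x\<^sup>2) * W x * of_real (exp (\<omega> * x))) \<le> cc * MV / x\<^sup>2"
      using norm_V_deriv_le[OF x0(2)] by simp
  qed
  also have "\<dots> \<le> cc * MV / a" using nn ab assms T_ge_1 by simp
  finally show ?thesis .
qed (use omega_pos assms T_ge_1 in \<open>auto simp: cc_def MV_def\<close>)

text \<open>Beyond a point a the oscillation of V is O(1/a), so V converges, and letting the far
  point tend to infinity keeps that rate.\<close>

lemma V_limit: "\<exists>L. \<forall>y\<ge>T. norm (V y - L) \<le> cc * MV / y"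
proof -
  have nn: "cc \<ge> 0" "MV \<ge> 0" using omega_pos by (auto simp: cc_def MV_def)
  define s where "s = (\<lambda>n::nat. V (T + real n))"
  have "Cauchy s"
  proof (rule CauchyI')
    fix e :: real assume e: "e > 0"
    obtain M :: nat where M: "real M > cc * MV / e" using reals_Archimedean2 by blast
    have "dist (s m) (s n) < e" if mn: "M \<le> m" "m < n" for m n
    proof -
      have "norm (s n - s m) \<le> cc * MV / (T + real m)"
        unfolding s_def using mn T_ge_1 by (intro V_diff_le) auto
      also have "\<dots> < e"
      proof -
        have "cc * MV < e * real M" using M e by (simp add: field_simps)
        also have "\<dots> \<le> e * (T + real m)" using e mn T_ge_1 by (intro mult_left_mono) auto
        finally show ?thesis using T_ge_1 by (simp add: field_simps)
      qed
      finally show ?thesis by (simp add: dist_norm norm_minus_commute)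
    qed
    thus "\<exists>M. \<forall>m\<ge>M. \<forall>n>m. dist (s m) (s n) < e" by blast
  qed
  then obtain L where L: "s \<longlonglongrightarrow> L" using Cauchy_convergent convergentD by blast
  have "norm (V y - L) \<le> cc * MV / y" if y: "y \<ge> T" for y
  proof (rule tendsto_upperbound[OF tendsto_norm[OF tendsto_diff[OF tendsto_const L]]])
    obtain M :: nat where M: "real M \<ge> y" using real_arch_simple by blast
    have "norm (V y - s n) \<le> cc * MV / y" if "n \<ge> M" for n
      unfolding s_def using y that M T_ge_1 by (subst norm_minus_commute, intro V_diff_le) auto
    thus "eventually (\<lambda>n. norm (V y - s n) \<le> cc * MV / y) sequentially"
      by (auto simp: eventually_sequentially)
  qed auto
  thus ?thesis by blast
qed

text \<open>The growing component is smaller by a factor 1/a. With Y = exp(-\<omega> y) Z the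
  derivative of Y consists of the perturbation alone and is O(exp(-2 \<omega> y) / a) beyond a;
  since Y tends to 0 at infinity, integrating back from there bounds Y at a.\<close>

lemma norm_Z_small:
  assumes a: "T \<le> a"
  shows "norm (Z a) * exp (\<omega> * a) \<le> cc * MV / (2 * \<omega>) / a"
proof -
  have nn: "cc \<ge> 0" "MV \<ge> 0" using omega_pos by (auto simp: cc_def MV_def)
  define Y where "Y = (\<lambda>y. of_real (exp (- \<omega> * y)) * Z y)"
  have a1: "a \<ge> 1" using a T_ge_1 by simp
  define D where "D = (\<lambda>y. - \<mu> / of_real (y\<^sup>2) * W y * of_real (exp (- \<omega> * y)))"
  have Yd: "(Y has_vector_derivative D y) (at y)" if "y > 0" for y
  proof -
    have "(Z has_vector_derivative ((of_real (\<omega>\<^sup>2) - \<mu> / of_real (y\<^sup>2)) * W y + of_real \<omega> * W1 y)) (at y)"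
      unfolding Z_def[abs_def]
      by (intro has_vector_derivative_add has_vector_derivative_mult_right W W1 that)
    from has_vector_derivative_mult[OF has_vector_derivative_exp_real[of "-\<omega>" y] this]
    show ?thesis unfolding Y_def D_def
      by (rule back_subst) (simp add: Z_def algebra_simps power2_eq_square)
  qed
  have bound: "norm (Y b - Y a) \<le> cc * MV / (2 * \<omega>) / a * exp (- 2 * \<omega> * a)" if ab: "a < b" for b
  proof -
    define K where "K = cc * MV / a"
    have K: "K \<ge> 0" using nn a1 by (simp add: K_def)
    have "norm (Y b - Y a) \<le> (- K / (2 * \<omega>) * exp (- 2 * \<omega> * b)) - (- K / (2 * \<omega>) * exp (- 2 * \<omega> * a))"
    proof (rule differentiable_bound_general[OF ab])
      have "Y differentiable (at x)" if "x \<in> {a..b}" for x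
        using Yd[of x] that a1 by (auto simp: has_vector_derivative_def differentiable_def)
      thus "continuous_on {a..b} Y"
        by (intro differentiable_imp_continuous_on) (auto simp: differentiable_on_def intro: differentiable_at_withinI)
      show "continuous_on {a..b} (\<lambda>y. - K / (2 * \<omega>) * exp (- 2 * \<omega> * y))"
        by (intro continuous_intros)
      fix x assume x: "a < x" "x < b"
      have x0: "x > 0" "x \<ge> T" "x \<ge> 1" "x \<ge> a" using x a T_ge_1 by auto
      show "(Y has_vector_derivative D x) (at x)" by (rule Yd[OF x0(1)])
      show "((\<lambda>y. - K / (2 * \<omega>) * exp (- 2 * \<omega> * y)) has_vector_derivative (K * exp (- 2 * \<omega> * x))) (at x)"
        unfolding has_real_derivative_iff_has_vector_derivative[symmetric]
        by (rule derivative_eq_intros refl)+ (use omega_pos in auto)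
      have "norm (D x) = norm \<mu> / x\<^sup>2 * norm (W x) * exp (- \<omega> * x)"
        by (simp add: D_def norm_mult norm_divide norm_power)
      also have "\<dots> \<le> norm \<mu> / a * (MV * exp (- \<omega> * x) / \<omega>) * exp (- \<omega> * x)"
      proof (intro mult_right_mono mult_mono)
        have "a * 1 \<le> x * x" using x0 a1 by (intro mult_mono) auto
        thus "norm \<mu> / x\<^sup>2 \<le> norm \<mu> / a"
          using a1 by (intro divide_left_mono) (auto simp: power2_eq_square)
        show "norm (W x) \<le> MV * exp (- \<omega> * x) / \<omega>"
          using norm_W_le[OF x0(2)] norm_X_le[OF x0(2)] omega_pos
          by (meson divide_right_mono less_imp_le order_trans)
      qed (use a1 nn in auto)
      also have "\<dots> = K * exp (- 2 * \<omega> * x)"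
        by (simp add: K_def cc_def mult.assoc flip: exp_add)
      finally show "norm (D x) \<le> K * exp (- 2 * \<omega> * x)" .
    qed
    also have "\<dots> \<le> K / (2 * \<omega>) * exp (- 2 * \<omega> * a)" using K omega_pos by simp
    finally show ?thesis by (simp add: K_def mult_ac)
  qed
  have "norm (Y a) \<le> cc * MV / (2 * \<omega>) / a * exp (- 2 * \<omega> * a)"
  proof -
    have "((\<lambda>b. MV * exp (- \<omega> * b)) \<longlongrightarrow> MV * 0) at_top"
    proof (intro tendsto_intros filterlim_compose[OF exp_at_bot])
      have "filterlim (\<lambda>y. \<omega> * y) at_top at_top"
        using omega_pos by (intro filterlim_tendsto_pos_mult_at_top[OF tendsto_const] filterlim_ident) auto
      thus "filterlim (\<lambda>y. - \<omega> * y) at_bot at_top" by (simp add: filterlim_uminus_at_bot)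
    qed
    hence lim0: "((\<lambda>b. MV * exp (- \<omega> * b)) \<longlongrightarrow> 0) at_top" by simp
    have "(Y \<longlongrightarrow> 0) at_top"
    proof (rule Lim_null_comparison[OF _ lim0])
      have "eventually (\<lambda>b. b \<ge> T) at_top" by (rule eventually_ge_at_top)
      thus "eventually (\<lambda>b. norm (Y b) \<le> MV * exp (- \<omega> * b)) at_top"
      proof eventually_elim
        case (elim b)
        have "norm (Y b) = exp (- \<omega> * b) * norm (Z b)" by (simp add: Y_def norm_mult)
        also have "\<dots> \<le> 1 * (MV * exp (- \<omega> * b))"
          using norm_Z_le[OF elim] norm_X_le[OF elim] omega_pos elim T_ge_1
          by (intro mult_mono) auto
        finally show ?case by simp
      qed
    qed
    hence "((\<lambda>b. norm (Y b - Y a)) \<longlongrightarrow> norm (0 - Y a)) at_top"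
      by (intro tendsto_intros)
    moreover have "eventually (\<lambda>b. norm (Y b - Y a) \<le> cc * MV / (2 * \<omega>) / a * exp (- 2 * \<omega> * a)) at_top"
      using eventually_gt_at_top[of a] by eventually_elim (rule bound)
    ultimately show ?thesis
      using tendsto_upperbound[of "\<lambda>b. norm (Y b - Y a)" "norm (0 - Y a)" at_top] by simp
  qed
  hence "norm (Y a) * exp (2 * \<omega> * a) \<le> cc * MV / (2 * \<omega>) / a * exp (- 2 * \<omega> * a) * exp (2 * \<omega> * a)"
    by (rule mult_right_mono) simp
  moreover have "norm (Y a) * exp (2 * \<omega> * a) = norm (Z a) * exp (\<omega> * a)"
    by (simp add: Y_def norm_mult mult_ac flip: exp_add)
  moreover have "exp (- 2 * \<omega> * a) * exp (2 * \<omega> * a) = 1" by (simp flip: exp_add)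
  ultimately show ?thesis by (simp add: mult.assoc)
qed

text \<open>Since 2 \<omega> W = Z - X, with Z small and V convergent to L, exp(\<omega> y) W tends
  to -L / (2 \<omega>). If L = 0, the lower Gronwall bound gives V T = 0, so W and W1 vanish beyond
  T, and uniqueness for the linear equation carries this down to 0. A nonzero solution thus has a
  nonzero leading constant.\<close>

theorem asymptotics:
  "\<exists>C0 K. (C0 = 0 \<longrightarrow> (\<forall>y>0. W y = 0)) \<and>
     (\<forall>y\<ge>T. norm (of_real (exp (\<omega> * y)) * W y - C0) \<le> K / y)"
proof -
  have nn: "cc \<ge> 0" "MV \<ge> 0" using omega_pos by (auto simp: cc_def MV_def)
  obtain L where L: "\<And>y. y \<ge> T \<Longrightarrow> norm (V y - L) \<le> cc * MV / y" using V_limit by blast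
  define C0 where "C0 = - L / of_real (2 * \<omega>)"
  define K where "K = (cc * MV / (2 * \<omega>) + cc * MV) / (2 * \<omega>)"
  have 1: "norm (of_real (exp (\<omega> * y)) * W y - C0) \<le> K / y" if y: "y \<ge> T" for y
  proof -
    have "of_real (2 * \<omega>) * (of_real (exp (\<omega> * y)) * W y - C0) = of_real (exp (\<omega> * y)) * Z y - (V y - L)"
      using omega_pos by (simp add: C0_def Z_def V_def X_def algebra_simps)
    hence "2 * \<omega> * norm (of_real (exp (\<omega> * y)) * W y - C0) = norm (of_real (exp (\<omega> * y)) * Z y - (V y - L))"
      using omega_pos by (metis abs_of_pos norm_mult norm_of_real mult_pos_pos zero_less_numeral)
    also have "\<dots> \<le> norm (of_real (exp (\<omega> * y)) * Z y) + norm (V y - L)" by (rule norm_triangle_ineq4)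
    also have "\<dots> \<le> cc * MV / (2 * \<omega>) / y + cc * MV / y"
      using norm_Z_small[OF y] L[OF y] by (intro add_mono) (auto simp: norm_mult mult.commute)
    also have "\<dots> = 2 * \<omega> * (K / y)" using omega_pos y T_ge_1 by (simp add: K_def divide_simps)
    finally show ?thesis
      using omega_pos by (metis mult_le_cancel_left_pos mult_pos_pos zero_less_numeral)
  qed
  have 2: "W y = 0" if C0: "C0 = 0" and y: "y > 0" for y
  proof -
    have "L = 0" using C0 omega_pos by (simp add: C0_def)
    have "(\<lambda>n::nat. cc * MV / (T + real n)) \<longlonglongrightarrow> 0" 
      by (intro real_tendsto_divide_at_top[OF tendsto_const] filterlim_tendsto_add_at_top[OF tendsto_const] filterlim_real_sequentially)
    hence "(\<lambda>n::nat. (cc * MV / (T + real n))\<^sup>2 * exp (2 * cc / T)) \<longlonglongrightarrow> 0\<^sup>2 * exp (2 * cc / T)"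
      by (intro tendsto_intros)
    moreover have "V T \<bullet> V T \<le> (cc * MV / (T + real n))\<^sup>2 * exp (2 * cc / T)" for n
    proof -
      have "V T \<bullet> V T \<le> (norm (V (T + real n)))\<^sup>2 * exp (2 * cc / T)"
        using norm_V_ge[of "T + real n"] by (simp add: power2_norm_eq_inner)
      also have "\<dots> \<le> (cc * MV / (T + real n))\<^sup>2 * exp (2 * cc / T)"
        using L[of "T + real n"] \<open>L = 0\<close> by (intro mult_right_mono power_mono) auto
      finally show ?thesis .
    qed
    ultimately have "V T \<bullet> V T \<le> 0"
      using LIMSEQ_le_const by fastforce
    hence "V T \<bullet> V T = 0" by (intro antisym) auto
    hence "MV = 0" by (simp add: MV_def)
    hence X0: "X z = 0" if "z \<ge> T" for z using norm_X_le[OF that] by simp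
    have far: "W z = 0 \<and> W1 z = 0" if "z \<ge> T" for z
      using norm_W_le[OF that] norm_W1_le[OF that] X0[OF that] by simp
    show "W y = 0"
    proof (cases "y \<ge> T")
      case False
      \<comment> \<open>The energy |W|^2 + |W1|^2 with the direction of y reversed, because
        \<open>gronwall_forward\<close> moves to the right. The rate k bounds the coefficients of
        the system between y and T.\<close>
      define n where "n = (\<lambda>z. W (- z) \<bullet> W (- z) + W1 (- z) \<bullet> W1 (- z))"
      define k where "k = 1 + \<omega>\<^sup>2 + norm \<mu> / y\<^sup>2"
      define W2 where "W2 = (\<lambda>z. (of_real (\<omega>\<^sup>2) - \<mu> / of_real (z\<^sup>2)) * W z)"
      have "n (- y) \<le> n (- T) * exp (k * (- y) - k * (- T))"
      proof (rule gronwall_forward)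
        fix z assume z: "- T \<le> z" "z \<le> - y"
        have z0: "- z > 0" using z y by simp
        have d: "((\<lambda>w. W w \<bullet> W w + W1 w \<bullet> W1 w) has_real_derivative
                (2 * (W (-z) \<bullet> W1 (-z)) + 2 * (W1 (-z) \<bullet> W2 (-z)))) (at (- z))"
          unfolding W2_def
          by (intro DERIV_add has_real_derivative_inner_self W W1 z0)
        show "(n has_real_derivative - (2 * (W (-z) \<bullet> W1 (-z)) + 2 * (W1 (-z) \<bullet> W2 (-z)))) (at z)"
          unfolding n_def using DERIV_chain'[OF DERIV_minus[OF DERIV_ident] d] by simp
        show "((\<lambda>z. k * z) has_real_derivative k) (at z)"
          by (auto intro!: derivative_eq_intros)
        define p q where "p = norm (W (-z))" and "q = norm (W1 (-z))"
        have "norm (W2 (-z)) \<le> (\<omega>\<^sup>2 + norm \<mu> / y\<^sup>2) * p"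
        proof -
          have "norm (of_real (\<omega>\<^sup>2) - \<mu> / of_real ((-z)\<^sup>2)) \<le> \<omega>\<^sup>2 + norm \<mu> / (-z)\<^sup>2"
            by (rule order.trans[OF norm_triangle_ineq4]) (simp add: norm_divide norm_power)
          also have "\<dots> \<le> \<omega>\<^sup>2 + norm \<mu> / y\<^sup>2"
          proof -
            have "y\<^sup>2 \<le> (-z)\<^sup>2" using z y by (intro power_mono) auto
            thus ?thesis using y z0 by (intro add_left_mono divide_left_mono) auto
          qed
          finally show ?thesis unfolding W2_def norm_mult p_def by (intro mult_right_mono) auto
        qed
        hence b: "\<bar>W1 (-z) \<bullet> W2 (-z)\<bar> \<le> q * ((\<omega>\<^sup>2 + norm \<mu> / y\<^sup>2) * p)"
          unfolding q_def by (intro order.trans[OF Cauchy_Schwarz_ineq2] mult_left_mono) auto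
        have "\<bar>W (-z) \<bullet> W1 (-z)\<bar> \<le> p * q" unfolding p_def q_def by (rule Cauchy_Schwarz_ineq2)
        hence "- (2 * (W (-z) \<bullet> W1 (-z)) + 2 * (W1 (-z) \<bullet> W2 (-z))) \<le> k * (2 * p * q)"
        proof -
          have "k * (2 * p * q) = 2 * (p * q) + 2 * (q * ((\<omega>\<^sup>2 + norm \<mu> / y\<^sup>2) * p))"
            by (simp add: k_def algebra_simps)
          with b \<open>\<bar>W (-z) \<bullet> W1 (-z)\<bar> \<le> p * q\<close> show ?thesis unfolding abs_le_iff by linarith
        qed
        also have "\<dots> \<le> k * (p\<^sup>2 + q\<^sup>2)"
          using sum_squares_bound[of p q] by (intro mult_left_mono) (auto simp: k_def)
        also have "p\<^sup>2 + q\<^sup>2 = n z" by (simp add: n_def p_def q_def power2_norm_eq_inner)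
        finally show "- (2 * (W (-z) \<bullet> W1 (-z)) + 2 * (W1 (-z) \<bullet> W2 (-z))) \<le> k * n z" .
      qed (use False in auto)
      also have "n (- T) = 0" using far[of T] by (simp add: n_def)
      finally have "W y \<bullet> W y + W1 y \<bullet> W1 y \<le> 0" by (simp add: n_def)
      thus ?thesis by (metis add_le_same_cancel1 inner_ge_zero inner_eq_zero_iff add_nonneg_eq_0_iff order_antisym add_nonneg_nonneg)
    qed (use far in blast)
  qed
  show ?thesis using 1 2 by blast
qed

text \<open>Beyond T this follows from the bounds through X; between c and T it is compactness. The
  constant depends on c because the locale controls nothing as y tends to 0.\<close>

lemma exp_decay:
  assumes c: "c > 0"
  shows "\<exists>K. \<forall>y\<ge>c. norm (W y) \<le> K * exp (- \<omega> * y) \<and> norm (W1 y) \<le> K * exp (- \<omega> * y)"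
proof -
  have cont: "continuous_on {c..T} W" "continuous_on {c..T} W1"
    using c by (auto intro!: continuous_at_imp_continuous_on has_vector_derivative_continuous[OF W]
        has_vector_derivative_continuous[OF W1])
  have "bounded (W ` {c..T})" "bounded (W1 ` {c..T})"
    using cont by (auto intro!: compact_imp_bounded compact_continuous_image)
  then obtain B1 B2 where B: "\<And>y. y \<in> {c..T} \<Longrightarrow> norm (W y) \<le> B1" "\<And>y. y \<in> {c..T} \<Longrightarrow> norm (W1 y) \<le> B2"
    unfolding bounded_iff by (metis imageI)
  define K where "K = max (max (\<bar>B1\<bar> * exp (\<omega> * T)) (\<bar>B2\<bar> * exp (\<omega> * T))) (max (MV / \<omega>) MV)"
  have small: "b \<le> K * exp (- \<omega> * y)" if "b \<le> B" "\<bar>B\<bar> * exp (\<omega> * T) \<le> K" "y \<le> T" for b B y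
  proof -
    have "b \<le> \<bar>B\<bar> * 1" using that by simp
    also have "\<dots> \<le> \<bar>B\<bar> * exp (\<omega> * T - \<omega> * y)" using that omega_pos by (intro mult_left_mono) auto
    also have "\<dots> = \<bar>B\<bar> * exp (\<omega> * T) * exp (- \<omega> * y)" by (simp add: exp_diff exp_minus field_simps)
    also have "\<dots> \<le> K * exp (- \<omega> * y)" by (intro mult_right_mono that) auto
    finally show ?thesis .
  qed
  have "norm (W y) \<le> K * exp (- \<omega> * y) \<and> norm (W1 y) \<le> K * exp (- \<omega> * y)" if y: "y \<ge> c" for y
  proof (cases "y \<le> T")
    case True
    have "norm (W y) \<le> K * exp (- \<omega> * y)"
      by (rule small[of _ B1]) (use B(1)[of y] True y in \<open>auto simp: K_def\<close>)
    moreover have "norm (W1 y) \<le> K * exp (- \<omega> * y)"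
      by (rule small[of _ B2]) (use B(2)[of y] True y in \<open>auto simp: K_def\<close>)
    ultimately show ?thesis ..
  next
    case False
    hence yT: "y \<ge> T" by simp
    have "norm (W y) \<le> MV * exp (- \<omega> * y) / \<omega>"
      using norm_W_le[OF yT] norm_X_le[OF yT] omega_pos by (meson divide_right_mono less_imp_le order_trans)
    also have "\<dots> = MV / \<omega> * exp (- \<omega> * y)" by simp
    also have "\<dots> \<le> K * exp (- \<omega> * y)" by (intro mult_right_mono) (auto simp: K_def)
    finally have 1: "norm (W y) \<le> K * exp (- \<omega> * y)" .
    have "norm (W1 y) \<le> MV * exp (- \<omega> * y)" using norm_W1_le[OF yT] norm_X_le[OF yT] by simp
    also have "\<dots> \<le> K * exp (- \<omega> * y)" by (intro mult_right_mono) (auto simp: K_def)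
    finally show ?thesis using 1 by simp
  qed
  thus ?thesis by blast
qed

end

section \<open>Mellin transforms in logarithmic coordinates\<close>

text \<open>With y = exp t this is the usual Mellin integral of a function of y against y^s
  dy/y.\<close>

definition mellin :: "(real \<Rightarrow> complex) \<Rightarrow> complex \<Rightarrow> complex" where
  "mellin h s = (\<integral>t. h t * exp (s * of_real t) \<partial>lborel)"

text \<open>In y = exp t: decay faster than any power of y both at 0 and at infinity, which is what
  makes the Mellin transform entire.\<close>

definition rapid :: "(real \<Rightarrow> complex) \<Rightarrow> bool" where
  "rapid h \<longleftrightarrow> continuous_on UNIV h \<and> (\<forall>m::nat. \<exists>C. \<forall>t. norm (h t) \<le> C * exp (- real m * \<bar>t\<bar>))"

lemma integrable_exp_minus_abs: "integrable lborel (\<lambda>t::real. exp (- \<bar>t\<bar>))"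
proof -
  have 1: "integrable lborel (\<lambda>t::real. exp (- t) * indicator {0..} t)"
  proof (rule integrableI_nonneg)
    have lim: "((\<lambda>t::real. - exp (- t)) \<longlongrightarrow> - 0) at_top"
      by (intro tendsto_intros filterlim_compose[OF exp_at_bot] filterlim_uminus_at_bot_at_top)
    have "(\<integral>\<^sup>+ t. ennreal (exp (- t)) * indicator {0..} t \<partial>lborel) = ennreal (- 0 - (- exp (- (0::real))))"
      by (rule nn_integral_FTC_atLeast[OF _ _ _ lim]) (auto intro!: derivative_eq_intros)
    also have "(\<integral>\<^sup>+ t. ennreal (exp (- t)) * indicator {0..} t \<partial>lborel) =
               (\<integral>\<^sup>+ t. ennreal (exp (- t) * indicator {0..} t) \<partial>lborel)"
      by (intro nn_integral_cong) (auto simp: indicator_def)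
    finally show "(\<integral>\<^sup>+ t. ennreal (exp (- t) * indicator {0..} t) \<partial>lborel) < \<infinity>" by simp
  qed auto
  have 2: "integrable lborel (\<lambda>t::real. exp (- (0 + (-1) * t)) * indicator {0..} (0 + (-1) * t))"
    using 1 by (intro lborel_integrable_real_affine) auto
  show ?thesis
    by (rule Bochner_Integration.integrable_bound[OF Bochner_Integration.integrable_add[OF 1 2]])
       (auto simp: indicator_def)
qed

lemma rapid_bound:
  assumes "rapid h"
  shows "\<exists>C. \<forall>t. norm (h t) * exp (\<sigma> * t) \<le> C * exp (- \<bar>t\<bar>)"
proof -
  obtain m :: nat where m: "real m \<ge> \<bar>\<sigma>\<bar> + 1" using real_arch_simple by blast
  obtain C where C: "\<And>t. norm (h t) \<le> C * exp (- real m * \<bar>t\<bar>)" using assms by (auto simp: rapid_def)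
  have "norm (h t) * exp (\<sigma> * t) \<le> \<bar>C\<bar> * exp (- \<bar>t\<bar>)" for t
  proof -
    have "norm (h t) * exp (\<sigma> * t) \<le> (\<bar>C\<bar> * exp (- real m * \<bar>t\<bar>)) * exp (\<bar>\<sigma>\<bar> * \<bar>t\<bar>)"
    proof (intro mult_mono)
      show "norm (h t) \<le> \<bar>C\<bar> * exp (- real m * \<bar>t\<bar>)"
        by (rule order.trans[OF C]) (intro mult_right_mono, auto)
      show "exp (\<sigma> * t) \<le> exp (\<bar>\<sigma>\<bar> * \<bar>t\<bar>)"
        by (metis abs_ge_self abs_mult exp_le_cancel_iff)
    qed auto
    also have "\<dots> = \<bar>C\<bar> * exp ((\<bar>\<sigma>\<bar> - real m) * \<bar>t\<bar>)"
      by (simp add: algebra_simps flip: exp_add)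
    also have "\<dots> \<le> \<bar>C\<bar> * exp (- 1 * \<bar>t\<bar>)"
      using m by (intro mult_left_mono, unfold exp_le_cancel_iff, intro mult_right_mono) auto
    finally show ?thesis by simp
  qed
  thus ?thesis by blast
qed

lemma mellin_integrable:
  assumes h: "continuous_on UNIV h" and i: "integrable lborel (\<lambda>t. norm (h t) * exp (Re s * t))"
  shows "integrable lborel (\<lambda>t. h t * exp (s * of_real t))"
proof (rule Bochner_Integration.integrable_bound[OF i])
  have "continuous_on UNIV (\<lambda>t. h t * exp (s * of_real t))"
    by (intro continuous_intros h)
  thus "(\<lambda>t. h t * exp (s * of_real t)) \<in> borel_measurable lborel"
    by (simp add: borel_measurable_continuous_onI)
qed (auto simp: norm_mult)

lemma rapid_integrable:
  assumes "rapid h"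
  shows "integrable lborel (\<lambda>t. norm (h t) * exp (\<sigma> * t))"
proof -
  obtain C where C: "\<And>t. norm (h t) * exp (\<sigma> * t) \<le> C * exp (- \<bar>t\<bar>)"
    using rapid_bound[OF assms] by blast
  have cont: "continuous_on UNIV (\<lambda>t. norm (h t) * exp (\<sigma> * t))"
    using assms by (intro continuous_intros) (auto simp: rapid_def)
  have i: "integrable lborel (\<lambda>t::real. C * exp (- \<bar>t\<bar>))"
    by (intro integrable_mult_right integrable_exp_minus_abs)
  show ?thesis
  proof (rule Bochner_Integration.integrable_bound[OF i])
    show "(\<lambda>t. norm (h t) * exp (\<sigma> * t)) \<in> borel_measurable lborel"
      using cont by (simp add: borel_measurable_continuous_onI)
    have "norm (norm (h t) * exp (\<sigma> * t)) \<le> norm (C * exp (- \<bar>t\<bar>))" for t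
    proof -
      have "norm (norm (h t) * exp (\<sigma> * t)) = norm (h t) * exp (\<sigma> * t)" by simp
      also have "\<dots> \<le> C * exp (- \<bar>t\<bar>)" by (rule C)
      also have "\<dots> \<le> norm (C * exp (- \<bar>t\<bar>))" by simp
      finally show ?thesis .
    qed
    thus "AE t in lborel. norm (norm (h t) * exp (\<sigma> * t)) \<le> norm (C * exp (- \<bar>t\<bar>))" by simp
  qed
qed

lemma rapid_mellin_integrable: "rapid h \<Longrightarrow> integrable lborel (\<lambda>t. h t * exp (s * of_real t))"
  by (intro mellin_integrable rapid_integrable) (auto simp: rapid_def)

text \<open>The integrals over [-n, n] are holomorphic by differentiation under the integral sign
  and converge locally uniformly to the full one.\<close>

lemma mellin_holomorphic:
  assumes h: "continuous_on UNIV h"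
    and i: "\<And>\<sigma>. \<sigma> > a \<Longrightarrow> integrable lborel (\<lambda>t. norm (h t) * exp (\<sigma> * t))"
  shows "mellin h holomorphic_on {s. Re s > a}"
proof -
  define F where "F = (\<lambda>(n::nat) s. integral (cbox (- real n) (real n)) (\<lambda>t. h t * exp (s * of_real t)))"
  have contF: "continuous_on A (\<lambda>t. h t * exp (s * of_real t))" for A s
    by (intro continuous_intros continuous_on_subset[OF h]) auto
  have hol: "F n holomorphic_on {s. Re s > a}" for n
  proof -
    have "F n holomorphic_on UNIV"
      unfolding F_def
    proof (rule leibniz_rule_holomorphic[where fx = "\<lambda>s t. h t * (of_real t * exp (s * of_real t))"])
      show "((\<lambda>s. h t * exp (s * of_real t)) has_field_derivative h t * (of_real t * exp (s * of_real t))) (at s within UNIV)" for s t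
        by (rule derivative_eq_intros refl | simp)+
      show "(\<lambda>t. h t * exp (s * of_real t)) integrable_on cbox (- real n) (real n)" for s
        by (intro integrable_continuous contF)
      have "continuous_on (UNIV \<times> cbox (- real n) (real n)) (\<lambda>p. h (snd p) * (of_real (snd p) * exp (fst p * of_real (snd p))))"
        by (intro continuous_intros continuous_on_compose2[OF h]) auto
      thus "continuous_on (UNIV \<times> cbox (- real n) (real n)) (\<lambda>(s, t). h t * (of_real t * exp (s * of_real t)))"
        by (simp add: case_prod_unfold)
    qed auto
    thus ?thesis by (rule holomorphic_on_subset) auto
  qed
  show ?thesis
  proof (rule holomorphic_uniform_sequence[OF _ hol])
    show "open {s. Re s > a}" by (rule open_halfspace_Re_gt)
    fix s0 assume "s0 \<in> {s. Re s > a}"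
    hence s0: "Re s0 > a" by simp
    define d where "d = (Re s0 - a) / 2"
    have d: "d > 0" using s0 by (simp add: d_def)
    have re: "Re s0 - d \<le> Re s" "Re s \<le> Re s0 + d" if "s \<in> cball s0 d" for s
    proof -
      have "\<bar>Re (s0 - s)\<bar> \<le> d" using that abs_Re_le_cmod[of "s0 - s"] by (simp add: dist_norm)
      thus "Re s0 - d \<le> Re s" "Re s \<le> Re s0 + d" by auto
    qed
    have gt: "Re s > a" if "s \<in> cball s0 d" for s using re(1)[OF that] s0 by (simp add: d_def field_simps)
    \<comment> \<open>On the ball, exp(Re s t) is at most the sum of the exponentials at its left
      and right edges, one being enough for each sign of t. This majorant does not depend on
      s.\<close>
    define k where "k = (\<lambda>t. norm (h t) * exp ((Re s0 - d) * t) + norm (h t) * exp ((Re s0 + d) * t))"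
    have ik: "integrable lborel k"
      unfolding k_def using s0 d by (intro Bochner_Integration.integrable_add i) (auto simp: d_def field_simps)
    have k0: "k t \<ge> 0" for t by (simp add: k_def)
    have kb: "norm (h t * exp (s * of_real t)) \<le> k t" if "s \<in> cball s0 d" for s t
    proof -
      have "exp (Re s * t) \<le> exp ((Re s0 - d) * t) + exp ((Re s0 + d) * t)"
      proof (cases "t \<ge> 0")
        case True
        hence "exp (Re s * t) \<le> exp ((Re s0 + d) * t)" using re[OF that] by (simp add: mult_right_mono)
        thus ?thesis by (smt (verit) exp_ge_zero)
      next
        case False
        hence "exp (Re s * t) \<le> exp ((Re s0 - d) * t)" using re[OF that] by (simp add: mult_right_mono_neg)
        thus ?thesis by (smt (verit) exp_ge_zero)
      qed
      hence "norm (h t) * exp (Re s * t) \<le> norm (h t) * (exp ((Re s0 - d) * t) + exp ((Re s0 + d) * t))"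
        by (intro mult_left_mono) auto
      thus ?thesis by (simp add: k_def norm_mult algebra_simps)
    qed
    define e where "e = (\<lambda>n::nat. \<integral>t. indicator (- {- real n..real n}) t * k t \<partial>lborel)"
    have e: "e \<longlonglongrightarrow> 0"
    proof -
      have "e \<longlonglongrightarrow> (\<integral>t. 0 \<partial>(lborel :: real measure))"
        unfolding e_def
      proof (rule integral_dominated_convergence[OF _ _ ik])
        show "(\<lambda>t. indicator (- {- real n..real n}) t * k t) \<in> borel_measurable lborel" for n
          using ik by (intro borel_measurable_times borel_measurable_indicator) auto
        have "(\<lambda>n. indicator (- {- real n..real n}) t * k t) \<longlonglongrightarrow> 0" for t :: real
        proof (rule tendsto_eventually)
          obtain N :: nat where N: "real N \<ge> \<bar>t\<bar>" using real_arch_simple by blast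
          have "indicator (- {- real n..real n}) t * k t = 0" if "n \<ge> N" for n
            using that N by (auto simp: indicator_def)
          thus "eventually (\<lambda>n. indicator (- {- real n..real n}) t * k t = 0) sequentially"
            by (auto simp: eventually_sequentially)
        qed
        thus "AE t in lborel. (\<lambda>n. indicator (- {- real n..real n}) t * k t) \<longlonglongrightarrow> 0" by simp
        show "AE t in lborel. norm (indicator (- {- real n..real n}) t * k t) \<le> k t" for n
          using k0 by (auto simp: indicator_def)
      qed auto
      thus ?thesis by simp
    qed
    have diff: "norm (F n s - mellin h s) \<le> e n" if s: "s \<in> cball s0 d" for n s
    proof -
      let ?f = "\<lambda>t. h t * exp (s * of_real t)"
      have int: "integrable lborel ?f"
        by (rule mellin_integrable[OF h i[OF gt[OF s]]])
      have si: "set_integrable lborel {- real n..real n} ?f"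
        unfolding set_integrable_def using int by (rule integrable_mult_indicator[rotated]) auto
      have "F n s = (LINT t:{- real n..real n}|lborel. ?f t)"
        using set_borel_integral_eq_integral(2)[OF si] by (simp add: F_def)
      also have "\<dots> - mellin h s = (\<integral>t. indicator {- real n..real n} t *\<^sub>R ?f t - ?f t \<partial>lborel)"
        unfolding mellin_def set_lebesgue_integral_def
        using si int by (subst Bochner_Integration.integral_diff) (auto simp: set_integrable_def)
      also have "norm \<dots> \<le> e n"
        unfolding e_def
      proof (rule Bochner_Integration.integral_norm_bound_integral)
        show "integrable lborel (\<lambda>t. indicator {- real n..real n} t *\<^sub>R ?f t - ?f t)"
          using si int by (auto simp: set_integrable_def)
        show "integrable lborel (\<lambda>t. indicator (- {- real n..real n}) t * k t)"
          using integrable_mult_indicator[OF _ ik, of "- {- real n..real n}"] by simp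
        show "norm (indicator {- real n..real n} t *\<^sub>R ?f t - ?f t) \<le> indicator (- {- real n..real n}) t * k t" for t
          using kb[OF s, of t] by (auto simp: indicator_def)
      qed
      finally show ?thesis .
    qed
    have "uniform_limit (cball s0 d) F (mellin h) sequentially"
      unfolding uniform_limit_iff
    proof (intro allI impI)
      fix r :: real assume "r > 0"
      hence "eventually (\<lambda>n. dist (e n) 0 < r) sequentially" using e by (simp add: tendsto_iff)
      thus "eventually (\<lambda>n. \<forall>s\<in>cball s0 d. dist (F n s) (mellin h s) < r) sequentially"
      proof eventually_elim
        case (elim n)
        thus ?case using diff[of _ n] by (fastforce simp: dist_norm)
      qed
    qed
    thus "\<exists>d>0. cball s0 d \<subseteq> {s. Re s > a} \<and> uniform_limit (cball s0 d) F (mellin h) sequentially"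
      using d gt by (intro exI[of _ d]) auto
  qed
qed

lemma rapid_mellin_holomorphic:
  assumes "rapid h"
  shows "mellin h holomorphic_on UNIV"
proof -
  have "mellin h holomorphic_on (\<Union>a. {s. Re s > a})"
  proof (rule holomorphic_on_UN_open)
    show "mellin h holomorphic_on {s. Re s > a}" for a
      using assms by (intro mellin_holomorphic rapid_integrable) (auto simp: rapid_def)
  qed (auto simp: open_halfspace_Re_gt)
  moreover have "(\<Union>a. {s. Re s > a}) = (UNIV :: complex set)"
    using gt_ex lt_ex by auto
  ultimately show ?thesis by simp
qed

section \<open>Dilation, reflection and the Gamma integral on the logarithmic line\<close>

lemma mellin_shift:
  "mellin (\<lambda>t. h (t + c)) s = exp (- s * of_real c) * mellin h s"
proof -
  have "mellin h s = (\<integral>t. h (c + 1 * t) * exp (s * of_real (c + 1 * t)) \<partial>lborel)"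
    unfolding mellin_def by (subst lborel_integral_real_affine[of 1 _ c]) auto
  also have "\<dots> = (\<integral>t. exp (s * of_real c) * (h (t + c) * exp (s * of_real t)) \<partial>lborel)"
    by (intro Bochner_Integration.integral_cong refl) (simp add: algebra_simps exp_add)
  finally have "mellin h s = exp (s * of_real c) * mellin (\<lambda>t. h (t + c)) s"
    by (simp add: mellin_def)
  thus ?thesis by (simp add: exp_minus)
qed

lemma integral_reflect_line:
  fixes \<phi> :: "real \<Rightarrow> complex"
  shows "(\<integral>t. \<phi> (c - t) \<partial>lborel) = (\<integral>t. \<phi> t \<partial>lborel)"
  using lborel_integral_real_affine[of "-1" \<phi> c] by simp

lemma integral_line_derivative_zero:
  fixes F :: "real \<Rightarrow> complex"
  assumes "\<And>t. (F has_vector_derivative f t) (at t)" "continuous_on UNIV f" "integrable lborel f"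
    and "(F \<longlongrightarrow> 0) at_top" "(F \<longlongrightarrow> 0) at_bot"
  shows "(\<integral>t. f t \<partial>lborel) = 0"
proof -
  have "(LBINT x=-\<infinity>..\<infinity>. f x) = 0 - 0"
    using assms
    by (intro interval_integral_FTC_integrable[where F = F])
       (auto simp: continuous_on_eq_continuous_at set_integrable_def ereal_tendsto_simps)
  thus ?thesis by (simp add: interval_lebesgue_integral_def set_lebesgue_integral_def)
qed

text \<open>Carries an integral over (0, \<infinity>), known as a gauge integral, to a Lebesgue
  integral over the line by y = exp t.\<close>

lemma has_real_integral_exp_subst:
  fixes \<phi> :: "real \<Rightarrow> real"
  assumes cont: "continuous_on {0<..} \<phi>" and ai: "\<phi> absolutely_integrable_on {0<..}"
  shows "integrable lborel (\<lambda>t. exp t * \<phi> (exp t))"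
    and "(\<integral>t. exp t * \<phi> (exp t) \<partial>lborel) = integral {0<..} \<phi>"
proof -
  have rng: "range exp = {0::real<..}"
    by (auto simp: image_iff) (metis exp_ln)
  have "(\<lambda>x. \<bar>exp x\<bar> * \<phi> (exp x)) absolutely_integrable_on UNIV \<and>
           integral UNIV (\<lambda>x. \<bar>exp x\<bar> * \<phi> (exp x)) = integral {0<..} \<phi>
     \<longleftrightarrow> \<phi> absolutely_integrable_on (range exp) \<and> integral (range exp) \<phi> = integral {0<..} \<phi>"
    by (intro has_absolute_integral_change_of_variables_1') (auto intro!: derivative_eq_intros simp: inj_on_def)
  hence *: "(\<lambda>x. exp x * \<phi> (exp x)) absolutely_integrable_on UNIV"
           "integral UNIV (\<lambda>x. exp x * \<phi> (exp x)) = integral {0<..} \<phi>"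
    using ai rng by auto
  have "continuous_on UNIV (\<lambda>x::real. exp x * \<phi> (exp x))"
    by (intro continuous_intros continuous_on_compose2[OF cont]) auto
  hence meas: "(\<lambda>x::real. exp x * \<phi> (exp x)) \<in> borel_measurable lborel"
    by (simp add: borel_measurable_continuous_onI)
  have leb: "integrable lebesgue (\<lambda>x. exp x * \<phi> (exp x))"
    using *(1) by (simp add: set_integrable_def)
  thus i: "integrable lborel (\<lambda>t. exp t * \<phi> (exp t))"
    using integrable_completion[OF meas] by simp
  show "(\<integral>t. exp t * \<phi> (exp t) \<partial>lborel) = integral {0<..} \<phi>"
    using *(2) integral_lborel[OF i] by simp
qed

text \<open>Euler's integral with y = exp t, treated for real and imaginary parts separately because
  the substitution above is for real integrands; the scale \<omega> becomes a shift of t by ln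
  \<omega>.\<close>

lemma Gamma_line:
  assumes p: "Re p > 0" and "\<omega> > 0"
  shows "integrable lborel (\<lambda>t. of_real (exp (- \<omega> * exp t)) * exp (p * of_real t))"
    and "mellin (\<lambda>t. of_real (exp (- \<omega> * exp t))) p = exp (- p * of_real (ln \<omega>)) * Gamma p"
proof -
  define \<phi> where "\<phi> = (\<lambda>t. complex_of_real t powr (p - 1) / of_real (exp t))"
  have ai: "\<phi> absolutely_integrable_on {0<..}"
    unfolding \<phi>_def by (rule absolutely_integrable_Gamma_integral'[OF p])
  have hi: "(\<phi> has_integral Gamma p) {0<..}"
    unfolding \<phi>_def by (rule Gamma_integral_complex'[OF p])
  have cont: "continuous_on {0<..} \<phi>"
    unfolding \<phi>_def by (intro continuous_intros) (auto simp: complex_nonpos_Reals_iff)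
  have cRe: "continuous_on {0<..} (\<lambda>t. Re (\<phi> t))" "continuous_on {0<..} (\<lambda>t. Im (\<phi> t))"
    by (intro continuous_intros cont)+
  have aRe: "(\<lambda>t. Re (\<phi> t)) absolutely_integrable_on {0<..}" "(\<lambda>t. Im (\<phi> t)) absolutely_integrable_on {0<..}"
    using absolutely_integrable_linear[OF ai bounded_linear_Re] absolutely_integrable_linear[OF ai bounded_linear_Im]
    by (simp_all add: o_def)
  have iRe: "integral {0<..} (\<lambda>t. Re (\<phi> t)) = Re (Gamma p)" "integral {0<..} (\<lambda>t. Im (\<phi> t)) = Im (Gamma p)"
    using has_integral_linear[OF hi bounded_linear_Re] has_integral_linear[OF hi bounded_linear_Im]
    by (simp_all add: o_def integral_unique)
  define \<psi> where "\<psi> = (\<lambda>t. complex_of_real (exp (- exp t)) * exp (p * of_real t))"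
  have \<psi>: "of_real (exp t) * \<phi> (exp t) = \<psi> t" for t
  proof -
    have "\<phi> (exp t) = exp ((p - 1) * of_real t) * of_real (exp (- exp t))"
      by (simp add: \<phi>_def powr_def Ln_of_real exp_minus field_simps flip: exp_of_real)
    moreover have "of_real (exp t) * exp ((p - 1) * of_real t) = exp (p * complex_of_real t)"
      by (simp add: algebra_simps exp_of_real[symmetric] flip: exp_add)
    ultimately show ?thesis by (simp add: \<psi>_def mult_ac)
  qed
  have re: "exp t * Re (\<phi> (exp t)) = Re (\<psi> t)" "exp t * Im (\<phi> (exp t)) = Im (\<psi> t)" for t
    unfolding \<psi>[symmetric] by simp_all
  have i: "integrable lborel (\<lambda>t. Re (\<psi> t))" "integrable lborel (\<lambda>t. Im (\<psi> t))"
    and v: "(\<integral>t. Re (\<psi> t) \<partial>lborel) = Re (Gamma p)" "(\<integral>t. Im (\<psi> t) \<partial>lborel) = Im (Gamma p)"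
    using has_real_integral_exp_subst[OF cRe(1) aRe(1)] has_real_integral_exp_subst[OF cRe(2) aRe(2)]
    by (simp_all add: re iRe)
  have \<psi>i: "integrable lborel \<psi>"
  proof -
    have "integrable lborel (\<lambda>t. of_real (Re (\<psi> t)) + \<i> * of_real (Im (\<psi> t)))"
      by (intro Bochner_Integration.integrable_add integrable_mult_right integrable_of_real i)
    thus ?thesis by (simp add: complex_eq[symmetric])
  qed
  have \<psi>v: "(\<integral>t. \<psi> t \<partial>lborel) = Gamma p"
    by (rule complex_eqI) (use v \<psi>i in \<open>simp_all add: integral_Re integral_Im\<close>)
  have shift: "of_real (exp (- \<omega> * exp t)) = complex_of_real (exp (- exp (t + ln \<omega>)))" for t
    using \<open>\<omega> > 0\<close> by (simp add: exp_add mult.commute)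
  show "mellin (\<lambda>t. of_real (exp (- \<omega> * exp t))) p = exp (- p * of_real (ln \<omega>)) * Gamma p"
    unfolding shift using \<psi>v
    by (subst mellin_shift[of "\<lambda>t. of_real (exp (- exp t))"]) (simp add: mellin_def \<psi>_def)
  have "integrable lborel (\<lambda>t. exp (- p * of_real (ln \<omega>)) * \<psi> (ln \<omega> + 1 * t))"
    by (intro integrable_mult_right lborel_integrable_real_affine \<psi>i) auto
  moreover have "exp (- p * of_real (ln \<omega>)) * \<psi> (ln \<omega> + 1 * t) =
     of_real (exp (- \<omega> * exp t)) * exp (p * of_real t)" for t
    unfolding shift by (simp add: \<psi>_def algebra_simps exp_add exp_minus)
  ultimately show "integrable lborel (\<lambda>t. of_real (exp (- \<omega> * exp t)) * exp (p * of_real t))" by simp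
qed

section \<open>Smooth functions on the upper half plane\<close>

lemma open_upper_half_plane: "open upper_half_plane"
  unfolding upper_half_plane_def by (rule open_halfspace_Im_gt)

lemma Complex_in_upper_half_plane [simp]: "Complex x y \<in> upper_half_plane \<longleftrightarrow> y > 0"
  by (simp add: upper_half_plane_def)

lemma smooth_on_differentiable: "smooth_on S f \<Longrightarrow> f differentiable_on S"
  unfolding smooth_on_def using C_k_on.simps(2) by blast

lemma smooth_on_continuous: "smooth_on S f \<Longrightarrow> continuous_on S f"
  by (rule differentiable_imp_continuous_on[OF smooth_on_differentiable])

lemma smooth_on_partial_x: "smooth_on S f \<Longrightarrow> smooth_on S (partial_x f)"
  unfolding smooth_on_def using C_k_on.simps(2) by blast

lemma smooth_on_partial_y: "smooth_on S f \<Longrightarrow> smooth_on S (partial_y f)"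
  unfolding smooth_on_def using C_k_on.simps(2) by blast

text \<open>Smoothness is meant over the reals, so the derivative is a real-linear map, determined
  by its values at 1 and at the imaginary unit.\<close>

lemma has_derivative_partials:
  assumes "smooth_on upper_half_plane f" "z \<in> upper_half_plane"
  shows "(f has_derivative (\<lambda>h. of_real (Re h) * partial_x f z + of_real (Im h) * partial_y f z)) (at z)"
proof -
  have "f differentiable (at z)"
    using smooth_on_differentiable[OF assms(1)] assms(2) open_upper_half_plane
    by (metis at_within_open differentiable_on_def)
  then obtain D where D: "(f has_derivative D) (at z)" by (auto simp: differentiable_def)
  interpret D: bounded_linear D using D by (rule has_derivative_bounded_linear)
  have dir: "((\<lambda>t. f (z + w * of_real t)) has_vector_derivative D w) (at 0)" for w
  proof -
    have "((\<lambda>t. z + w * of_real t) has_derivative (\<lambda>t. w * of_real t)) (at 0)"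
      by (auto intro!: derivative_eq_intros)
    from has_derivative_compose[OF this, of f D] D
    have "((\<lambda>t. f (z + w * of_real t)) has_derivative (\<lambda>t. D (w * of_real t))) (at 0)" by simp
    moreover have "D (w * of_real t) = t *\<^sub>R D w" for t
      using D.scaleR[of t w] by (simp add: scaleR_conv_of_real mult.commute)
    ultimately show ?thesis by (simp add: has_vector_derivative_def)
  qed
  have x: "partial_x f z = D 1"
    unfolding partial_x_def using dir[of 1] by (intro vector_derivative_at) simp
  have y: "partial_y f z = D \<i>"
    unfolding partial_y_def using dir[of \<i>] by (intro vector_derivative_at) simp
  have "D h = of_real (Re h) * partial_x f z + of_real (Im h) * partial_y f z" for h
  proof -
    have "D h = D (Re h *\<^sub>R 1 + Im h *\<^sub>R \<i>)"
      by (rule arg_cong[of _ _ D]) (simp add: complex_eq_iff)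
    thus ?thesis unfolding D.add D.scaleR x y by (simp add: scaleR_conv_of_real)
  qed
  thus ?thesis using D by presburger
qed

lemma has_vector_derivative_along:
  assumes "smooth_on upper_half_plane f" "\<gamma> t \<in> upper_half_plane" "(\<gamma> has_vector_derivative w) (at t)"
  shows "((\<lambda>t. f (\<gamma> t)) has_vector_derivative
           (of_real (Re w) * partial_x f (\<gamma> t) + of_real (Im w) * partial_y f (\<gamma> t))) (at t)"
proof -
  have "(\<gamma> has_derivative (\<lambda>h. h *\<^sub>R w)) (at t)" using assms(3) by (simp add: has_vector_derivative_def)
  from has_derivative_compose[OF this has_derivative_partials[OF assms(1,2)]]
  show ?thesis by (simp add: has_vector_derivative_def scaleR_conv_of_real algebra_simps)
qed

lemma Complex_has_vector_derivative_x: "((\<lambda>x. Complex x y) has_vector_derivative 1) (at x)"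
proof -
  have "((\<lambda>x. of_real x + \<i> * of_real y) has_vector_derivative 1) (at x)"
    by (auto intro!: derivative_eq_intros)
  thus ?thesis by (simp add: Complex_eq)
qed

lemma Complex_has_vector_derivative_y: "((\<lambda>y. Complex x y) has_vector_derivative \<i>) (at y)"
proof -
  have "((\<lambda>y. of_real x + \<i> * of_real y) has_vector_derivative \<i>) (at y)"
    by (auto intro!: derivative_eq_intros)
  thus ?thesis by (simp add: Complex_eq)
qed

lemma has_vector_derivative_x:
  assumes "smooth_on upper_half_plane f" "y > 0"
  shows "((\<lambda>x. f (Complex x y)) has_vector_derivative partial_x f (Complex x y)) (at x)"
  using has_vector_derivative_along[OF assms(1) _ Complex_has_vector_derivative_x[of y x]] assms(2) by simp

lemma has_vector_derivative_y:
  assumes "smooth_on upper_half_plane f" "y > 0"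
  shows "((\<lambda>y. f (Complex x y)) has_vector_derivative partial_y f (Complex x y)) (at y)"
  using has_vector_derivative_along[OF assms(1) _ Complex_has_vector_derivative_y[of x y]] assms(2) by simp

section \<open>Fourier coefficients along horizontal lines\<close>

lemma continuous_on_horizontal:
  assumes "continuous_on upper_half_plane g" "y > 0"
  shows "continuous_on A (\<lambda>x. g (Complex x y))"
  by (intro continuous_on_compose2[OF assms(1)] continuous_intros) (use assms in auto)

definition strip_coeff :: "(complex \<Rightarrow> complex) \<Rightarrow> int \<Rightarrow> real \<Rightarrow> complex" where
  "strip_coeff g n y = fourier_coeff (\<lambda>x. g (Complex x y)) n"

lemma fourier_coeff_norm_le:
  assumes "continuous_on {0..1} g" "\<And>x. x \<in> {0..1} \<Longrightarrow> norm (g x) \<le> B"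
  shows "norm (fourier_coeff g n) \<le> B"
proof -
  have "norm (fourier_coeff g n) \<le> integral {0..1} (\<lambda>x::real. B)"
    unfolding fourier_coeff_def
    by (intro Henstock_Kurzweil_Integration.integral_norm_bound_integral integrable_fourier assms)
       (auto simp: norm_mult assms)
  thus ?thesis by simp
qed

lemma strip_coeff_has_vector_derivative:
  assumes g: "smooth_on upper_half_plane g" and y: "y > 0"
  shows "(strip_coeff g n has_vector_derivative strip_coeff (partial_y g) n y) (at y)"
proof -
  let ?c = "\<lambda>t. cis (- 2 * pi * of_int n * t)"
  have "((\<lambda>y. integral (cbox 0 1) (\<lambda>t. g (Complex t y) * ?c t)) has_vector_derivative
          integral (cbox 0 1) (\<lambda>t. partial_y g (Complex t y) * ?c t)) (at y within {0<..})"
  proof (rule leibniz_rule_vector_derivative[where fx = "\<lambda>y t. partial_y g (Complex t y) * ?c t"])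
    show "((\<lambda>y. g (Complex t y) * ?c t) has_vector_derivative partial_y g (Complex t y) * ?c t) (at y within {0<..})"
      if "y \<in> {0<..}" for y t
      using has_vector_derivative_mult_left[OF has_vector_derivative_y[OF g, of y t], of "?c t"] that
      by (auto intro: has_vector_derivative_at_within)
    show "(\<lambda>t. g (Complex t y) * ?c t) integrable_on cbox 0 1" if "y \<in> {0<..}" for y
      using that unfolding cbox_interval
      by (intro integrable_fourier continuous_on_horizontal smooth_on_continuous[OF g]) auto
    have "continuous_on ({0<..} \<times> cbox 0 1) (\<lambda>p. partial_y g (Complex (snd p) (fst p)) * ?c (snd p))"
      by (intro continuous_intros continuous_on_compose2[OF smooth_on_continuous[OF smooth_on_partial_y[OF g]]]) auto
    thus "continuous_on ({0<..} \<times> cbox 0 1) (\<lambda>(y, t). partial_y g (Complex t y) * ?c t)"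
      by (simp add: case_prod_unfold)
  qed (use y in auto)
  thus ?thesis
    using y unfolding strip_coeff_def[abs_def] fourier_coeff_def cbox_interval
    by (simp add: at_within_open[of y "{0<..}"])
qed

definition periodic_H :: "(complex \<Rightarrow> complex) \<Rightarrow> bool" where
  "periodic_H g \<longleftrightarrow> (\<forall>z\<in>upper_half_plane. g (z + 1) = g z)"

lemma periodic_H_Complex: "periodic_H g \<Longrightarrow> y > 0 \<Longrightarrow> g (Complex (x + 1) y) = g (Complex x y)"
proof -
  assume "periodic_H g" "y > 0"
  hence "g (Complex x y + 1) = g (Complex x y)" unfolding periodic_H_def by simp
  moreover have "Complex x y + 1 = Complex (x + 1) y" by (simp add: complex_eq_iff)
  ultimately show ?thesis by simp
qed

lemma periodic_H_partial_x: "periodic_H g \<Longrightarrow> periodic_H (partial_x g)"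
proof -
  assume g: "periodic_H g"
  show ?thesis unfolding periodic_H_def
  proof
    fix z assume z: "z \<in> upper_half_plane"
    have "g (z + 1 + of_real t) = g (z + of_real t)" for t
    proof -
      have "z + of_real t \<in> upper_half_plane" using z by (simp add: upper_half_plane_def)
      hence "g (z + of_real t + 1) = g (z + of_real t)" using g by (simp add: periodic_H_def)
      thus ?thesis by (simp add: add_ac)
    qed
    thus "partial_x g (z + 1) = partial_x g z" by (simp add: partial_x_def)
  qed
qed

lemma periodic_H_partial_y: "periodic_H g \<Longrightarrow> periodic_H (partial_y g)"
proof -
  assume g: "periodic_H g"
  show ?thesis unfolding periodic_H_def
  proof
    fix z assume z: "z \<in> upper_half_plane"
    have "eventually (\<lambda>t. t \<in> {- Im z<..}) (nhds (0::real))"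
      using z by (intro eventually_nhds_in_open) (auto simp: upper_half_plane_def)
    hence "eventually (\<lambda>t. g (z + 1 + \<i> * of_real t) = g (z + \<i> * of_real t)) (nhds 0)"
    proof eventually_elim
      case (elim t)
      hence "z + \<i> * of_real t \<in> upper_half_plane" by (simp add: upper_half_plane_def)
      hence "g (z + \<i> * of_real t + 1) = g (z + \<i> * of_real t)" using g by (simp add: periodic_H_def)
      thus ?case by (simp add: add_ac)
    qed
    thus "partial_y g (z + 1) = partial_y g z"
      unfolding partial_y_def by (intro vector_derivative_cong_eq) auto
  qed
qed

text \<open>Integration by parts over one period; the boundary terms cancel by periodicity.\<close>

lemma strip_coeff_partial_x:
  assumes g: "smooth_on upper_half_plane g" "periodic_H g" and y: "y > 0"
  shows "strip_coeff (partial_x g) n y = 2 * of_real pi * \<i> * of_int n * strip_coeff g n y"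
proof -
  let ?c = "\<lambda>t. cis (- 2 * pi * of_int n * t)"
  define k where "k = - 2 * pi * of_int n"
  have "((\<lambda>x. g (Complex x y) * (\<i> * of_real k * cis (k * x)) + partial_x g (Complex x y) * cis (k * x)) has_integral
          (g (Complex 1 y) * cis (k * 1) - g (Complex 0 y) * cis (k * 0))) {0..1}"
    by (rule fundamental_theorem_of_calculus)
       (auto intro!: has_vector_derivative_mult has_vector_derivative_cis_mult
          has_vector_derivative_at_within[OF has_vector_derivative_x[OF g(1) y]])
  moreover have "cis k = 1"
    using cis_2pi_eq_1_iff[of "- of_int n"] by (simp add: k_def)
  ultimately have 1: "((\<lambda>x. g (Complex x y) * (\<i> * of_real k * cis (k * x)) + partial_x g (Complex x y) * cis (k * x)) has_integral 0) {0..1}"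
    using periodic_H_Complex[OF g(2) y, of 0] by simp
  have 2: "((\<lambda>x. \<i> * of_real k * (g (Complex x y) * cis (k * x))) has_integral (\<i> * of_real k * strip_coeff g n y)) {0..1}"
    unfolding strip_coeff_def fourier_coeff_def k_def
    by (intro has_integral_mult_right integrable_integral integrable_fourier continuous_on_horizontal smooth_on_continuous g y)
  from has_integral_diff[OF 1 2]
  have "((\<lambda>x. partial_x g (Complex x y) * cis (k * x)) has_integral - (\<i> * of_real k * strip_coeff g n y)) {0..1}"
    by (simp add: algebra_simps)
  thus ?thesis by (simp add: strip_coeff_def fourier_coeff_def k_def integral_unique algebra_simps)
qed

text \<open>Iterated partial derivatives with x and y in any order, as an inductive set so that
  smoothness, periodicity and decay can be proved once for all of them.\<close>

inductive derivs :: "(complex \<Rightarrow> complex) \<Rightarrow> (complex \<Rightarrow> complex) \<Rightarrow> bool" for f where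
  derivs_self: "derivs f f"
| derivs_x: "derivs f g \<Longrightarrow> derivs f (partial_x g)"
| derivs_y: "derivs f g \<Longrightarrow> derivs f (partial_y g)"

lemma derivs_smooth: "derivs f g \<Longrightarrow> smooth_on upper_half_plane f \<Longrightarrow> smooth_on upper_half_plane g"
  by (induction rule: derivs.induct) (auto intro: smooth_on_partial_x smooth_on_partial_y)

lemma derivs_periodic: "derivs f g \<Longrightarrow> periodic_H f \<Longrightarrow> periodic_H g"
  by (induction rule: derivs.induct) (auto intro: periodic_H_partial_x periodic_H_partial_y)

text \<open>The frequencies n and -n are paired, so that convergence of the symmetric partial sums
  becomes convergence of an ordinary series.\<close>

lemma strip_fourier_series:
  assumes g: "smooth_on upper_half_plane g" "periodic_H g" and y: "y > 0" and z: "strip_coeff g 0 y = 0"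
  shows "(\<lambda>k. strip_coeff g (int (Suc k)) y * cis (2 * pi * real (Suc k) * x) +
              strip_coeff g (- int (Suc k)) y * cis (- 2 * pi * real (Suc k) * x)) sums g (Complex x y)"
proof -
  have "(\<lambda>N. \<Sum>n=-int N..int N. strip_coeff g n y * cis (2 * pi * of_int n * x)) \<longlonglongrightarrow> g (Complex x y)"
    unfolding strip_coeff_def
    by (rule fourier_series) (use g y in \<open>auto intro!: continuous_on_horizontal smooth_on_continuous
        has_vector_derivative_x periodic_H_Complex\<close>)
  moreover have "(\<Sum>n=-int N..int N. strip_coeff g n y * cis (2 * pi * of_int n * x)) =
      (\<Sum>k<N. strip_coeff g (int (Suc k)) y * cis (2 * pi * real (Suc k) * x) +
              strip_coeff g (- int (Suc k)) y * cis (- 2 * pi * real (Suc k) * x))" for N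
  proof (induction N)
    case 0
    thus ?case by (simp add: z)
  next
    case (Suc N)
    have "{-int (Suc N)..int (Suc N)} = insert (-int (Suc N)) (insert (int (Suc N)) {-int N..int N})"
      by auto
    thus ?case using Suc by (simp add: algebra_simps)
  qed
  ultimately show ?thesis by (simp add: sums_def)
qed

section \<open>Polynomial growth against exponential decay\<close>

lemma power_exp_le:
  fixes a x :: real
  assumes "a > 0" "x \<ge> 0"
  shows "x ^ B * exp (- a * x) \<le> (real B / a) ^ B"
proof (cases "B = 0")
  case False
  have "x ^ B = (real B / a) ^ B * (a * x / real B) ^ B"
    using assms False by (simp add: power_mult_distrib[symmetric])
  also have "\<dots> \<le> (real B / a) ^ B * (exp (a * x / real B)) ^ B"
    using assms by (intro mult_left_mono power_mono) (auto intro: order.trans[OF _ exp_ge_add_one_self])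
  also have "(exp (a * x / real B)) ^ B = exp (a * x)"
    using False by (simp flip: exp_of_nat_mult)
  finally have "x ^ B * exp (- a * x) \<le> (real B / a) ^ B * exp (a * x) * exp (- a * x)"
    by (intro mult_right_mono) auto
  thus ?thesis by (simp add: mult.assoc flip: exp_add)
qed (use assms in auto)

lemma power_exp_decay_sum:
  fixes c :: real
  assumes c: "c > 0"
  shows "summable (\<lambda>k. real (Suc k) ^ B * exp (- c * real (Suc k)))"
proof (rule summable_comparison_test)
  define K where "K = (real B / (c / 2)) ^ B"
  show "\<exists>N. \<forall>n\<ge>N. norm (real (Suc n) ^ B * exp (- c * real (Suc n))) \<le> K * exp (- c / 2) ^ (Suc n)"
  proof (intro exI[of _ 0] allI impI)
    fix n
    have "real (Suc n) ^ B * exp (- c * real (Suc n)) =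
          (real (Suc n) ^ B * exp (- (c / 2) * real (Suc n))) * exp (- (c / 2) * real (Suc n))"
      by (simp add: mult.assoc field_simps flip: exp_add)
    also have "\<dots> \<le> K * exp (- (c / 2) * real (Suc n))"
      unfolding K_def using c by (intro mult_right_mono power_exp_le) auto
    also have "exp (- (c / 2) * real (Suc n)) = exp (- c / 2) ^ (Suc n)"
      by (subst exp_of_nat_mult[symmetric]) (simp add: field_simps)
    finally show "norm (real (Suc n) ^ B * exp (- c * real (Suc n))) \<le> K * exp (- c / 2) ^ (Suc n)" by simp
  qed
  show "summable (\<lambda>n. K * exp (- c / 2) ^ (Suc n))"
    using c by (intro summable_mult, subst summable_Suc_iff) (auto intro: summable_geometric)
qed

text \<open>
  Coefficients depending polynomially on the frequency \<open>n\<close> and on \<open>1/y\<close>; they arise when the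
  radial equation is used to reduce higher derivatives of Fourier coefficients.
\<close>

inductive radial_coeff :: "(int \<Rightarrow> real \<Rightarrow> complex) \<Rightarrow> bool" where
  rc_const: "radial_coeff (\<lambda>n y. c)"
| rc_freq: "radial_coeff (\<lambda>n y. of_int n)"
| rc_inv: "radial_coeff (\<lambda>n y. of_real (1 / y))"
| rc_add: "radial_coeff A \<Longrightarrow> radial_coeff B \<Longrightarrow> radial_coeff (\<lambda>n y. A n y + B n y)"
| rc_mult: "radial_coeff A \<Longrightarrow> radial_coeff B \<Longrightarrow> radial_coeff (\<lambda>n y. A n y * B n y)"

text \<open>Differentiating 1/y gives -(1/y)^2, so the class is closed under d/dy. The induction
  over y-derivatives in \<open>derivs_coeff\<close> rests on this.\<close>

lemma radial_coeff_deriv: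
  "radial_coeff A \<Longrightarrow> \<exists>A'. radial_coeff A' \<and> (\<forall>n. \<forall>y>0. (A n has_vector_derivative A' n y) (at y))"
proof (induction rule: radial_coeff.induct)
  case (rc_const c)
  show ?case by (intro exI[of _ "\<lambda>n y. 0"]) (auto intro: radial_coeff.rc_const)
next
  case rc_freq
  show ?case by (intro exI[of _ "\<lambda>n y. 0"]) (auto intro: radial_coeff.rc_const)
next
  case rc_inv
  have "radial_coeff (\<lambda>n y. (-1) * (of_real (1 / y) * of_real (1 / y)))"
    by (intro radial_coeff.intros)
  moreover have "((\<lambda>y. of_real (1 / y)) has_vector_derivative (-1) * (of_real (1 / y) * complex_of_real (1 / y))) (at y)"
    if "y > 0" for y :: real
  proof -
    have "((\<lambda>y. 1 / y) has_real_derivative - 1 * (1 / y * (1 / y))) (at y)"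
      using that by (auto intro!: derivative_eq_intros)
    hence "((\<lambda>y. complex_of_real (1 / y)) has_vector_derivative of_real (- 1 * (1 / y * (1 / y)))) (at y)"
      by (rule has_vector_derivative_of_real)
    thus ?thesis by simp
  qed
  ultimately show ?case by blast
next
  case (rc_add A B)
  then obtain A' B' where "radial_coeff A'" "radial_coeff B'"
    "\<forall>n. \<forall>y>0. (A n has_vector_derivative A' n y) (at y)" "\<forall>n. \<forall>y>0. (B n has_vector_derivative B' n y) (at y)" by blast
  thus ?case
    by (intro exI[of _ "\<lambda>n y. A' n y + B' n y"]) (auto intro: radial_coeff.rc_add has_vector_derivative_add)
next
  case (rc_mult A B)
  then obtain A' B' where "radial_coeff A'" "radial_coeff B'"
    "\<forall>n. \<forall>y>0. (A n has_vector_derivative A' n y) (at y)" "\<forall>n. \<forall>y>0. (B n has_vector_derivative B' n y) (at y)" by blast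
  thus ?case using rc_mult.hyps
    by (intro exI[of _ "\<lambda>n y. A n y * B' n y + A' n y * B n y"])
       (auto intro!: radial_coeff.rc_add radial_coeff.rc_mult has_vector_derivative_mult)
qed

lemma radial_coeff_bound:
  assumes c: "c > 0"
  shows "radial_coeff A \<Longrightarrow> \<exists>C\<ge>0. \<exists>B::nat. \<forall>n y. y \<ge> c \<longrightarrow> norm (A n y) \<le> C * (1 + \<bar>real_of_int n\<bar>) ^ B"
proof (induction rule: radial_coeff.induct)
  case (rc_const k)
  show ?case by (intro exI[of _ "norm k"] conjI exI[of _ 0]) auto
next
  case rc_freq
  show ?case by (intro exI[of _ 1] conjI exI[of _ 1]) auto
next
  case rc_inv
  show ?case using c by (intro exI[of _ "1 / c"] conjI exI[of _ 0]) (auto simp: norm_divide field_simps)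
next
  case (rc_add A B)
  then obtain C1 B1 C2 B2 where *: "C1 \<ge> 0" "C2 \<ge> 0"
    "\<And>n y. y \<ge> c \<Longrightarrow> norm (A n y) \<le> C1 * (1 + \<bar>real_of_int n\<bar>) ^ B1"
    "\<And>n y. y \<ge> c \<Longrightarrow> norm (B n y) \<le> C2 * (1 + \<bar>real_of_int n\<bar>) ^ B2" by metis
  have "norm (A n y + B n y) \<le> (C1 + C2) * (1 + \<bar>real_of_int n\<bar>) ^ (B1 + B2)" if "y \<ge> c" for n y
  proof -
    have "norm (A n y + B n y) \<le> C1 * (1 + \<bar>real_of_int n\<bar>) ^ B1 + C2 * (1 + \<bar>real_of_int n\<bar>) ^ B2"
      using *(3,4)[OF that] by (intro norm_triangle_le add_mono) auto
    also have "\<dots> \<le> C1 * (1 + \<bar>real_of_int n\<bar>) ^ (B1 + B2) + C2 * (1 + \<bar>real_of_int n\<bar>) ^ (B1 + B2)"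
      using * by (intro add_mono mult_left_mono power_increasing) auto
    finally show ?thesis by (simp add: algebra_simps)
  qed
  thus ?case using * by (intro exI[of _ "C1 + C2"] conjI exI[of _ "B1 + B2"]) auto
next
  case (rc_mult A B)
  then obtain C1 B1 C2 B2 where *: "C1 \<ge> 0" "C2 \<ge> 0"
    "\<And>n y. y \<ge> c \<Longrightarrow> norm (A n y) \<le> C1 * (1 + \<bar>real_of_int n\<bar>) ^ B1"
    "\<And>n y. y \<ge> c \<Longrightarrow> norm (B n y) \<le> C2 * (1 + \<bar>real_of_int n\<bar>) ^ B2" by metis
  have "norm (A n y * B n y) \<le> (C1 * C2) * (1 + \<bar>real_of_int n\<bar>) ^ (B1 + B2)" if "y \<ge> c" for n y
  proof -
    have "norm (A n y * B n y) \<le> (C1 * (1 + \<bar>real_of_int n\<bar>) ^ B1) * (C2 * (1 + \<bar>real_of_int n\<bar>) ^ B2)"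
      unfolding norm_mult using *(3,4)[OF that] * by (intro mult_mono) auto
    thus ?thesis by (simp add: power_add mult_ac)
  qed
  thus ?case using * by (intro exI[of _ "C1 * C2"] conjI exI[of _ "B1 + B2"]) auto
qed

section \<open>Hecke-Maass cusp forms\<close>

lemma sum_shift_periodic:
  fixes G :: "nat \<Rightarrow> 'a :: ab_group_add"
  assumes "G d = G 0"
  shows "(\<Sum>b<d. G (Suc b)) = (\<Sum>b<d. G b)"
proof -
  have "(\<Sum>b<d. G (Suc b)) + G 0 = (\<Sum>b<d. G b) + G d"
    by (metis add.commute sum.lessThan_Suc sum.lessThan_Suc_shift)
  thus ?thesis using assms by simp
qed

locale hecke_form =
  fixes f :: "complex \<Rightarrow> complex"
  assumes hf: "hecke_maass_cusp_form f"
begin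

abbreviation "l \<equiv> hecke_eigenvalue f"

definition "a = strip_coeff f"
definition "a1 = strip_coeff (partial_y f)"
definition "mu = (SOME \<mu>. \<forall>z\<in>upper_half_plane. hyperbolic_laplacian f z = \<mu> * f z)"

lemma mf: "maass_cusp_form f" using hf by (simp add: hecke_maass_cusp_form_def)

lemma smooth: "smooth_on upper_half_plane f" using mf by (simp add: maass_cusp_form_def)

lemma cont: "continuous_on upper_half_plane f" by (rule smooth_on_continuous[OF smooth])

lemma invariant:
  fixes a b c d :: int
  assumes "a * d - b * c = 1" "z \<in> upper_half_plane"
  shows "f ((of_int a * z + of_int b) / (of_int c * z + of_int d)) = f z"
  using mf assms unfolding maass_cusp_form_def SL2Z_invariant_def by blast

lemma translate: "z \<in> upper_half_plane \<Longrightarrow> f (z + of_int k) = f z"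
  using invariant[of 1 1 k 0 z] by simp

lemma periodic: "periodic_H f"
  unfolding periodic_H_def using translate[of _ 1] by simp

lemma laplacian: "z \<in> upper_half_plane \<Longrightarrow> hyperbolic_laplacian f z = mu * f z"
proof -
  have "\<exists>\<mu>. \<forall>z\<in>upper_half_plane. hyperbolic_laplacian f z = \<mu> * f z"
    using mf by (auto simp: maass_cusp_form_def)
  from someI_ex[OF this] show "z \<in> upper_half_plane \<Longrightarrow> hyperbolic_laplacian f z = mu * f z"
    unfolding mu_def by blast
qed

lemma a_0: "y > 0 \<Longrightarrow> a 0 y = 0"
  using mf by (simp add: a_def strip_coeff_def fourier_coeff_def maass_cusp_form_def)

lemma a_deriv: "y > 0 \<Longrightarrow> (a n has_vector_derivative a1 n y) (at y)"
  unfolding a_def a1_def by (rule strip_coeff_has_vector_derivative[OF smooth])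

text \<open>The n-th Fourier coefficient of the Laplace equation, in which the two x-derivatives
  contribute (2 pi i n)^2. For n = 1 and n = -1 it is the radial equation with \<omega> = 2
  pi.\<close>

lemma a1_deriv:
  assumes y: "y > 0"
  shows "(a1 n has_vector_derivative ((of_real ((2 * pi * of_int n)\<^sup>2) - mu / of_real (y\<^sup>2)) * a n y)) (at y)"
proof -
  have sx: "smooth_on upper_half_plane (partial_x f)" and sy: "smooth_on upper_half_plane (partial_y f)"
    and sxx: "smooth_on upper_half_plane (partial_x (partial_x f))"
    by (intro smooth_on_partial_x smooth_on_partial_y smooth)+
  define k where "k = - mu / of_real (y\<^sup>2)"
  have "partial_y (partial_y f) (Complex x y) = k * f (Complex x y) - partial_x (partial_x f) (Complex x y)" for x
  proof -
    define A B where "A = partial_x (partial_x f) (Complex x y)" and "B = partial_y (partial_y f) (Complex x y)"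
    have "- of_real (y\<^sup>2) * (A + B) = mu * f (Complex x y)"
      using laplacian[of "Complex x y"] y by (simp add: hyperbolic_laplacian_def A_def B_def)
    hence "k * f (Complex x y) = - (- of_real (y\<^sup>2) * (A + B)) / of_real (y\<^sup>2)" by (simp add: k_def)
    also have "\<dots> = A + B" using y by simp
    finally have "A + B = k * f (Complex x y)" ..
    thus ?thesis by (simp add: A_def B_def algebra_simps)
  qed
  hence "strip_coeff (partial_y (partial_y f)) n y =
     integral {0..1} (\<lambda>x. k * (f (Complex x y) * cis (- 2 * pi * of_int n * x)) -
        partial_x (partial_x f) (Complex x y) * cis (- 2 * pi * of_int n * x))"
    unfolding strip_coeff_def fourier_coeff_def by (simp only: left_diff_distrib mult.assoc)
  also have "\<dots> = k * a n y - strip_coeff (partial_x (partial_x f)) n y"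
    unfolding strip_coeff_def a_def fourier_coeff_def
    by (intro integral_unique has_integral_diff has_integral_mult_right integrable_integral integrable_fourier
          continuous_on_horizontal cont smooth_on_continuous sxx y)
  also have "strip_coeff (partial_x (partial_x f)) n y =
      2 * of_real pi * \<i> * of_int n * (2 * of_real pi * \<i> * of_int n * a n y)"
    unfolding a_def
    by (simp only: strip_coeff_partial_x[OF sx periodic_H_partial_x[OF periodic] y] strip_coeff_partial_x[OF smooth periodic y])
  finally have "strip_coeff (partial_y (partial_y f)) n y =
      (of_real ((2 * pi * of_int n)\<^sup>2) - mu / of_real (y\<^sup>2)) * a n y"
    by (simp add: k_def algebra_simps power2_eq_square)
  thus ?thesis using strip_coeff_has_vector_derivative[OF sy y, of n] by (simp add: a1_def)
qed

lemma nonzero_coeff: "\<exists>n y. y > 0 \<and> a n y \<noteq> 0"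
proof (rule ccontr)
  assume "\<not> (\<exists>n y. y > 0 \<and> a n y \<noteq> 0)"
  hence z: "strip_coeff f n y = 0" if "y > 0" for n y using that by (auto simp: a_def)
  obtain w where w: "w \<in> upper_half_plane" "f w \<noteq> 0" using mf by (auto simp: maass_cusp_form_def)
  hence "Im w > 0" by (simp add: upper_half_plane_def)
  from strip_fourier_series[OF smooth periodic this z[OF this], of "Re w"] z[OF this]
  have "f w = 0" by (simp add: sums_iff)
  with w show False by simp
qed

text \<open>Compare the m-th Fourier coefficients of the two sides of T_n f = l(n) f. For n = a d,
  the dilation by a requires a to divide m and replaces m by m/a, and the average over b mod d then
  selects the frequency (m/a) d.\<close>

lemma hecke_fourier:
  assumes n: "n \<ge> 1" and y: "y > 0"
  shows "of_real (sqrt (real n)) * l n * a m y =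
     (\<Sum>d | d dvd n. if int (n div d) dvd m
        then of_nat d * a (m div int (n div d) * int d) (real (n div d) * y / real d) else 0)"
proof -
  define g where "g = (\<lambda>d u. f (Complex u (real (n div d) * y / real d)))"
  define \<phi> where "\<phi> = (\<lambda>d t. \<Sum>b<d. g d ((t + real b) / real d))"
  have fin: "finite {d. d dvd n}" using n by simp
  have dpos: "d > 0" "n div d > 0" if "d dvd n" for d
    using that n by (auto simp: dvd_div_eq_0_iff intro: Nat.gr0I)
  have contg: "continuous_on A (g d)" if "d dvd n" for d A
    unfolding g_def using dpos[OF that] y by (intro continuous_on_horizontal cont) auto
  have perg: "g d (u + 1) = g d u" if "d dvd n" for d u
    unfolding g_def using dpos[OF that] y by (intro periodic_H_Complex periodic) auto
  have cont\<phi>: "continuous_on A (\<phi> d)" if "d dvd n" for d A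
    unfolding \<phi>_def
    by (intro continuous_intros continuous_on_compose2[OF contg[OF that, of UNIV]]) (use dpos[OF that] in auto)
  have per\<phi>: "\<phi> d (t + 1) = \<phi> d t" if "d dvd n" for d t
  proof -
    have "\<phi> d (t + 1) = (\<Sum>b<d. (\<lambda>b. g d ((t + real b) / real d)) (Suc b))"
      by (simp add: \<phi>_def add_ac)
    also have "\<dots> = (\<Sum>b<d. (\<lambda>b. g d ((t + real b) / real d)) b)"
    proof (rule sum_shift_periodic)
      have "(t + real d) / real d = t / real d + 1" using dpos[OF that] by (simp add: field_simps)
      thus "g d ((t + real d) / real d) = g d ((t + real 0) / real d)" using perg[OF that, of "t / real d"] by simp
    qed
    finally show ?thesis by (simp add: \<phi>_def)
  qed
  have arg: "(of_nat (n div d) * Complex x y + of_nat b) / of_nat d =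
       Complex ((real (n div d) * x + real b) / real d) (real (n div d) * y / real d)" for d x b
    by (simp add: complex_eq_iff Re_divide_of_nat Im_divide_of_nat)
  have op: "of_real (sqrt (real n)) * (l n * f (Complex x y)) = (\<Sum>d | d dvd n. \<phi> d (real (n div d) * x))" for x
  proof -
    have "hecke_operator n f (Complex x y) = l n * f (Complex x y)"
      using hecke_operator_eigenvalue[OF hf n, of "Complex x y"] y by simp
    hence "l n * f (Complex x y) = (\<Sum>d | d dvd n. \<phi> d (real (n div d) * x)) / of_real (sqrt (real n))"
      unfolding hecke_operator_def arg \<phi>_def g_def by simp
    thus ?thesis using n by simp
  qed
  have "of_real (sqrt (real n)) * l n * a m y =
        integral {0..1} (\<lambda>x. (\<Sum>d | d dvd n. \<phi> d (real (n div d) * x) * cis (- 2 * pi * of_int m * x)))"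
    unfolding a_def strip_coeff_def fourier_coeff_def integral_mult_right[symmetric] sum_distrib_right[symmetric]
    by (intro integral_cong) (simp only: op[symmetric] mult.assoc)
  also have "\<dots> = (\<Sum>d | d dvd n. fourier_coeff (\<lambda>x. \<phi> d (real (n div d) * x)) m)"
    unfolding fourier_coeff_def
    by (intro integral_sum fin integrable_fourier continuous_on_compose2[OF cont\<phi>[of _ UNIV]] continuous_intros) auto
  also have "\<dots> = (\<Sum>d | d dvd n. if int (n div d) dvd m
        then of_nat d * a (m div int (n div d) * int d) (real (n div d) * y / real d) else 0)"
  proof (intro sum.cong refl)
    fix d assume "d \<in> {d. d dvd n}"
    hence d: "d dvd n" by simp
    have "fourier_coeff (\<lambda>x. \<phi> d (real (n div d) * x)) m =
        (if int (n div d) dvd m then fourier_coeff (\<phi> d) (m div int (n div d)) else 0)"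
      using dpos[OF d] by (intro fourier_coeff_dilate cont\<phi> per\<phi> d) auto
    also have "fourier_coeff (\<phi> d) k = of_nat d * fourier_coeff (g d) (k * int d)" for k
      unfolding \<phi>_def using dpos[OF d] by (intro fourier_coeff_average contg d) auto
    finally show "fourier_coeff (\<lambda>x. \<phi> d (real (n div d) * x)) m = (if int (n div d) dvd m
        then of_nat d * a (m div int (n div d) * int d) (real (n div d) * y / real d) else 0)"
      by (simp add: g_def a_def strip_coeff_def)
  qed
  finally show ?thesis .
qed

text \<open>At the frequencies 1 and -1 only the divisor d = n survives in
  \<open>hecke_fourier\<close>. The same eigenvalue occurs for both signs, which is why no parity of
  f is required.\<close>

lemma a_scale:
  assumes n: "n \<ge> 1" and y: "y > 0" and s: "\<bar>s\<bar> = 1"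
  shows "a (s * int n) y = l n / of_real (sqrt (real n)) * a s (real n * y)"
proof -
  have "of_real (sqrt (real n)) * l n * a s (real n * y) =
     (\<Sum>d | d dvd n. if int (n div d) dvd s
        then of_nat d * a (s div int (n div d) * int d) (real (n div d) * (real n * y) / real d) else 0)"
    using n y by (intro hecke_fourier) auto
  also have "\<dots> = (\<Sum>d | d dvd n. if d = n then of_nat n * a (s * int n) y else 0)"
  proof (intro sum.cong refl)
    fix d assume "d \<in> {d. d dvd n}"
    hence d: "d dvd n" by simp
    have "int (n div d) dvd s \<longleftrightarrow> d = n"
    proof
      assume "int (n div d) dvd s"
      hence "int (n div d) dvd 1" using s by (metis dvd_abs_iff)
      hence "n div d = 1" by simp
      thus "d = n" using d by (metis dvd_mult_div_cancel mult.right_neutral)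
    qed (use n in auto)
    thus "(if int (n div d) dvd s
        then of_nat d * a (s div int (n div d) * int d) (real (n div d) * (real n * y) / real d) else 0) =
       (if d = n then of_nat n * a (s * int n) y else 0)" using n by auto
  qed
  also have "\<dots> = of_nat n * a (s * int n) y" using n by (simp add: sum.delta)
  finally have *: "of_real (sqrt (real n)) * l n * a s (real n * y) = of_nat n * a (s * int n) y" .
  have "of_nat n = complex_of_real (sqrt (real n)) * of_real (sqrt (real n))"
    by (simp flip: of_real_mult)
  hence "complex_of_real (sqrt (real n)) * (l n * a s (real n * y)) =
         complex_of_real (sqrt (real n)) * (of_real (sqrt (real n)) * a (s * int n) y)"
    using * by (simp add: mult_ac)
  thus ?thesis using n by (simp add: field_simps)
qed

lemma nonzero_sign: "\<exists>s y. \<bar>s\<bar> = 1 \<and> y > 0 \<and> a s y \<noteq> 0"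
proof -
  obtain n y where ny: "y > 0" "a n y \<noteq> 0" using nonzero_coeff by blast
  have "n \<noteq> 0" using ny a_0 by auto
  hence "a (sgn n * int (nat \<bar>n\<bar>)) y = l (nat \<bar>n\<bar>) / of_real (sqrt (real (nat \<bar>n\<bar>))) * a (sgn n) (real (nat \<bar>n\<bar>) * y)"
    using ny by (intro a_scale) (auto simp: abs_sgn_eq)
  hence "a (sgn n) (real (nat \<bar>n\<bar>) * y) \<noteq> 0" using ny by (auto simp: sgn_mult_abs)
  thus ?thesis using \<open>n \<noteq> 0\<close> ny by (intro exI[of _ "sgn n"] exI[of _ "real (nat \<bar>n\<bar>) * y"]) (auto simp: abs_sgn_eq)
qed

text \<open>Apply \<open>hecke_fourier\<close> with n = q at frequency s m. By
  \<open>a_scale\<close> every term is a multiple of one nonzero value of a coefficient of index 1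
  or -1, which can be cancelled.\<close>

lemma hecke_mult:
  assumes q: "prime q" and m: "m \<ge> 1"
  shows "l q * l m = l (q * m) + (if q dvd m then l (m div q) else 0)"
proof -
  obtain s y0 where s: "\<bar>s\<bar> = 1" "y0 > 0" "a s y0 \<noteq> 0" using nonzero_sign by blast
  \<comment> \<open>At this height the rescaled arguments m y, (q m) (y / q) and (m / q) (q y) all
    equal y0.\<close>
  define y where "y = y0 / real m"
  have y: "y > 0" "real m * y = y0" using s m by (auto simp: y_def)
  have q0: "q > 1" using q prime_gt_1_nat by blast
  have sq: "complex_of_real (sqrt (real q)) * of_real (sqrt (real q)) = of_nat q" by (simp flip: of_real_mult)
  have div: "{d. d dvd q} = {1, q}" using q by (auto simp: prime_nat_iff)
  have "of_real (sqrt (real q)) * l q * a (s * int m) y =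
     (\<Sum>d | d dvd q. if int (q div d) dvd s * int m
        then of_nat d * a (s * int m div int (q div d) * int d) (real (q div d) * y / real d) else 0)"
    using q0 y by (intro hecke_fourier) auto
  also have "\<dots> = (if int q dvd s * int m then a (s * int m div int q) (real q * y) else 0) +
                  of_nat q * a (s * int (q * m)) (y / real q)"
    unfolding div using q0 by (simp add: mult_ac)
  also have "int q dvd s * int m \<longleftrightarrow> q dvd m"
    using s(1) by (metis dvd_abs_iff abs_mult mult_1 abs_of_nat int_dvd_int_iff)
  also have "(if q dvd m then a (s * int m div int q) (real q * y) else 0) =
             (if q dvd m then l (m div q) else 0) * of_real (sqrt (real q)) / of_real (sqrt (real m)) * a s y0"
  proof (cases "q dvd m")
    case True
    then obtain r where r: "m = q * r" by (elim dvdE)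
    have r1: "r \<ge> 1" using m r by (cases r) auto
    have "s * int m div int q = s * int r" using q0 by (simp add: r)
    moreover have "a (s * int r) (real q * y) = l r / of_real (sqrt (real r)) * a s (real r * (real q * y))"
      using r1 q0 y s by (intro a_scale) auto
    moreover have "real r * (real q * y) = y0" using y by (simp add: r mult_ac)
    moreover have "of_real (sqrt (real m)) = complex_of_real (sqrt (real q)) * of_real (sqrt (real r))"
      by (simp add: r real_sqrt_mult)
    ultimately show ?thesis using True q0 r by (simp add: field_simps)
  qed auto
  also have "a (s * int (q * m)) (y / real q) = l (q * m) / of_real (sqrt (real (q * m))) * a s y0"
  proof -
    have "a (s * int (q * m)) (y / real q) = l (q * m) / of_real (sqrt (real (q * m))) * a s (real (q * m) * (y / real q))"
      using q0 m y s by (intro a_scale) auto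
    thus ?thesis using q0 y by simp
  qed
  also have "a (s * int m) y = l m / of_real (sqrt (real m)) * a s y0"
    using a_scale[OF m y(1) s(1)] y by simp
  finally have *: "of_real (sqrt (real q)) * l q * (l m / of_real (sqrt (real m)) * a s y0) =
     (if q dvd m then l (m div q) else 0) * of_real (sqrt (real q)) / of_real (sqrt (real m)) * a s y0 +
     of_nat q * (l (q * m) / of_real (sqrt (real (q * m))) * a s y0)" .
  define Q M A where "Q = complex_of_real (sqrt (real q))" and "M = complex_of_real (sqrt (real m))" and "A = a s y0"
  have nz: "Q \<noteq> 0" "M \<noteq> 0" "A \<noteq> 0" using q0 m s by (auto simp: Q_def M_def A_def)
  have "of_nat q * (l (q * m) / of_real (sqrt (real (q * m))) * a s y0) = Q * l (q * m) / M * A"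
    using nz sq by (simp add: Q_def M_def A_def real_sqrt_mult field_simps)
  with * have "Q * l q * (l m / M * A) = (if q dvd m then l (m div q) else 0) * Q / M * A + Q * l (q * m) / M * A"
    by (simp add: Q_def M_def A_def)
  hence "(Q / M * A) * (l q * l m) = (Q / M * A) * (l (q * m) + (if q dvd m then l (m div q) else 0))"
    by (simp add: algebra_simps add_divide_distrib)
  thus ?thesis using nz by simp
qed

text \<open>Dirichlet approximation replaces the fundamental domain. With N about y^(-1/2), some h/k
  with k \<le> N satisfies |k x - h| < 1/N, so |k z - h|^2 \<le> 4 y + y = 5 y, and a matrix with
  lower row (k, -h) moves z to height at least 1/5. The bound |k z - h| \<ge> y limits that height
  by 1/y.\<close>

lemma reduction:
  assumes z: "z \<in> upper_half_plane" "Im z < 1"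
  shows "\<exists>w. f w = f z \<and> Im w \<ge> 1 / 5 \<and> Im w \<le> 1 / Im z"
proof -
  define x y where "x = Re z" and "y = Im z"
  have y: "y > 0" "y < 1" using z by (auto simp: upper_half_plane_def y_def)
  define r where "r = 1 / sqrt y"
  have r: "r \<ge> 1" using y by (simp add: r_def real_sqrt_le_1_iff)
  define N where "N = nat \<lfloor>r\<rfloor>"
  have N: "N \<ge> 1" "real N \<le> r" "real N \<ge> r / 2"
  proof -
    have "\<lfloor>r\<rfloor> \<ge> 1" using r by linarith
    thus "N \<ge> 1" unfolding N_def by linarith
    have "real N = of_int \<lfloor>r\<rfloor>" using \<open>\<lfloor>r\<rfloor> \<ge> 1\<close> by (simp add: N_def)
    moreover have "real_of_int \<lfloor>r\<rfloor> \<ge> 1" using \<open>\<lfloor>r\<rfloor> \<ge> 1\<close> by simp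
    ultimately show "real N \<le> r" "real N \<ge> r / 2" by linarith+
  qed
  have ry: "r\<^sup>2 * y = 1" using y by (simp add: r_def power_divide)
  from N(1) have "N > 0" by simp
  then obtain h k :: int where hk: "coprime h k" "0 < k" "k \<le> int N" "\<bar>of_int k * x - of_int h\<bar> < 1 / real N"
    using Dirichlet_approx_coprime[of N x] by metis
  obtain u v where uv: "u * h + v * k = 1"
    using bezout_int[of h k] hk(1) by (auto simp: coprime_iff_gcd_eq_1)
  define den where "den = of_int k * z + of_int (- h)"
  define w where "w = (of_int (- u) * z + of_int (- v)) / den"
  have "(- u) * (- h) - (- v) * k = 1" using uv by (simp add: algebra_simps)
  from invariant[OF this z(1)] have fw: "f w = f z" by (simp add: w_def den_def)
  have den2: "(norm den)\<^sup>2 = (of_int k * x - of_int h)\<^sup>2 + (of_int k * y)\<^sup>2"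
    by (simp add: den_def cmod_power2 x_def y_def)
  have kpos: "real_of_int k \<ge> 1" using hk by simp
  have den_pos: "(norm den)\<^sup>2 \<ge> y\<^sup>2"
  proof -
    have "(1 * y)\<^sup>2 \<le> (of_int k * y)\<^sup>2" using kpos y by (intro power_mono mult_right_mono) auto
    thus ?thesis using den2 by (smt (verit) mult_1 zero_le_power2)
  qed
  hence den0: "den \<noteq> 0" using y by auto
  have Imw: "Im w = y / (norm den)\<^sup>2"
  proof -
    define num where "num = of_int (- u) * z + of_int (- v)"
    have "Im w = (Im num * Re den - Re num * Im den) / (norm den)\<^sup>2"
      unfolding w_def num_def[symmetric] Im_divide cmod_power2 ..
    also have "Im num * Re den - Re num * Im den =
        - of_int u * y * (of_int k * x - of_int h) - (- of_int u * x - of_int v) * (of_int k * y)"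
      by (simp add: num_def den_def x_def y_def)
    also have "\<dots> = of_int (u * h + v * k) * y" by (simp add: algebra_simps)
    finally show ?thesis by (simp add: uv)
  qed
  have "(norm den)\<^sup>2 \<le> 5 * y"
  proof -
    have "(of_int k * x - of_int h)\<^sup>2 \<le> (1 / real N)\<^sup>2"
      using hk(4) by (metis abs_le_square_iff abs_of_nonneg divide_nonneg_nonneg less_imp_le of_nat_0_le_iff zero_le_one)
    also have "\<dots> \<le> (2 / r)\<^sup>2"
      using N r by (intro power_mono) (auto simp: field_simps)
    also have "\<dots> = 4 * y" using ry r by (simp add: power_divide field_simps)
    finally have 1: "(of_int k * x - of_int h)\<^sup>2 \<le> 4 * y" .
    have "(of_int k * y)\<^sup>2 \<le> (r * y)\<^sup>2"
      using hk N y kpos by (intro power_mono mult_right_mono) (auto intro: order.trans[of _ "real N"])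
    also have "\<dots> = y * (r\<^sup>2 * y)" by (simp add: power2_eq_square)
    also have "\<dots> = y" using ry by simp
    finally show ?thesis using 1 den2 by simp
  qed
  hence "Im w \<ge> 1 / 5" unfolding Imw using y den0 by (simp add: field_simps)
  moreover have "Im w \<le> 1 / y"
    unfolding Imw using den_pos y den0 by (simp add: field_simps power2_eq_square)
  ultimately show ?thesis using fw by (auto simp: y_def)
qed

text \<open>The definition grants moderate growth only for Im z \<ge> 1. Compactness covers heights
  between 1/5 and 1 after a translation, and \<open>reduction\<close> transports the bound to all
  smaller heights.\<close>

lemma poly_bound: "\<exists>C\<ge>0. \<exists>m::nat. \<forall>z\<in>upper_half_plane. norm (f z) \<le> C * (1 + Im z + 1 / Im z) ^ m"
proof -
  obtain C A where CA: "\<And>z. Im z \<ge> 1 \<Longrightarrow> norm (f z) \<le> C * Im z powr A"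
    using mf unfolding maass_cusp_form_def by blast
  obtain m :: nat where m: "real m \<ge> A" using real_arch_simple by blast
  define K where "K = {0..1::real} \<times> {1/5..1::real}"
  have "compact ((\<lambda>p. f (Complex (fst p) (snd p))) ` K)"
    unfolding K_def
    by (intro compact_continuous_image compact_Times continuous_on_compose2[OF cont] continuous_intros) auto
  hence "bounded ((\<lambda>p. f (Complex (fst p) (snd p))) ` K)" by (rule compact_imp_bounded)
  then obtain B where B: "\<And>p. p \<in> K \<Longrightarrow> norm (f (Complex (fst p) (snd p))) \<le> B"
    unfolding bounded_iff by (metis imageI)
  define D where "D = max \<bar>C\<bar> \<bar>B\<bar>"
  have big: "norm (f z) \<le> D * (1 + Im z) ^ m" if z: "Im z \<ge> 1 / 5" for z
  proof (cases "Im z \<ge> 1")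
    case True
    have "norm (f z) \<le> C * Im z powr A" by (rule CA[OF True])
    also have "\<dots> \<le> D * (1 + Im z) ^ m"
    proof (intro mult_mono)
      have "Im z powr A \<le> Im z powr real m" using True m by (intro powr_mono) auto
      also have "\<dots> = Im z ^ m" using True by (simp add: powr_realpow)
      also have "\<dots> \<le> (1 + Im z) ^ m" using True by (intro power_mono) auto
      finally show "Im z powr A \<le> (1 + Im z) ^ m" .
    qed (auto simp: D_def)
    finally show ?thesis .
  next
    case False
    define w where "w = z + of_int (- \<lfloor>Re z\<rfloor>)"
    have "f w = f z" unfolding w_def using z by (intro translate) (auto simp: upper_half_plane_def)
    moreover have "norm (f w) \<le> B"
    proof -
      have "Re z - of_int \<lfloor>Re z\<rfloor> \<ge> 0" "Re z - of_int \<lfloor>Re z\<rfloor> \<le> 1" by linarith+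
      hence "(Re w, Im w) \<in> K" using z False by (auto simp: K_def w_def)
      from B[OF this] show ?thesis by simp
    qed
    ultimately have "norm (f z) \<le> D * 1" by (auto simp: D_def)
    also have "\<dots> \<le> D * (1 + Im z) ^ m" using z by (intro mult_left_mono one_le_power) (auto simp: D_def)
    finally show ?thesis .
  qed
  have "norm (f z) \<le> D * (1 + Im z + 1 / Im z) ^ m" if z: "z \<in> upper_half_plane" for z
  proof (cases "Im z < 1")
    case True
    have iz: "Im z > 0" using z by (simp add: upper_half_plane_def)
    obtain w where w: "f w = f z" "Im w \<ge> 1 / 5" "Im w \<le> 1 / Im z" using reduction[OF z True] by blast
    have "norm (f z) \<le> D * (1 + Im w) ^ m" using big[OF w(2)] w by simp
    also have "\<dots> \<le> D * (1 + Im z + 1 / Im z) ^ m"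
      using w iz by (intro mult_left_mono power_mono) (auto simp: D_def)
    finally show ?thesis .
  next
    case False
    have "norm (f z) \<le> D * (1 + Im z) ^ m" using False by (intro big) auto
    also have "\<dots> \<le> D * (1 + Im z + 1 / Im z) ^ m"
      using False by (intro mult_left_mono power_mono) (auto simp: D_def)
    finally show ?thesis .
  qed
  moreover have "D \<ge> 0" by (simp add: D_def)
  ultimately show ?thesis by blast
qed

lemma a_poly_bound: "\<exists>C\<ge>0. \<exists>m::nat. \<forall>n y. y > 0 \<longrightarrow> norm (a n y) \<le> C * (1 + y + 1 / y) ^ m"
proof -
  obtain C m where C: "C \<ge> 0" "\<And>z. z \<in> upper_half_plane \<Longrightarrow> norm (f z) \<le> C * (1 + Im z + 1 / Im z) ^ m"
    using poly_bound by blast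
  have "norm (a n y) \<le> C * (1 + y + 1 / y) ^ m" if "y > 0" for n y
    unfolding a_def strip_coeff_def
    using C(2)[of "Complex _ y"] that by (intro fourier_coeff_norm_le continuous_on_horizontal cont) auto
  thus ?thesis using C(1) by blast
qed

text \<open>Take y = y0 / n in \<open>a_scale\<close>: the coefficient on the right stays at the
  fixed nonzero value at y0, and the one on the left grows at most polynomially in n.\<close>

lemma l_poly_bound: "\<exists>C\<ge>0. \<exists>B::nat. \<forall>n\<ge>1. norm (l n) \<le> C * real n ^ B"
proof -
  obtain s y0 where s: "\<bar>s\<bar> = 1" "y0 > 0" "a s y0 \<noteq> 0" using nonzero_sign by blast
  obtain C m where C: "C \<ge> 0" "\<And>n y. y > 0 \<Longrightarrow> norm (a n y) \<le> C * (1 + y + 1 / y) ^ m"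
    using a_poly_bound by blast
  define D where "D = C * (1 + y0 + 1 / y0) ^ m / norm (a s y0)"
  have "norm (l n) \<le> D * real n ^ Suc m" if n: "n \<ge> 1" for n
  proof -
    have n1: "real n \<ge> 1" using n by simp
    have "a (s * int n) (y0 / real n) = l n / of_real (sqrt (real n)) * a s y0"
      using a_scale[OF n, of "y0 / real n" s] s n by simp
    hence "norm (l n) * norm (a s y0) = sqrt (real n) * norm (a (s * int n) (y0 / real n))"
      using n by (simp add: norm_mult norm_divide)
    also have "\<dots> \<le> real n * (C * ((1 + y0 + 1 / y0) * real n) ^ m)"
    proof (intro mult_mono)
      show "sqrt (real n) \<le> real n" using mult_left_mono[OF n1, of "real n"] by (intro real_le_lsqrt) (auto simp: power2_eq_square)
      have "norm (a (s * int n) (y0 / real n)) \<le> C * (1 + y0 / real n + 1 / (y0 / real n)) ^ m"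
        using s n by (intro C(2)) auto
      also have "\<dots> \<le> C * ((1 + y0 + 1 / y0) * real n) ^ m"
      proof (intro mult_left_mono power_mono)
        have "1 \<le> real n" "y0 / real n \<le> y0 * real n" "1 / (y0 / real n) = real n / y0"
          using n1 s(2) by (auto simp: field_simps mult_ge1_I)
        thus "1 + y0 / real n + 1 / (y0 / real n) \<le> (1 + y0 + 1 / y0) * real n"
          by (simp add: algebra_simps)
      qed (use C s n in auto)
      finally show "norm (a (s * int n) (y0 / real n)) \<le> C * ((1 + y0 + 1 / y0) * real n) ^ m" .
    qed auto
    also have "\<dots> = D * real n ^ Suc m * norm (a s y0)"
      using s by (simp add: D_def power_mult_distrib)
    finally show ?thesis using s by simp
  qed
  moreover have "D \<ge> 0" using C s by (simp add: D_def)
  ultimately show ?thesis by blast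
qed

section \<open>Exponential decay towards the cusp at infinity\<close>

lemma radial: "\<bar>s\<bar> = 1 \<Longrightarrow> \<exists>C m. radial_ode (a s) (a1 s) (2 * pi) mu C m"
proof -
  assume s: "\<bar>s\<bar> = 1"
  hence s2: "(2 * pi * real_of_int s)\<^sup>2 = (2 * pi)\<^sup>2" by (cases "s = 1") (auto simp: abs_eq_iff')
  obtain C m where C: "C \<ge> 0" "\<And>n y. y > 0 \<Longrightarrow> norm (a n y) \<le> C * (1 + y + 1 / y) ^ m"
    using a_poly_bound by blast
  have "radial_ode (a s) (a1 s) (2 * pi) mu (C * 3 ^ m) m"
  proof
    show "(a s has_vector_derivative a1 s y) (at y)" if "y > 0" for y by (rule a_deriv[OF that])
    show "(a1 s has_vector_derivative (of_real ((2 * pi)\<^sup>2) - mu / of_real (y\<^sup>2)) * a s y) (at y)" if "y > 0" for y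
      using a1_deriv[OF that, of s] unfolding s2 .
    show "norm (a s y) \<le> C * 3 ^ m * y ^ m" if y: "y \<ge> 1" for y
    proof -
      have "norm (a s y) \<le> C * (1 + y + 1 / y) ^ m" using y by (intro C) auto
      also have "\<dots> \<le> C * (3 * y) ^ m"
      proof (intro mult_left_mono power_mono)
        have "1 / y \<le> 1" using y by simp
        thus "1 + y + 1 / y \<le> 3 * y" using y by linarith
      qed (use C y in auto)
      finally show ?thesis by (simp add: power_mult_distrib)
    qed
  qed auto
  thus ?thesis by blast
qed

lemma a1_scale:
  assumes n: "n \<ge> 1" and y: "y > 0" and s: "\<bar>s\<bar> = 1"
  shows "a1 (s * int n) y = l n / of_real (sqrt (real n)) * of_nat n * a1 s (real n * y)"
proof -
  have d: "(a (s * int n) has_vector_derivative a1 (s * int n) y) (at y)" by (rule a_deriv[OF y])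
  have "(a s \<circ> (\<lambda>y. real n * y) has_vector_derivative real n *\<^sub>R a1 s (real n * y)) (at y)"
    by (rule vector_diff_chain_at) (use n y in \<open>auto intro!: derivative_eq_intros a_deriv\<close>)
  from has_vector_derivative_mult_right[OF this, of "l n / of_real (sqrt (real n))"]
  have "((\<lambda>y. l n / of_real (sqrt (real n)) * a s (real n * y)) has_vector_derivative
       l n / of_real (sqrt (real n)) * (real n *\<^sub>R a1 s (real n * y))) (at y)" by (simp add: o_def)
  hence "(a (s * int n) has_vector_derivative l n / of_real (sqrt (real n)) * (real n *\<^sub>R a1 s (real n * y))) (at y)"
  proof (rule has_vector_derivative_transform_within_open)
    show "open {0::real<..}" "y \<in> {0<..}" using y by auto
    show "l n / of_real (sqrt (real n)) * a s (real n * x) = a (s * int n) x" if "x \<in> {0<..}" for x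
      using a_scale[OF n, of x s] that s by simp
  qed
  from vector_derivative_unique_at[OF d this] show ?thesis by (simp add: scaleR_conv_of_real)
qed

text \<open>\<open>a_scale\<close> and \<open>a1_scale\<close> reduce all frequencies to 1 and -1,
  where the radial equation gives decay. The rescaled argument |n| y stays in the range y \<ge>
  c.\<close>

lemma a_exp_bound:
  assumes c: "c > 0"
  shows "\<exists>K\<ge>0. \<exists>B::nat. \<forall>n y. n \<noteq> 0 \<longrightarrow> y \<ge> c \<longrightarrow>
     norm (a n y) \<le> K * \<bar>real_of_int n\<bar> ^ B * exp (- 2 * pi * \<bar>real_of_int n\<bar> * y) \<and>
     norm (a1 n y) \<le> K * \<bar>real_of_int n\<bar> ^ B * exp (- 2 * pi * \<bar>real_of_int n\<bar> * y)"
proof -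
  have ex: "\<exists>K. \<forall>y\<ge>c. norm (a s y) \<le> K * exp (- (2 * pi) * y) \<and> norm (a1 s y) \<le> K * exp (- (2 * pi) * y)"
    if s: "\<bar>s\<bar> = 1" for s
  proof -
    obtain C m where "radial_ode (a s) (a1 s) (2 * pi) mu C m" using radial[OF s] by blast
    from radial_ode.exp_decay[OF this c] show ?thesis .
  qed
  obtain K1 where K1: "\<And>y. y \<ge> c \<Longrightarrow> norm (a 1 y) \<le> K1 * exp (- (2 * pi) * y) \<and> norm (a1 1 y) \<le> K1 * exp (- (2 * pi) * y)"
    using ex[of 1] by auto
  obtain K2 where K2: "\<And>y. y \<ge> c \<Longrightarrow> norm (a (-1) y) \<le> K2 * exp (- (2 * pi) * y) \<and> norm (a1 (-1) y) \<le> K2 * exp (- (2 * pi) * y)"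
    using ex[of "-1"] by auto
  define K where "K = max \<bar>K1\<bar> \<bar>K2\<bar>"
  have K: "norm (a s y) \<le> K * exp (- (2 * pi) * y)" "norm (a1 s y) \<le> K * exp (- (2 * pi) * y)"
    if "\<bar>s\<bar> = 1" "y \<ge> c" for s y
  proof -
    have 1: "K1 * exp (- (2 * pi) * y) \<le> K * exp (- (2 * pi) * y)" "K2 * exp (- (2 * pi) * y) \<le> K * exp (- (2 * pi) * y)"
      by (intro mult_right_mono; auto simp: K_def)+
    have "s = 1 \<or> s = -1" using that by auto
    thus "norm (a s y) \<le> K * exp (- (2 * pi) * y)" "norm (a1 s y) \<le> K * exp (- (2 * pi) * y)"
      using order.trans[OF conjunct1[OF K1[OF that(2)]] 1(1)] order.trans[OF conjunct2[OF K1[OF that(2)]] 1(1)]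
        order.trans[OF conjunct1[OF K2[OF that(2)]] 1(2)] order.trans[OF conjunct2[OF K2[OF that(2)]] 1(2)] by auto
  qed
  have K0: "K \<ge> 0" by (simp add: K_def)
  obtain C B where C: "C \<ge> 0" "\<And>n. n \<ge> 1 \<Longrightarrow> norm (l n) \<le> C * real n ^ B" using l_poly_bound by blast
  have main: "norm (a n y) \<le> C * K * \<bar>real_of_int n\<bar> ^ Suc B * exp (- 2 * pi * \<bar>real_of_int n\<bar> * y) \<and>
     norm (a1 n y) \<le> C * K * \<bar>real_of_int n\<bar> ^ Suc B * exp (- 2 * pi * \<bar>real_of_int n\<bar> * y)"
    if n: "n \<noteq> 0" and y: "y \<ge> c" for n y
  proof -
    define N where "N = nat \<bar>n\<bar>"
    define s where "s = sgn n"
    have N: "N \<ge> 1" "n = s * int N" "real N = \<bar>real_of_int n\<bar>" using n by (auto simp: N_def s_def sgn_mult_abs)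
    have s: "\<bar>s\<bar> = 1" using n by (auto simp: s_def abs_sgn_eq)
    have y0: "y > 0" using y c by simp
    have "c * 1 \<le> y * real N" using N y c by (intro mult_mono) auto
    hence Ny: "real N * y \<ge> c" by (simp add: mult.commute)
    have sq: "sqrt (real N) \<ge> 1" using N by simp
    have lN: "norm (l N / of_real (sqrt (real N))) \<le> C * real N ^ B"
    proof -
      have "norm (l N / of_real (sqrt (real N))) \<le> norm (l N) / 1"
        unfolding norm_divide using sq by (intro divide_left_mono) auto
      thus ?thesis using C(2)[OF N(1)] by simp
    qed
    have "norm (a n y) = norm (l N / of_real (sqrt (real N))) * norm (a s (real N * y))"
      unfolding N(2) using a_scale[OF N(1) y0 s] by (simp add: norm_mult norm_divide)
    also have "\<dots> \<le> (C * real N ^ B) * (K * exp (- (2 * pi) * (real N * y)))"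
      by (intro mult_mono lN K s Ny mult_nonneg_nonneg C) auto
    also have "\<dots> \<le> (C * real N ^ Suc B) * (K * exp (- (2 * pi) * (real N * y)))"
      using N C K0 by (intro mult_right_mono mult_left_mono power_increasing) auto
    finally have 1: "norm (a n y) \<le> C * K * \<bar>real_of_int n\<bar> ^ Suc B * exp (- 2 * pi * \<bar>real_of_int n\<bar> * y)"
      unfolding N(3) by (simp add: mult_ac)
    have "norm (a1 n y) = norm (l N / of_real (sqrt (real N))) * real N * norm (a1 s (real N * y))"
      unfolding N(2) using a1_scale[OF N(1) y0 s] by (simp add: norm_mult norm_divide)
    also have "\<dots> \<le> (C * real N ^ B) * real N * (K * exp (- (2 * pi) * (real N * y)))"
      by (intro mult_mono mult_right_mono lN K s Ny mult_nonneg_nonneg C) auto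
    finally have 2: "norm (a1 n y) \<le> C * K * \<bar>real_of_int n\<bar> ^ Suc B * exp (- 2 * pi * \<bar>real_of_int n\<bar> * y)"
      unfolding N(3) by (simp add: mult_ac)
    from 1 2 show ?thesis ..
  qed
  show ?thesis
    by (rule exI[of _ "C * K"], rule conjI, use C K0 in simp, rule exI[of _ "Suc B"]) (use main in blast)
qed

lemma a1_0: "y > 0 \<Longrightarrow> a1 0 y = 0"
proof -
  assume y: "y > 0"
  have "(a 0 has_vector_derivative 0) (at y)"
    by (rule has_vector_derivative_transform_within_open[of "\<lambda>_. 0" _ _ "{0<..}"]) (use y a_0 in auto)
  from vector_derivative_unique_at[OF a_deriv[OF y] this] show ?thesis .
qed

lemma derivs_coeff:
  "derivs f g \<Longrightarrow> \<exists>A B. radial_coeff A \<and> radial_coeff B \<and>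
     (\<forall>n. \<forall>y>0. strip_coeff g n y = A n y * a n y + B n y * a1 n y)"
proof (induction rule: derivs.induct)
  case derivs_self
  show ?case
    by (intro exI[of _ "\<lambda>n y. 1"] exI[of _ "\<lambda>n y. 0"]) (auto simp: a_def intro: radial_coeff.rc_const)
next
  case (derivs_x g)
  then obtain A B where AB: "radial_coeff A" "radial_coeff B"
    "\<And>n y. y > 0 \<Longrightarrow> strip_coeff g n y = A n y * a n y + B n y * a1 n y" by blast
  have g: "smooth_on upper_half_plane g" "periodic_H g"
    using derivs_x derivs_smooth smooth derivs_periodic periodic by blast+
  show ?case
  proof (intro exI conjI allI impI)
    show "radial_coeff (\<lambda>n y. (2 * of_real pi * \<i>) * of_int n * A n y)" "radial_coeff (\<lambda>n y. (2 * of_real pi * \<i>) * of_int n * B n y)"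
      by (intro radial_coeff.intros AB)+
    show "strip_coeff (partial_x g) n y = (2 * of_real pi * \<i>) * of_int n * A n y * a n y + (2 * of_real pi * \<i>) * of_int n * B n y * a1 n y"
      if "y > 0" for n y
      using strip_coeff_partial_x[OF g that, of n] AB(3)[OF that, of n] by (simp add: algebra_simps)
  qed
next
  case (derivs_y g)
  then obtain A B where AB: "radial_coeff A" "radial_coeff B"
    "\<And>n y. y > 0 \<Longrightarrow> strip_coeff g n y = A n y * a n y + B n y * a1 n y" by blast
  have g: "smooth_on upper_half_plane g"
    using derivs_y derivs_smooth smooth by blast
  obtain A' where A': "radial_coeff A'" "\<And>n y. y > 0 \<Longrightarrow> (A n has_vector_derivative A' n y) (at y)"
    using radial_coeff_deriv[OF AB(1)] by blast
  obtain B' where B': "radial_coeff B'" "\<And>n y. y > 0 \<Longrightarrow> (B n has_vector_derivative B' n y) (at y)"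
    using radial_coeff_deriv[OF AB(2)] by blast
  define A2 where "A2 = (\<lambda>n y. A' n y + B n y * ((2 * of_real pi * of_int n) * (2 * of_real pi * of_int n) + (- mu) * (of_real (1 / y) * of_real (1 / y))))"
  define B2 where "B2 = (\<lambda>n y. A n y + B' n y)"
  show ?case
  proof (intro exI conjI allI impI)
    show "radial_coeff A2" unfolding A2_def by (intro radial_coeff.intros AB A')
    show "radial_coeff B2" unfolding B2_def by (intro radial_coeff.intros AB B')
    fix n and y :: real assume y: "y > 0"
    have "((\<lambda>y. A n y * a n y + B n y * a1 n y) has_vector_derivative
       (A n y * a1 n y + A' n y * a n y) +
       (B n y * ((of_real ((2 * pi * of_int n)\<^sup>2) - mu / of_real (y\<^sup>2)) * a n y) + B' n y * a1 n y)) (at y)"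
      by (intro has_vector_derivative_add has_vector_derivative_mult A' B' a_deriv a1_deriv y)
    hence "(strip_coeff g n has_vector_derivative
       (A n y * a1 n y + A' n y * a n y) +
       (B n y * ((of_real ((2 * pi * of_int n)\<^sup>2) - mu / of_real (y\<^sup>2)) * a n y) + B' n y * a1 n y)) (at y)"
      by (rule has_vector_derivative_transform_within_open[of _ _ _ "{0<..}"]) (use y AB(3) in auto)
    from vector_derivative_unique_at[OF strip_coeff_has_vector_derivative[OF g y] this]
    show "strip_coeff (partial_y g) n y = A2 n y * a n y + B2 n y * a1 n y"
      by (simp add: A2_def B2_def algebra_simps power2_eq_square)
  qed
qed

lemma derivs_coeff_bound:
  assumes g: "derivs f g" and c: "c > 0"
  shows "\<exists>K\<ge>0. \<exists>B::nat. \<forall>n y. n \<noteq> 0 \<longrightarrow> y \<ge> c \<longrightarrow>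
     norm (strip_coeff g n y) \<le> K * \<bar>real_of_int n\<bar> ^ B * exp (- 2 * pi * \<bar>real_of_int n\<bar> * y)"
proof -
  obtain A B where AB: "radial_coeff A" "radial_coeff B"
    "\<And>n y. y > 0 \<Longrightarrow> strip_coeff g n y = A n y * a n y + B n y * a1 n y" using derivs_coeff[OF g] by blast
  obtain CA mA where A: "CA \<ge> 0" "\<And>n y. y \<ge> c \<Longrightarrow> norm (A n y) \<le> CA * (1 + \<bar>real_of_int n\<bar>) ^ mA"
    using radial_coeff_bound[OF c AB(1)] by blast
  obtain CB mB where B: "CB \<ge> 0" "\<And>n y. y \<ge> c \<Longrightarrow> norm (B n y) \<le> CB * (1 + \<bar>real_of_int n\<bar>) ^ mB"
    using radial_coeff_bound[OF c AB(2)] by blast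
  obtain K m where K: "K \<ge> 0" "\<And>n y. n \<noteq> 0 \<Longrightarrow> y \<ge> c \<Longrightarrow>
     norm (a n y) \<le> K * \<bar>real_of_int n\<bar> ^ m * exp (- 2 * pi * \<bar>real_of_int n\<bar> * y) \<and>
     norm (a1 n y) \<le> K * \<bar>real_of_int n\<bar> ^ m * exp (- 2 * pi * \<bar>real_of_int n\<bar> * y)"
    using a_exp_bound[OF c] by blast
  define D where "D = (CA * 2 ^ mA + CB * 2 ^ mB) * K"
  have "norm (strip_coeff g n y) \<le> D * \<bar>real_of_int n\<bar> ^ (mA + mB + m) * exp (- 2 * pi * \<bar>real_of_int n\<bar> * y)"
    if n: "n \<noteq> 0" and y: "y \<ge> c" for n y
  proof -
    define t where "t = \<bar>real_of_int n\<bar>"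
    have t: "t \<ge> 1" using n by (simp add: t_def)
    have pw: "C * (1 + t) ^ k \<le> C * 2 ^ k * t ^ (mA + mB)" if "k \<le> mA + mB" "C \<ge> 0" for k C
    proof -
      have "(1 + t) ^ k \<le> (2 * t) ^ k" using t by (intro power_mono) auto
      also have "\<dots> = 2 ^ k * t ^ k" by (simp add: power_mult_distrib)
      also have "\<dots> \<le> 2 ^ k * t ^ (mA + mB)" using t that by (intro mult_left_mono power_increasing) auto
      finally show ?thesis using that by (simp add: mult.assoc mult_left_mono)
    qed
    define E where "E = K * t ^ m * exp (- 2 * pi * t * y)"
    have E: "norm (a n y) \<le> E" "norm (a1 n y) \<le> E" using K(2)[OF n y] by (auto simp: E_def t_def)
    have E0: "E \<ge> 0" using E(1) norm_ge_zero order.trans by blast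
    have "norm (strip_coeff g n y) \<le> norm (A n y) * norm (a n y) + norm (B n y) * norm (a1 n y)"
      using AB(3)[of y n] y c by (metis norm_mult norm_triangle_ineq less_le_trans)
    also have "\<dots> \<le> (CA * 2 ^ mA * t ^ (mA + mB)) * E + (CB * 2 ^ mB * t ^ (mA + mB)) * E"
    proof (intro add_mono mult_mono E)
      show "norm (A n y) \<le> CA * 2 ^ mA * t ^ (mA + mB)"
        using A(2)[OF y, of n] pw[of mA CA] A(1) by (simp add: t_def)
      show "norm (B n y) \<le> CB * 2 ^ mB * t ^ (mA + mB)"
        using B(2)[OF y, of n] pw[of mB CB] B(1) by (simp add: t_def)
    qed (use A B t in auto)
    also have "\<dots> = D * t ^ (mA + mB + m) * exp (- 2 * pi * t * y)"
      by (simp add: D_def E_def power_add algebra_simps)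
    finally show ?thesis by (simp add: t_def)
  qed
  moreover have "D \<ge> 0" using A B K by (simp add: D_def)
  ultimately show ?thesis by blast
qed

lemma derivs_coeff_0: "derivs f g \<Longrightarrow> y > 0 \<Longrightarrow> strip_coeff g 0 y = 0"
  using derivs_coeff[of g] a_0 a1_0 by fastforce

text \<open>Sum the bounds for the Fourier coefficients; the coefficient of index 0 vanishes for all
  derivatives because f is cuspidal.\<close>

lemma derivs_decay:
  assumes g: "derivs f g" and c: "c > 0"
  shows "\<exists>C\<ge>0. \<forall>z. Im z \<ge> c \<longrightarrow> norm (g z) \<le> C * exp (- pi * Im z)"
proof -
  obtain K B where K: "K \<ge> 0" "\<And>n y. n \<noteq> 0 \<Longrightarrow> y \<ge> c \<Longrightarrow>
     norm (strip_coeff g n y) \<le> K * \<bar>real_of_int n\<bar> ^ B * exp (- 2 * pi * \<bar>real_of_int n\<bar> * y)"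
    using derivs_coeff_bound[OF g c] by blast
  define S where "S = (\<Sum>k. real (Suc k) ^ B * exp (- (pi * c) * real (Suc k)))"
  have sm: "summable (\<lambda>k. real (Suc k) ^ B * exp (- (pi * c) * real (Suc k)))"
    using c by (intro power_exp_decay_sum) simp
  have "norm (g z) \<le> 2 * K * S * exp (- pi * Im z)" if z: "Im z \<ge> c" for z
  proof -
    define x y where "x = Re z" and "y = Im z"
    have y: "y \<ge> c" "y > 0" using z c by (auto simp: y_def)
    define u where "u = (\<lambda>k. strip_coeff g (int (Suc k)) y * cis (2 * pi * real (Suc k) * x) +
              strip_coeff g (- int (Suc k)) y * cis (- 2 * pi * real (Suc k) * x))"
    have u: "u sums g z"
      using strip_fourier_series[OF derivs_smooth[OF g smooth] derivs_periodic[OF g periodic] y(2) derivs_coeff_0[OF g y(2)], of x]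
      by (simp add: u_def x_def y_def)
    have ub: "norm (u k) \<le> 2 * K * exp (- pi * y) * (real (Suc k) ^ B * exp (- (pi * c) * real (Suc k)))" for k
    proof -
      have "exp (- 2 * pi * real (Suc k) * y) \<le> exp (- pi * y) * exp (- (pi * c) * real (Suc k))"
      proof -
        \<comment> \<open>Of the exponent 2 pi n y, a part pi y is kept as decay in y, and what
          remains dominates pi c n, which makes the sum over n converge.\<close>
        have "1 * y + c * real (Suc k) \<le> real (Suc k) * y + y * real (Suc k)"
          using y c by (intro add_mono mult_right_mono) auto
        hence "pi * (y + c * real (Suc k)) \<le> pi * (2 * real (Suc k) * y)"
          by (intro mult_left_mono) (auto simp: algebra_simps)
        thus ?thesis unfolding exp_add[symmetric] exp_le_cancel_iff by (simp add: algebra_simps)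
      qed
      hence b: "K * real (Suc k) ^ B * exp (- 2 * pi * real (Suc k) * y) \<le>
            K * real (Suc k) ^ B * (exp (- pi * y) * exp (- (pi * c) * real (Suc k)))"
        using K by (intro mult_left_mono) auto
      have "norm (u k) \<le> norm (strip_coeff g (int (Suc k)) y) + norm (strip_coeff g (- int (Suc k)) y)"
        unfolding u_def by (rule order.trans[OF norm_triangle_ineq]) (simp add: norm_mult)
      also have "\<dots> \<le> K * real (Suc k) ^ B * exp (- 2 * pi * real (Suc k) * y) +
                      K * real (Suc k) ^ B * exp (- 2 * pi * real (Suc k) * y)"
        using K(2)[of "int (Suc k)" y] K(2)[of "- int (Suc k)" y] y by (intro add_mono) (auto simp: add_ac)
      also have "\<dots> \<le> 2 * (K * real (Suc k) ^ B * (exp (- pi * y) * exp (- (pi * c) * real (Suc k))))"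
        using b by linarith
      finally show ?thesis by (simp add: mult_ac)
    qed
    have "norm (suminf u) \<le> (\<Sum>k. 2 * K * exp (- pi * y) * (real (Suc k) ^ B * exp (- (pi * c) * real (Suc k))))"
      by (rule norm_suminf_le[OF ub summable_mult[OF sm]])
    also have "\<dots> = 2 * K * exp (- pi * y) * S" unfolding S_def by (rule suminf_mult[OF sm])
    finally show ?thesis using u by (simp add: sums_iff y_def mult_ac)
  qed
  moreover have "2 * K * S \<ge> 0" unfolding S_def using K by (intro mult_nonneg_nonneg suminf_nonneg sm) auto
  ultimately show ?thesis by blast
qed

text \<open>By \<open>reduction\<close> only heights from 1/5 upwards matter, and there f decays.
  Boundedness up to the real axis is what makes Bessel's inequality effective at arbitrarily small
  heights.\<close>

lemma bounded_H: "\<exists>B>0. \<forall>z\<in>upper_half_plane. norm (f z) \<le> B"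
proof -
  obtain C where C: "C \<ge> 0" "\<And>z. Im z \<ge> 1/5 \<Longrightarrow> norm (f z) \<le> C * exp (- pi * Im z)"
    using derivs_decay[OF derivs_self, of "1/5"] by auto
  have b: "norm (f z) \<le> C + 1" if "Im z \<ge> 1/5" for z
  proof -
    have "C * exp (- pi * Im z) \<le> C * 1" using C that by (intro mult_left_mono) auto
    thus ?thesis using C(2)[OF that] by simp
  qed
  have "norm (f z) \<le> C + 1" if z: "z \<in> upper_half_plane" for z
  proof (cases "Im z < 1")
    case True
    from reduction[OF z True] b show ?thesis by metis
  qed (use b[of z] in auto)
  thus ?thesis using C(1) by (intro exI[of _ "C + 1"]) auto
qed

end

section \<open>Approach to the cusps\<close>

lemma of_real_Re_has_vector_derivative:
  assumes "(\<phi> has_vector_derivative d) (at x)"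
  shows "((\<lambda>x. complex_of_real (Re (\<phi> x))) has_vector_derivative of_real (Re d)) (at (x::real))"
    and "((\<lambda>x. complex_of_real (Im (\<phi> x))) has_vector_derivative of_real (Im d)) (at (x::real))"
  using bounded_linear.has_vector_derivative[OF bounded_linear_of_real
          bounded_linear.has_vector_derivative[OF bounded_linear_Re assms]]
        bounded_linear.has_vector_derivative[OF bounded_linear_of_real
          bounded_linear.has_vector_derivative[OF bounded_linear_Im assms]] by simp_all

lemma inverse_Complex_has_vector_derivative:
  assumes "y > 0"
  shows "((\<lambda>x. 1 / Complex x y) has_vector_derivative - ((1 / Complex x y)\<^sup>2)) (at x)"
proof -
  have nz: "Complex x y \<noteq> 0" using assms by (simp add: complex_eq_iff)
  have "((\<lambda>w. 1 / w) has_field_derivative - ((1 / Complex x y)\<^sup>2)) (at (Complex x y))"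
    using nz by (auto intro!: derivative_eq_intros simp: power2_eq_square)
  from field_vector_diff_chain_at[OF Complex_has_vector_derivative_x this] show ?thesis by (simp add: o_def)
qed

lemma Re_square: "Re (w\<^sup>2) = Re w * Re w - Im w * Im w" and Im_square: "Im (w\<^sup>2) = 2 * (Re w * Im w)"
  by (simp_all add: power2_eq_square)

lemma uminus_inverse_in_upper_half_plane:
  assumes "z \<in> upper_half_plane"
  shows "- 1 / z \<in> upper_half_plane" "Im (- 1 / z) = Im z / (norm z)\<^sup>2"
proof -
  have nz: "Im z > 0" using assms by (simp add: upper_half_plane_def)
  hence "norm z > 0" by auto
  show "Im (- 1 / z) = Im z / (norm z)\<^sup>2" by (simp add: Im_divide cmod_power2)
  thus "- 1 / z \<in> upper_half_plane"
    unfolding upper_half_plane_def using nz \<open>norm z > 0\<close> by simp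
qed

text \<open>
  Functions of the shape \<open>P(Re (1/z), Im (1/z)) g(-1/z)\<close> with a polynomial \<open>P\<close> and an iterated
  partial derivative \<open>g\<close> of \<open>f\<close>. The class contains \<open>f\<close> itself by invariance, is stable under
  differentiation, and all its members decay rapidly at \<open>0\<close> inside a cone.
\<close>

inductive cone_class :: "(complex \<Rightarrow> complex) \<Rightarrow> (complex \<Rightarrow> complex) \<Rightarrow> bool" for f where
  cc_base: "derivs f g \<Longrightarrow> cone_class f (\<lambda>z. g (- 1 / z))"
| cc_re: "cone_class f h \<Longrightarrow> cone_class f (\<lambda>z. of_real (Re (1 / z)) * h z)"
| cc_im: "cone_class f h \<Longrightarrow> cone_class f (\<lambda>z. of_real (Im (1 / z)) * h z)"
| cc_add: "cone_class f h \<Longrightarrow> cone_class f k \<Longrightarrow> cone_class f (\<lambda>z. h z + k z)"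
| cc_scale: "cone_class f h \<Longrightarrow> cone_class f (\<lambda>z. c * h z)"

lemma cone_class_deriv:
  assumes f: "smooth_on upper_half_plane f"
  shows "cone_class f h \<Longrightarrow> \<exists>h'. cone_class f h' \<and>
    (\<forall>x y. y > 0 \<longrightarrow> ((\<lambda>x. h (Complex x y)) has_vector_derivative h' (Complex x y)) (at x))"
proof (induction rule: cone_class.induct)
  case (cc_base g)
  \<comment> \<open>Since d/dx (-1/z) = 1/z^2, the chain rule multiplies the x- and y-derivatives of
    g by the real and imaginary parts of (1/z)^2, which are polynomials in Re (1/z) and Im
    (1/z).\<close>
  define h' where "h' = (\<lambda>z. (of_real (Re (1 / z)) * (of_real (Re (1 / z)) * partial_x g (- 1 / z)) +
      (-1) * (of_real (Im (1 / z)) * (of_real (Im (1 / z)) * partial_x g (- 1 / z)))) +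
      2 * (of_real (Re (1 / z)) * (of_real (Im (1 / z)) * partial_y g (- 1 / z))))"
  have "cone_class f h'"
    unfolding h'_def by (intro cone_class.intros derivs.intros cc_base)
  moreover have "((\<lambda>x. g (- 1 / Complex x y)) has_vector_derivative h' (Complex x y)) (at x)" if y: "y > 0" for x y
  proof -
    define w where "w = 1 / Complex x y"
    have "((\<lambda>x. - (1 / Complex x y)) has_vector_derivative - (- (w\<^sup>2))) (at x)"
      unfolding w_def by (intro has_vector_derivative_minus inverse_Complex_has_vector_derivative y)
    hence d: "((\<lambda>x. - 1 / Complex x y) has_vector_derivative w\<^sup>2) (at x)" by simp
    have "- 1 / Complex x y \<in> upper_half_plane" using y by (intro uminus_inverse_in_upper_half_plane) simp
    from has_vector_derivative_along[OF derivs_smooth[OF cc_base f] this d]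
    show ?thesis
      by (rule back_subst[of "\<lambda>d. (_ has_vector_derivative d) _"])
         (simp add: h'_def Re_square Im_square w_def[symmetric] algebra_simps)
  qed
  ultimately show ?case by blast
next
  case (cc_re h)
  then obtain h' where h': "cone_class f h'"
    "\<And>x y. y > 0 \<Longrightarrow> ((\<lambda>x. h (Complex x y)) has_vector_derivative h' (Complex x y)) (at x)" by blast
  define k where "k = (\<lambda>z. (of_real (Re (1 / z)) * h' z + (-1) * (of_real (Re (1 / z)) * (of_real (Re (1 / z)) * h z))) +
      of_real (Im (1 / z)) * (of_real (Im (1 / z)) * h z))"
  have "cone_class f k" unfolding k_def by (intro cone_class.intros h' cc_re)
  moreover have "((\<lambda>x. of_real (Re (1 / Complex x y)) * h (Complex x y)) has_vector_derivative k (Complex x y)) (at x)"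
    if y: "y > 0" for x y
  proof -
    define w where "w = 1 / Complex x y"
    have d: "((\<lambda>x. complex_of_real (Re (1 / Complex x y))) has_vector_derivative of_real (Re (- (w\<^sup>2)))) (at x)"
      unfolding w_def by (intro of_real_Re_has_vector_derivative inverse_Complex_has_vector_derivative y)
    from has_vector_derivative_mult[OF d h'(2)[OF y, of x]] show ?thesis
      by (rule back_subst[of "\<lambda>d. (_ has_vector_derivative d) _"])
         (simp add: k_def Re_square w_def[symmetric] algebra_simps)
  qed
  ultimately show ?case by blast
next
  case (cc_im h)
  then obtain h' where h': "cone_class f h'"
    "\<And>x y. y > 0 \<Longrightarrow> ((\<lambda>x. h (Complex x y)) has_vector_derivative h' (Complex x y)) (at x)" by blast
  define k where "k = (\<lambda>z. of_real (Im (1 / z)) * h' z + (-2) * (of_real (Re (1 / z)) * (of_real (Im (1 / z)) * h z)))"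
  have "cone_class f k" unfolding k_def by (intro cone_class.intros h' cc_im)
  moreover have "((\<lambda>x. of_real (Im (1 / Complex x y)) * h (Complex x y)) has_vector_derivative k (Complex x y)) (at x)"
    if y: "y > 0" for x y
  proof -
    define w where "w = 1 / Complex x y"
    have d: "((\<lambda>x. complex_of_real (Im (1 / Complex x y))) has_vector_derivative of_real (Im (- (w\<^sup>2)))) (at x)"
      unfolding w_def by (intro of_real_Re_has_vector_derivative inverse_Complex_has_vector_derivative y)
    from has_vector_derivative_mult[OF d h'(2)[OF y, of x]] show ?thesis
      by (rule back_subst[of "\<lambda>d. (_ has_vector_derivative d) _"])
         (simp add: k_def Im_square w_def[symmetric] algebra_simps)
  qed
  ultimately show ?case by blast
next
  case (cc_add h k)
  then obtain h' k' where "cone_class f h'" "cone_class f k'"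
    "\<And>x y. y > 0 \<Longrightarrow> ((\<lambda>x. h (Complex x y)) has_vector_derivative h' (Complex x y)) (at x)"
    "\<And>x y. y > 0 \<Longrightarrow> ((\<lambda>x. k (Complex x y)) has_vector_derivative k' (Complex x y)) (at x)" by blast
  thus ?case
    by (intro exI[of _ "\<lambda>z. h' z + k' z"]) (auto intro: cone_class.cc_add has_vector_derivative_add)
next
  case (cc_scale h c)
  then obtain h' where "cone_class f h'"
    "\<And>x y. y > 0 \<Longrightarrow> ((\<lambda>x. h (Complex x y)) has_vector_derivative h' (Complex x y)) (at x)" by blast
  thus ?case
    by (intro exI[of _ "\<lambda>z. c * h' z"]) (auto intro: cone_class.cc_scale has_vector_derivative_mult_right)
qed

lemma exp_minus_le_power:
  fixes u :: real
  assumes "u > 0"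
  shows "exp (- u) \<le> real m ^ m * (1 / u) ^ m"
  using power_exp_le[of 1 u m] assms by (simp add: field_simps)

text \<open>The left bound is requested only from -T on because inversion at p/q provides it only
  below the height q^(-2).\<close>

lemma rapidI:
  assumes h: "continuous_on UNIV h"
    and pos: "\<And>m::nat. \<exists>C. \<forall>t\<ge>0. norm (h t) \<le> C * exp (- real m * t)"
    and neg: "\<And>m::nat. \<exists>C. \<forall>t\<le>-T. norm (h t) \<le> C * exp (real m * t)" and T: "T \<ge> 0"
  shows "rapid h"
  unfolding rapid_def
proof (intro conjI allI h)
  fix m :: nat
  obtain C1 where C1: "\<And>t. t \<ge> 0 \<Longrightarrow> norm (h t) \<le> C1 * exp (- real m * t)" using pos by blast
  obtain C2 where C2: "\<And>t. t \<le> - T \<Longrightarrow> norm (h t) \<le> C2 * exp (real m * t)" using neg by blast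
  have "bounded (h ` {-T..0})"
    by (intro compact_imp_bounded compact_continuous_image continuous_on_subset[OF h]) auto
  then obtain B where B: "\<And>t. t \<in> {-T..0} \<Longrightarrow> norm (h t) \<le> B" unfolding bounded_iff by (metis imageI)
  define C where "C = max (max C1 C2) (\<bar>B\<bar> * exp (real m * T))"
  have mono: "D * exp (- real m * \<bar>t\<bar>) \<le> C * exp (- real m * \<bar>t\<bar>)" if "D \<le> C" for D t
    using that by (intro mult_right_mono) auto
  have "norm (h t) \<le> C * exp (- real m * \<bar>t\<bar>)" for t
  proof -
    consider "t \<ge> 0" | "t \<le> - T" | "t \<in> {-T..0}" by force
    thus ?thesis
    proof cases
      case 1
      have "norm (h t) \<le> C1 * exp (- real m * \<bar>t\<bar>)" using C1[OF 1] 1 by simp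
      also have "\<dots> \<le> C * exp (- real m * \<bar>t\<bar>)" by (rule mono) (simp add: C_def)
      finally show ?thesis .
    next
      case 2
      hence "\<bar>t\<bar> = - t" using T by simp
      hence "norm (h t) \<le> C2 * exp (- real m * \<bar>t\<bar>)" using C2[OF 2] by simp
      also have "\<dots> \<le> C * exp (- real m * \<bar>t\<bar>)" by (rule mono) (simp add: C_def)
      finally show ?thesis .
    next
      case 3
      have "norm (h t) \<le> \<bar>B\<bar> * 1" using B[OF 3] by simp
      also have "\<dots> \<le> \<bar>B\<bar> * (exp (real m * T) * exp (- real m * \<bar>t\<bar>))"
      proof (intro mult_left_mono)
        have "real m * \<bar>t\<bar> \<le> real m * T" using 3 by (intro mult_left_mono) auto
        thus "1 \<le> exp (real m * T) * exp (- real m * \<bar>t\<bar>)" by (simp flip: exp_add)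
      qed auto
      also have "\<dots> \<le> C * exp (- real m * \<bar>t\<bar>)"
        unfolding mult.assoc[symmetric] by (rule mono) (simp add: C_def)
      finally show ?thesis .
    qed
  qed
  thus "\<exists>C. \<forall>t. norm (h t) \<le> C * exp (- real m * \<bar>t\<bar>)" by blast
qed

context hecke_form
begin

text \<open>In the cone, Im (-1/z) \<ge> 1 / (2 y), so g(-1/z) is exponentially small in 1/y. Each
  factor Re (1/z) or Im (1/z) costs at most 1/y; hence the exponent m is arbitrary in the induction
  and is raised by one in those cases.\<close>

lemma cone_class_bound:
  "cone_class f h \<Longrightarrow> \<exists>C\<ge>0. \<forall>x y. 0 < y \<longrightarrow> y \<le> 1 \<longrightarrow> \<bar>x\<bar> \<le> y \<longrightarrow> norm (h (Complex x y)) \<le> C * y ^ m"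
proof (induction arbitrary: m rule: cone_class.induct)
  case (cc_base g)
  obtain C where C: "C \<ge> 0" "\<And>z. Im z \<ge> 1/2 \<Longrightarrow> norm (g z) \<le> C * exp (- pi * Im z)"
    using derivs_decay[OF cc_base, of "1/2"] by auto
  have "norm (g (- 1 / Complex x y)) \<le> C * real m ^ m * y ^ m" if y: "0 < y" "y \<le> 1" "\<bar>x\<bar> \<le> y" for x y
  proof -
    define w where "w = - 1 / Complex x y"
    have "x\<^sup>2 \<le> y\<^sup>2" using y by (metis abs_le_square_iff abs_of_pos)
    have "Im w = y / (x\<^sup>2 + y\<^sup>2)"
      unfolding w_def using y by (subst uminus_inverse_in_upper_half_plane) (auto simp: cmod_power2)
    also have "\<dots> \<ge> y / (2 * y\<^sup>2)"
      using y \<open>x\<^sup>2 \<le> y\<^sup>2\<close> by (intro divide_left_mono) (auto intro!: mult_pos_pos add_nonneg_pos)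
    also have "y / (2 * y\<^sup>2) = 1 / (2 * y)" using y by (simp add: power2_eq_square)
    finally have Imw: "Im w \<ge> 1 / (2 * y)" .
    hence "Im w \<ge> 1 / 2" using y by (smt (verit) frac_le)
    hence "norm (g w) \<le> C * exp (- pi * Im w)" by (rule C)
    also have "\<dots> \<le> C * exp (- (1 / y))"
    proof -
      have "2 * (1 / (2 * y)) \<le> pi * Im w" using Imw pi_ge_two y by (intro mult_mono) auto
      thus ?thesis using C y by (intro mult_left_mono) auto
    qed
    also have "\<dots> \<le> C * (real m ^ m * (1 / (1 / y)) ^ m)"
      using C y by (intro mult_left_mono exp_minus_le_power) auto
    finally show ?thesis by (simp add: w_def)
  qed
  thus ?case using C(1) by (intro exI[of _ "C * real m ^ m"]) auto
next
  case (cc_re h)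
  then obtain C where C: "C \<ge> 0"
    "\<And>x y. 0 < y \<Longrightarrow> y \<le> 1 \<Longrightarrow> \<bar>x\<bar> \<le> y \<Longrightarrow> norm (h (Complex x y)) \<le> C * y ^ Suc m" by blast
  have "norm (of_real (Re (1 / Complex x y)) * h (Complex x y)) \<le> C * y ^ m" if y: "0 < y" "y \<le> 1" "\<bar>x\<bar> \<le> y" for x y
  proof -
    have "\<bar>Re (1 / Complex x y)\<bar> \<le> 1 / norm (Complex x y)"
      using abs_Re_le_cmod[of "1 / Complex x y"] by (simp only: norm_divide norm_one)
    also have "\<dots> \<le> 1 / y" using y abs_Im_le_cmod[of "Complex x y"] by (intro frac_le) auto
    finally have "norm (of_real (Re (1 / Complex x y)) * h (Complex x y)) \<le> 1 / y * (C * y ^ Suc m)"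
      unfolding norm_mult norm_of_real using C(2)[OF y] y by (intro mult_mono) auto
    thus ?thesis using y by simp
  qed
  thus ?case using C(1) by blast
next
  case (cc_im h)
  then obtain C where C: "C \<ge> 0"
    "\<And>x y. 0 < y \<Longrightarrow> y \<le> 1 \<Longrightarrow> \<bar>x\<bar> \<le> y \<Longrightarrow> norm (h (Complex x y)) \<le> C * y ^ Suc m" by blast
  have "norm (of_real (Im (1 / Complex x y)) * h (Complex x y)) \<le> C * y ^ m" if y: "0 < y" "y \<le> 1" "\<bar>x\<bar> \<le> y" for x y
  proof -
    have "\<bar>Im (1 / Complex x y)\<bar> \<le> 1 / norm (Complex x y)"
      using abs_Im_le_cmod[of "1 / Complex x y"] by (simp only: norm_divide norm_one)
    also have "\<dots> \<le> 1 / y" using y abs_Im_le_cmod[of "Complex x y"] by (intro frac_le) auto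
    finally have "norm (of_real (Im (1 / Complex x y)) * h (Complex x y)) \<le> 1 / y * (C * y ^ Suc m)"
      unfolding norm_mult norm_of_real using C(2)[OF y] y by (intro mult_mono) auto
    thus ?thesis using y by simp
  qed
  thus ?case using C(1) by blast
next
  case (cc_add h k)
  obtain C where C: "C \<ge> 0"
    "\<And>x y. 0 < y \<Longrightarrow> y \<le> 1 \<Longrightarrow> \<bar>x\<bar> \<le> y \<Longrightarrow> norm (h (Complex x y)) \<le> C * y ^ m" using cc_add.IH(1) by blast
  obtain D where D: "D \<ge> 0"
    "\<And>x y. 0 < y \<Longrightarrow> y \<le> 1 \<Longrightarrow> \<bar>x\<bar> \<le> y \<Longrightarrow> norm (k (Complex x y)) \<le> D * y ^ m" using cc_add.IH(2) by blast
  have "norm (h (Complex x y) + k (Complex x y)) \<le> (C + D) * y ^ m" if y: "0 < y" "y \<le> 1" "\<bar>x\<bar> \<le> y" for x y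
    using norm_triangle_ineq[of "h (Complex x y)" "k (Complex x y)"] C(2)[OF y] D(2)[OF y]
    by (simp add: algebra_simps)
  thus ?case using C(1) D(1) by (intro exI[of _ "C + D"]) auto
next
  case (cc_scale h c)
  obtain C where C: "C \<ge> 0"
    "\<And>x y. 0 < y \<Longrightarrow> y \<le> 1 \<Longrightarrow> \<bar>x\<bar> \<le> y \<Longrightarrow> norm (h (Complex x y)) \<le> C * y ^ m" using cc_scale.IH by blast
  thus ?case
    by (intro exI[of _ "norm c * C"]) (auto simp: norm_mult mult.assoc intro!: mult_left_mono)
qed

section \<open>Horizontal derivatives in the cone at 0\<close>

definition "fx k = (partial_x ^^ k) f"

lemma fx_0 [simp]: "fx 0 = f" and fx_Suc: "fx (Suc k) = partial_x (fx k)"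
  by (simp_all add: fx_def)

lemma fx_derivs: "derivs f (fx k)"
  by (induction k) (auto simp: fx_Suc intro: derivs.intros)

lemma fx_smooth: "smooth_on upper_half_plane (fx k)"
  by (rule derivs_smooth[OF fx_derivs smooth])

text \<open>Invariance under z \<mapsto> -1/z starts the induction; uniqueness of the derivative
  along horizontal lines carries it on.\<close>

lemma fx_cone_class: "\<exists>h. cone_class f h \<and> (\<forall>z\<in>upper_half_plane. fx k z = h z)"
proof (induction k)
  case 0
  have "f z = f (- 1 / z)" if "z \<in> upper_half_plane" for z
    using invariant[of 0 0 "-1" 1 z] that by simp
  moreover have "cone_class f (\<lambda>z. f (- 1 / z))" by (intro cone_class.intros derivs.intros)
  ultimately show ?case by auto
next
  case (Suc k)
  then obtain h where h: "cone_class f h" "\<And>z. z \<in> upper_half_plane \<Longrightarrow> fx k z = h z" by blast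
  obtain h' where h': "cone_class f h'"
    "\<And>x y. y > 0 \<Longrightarrow> ((\<lambda>x. h (Complex x y)) has_vector_derivative h' (Complex x y)) (at x)"
    using cone_class_deriv[OF smooth h(1)] by blast
  have "fx (Suc k) z = h' z" if z: "z \<in> upper_half_plane" for z
  proof -
    have y: "Im z > 0" using z by (simp add: upper_half_plane_def)
    have "((\<lambda>x. fx k (Complex x (Im z))) has_vector_derivative partial_x (fx k) (Complex (Re z) (Im z))) (at (Re z))"
      by (rule has_vector_derivative_x[OF fx_smooth y])
    moreover have "(\<lambda>x. fx k (Complex x (Im z))) = (\<lambda>x. h (Complex x (Im z)))" using h(2) y by auto
    ultimately have "((\<lambda>x. h (Complex x (Im z))) has_vector_derivative fx (Suc k) z) (at (Re z))"
      by (simp add: fx_Suc)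
    from vector_derivative_unique_at[OF this h'(2)[OF y]] show ?thesis by simp
  qed
  thus ?case using h'(1) by blast
qed

lemma derivs_exp_bound:
  assumes "derivs f g"
  shows "\<exists>C\<ge>0. \<forall>x t. t \<ge> 0 \<longrightarrow> norm (g (Complex x (exp t))) \<le> C * exp (- real m * t)"
proof -
  obtain C where C: "C \<ge> 0" "\<And>z. Im z \<ge> 1 \<Longrightarrow> norm (g z) \<le> C * exp (- pi * Im z)"
    using derivs_decay[OF assms, of 1] by auto
  have "norm (g (Complex x (exp t))) \<le> C * real m ^ m * exp (- real m * t)" if t: "t \<ge> 0" for x t
  proof -
    have "norm (g (Complex x (exp t))) \<le> C * exp (- pi * exp t)" using C(2)[of "Complex x (exp t)"] t by simp
    also have "\<dots> \<le> C * exp (- exp t)"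
    proof -
      have "1 * exp t \<le> pi * exp t" using pi_ge_two by (intro mult_right_mono) auto
      thus ?thesis using C by (intro mult_left_mono) auto
    qed
    also have "\<dots> \<le> C * (real m ^ m * (1 / exp t) ^ m)"
      using C by (intro mult_left_mono exp_minus_le_power) auto
    also have "(1 / exp t) ^ m = exp (- real m * t)"
      by (simp add: exp_minus exp_of_nat_mult divide_inverse power_inverse)
    finally show ?thesis by simp
  qed
  thus ?thesis using C(1) by (intro exI[of _ "C * real m ^ m"]) auto
qed

text \<open>Above height 1 this is decay at infinity, uniformly in x; below height 1 it is the cone
  bound at the cusp 0.\<close>

lemma cone_rapid:
  "\<exists>C\<ge>0. \<forall>x t. \<bar>x\<bar> \<le> exp t \<longrightarrow> norm (fx k (Complex x (exp t))) \<le> C * exp (- real m * \<bar>t\<bar>)"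
proof -
  obtain C1 where C1: "C1 \<ge> 0" "\<And>x t. t \<ge> 0 \<Longrightarrow> norm (fx k (Complex x (exp t))) \<le> C1 * exp (- real m * t)"
    using derivs_exp_bound[OF fx_derivs] by blast
  obtain h where h: "cone_class f h" "\<And>z. z \<in> upper_half_plane \<Longrightarrow> fx k z = h z" using fx_cone_class by blast
  obtain C2 where C2: "C2 \<ge> 0" "\<And>x y. 0 < y \<Longrightarrow> y \<le> 1 \<Longrightarrow> \<bar>x\<bar> \<le> y \<Longrightarrow> norm (h (Complex x y)) \<le> C2 * y ^ m"
    using cone_class_bound[OF h(1)] by blast
  have "norm (fx k (Complex x (exp t))) \<le> max C1 C2 * exp (- real m * \<bar>t\<bar>)" if x: "\<bar>x\<bar> \<le> exp t" for x t
  proof (cases "t \<ge> 0")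
    case True
    have "C1 * exp (- real m * t) \<le> max C1 C2 * exp (- real m * t)" by (intro mult_right_mono) auto
    from order.trans[OF C1(2)[OF True, of x] this] show ?thesis using True by simp
  next
    case False
    have "norm (fx k (Complex x (exp t))) \<le> C2 * exp t ^ m"
      using C2(2)[of "exp t" x] x False h(2)[of "Complex x (exp t)"] by simp
    also have "exp t ^ m = exp (- real m * \<bar>t\<bar>)" using False by (simp flip: exp_of_nat_mult)
    also have "C2 * exp (- real m * \<bar>t\<bar>) \<le> max C1 C2 * exp (- real m * \<bar>t\<bar>)" by (intro mult_right_mono) auto
    finally show ?thesis .
  qed
  thus ?thesis using C1(1) by (intro exI[of _ "max C1 C2"]) auto
qed

text \<open>The matrix with rows (\<alpha>, \<beta>) and (q, -p) has determinant 1 and sends p/q + i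
  y to \<alpha>/q + i / (q^2 y). Its derivative there is 1 / (q z - p)^2 = -1 / (q^2 y^2), which is
  real, so the x-derivative goes to a multiple of the x-derivative alone.\<close>

lemma line_inversion:
  fixes p \<alpha> \<beta> :: int and q :: nat
  assumes det: "\<alpha> * p + \<beta> * int q = - 1" and q: "q > 0" and y: "y > 0"
  shows "f (Complex (of_int p / real q) y) = f (Complex (of_int \<alpha> / real q) (1 / (real q ^ 2 * y)))"
    and "partial_x f (Complex (of_int p / real q) y) =
         - of_real (1 / (real q ^ 2 * y ^ 2)) * partial_x f (Complex (of_int \<alpha> / real q) (1 / (real q ^ 2 * y)))"
proof -
  define z where "z = Complex (of_int p / real q) y"
  define w where "w = Complex (of_int \<alpha> / real q) (1 / (real q ^ 2 * y))"
  define M where "M = (\<lambda>z::complex. (of_int \<alpha> * z + of_int \<beta>) / (of_int (int q) * z + of_int (- p)))"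
  have z: "z \<in> upper_half_plane" and w: "w \<in> upper_half_plane" using y q by (auto simp: z_def w_def)
  have den: "of_int (int q) * z + of_int (- p) = \<i> * of_real (real q * y)"
    using q by (simp add: z_def complex_eq_iff)
  have num: "of_int \<alpha> * z + of_int \<beta> = Complex (- 1 / real q) (of_int \<alpha> * y)"
  proof -
    have "real_of_int \<alpha> * real_of_int p + real_of_int \<beta> * real q = -1"
      using det by (metis of_int_add of_int_mult of_int_of_nat_eq of_int_minus of_int_1)
    thus ?thesis using q by (simp add: z_def complex_eq_iff field_simps)
  qed
  have Mz: "M z = w"
    unfolding M_def den num w_def using q y
    by (simp add: complex_eq_iff Re_divide Im_divide power2_eq_square field_simps)
  have inv: "f (M v) = f v" if "v \<in> upper_half_plane" for v
    unfolding M_def using that det by (intro invariant) (auto simp: algebra_simps)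
  show "f (Complex (of_int p / real q) y) = f (Complex (of_int \<alpha> / real q) (1 / (real q ^ 2 * y)))"
    using inv[OF z] Mz by (simp add: z_def w_def)
  define k where "k = - 1 / complex_of_real (real q ^ 2 * y ^ 2)"
  have den0: "of_int (int q) * z + of_int (- p) \<noteq> 0" unfolding den using q y by simp
  have "(M has_field_derivative k) (at z)"
  proof -
    have "(M has_field_derivative ((of_int \<alpha> * (of_int (int q) * z + of_int (- p)) - (of_int \<alpha> * z + of_int \<beta>) * of_int (int q)) /
         ((of_int (int q) * z + of_int (- p)) * (of_int (int q) * z + of_int (- p))))) (at z)"
      unfolding M_def using den0 by (auto intro!: derivative_eq_intros)
    also have "of_int \<alpha> * (of_int (int q) * z + of_int (- p)) - (of_int \<alpha> * z + of_int \<beta>) * of_int (int q) =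
         of_int (- (\<alpha> * p + \<beta> * int q))" by (simp add: algebra_simps)
    also have "\<dots> = (1::complex)" unfolding det by simp
    also have "1 / ((of_int (int q) * z + of_int (- p)) * (of_int (int q) * z + of_int (- p))) = k"
      unfolding den k_def by (simp add: power2_eq_square field_simps)
    finally show ?thesis .
  qed
  hence M': "(M has_field_derivative k) (at (z + of_real 0))" by simp
  have "((\<lambda>t. z + of_real t) has_vector_derivative 1) (at 0)" by (auto intro!: derivative_eq_intros)
  from field_vector_diff_chain_at[OF this M']
  have "((\<lambda>t. M (z + of_real t)) has_vector_derivative k) (at 0)" by (simp add: o_def)
  from has_vector_derivative_along[OF smooth _ this] w
  have d: "((\<lambda>t. f (M (z + of_real t))) has_vector_derivative
          of_real (Re k) * partial_x f w + of_real (Im k) * partial_y f w) (at 0)" by (simp add: Mz)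
  have "f (M (z + of_real t)) = f (z + of_real t)" for t
    using z by (intro inv) (auto simp: upper_half_plane_def)
  hence "((\<lambda>t. f (z + of_real t)) has_vector_derivative
          of_real (Re k) * partial_x f w + of_real (Im k) * partial_y f w) (at 0)" using d by simp
  hence "partial_x f z = of_real (Re k) * partial_x f w + of_real (Im k) * partial_y f w"
    unfolding partial_x_def by (rule vector_derivative_at)
  moreover have "k = of_real (- (1 / (real q ^ 2 * y ^ 2)))" by (simp add: k_def)
  hence "Re k = - (1 / (real q ^ 2 * y ^ 2))" "Im k = 0" by (simp_all only: Re_complex_of_real Im_complex_of_real)
  ultimately show "partial_x f (Complex (of_int p / real q) y) =
         - of_real (1 / (real q ^ 2 * y ^ 2)) * partial_x f (Complex (of_int \<alpha> / real q) (1 / (real q ^ 2 * y)))"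
    by (simp add: z_def w_def)
qed

lemma continuous_on_vertical:
  assumes "continuous_on upper_half_plane g"
  shows "continuous_on UNIV (\<lambda>t. g (Complex x (exp t)))"
  by (intro continuous_on_compose2[OF assms] continuous_intros) auto

text \<open>Near the real point p/q the inversion leads back to large heights on another vertical
  line, where f decays. In t = ln y it is t \<mapsto> -t - 2 ln q.\<close>

lemma rapid_lines:
  fixes p :: int and q :: nat
  assumes "coprime p (int q)" and q: "q > 0"
  shows "rapid (\<lambda>t. f (Complex (of_int p / real q) (exp t)))"
    and "rapid (\<lambda>t. partial_x f (Complex (of_int p / real q) (exp t)) * of_real (exp t))"
proof -
  obtain u v where "u * p + v * int q = 1"
    using bezout_int[of p "int q"] assms(1) by (auto simp: coprime_iff_gcd_eq_1)
  hence det: "(- u) * p + (- v) * int q = - 1" by (simp add: algebra_simps)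
  define T where "T = 2 * ln (real q)"
  have T: "T \<ge> 0" using q by (simp add: T_def)
  have eT: "exp T = real q ^ 2" using q by (simp add: T_def exp_double)
  have y': "1 / (real q ^ 2 * exp t) = exp (- t - T)" for t
    using q by (simp add: exp_diff exp_minus eT field_simps)
  have inv1: "f (Complex (of_int p / real q) (exp t)) = f (Complex (of_int (- u) / real q) (exp (- t - T)))" for t
    unfolding y'[symmetric] using line_inversion(1)[OF det q exp_gt_zero] by blast
  have inv2: "partial_x f (Complex (of_int p / real q) (exp t)) =
      - of_real (exp (- 2 * t - T)) * partial_x f (Complex (of_int (- u) / real q) (exp (- t - T)))" for t
  proof -
    have "exp t ^ 2 = exp (2 * t)" by (simp add: exp_double)
    hence "1 / (real q ^ 2 * exp t ^ 2) = exp (- 2 * t - T)"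
      using q by (simp add: exp_diff exp_minus eT field_simps)
    thus ?thesis unfolding y'[symmetric] using line_inversion(2)[OF det q exp_gt_zero, of t] by simp
  qed
  have dx: "derivs f (partial_x f)" by (intro derivs.intros)
  show "rapid (\<lambda>t. f (Complex (of_int p / real q) (exp t)))"
  proof (rule rapidI[OF continuous_on_vertical[OF cont] _ _ T])
    fix m :: nat
    obtain C where C: "\<And>x t. t \<ge> 0 \<Longrightarrow> norm (f (Complex x (exp t))) \<le> C * exp (- real m * t)"
      using derivs_exp_bound[OF derivs_self] by blast
    thus "\<exists>C. \<forall>t\<ge>0. norm (f (Complex (of_int p / real q) (exp t))) \<le> C * exp (- real m * t)" by blast
    have "norm (f (Complex (of_int p / real q) (exp t))) \<le> C * exp (real m * T) * exp (real m * t)" if "t \<le> - T" for t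
    proof -
      have "norm (f (Complex (of_int p / real q) (exp t))) \<le> C * exp (- real m * (- t - T))"
        unfolding inv1 using that by (intro C) auto
      thus ?thesis by (simp add: algebra_simps exp_add)
    qed
    thus "\<exists>C. \<forall>t\<le>-T. norm (f (Complex (of_int p / real q) (exp t))) \<le> C * exp (real m * t)" by blast
  qed
  show "rapid (\<lambda>t. partial_x f (Complex (of_int p / real q) (exp t)) * of_real (exp t))"
  proof (rule rapidI[OF _ _ _ T])
    show "continuous_on UNIV (\<lambda>t. partial_x f (Complex (of_int p / real q) (exp t)) * of_real (exp t))"
      by (intro continuous_intros continuous_on_vertical smooth_on_continuous smooth_on_partial_x smooth)
    fix m :: nat
    obtain C where C: "\<And>x t. t \<ge> 0 \<Longrightarrow> norm (partial_x f (Complex x (exp t))) \<le> C * exp (- real (Suc m) * t)"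
      using derivs_exp_bound[OF dx] by blast
    have "norm (partial_x f (Complex (of_int p / real q) (exp t)) * of_real (exp t)) \<le> C * exp (- real m * t)" if "t \<ge> 0" for t
    proof -
      have "norm (partial_x f (Complex (of_int p / real q) (exp t)) * of_real (exp t)) \<le> C * exp (- real (Suc m) * t) * exp t"
        unfolding norm_mult using C[OF that] by simp
      thus ?thesis by (simp add: algebra_simps mult.assoc flip: exp_add)
    qed
    thus "\<exists>C. \<forall>t\<ge>0. norm (partial_x f (Complex (of_int p / real q) (exp t)) * of_real (exp t)) \<le> C * exp (- real m * t)" by blast
    have "norm (partial_x f (Complex (of_int p / real q) (exp t)) * of_real (exp t)) \<le> C * exp (real m * T) * exp (real m * t)"
      if "t \<le> - T" for t
    proof -
      have "norm (partial_x f (Complex (of_int p / real q) (exp t)) * of_real (exp t)) =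
           norm (partial_x f (Complex (of_int (- u) / real q) (exp (- t - T)))) * (exp (- 2 * t - T) * exp t)"
        unfolding inv2 by (simp add: norm_mult)
      also have "\<dots> \<le> C * exp (- real (Suc m) * (- t - T)) * (exp (- 2 * t - T) * exp t)"
        using that by (intro mult_right_mono C) auto
      also have "\<dots> = C * exp (real m * T) * exp (real m * t)"
        by (simp add: algebra_simps mult.assoc flip: exp_add)
      finally show ?thesis .
    qed
    thus "\<exists>C. \<forall>t\<le>-T. norm (partial_x f (Complex (of_int p / real q) (exp t)) * of_real (exp t)) \<le> C * exp (real m * t)" by blast
  qed
qed

text \<open>Bessel's inequality at height y bounds the sum of |a_{s n}(y)|^2 by the square of the
  sup norm of f. Split n into blocks [\<rho>^i, \<rho>^(i+1)] and take y proportional to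
  \<rho>^(-i): by \<open>a_scale\<close> the coefficient is l(n) / n^(1/2) times a value bounded
  below. So |l(n)|^2 / n has bounded sum over each block, and n^(1 - \<sigma>) makes the blocks
  geometrically summable.\<close>

lemma l_square_summable:
  assumes \<sigma>: "\<sigma> > 1"
  shows "summable (\<lambda>n. (norm (l (Suc n)))\<^sup>2 / real (Suc n) powr \<sigma>)"
proof -
  obtain s y0 where s: "\<bar>s\<bar> = 1" "y0 > 0" "a s y0 \<noteq> 0" using nonzero_sign by blast
  obtain B where B: "B > 0" "\<And>z. z \<in> upper_half_plane \<Longrightarrow> norm (f z) \<le> B" using bounded_H by blast
  define w where "w = norm (a s y0) / 2"
  have w: "w > 0" using s by (simp add: w_def)
  have "isCont (a s) y0" using a_deriv[OF s(2)] has_vector_derivative_continuous by blast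
  hence "isCont (\<lambda>y. norm (a s y)) y0" by (intro continuous_intros)
  moreover have "norm (a s y0) > w" using s by (simp add: w_def)
  ultimately have "eventually (\<lambda>y. norm (a s y) > w) (nhds y0)"
    unfolding continuous_at_imp_continuous_on isCont_def tendsto_nhds_iff[symmetric]
    by (metis (no_types) order_tendstoD(1) continuous_at tendsto_at_iff_tendsto_nhds)
  then obtain e where e: "e > 0" "\<And>y. dist y y0 < e \<Longrightarrow> norm (a s y) > w"
    by (auto simp: eventually_nhds_metric)
  \<comment> \<open>Narrow enough that |a_s| > w on the whole interval from y0 to \<rho> y0.\<close>
  define \<rho> where "\<rho> = 1 + e / (2 * y0)"
  have \<rho>: "\<rho> > 1" using e s by (simp add: \<rho>_def)
  have near: "norm (a s y) > w" if "y0 \<le> y" "y \<le> \<rho> * y0" for y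
  proof (rule e(2))
    have "\<rho> * y0 = y0 + e / 2" using s by (simp add: \<rho>_def field_simps)
    thus "dist y y0 < e" using that e(1) by (simp add: dist_real_def)
  qed
  define j where "j = (\<lambda>n::nat. nat \<lfloor>log \<rho> (real n)\<rfloor>)"
  have j: "\<rho> ^ j n \<le> real n" "real n \<le> \<rho> ^ Suc (j n)" if n: "n \<ge> 1" for n
  proof -
    have lg: "log \<rho> (real n) \<ge> 0" using n \<rho> by simp
    hence jn: "real (j n) = of_int \<lfloor>log \<rho> (real n)\<rfloor>" by (simp add: j_def)
    have n_eq: "real n = \<rho> powr (log \<rho> (real n))" using n \<rho> by simp
    have "\<rho> ^ j n = \<rho> powr real (j n)" using \<rho> by (simp add: powr_realpow)
    also have "\<dots> \<le> \<rho> powr (log \<rho> (real n))" using \<rho> jn by (intro powr_mono) auto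
    finally show "\<rho> ^ j n \<le> real n" using n_eq by simp
    have "\<rho> powr (log \<rho> (real n)) \<le> \<rho> powr real (Suc (j n))" using \<rho> jn by (intro powr_mono) (auto, linarith)
    also have "\<dots> = \<rho> ^ Suc (j n)" using \<rho> by (subst powr_realpow) auto
    finally show "real n \<le> \<rho> ^ Suc (j n)" using n_eq by simp
  qed
  define \<epsilon> where "\<epsilon> = \<sigma> - 1"
  have \<epsilon>: "\<epsilon> > 0" using \<sigma> by (simp add: \<epsilon>_def)
  define r where "r = \<rho> powr (- \<epsilon>)"
  have r: "0 < r" "r < 1" using \<rho> \<epsilon> by (auto simp: r_def powr_less_one)
  define D where "D = B\<^sup>2 / w\<^sup>2"
  define x where "x = (\<lambda>n. (norm (l n))\<^sup>2 / real n powr \<sigma>)"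
  have block: "(\<Sum>n\<in>{n\<in>{1..N}. j n = i}. x n) \<le> D * r ^ i" for N i
  proof -
    define S where "S = {n\<in>{1..N}. j n = i}"
    \<comment> \<open>For every n in the block, n y then lies between y0 and \<rho> y0.\<close>
    define y where "y = y0 / \<rho> ^ i"
    have y: "y > 0" using s \<rho> by (simp add: y_def)
    have each: "x n \<le> r ^ i / w\<^sup>2 * (norm (a (s * int n) y))\<^sup>2" if n: "n \<in> S" for n
    proof -
      have n1: "n \<ge> 1" and ji: "j n = i" using n by (auto simp: S_def)
      have "real n * y \<ge> y0" using j(1)[OF n1] s \<rho> by (simp add: y_def ji field_simps)
      moreover have "real n * y \<le> \<rho> * y0" using j(2)[OF n1] s \<rho> by (simp add: y_def ji field_simps)
      ultimately have wn: "norm (a s (real n * y)) \<ge> w" using near less_imp_le by blast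
      have "(norm (a (s * int n) y))\<^sup>2 = (norm (l n))\<^sup>2 / real n * (norm (a s (real n * y)))\<^sup>2"
        using a_scale[OF n1 y s(1)] by (simp add: norm_mult norm_divide power_mult_distrib power_divide)
      also have "\<dots> \<ge> (norm (l n))\<^sup>2 / real n * w\<^sup>2"
        using wn w by (intro mult_left_mono power_mono) auto
      finally have 1: "(norm (l n))\<^sup>2 / real n \<le> (norm (a (s * int n) y))\<^sup>2 / w\<^sup>2"
        using w by (simp add: field_simps)
      have "real n powr (- \<epsilon>) \<le> (\<rho> ^ i) powr (- \<epsilon>)"
        using j(1)[OF n1] \<rho> \<epsilon> ji by (intro powr_mono2') auto
      also have "\<dots> = r ^ i" using \<rho> by (simp add: r_def powr_powr powr_realpow[symmetric] mult.commute)
      finally have 2: "real n powr (- \<epsilon>) \<le> r ^ i" .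
      have "x n = (norm (l n))\<^sup>2 / real n * real n powr (- \<epsilon>)"
        using n1 by (simp add: x_def \<epsilon>_def powr_minus powr_diff field_simps)
      also have "\<dots> \<le> ((norm (a (s * int n) y))\<^sup>2 / w\<^sup>2) * r ^ i"
        using 1 2 by (intro mult_mono) auto
      finally show ?thesis by (simp add: mult.commute)
    qed
    have "(\<Sum>n\<in>S. x n) \<le> (\<Sum>n\<in>S. r ^ i / w\<^sup>2 * (norm (a (s * int n) y))\<^sup>2)" by (rule sum_mono[OF each])
    also have "\<dots> = r ^ i / w\<^sup>2 * (\<Sum>n\<in>S. (norm (a (s * int n) y))\<^sup>2)" by (simp add: sum_distrib_left)
    also have "(\<Sum>n\<in>S. (norm (a (s * int n) y))\<^sup>2) \<le> B\<^sup>2"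
    proof -
      have inj: "inj_on (\<lambda>n. s * int n) S" using s by (auto simp: inj_on_def)
      have "(\<Sum>n\<in>S. (norm (a (s * int n) y))\<^sup>2) = (\<Sum>k\<in>(\<lambda>n. s * int n) ` S. (norm (fourier_coeff (\<lambda>x. f (Complex x y)) k))\<^sup>2)"
        unfolding a_def strip_coeff_def by (subst sum.reindex[OF inj]) simp
      also have "\<dots> \<le> integral {0..1} (\<lambda>x. (norm (f (Complex x y)))\<^sup>2)"
        by (intro bessel_inequality continuous_on_horizontal cont y) (auto simp: S_def)
      also have "\<dots> \<le> integral {0..1} (\<lambda>x::real. B\<^sup>2)"
        using B(2) y by (intro integral_le integrable_continuous_interval continuous_intros continuous_on_horizontal cont power_mono) auto
      finally show ?thesis by simp
    qed
    finally show ?thesis using r by (simp add: S_def D_def mult_left_mono divide_right_mono mult.commute)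
  qed
  have "summable (\<lambda>n. x (Suc n))"
  proof (rule bounded_imp_summable)
    fix n
    have "(\<Sum>k\<le>n. x (Suc k)) = (\<Sum>k\<in>{1..Suc n}. x k)"
      by (simp add: sum.shift_bounds_Suc_ivl atLeast0AtMost[symmetric] del: sum.cl_ivl_Suc) (metis One_nat_def sum.shift_bounds_cl_Suc_ivl)
    also have "\<dots> = (\<Sum>i\<in>j ` {1..Suc n}. \<Sum>k\<in>{k\<in>{1..Suc n}. j k = i}. x k)"
      by (rule sum.group[symmetric]) auto
    also have "\<dots> \<le> (\<Sum>i\<in>j ` {1..Suc n}. D * r ^ i)" by (intro sum_mono block)
    also have "\<dots> \<le> (\<Sum>i. D * r ^ i)"
      using r by (intro sum_le_suminf summable_mult summable_geometric) (auto simp: D_def)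
    finally show "(\<Sum>k\<le>n. x (Suc k)) \<le> (\<Sum>i. D * r ^ i)" .
  qed (auto simp: x_def)
  thus ?thesis by (simp add: x_def)
qed

text \<open>From |l| \<le> |l|^2 + 1 and the convergence of the sum of n^(-\<sigma>).\<close>

lemma l_abs_summable:
  assumes \<sigma>: "\<sigma> > 1"
  shows "summable (\<lambda>n. norm (l (Suc n)) / real (Suc n) powr \<sigma>)"
proof (rule summable_comparison_test)
  have z: "summable (\<lambda>n. real (Suc n) powr (- \<sigma>))"
    using \<sigma> by (subst summable_Suc_iff) (simp add: summable_real_powr_iff)
  show "summable (\<lambda>n. (norm (l (Suc n)))\<^sup>2 / real (Suc n) powr \<sigma> + real (Suc n) powr (- \<sigma>))"
    by (intro summable_add l_square_summable \<sigma> z)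
  show "\<exists>N. \<forall>n\<ge>N. norm (norm (l (Suc n)) / real (Suc n) powr \<sigma>) \<le>
      (norm (l (Suc n)))\<^sup>2 / real (Suc n) powr \<sigma> + real (Suc n) powr (- \<sigma>)"
  proof (intro exI[of _ 0] allI impI)
    fix n
    have "norm (l (Suc n)) \<le> (norm (l (Suc n)))\<^sup>2 + 1"
      using sum_squares_bound[of "norm (l (Suc n))" 1] by (smt (verit) norm_ge_zero one_power2)
    hence "norm (l (Suc n)) / real (Suc n) powr \<sigma> \<le> ((norm (l (Suc n)))\<^sup>2 + 1) / real (Suc n) powr \<sigma>"
      by (intro divide_right_mono) auto
    also have "\<dots> = (norm (l (Suc n)))\<^sup>2 / real (Suc n) powr \<sigma> + real (Suc n) powr (- \<sigma>)"
      by (simp add: powr_minus divide_inverse algebra_simps)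
    finally show "norm (norm (l (Suc n)) / real (Suc n) powr \<sigma>) \<le>
      (norm (l (Suc n)))\<^sup>2 / real (Suc n) powr \<sigma> + real (Suc n) powr (- \<sigma>)" by simp
  qed
qed

end

section \<open>The archimedean factor\<close>

text \<open>The ratio |Gamma(z + n)| / Gamma(Re z + n) does not decrease with n, since each step
  multiplies it by |z + n| / (Re z + n) \<ge> 1.\<close>

lemma norm_Gamma_shift_ge:
  assumes z: "Re z > 0"
  shows "norm (Gamma (z + of_nat n)) * Gamma (Re z) \<ge> norm (Gamma z) * Gamma (Re z + real n)"
proof (induction n)
  case (Suc n)
  have nz: "z + of_nat n \<notin> \<int>\<^sub>\<le>\<^sub>0" "Re z + real n \<notin> \<int>\<^sub>\<le>\<^sub>0"
    using z by (auto elim!: nonpos_Ints_cases simp: complex_eq_iff)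
  have "norm (Gamma z) * Gamma (Re z + real (Suc n)) = (Re z + real n) * (norm (Gamma z) * Gamma (Re z + real n))"
    using Gamma_plus1[OF nz(2)] by (simp add: add_ac mult_ac)
  also have "\<dots> \<le> (Re z + real n) * (norm (Gamma (z + of_nat n)) * Gamma (Re z))"
    using Suc z by (intro mult_left_mono) auto
  also have "\<dots> \<le> norm (z + of_nat n) * (norm (Gamma (z + of_nat n)) * Gamma (Re z))"
    using complex_Re_le_cmod[of "z + of_nat n"] z
    by (intro mult_right_mono mult_nonneg_nonneg less_imp_le[OF Gamma_real_pos]) auto
  also have "\<dots> = norm (Gamma (z + of_nat (Suc n))) * Gamma (Re z)"
    using Gamma_plus1[OF nz(1)] by (simp add: add_ac norm_mult mult_ac)
  finally show ?case .
qed simp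

lemma of_nat_powr_conv_exp: "n > 0 \<Longrightarrow> of_nat n powr (s::complex) = exp (s * of_real (ln (real n)))"
  by (simp add: powr_def Ln_of_nat)

lemma norm_of_nat_powr: "n > 0 \<Longrightarrow> norm (of_nat n powr (s::complex)) = real n powr Re s"
  by (simp add: norm_powr_real_powr)

text \<open>A sign for which a_1 + e a_{-1} is not identically zero; f need not be an eigenfunction
  of the reflection in the imaginary axis. The one radial function W obtained this way supplies the
  archimedean factor for all twists.\<close>

locale signed_form = hecke_form +
  fixes e :: complex
  assumes e: "e = 1 \<or> e = - 1" and nonzero: "\<exists>y>0. a 1 y + e * a (- 1) y \<noteq> 0"
begin

lemma e_square: "e * e = 1" and norm_e: "norm e = 1" using e by auto

definition "W y = a 1 y + e * a (- 1) y"
definition "W1 y = a1 1 y + e * a1 (- 1) y"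

lemma W_ode: "\<exists>C m. radial_ode W W1 (2 * pi) mu C m"
proof -
  obtain C1 m1 where r1: "radial_ode (a 1) (a1 1) (2 * pi) mu C1 m1" using radial[of 1] by auto
  obtain C2 m2 where r2: "radial_ode (a (-1)) (a1 (-1)) (2 * pi) mu C2 m2" using radial[of "-1"] by auto
  have "radial_ode W W1 (2 * pi) mu (\<bar>C1\<bar> + \<bar>C2\<bar>) (m1 + m2)"
  proof
    fix y :: real assume y: "y > 0"
    show "(W has_vector_derivative W1 y) (at y)"
      unfolding W_def[abs_def] W1_def
      by (intro has_vector_derivative_add has_vector_derivative_mult_right a_deriv y)
    have "(W1 has_vector_derivative
        ((of_real ((2 * pi)\<^sup>2) - mu / of_real (y\<^sup>2)) * a 1 y + e * ((of_real ((2 * pi)\<^sup>2) - mu / of_real (y\<^sup>2)) * a (-1) y))) (at y)"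
      unfolding W1_def[abs_def]
      by (intro has_vector_derivative_add has_vector_derivative_mult_right radial_ode.W1[OF r1] radial_ode.W1[OF r2] y)
    thus "(W1 has_vector_derivative (of_real ((2 * pi)\<^sup>2) - mu / of_real (y\<^sup>2)) * W y) (at y)"
      by (simp only: W_def distrib_left mult.left_commute)
  next
    fix y :: real assume y: "y \<ge> 1"
    have "norm (W y) \<le> norm (a 1 y) + norm (a (-1) y)"
      unfolding W_def by (rule order.trans[OF norm_triangle_ineq]) (simp add: norm_mult norm_e)
    also have "\<dots> \<le> C1 * y ^ m1 + C2 * y ^ m2"
      using radial_ode.growth[OF r1 y] radial_ode.growth[OF r2 y] by (rule add_mono)
    also have "\<dots> \<le> \<bar>C1\<bar> * y ^ (m1 + m2) + \<bar>C2\<bar> * y ^ (m1 + m2)"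
      using y by (intro add_mono mult_mono power_increasing) auto
    finally show "norm (W y) \<le> (\<bar>C1\<bar> + \<bar>C2\<bar>) * y ^ (m1 + m2)" by (simp add: algebra_simps)
  qed auto
  thus ?thesis by blast
qed

lemma
  assumes "y > 0"
  shows W_deriv: "(W has_vector_derivative W1 y) (at y)"
    and W1_deriv: "(W1 has_vector_derivative (of_real ((2 * pi)\<^sup>2) - mu / of_real (y\<^sup>2)) * W y) (at y)"
proof -
  obtain C m where r: "radial_ode W W1 (2 * pi) mu C m" using W_ode by blast
  show "(W has_vector_derivative W1 y) (at y)" by (rule radial_ode.W[OF r assms])
  show "(W1 has_vector_derivative (of_real ((2 * pi)\<^sup>2) - mu / of_real (y\<^sup>2)) * W y) (at y)"
    by (rule radial_ode.W1[OF r assms])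
qed

text \<open>Unlike \<open>exp_decay\<close>, the bound reaches down to y = 0, where the boundedness
  of f replaces the radial equation.\<close>

lemma W_exp_bound: "\<exists>K>0. \<forall>y>0. norm (W y) \<le> K * exp (- (2 * pi) * y)"
proof -
  obtain C m where "radial_ode W W1 (2 * pi) mu C m" using W_ode by blast
  from radial_ode.exp_decay[OF this, of 1] obtain K1
    where K1: "\<And>y. y \<ge> 1 \<Longrightarrow> norm (W y) \<le> K1 * exp (- (2 * pi) * y)" by auto
  obtain B where B: "B > 0" "\<And>z. z \<in> upper_half_plane \<Longrightarrow> norm (f z) \<le> B" using bounded_H by blast
  have ab: "norm (a n y) \<le> B" if "y > 0" for n y
    unfolding a_def strip_coeff_def
    using B(2) that by (intro fourier_coeff_norm_le continuous_on_horizontal cont) auto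
  define K where "K = max K1 (2 * B * exp (2 * pi))"
  have "norm (W y) \<le> K * exp (- (2 * pi) * y)" if y: "y > 0" for y
  proof (cases "y \<ge> 1")
    case True
    have "K1 * exp (- (2 * pi) * y) \<le> K * exp (- (2 * pi) * y)" by (intro mult_right_mono) (auto simp: K_def)
    from order.trans[OF K1[OF True] this] show ?thesis .
  next
    case False
    have "norm (W y) \<le> norm (a 1 y) + norm (a (-1) y)"
      unfolding W_def by (rule order.trans[OF norm_triangle_ineq]) (simp add: norm_mult norm_e)
    also have "\<dots> \<le> 2 * B * 1" using ab[OF y, of 1] ab[OF y, of "-1"] by simp
    also have "\<dots> \<le> 2 * B * (exp (2 * pi) * exp (- (2 * pi) * y))"
    proof (intro mult_left_mono)
      have "2 * pi * y \<le> 2 * pi * 1" using False by (intro mult_left_mono) auto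
      thus "1 \<le> exp (2 * pi) * exp (- (2 * pi) * y)" by (simp flip: exp_add)
    qed (use B in auto)
    also have "\<dots> \<le> K * exp (- (2 * pi) * y)"
      unfolding mult.assoc[symmetric] by (intro mult_right_mono) (auto simp: K_def)
    finally show ?thesis .
  qed
  moreover have "K > 0" using B by (simp add: K_def less_max_iff_disj)
  ultimately show ?thesis by blast
qed

definition "KW = (SOME K. K > 0 \<and> (\<forall>y>0. norm (W y) \<le> K * exp (- (2 * pi) * y)))"

lemma KW: "KW > 0" "y > 0 \<Longrightarrow> norm (W y) \<le> KW * exp (- (2 * pi) * y)"
proof -
  have "KW > 0 \<and> (\<forall>y>0. norm (W y) \<le> KW * exp (- (2 * pi) * y))"
    unfolding KW_def by (rule someI_ex[OF W_exp_bound])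
  thus "KW > 0" "y > 0 \<Longrightarrow> norm (W y) \<le> KW * exp (- (2 * pi) * y)" by blast+
qed

text \<open>As W is bounded, W1' = O(1 / y^2) near 0, and integrating from y to 1 gives O(1/y). This
  keeps y W1 bounded, as the boundary terms of the Mellin recurrence require.\<close>

lemma W1_bounds: "\<exists>K. (\<forall>y\<ge>1. norm (W1 y) \<le> K * exp (- (2 * pi) * y)) \<and> (\<forall>y. 0 < y \<longrightarrow> y \<le> 1 \<longrightarrow> norm (W1 y) \<le> K / y)"
proof -
  obtain C m where "radial_ode W W1 (2 * pi) mu C m" using W_ode by blast
  from radial_ode.exp_decay[OF this, of 1] obtain K1
    where K1: "\<And>y. y \<ge> 1 \<Longrightarrow> norm (W1 y) \<le> K1 * exp (- (2 * pi) * y)" by auto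
  define D where "D = ((2 * pi)\<^sup>2 + norm mu) * KW"
  have D: "D \<ge> 0" using KW(1) by (simp add: D_def)
  define K where "K = max K1 (norm (W1 1) + D)"
  have 1: "norm (W1 y) \<le> K * exp (- (2 * pi) * y)" if "y \<ge> 1" for y
  proof -
    have "K1 * exp (- (2 * pi) * y) \<le> K * exp (- (2 * pi) * y)" by (intro mult_right_mono) (auto simp: K_def)
    from order.trans[OF K1[OF that] this] show ?thesis .
  qed
  have 2: "norm (W1 y) \<le> K / y" if y: "0 < y" "y \<le> 1" for y
  proof -
    have "norm (W1 1 - W1 y) \<le> D / y"
    proof (cases "y = 1")
      case False
      hence "y < 1" using y by simp
      have "norm (W1 1 - W1 y) \<le> (- D / 1) - (- D / y)"
      proof (rule differentiable_bound_general[OF \<open>y < 1\<close>])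
        show "continuous_on {y..1} W1"
          using y by (auto intro!: continuous_at_imp_continuous_on has_vector_derivative_continuous[OF W1_deriv])
        show "continuous_on {y..1} (\<lambda>y. - D / y)" using y by (intro continuous_intros) auto
        fix v assume v: "y < v" "v < 1"
        hence v0: "v > 0" using y by simp
        show "(W1 has_vector_derivative (of_real ((2 * pi)\<^sup>2) - mu / of_real (v\<^sup>2)) * W v) (at v)"
          by (rule W1_deriv[OF v0])
        show "((\<lambda>y. - D / y) has_vector_derivative D / v\<^sup>2) (at v)"
          unfolding has_real_derivative_iff_has_vector_derivative[symmetric]
          by (rule derivative_eq_intros refl)+ (use v0 in \<open>auto simp: power2_eq_square\<close>)
        have "norm (of_real ((2 * pi)\<^sup>2) - mu / of_real (v\<^sup>2)) \<le> (2 * pi)\<^sup>2 + norm mu / v\<^sup>2"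
          by (rule order.trans[OF norm_triangle_ineq4]) (simp add: norm_divide norm_power norm_mult)
        also have "\<dots> \<le> (2 * pi)\<^sup>2 / v\<^sup>2 + norm mu / v\<^sup>2"
        proof -
          have "(2 * pi)\<^sup>2 / 1 \<le> (2 * pi)\<^sup>2 / v\<^sup>2" using v v0 by (intro divide_left_mono) (auto simp: power_le_one)
          thus ?thesis by simp
        qed
        also have "\<dots> = ((2 * pi)\<^sup>2 + norm mu) / v\<^sup>2" by (simp add: add_divide_distrib)
        finally have c: "norm (of_real ((2 * pi)\<^sup>2) - mu / of_real (v\<^sup>2)) \<le> ((2 * pi)\<^sup>2 + norm mu) / v\<^sup>2" .
        have "KW * exp (- (2 * pi) * v) \<le> KW * 1" using KW(1) v0 by (intro mult_left_mono) auto
        hence "norm (W v) \<le> KW" using KW(2)[OF v0] by simp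
        with c have "norm ((of_real ((2 * pi)\<^sup>2) - mu / of_real (v\<^sup>2)) * W v) \<le> ((2 * pi)\<^sup>2 + norm mu) / v\<^sup>2 * KW"
          unfolding norm_mult by (intro mult_mono) auto
        thus "norm ((of_real ((2 * pi)\<^sup>2) - mu / of_real (v\<^sup>2)) * W v) \<le> D / v\<^sup>2" by (simp add: D_def)
      qed
      thus ?thesis using D by simp
    qed (use D in auto)
    moreover have "norm (W1 y) \<le> norm (W1 1) + norm (W1 1 - W1 y)"
      by (metis norm_minus_commute norm_triangle_sub)
    moreover have "norm (W1 1) \<le> norm (W1 1) / y" using y by (simp add: field_simps mult_left_le_one_le)
    ultimately have "norm (W1 y) \<le> (norm (W1 1) + D) / y" by (simp add: add_divide_distrib)
    also have "\<dots> \<le> K / y" using y by (intro divide_right_mono) (auto simp: K_def)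
    finally show ?thesis .
  qed
  from 1 2 show ?thesis by blast
qed

section \<open>The Mellin transform of the radial function\<close>

definition "w t = W (exp t)"

lemma w_cont: "continuous_on UNIV w"
proof -
  have "continuous_on {0<..} W"
    by (auto intro!: continuous_at_imp_continuous_on has_vector_derivative_continuous[OF W_deriv])
  thus ?thesis unfolding w_def[abs_def] by (rule continuous_on_compose2) (auto intro!: continuous_on_exp continuous_on_id)
qed

lemma integrable_exp_exp:
  assumes "\<sigma> > 0"
  shows "integrable lborel (\<lambda>t. exp (- (2 * pi) * exp t) * exp (\<sigma> * t))"
    and "(\<integral>t. exp (- (2 * pi) * exp t) * exp (\<sigma> * t) \<partial>lborel) = exp (- \<sigma> * ln (2 * pi)) * Gamma \<sigma>"
proof -
  have *: "complex_of_real (exp (- (2 * pi) * exp t)) * exp (of_real \<sigma> * of_real t) =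
         of_real (exp (- (2 * pi) * exp t) * exp (\<sigma> * t))" for t
    by (simp only: of_real_mult exp_of_real[symmetric])
  have "integrable lborel (\<lambda>t. complex_of_real (exp (- (2 * pi) * exp t)) * exp (of_real \<sigma> * of_real t))"
    using Gamma_line(1)[of "of_real \<sigma>" "2 * pi"] assms by simp
  from integrable_norm[OF this] show "integrable lborel (\<lambda>t. exp (- (2 * pi) * exp t) * exp (\<sigma> * t))"
    unfolding * norm_of_real abs_mult abs_exp_cancel .
  have "(\<integral>t. complex_of_real (exp (- (2 * pi) * exp t) * exp (\<sigma> * t)) \<partial>lborel) = of_real (exp (- \<sigma> * ln (2 * pi)) * Gamma \<sigma>)"
  proof -
    have "exp (- complex_of_real \<sigma> * of_real (ln (2 * pi))) = of_real (exp (- \<sigma> * ln (2 * pi)))"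
      by (simp only: exp_of_real[symmetric] of_real_mult of_real_minus)
    thus ?thesis
      using Gamma_line(2)[of "of_real \<sigma>" "2 * pi"] assms
      unfolding mellin_def * by (simp only: Gamma_complex_of_real of_real_mult Re_complex_of_real) auto
  qed
  thus "(\<integral>t. exp (- (2 * pi) * exp t) * exp (\<sigma> * t) \<partial>lborel) = exp (- \<sigma> * ln (2 * pi)) * Gamma \<sigma>"
    unfolding integral_complex_of_real by (simp only: of_real_eq_iff)
qed

lemma w_bound: "norm (w t) \<le> KW * exp (- (2 * pi) * exp t)"
  unfolding w_def by (rule KW(2)) simp

lemma w_integrable:
  assumes "\<sigma> > 0"
  shows "integrable lborel (\<lambda>t. norm (w t) * exp (\<sigma> * t))"
proof (rule Bochner_Integration.integrable_bound[OF integrable_mult_right[OF integrable_exp_exp(1)[OF assms], of KW]])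
  show "(\<lambda>t. norm (w t) * exp (\<sigma> * t)) \<in> borel_measurable lborel"
    using w_cont by (simp add: borel_measurable_continuous_onI continuous_intros)
  have "norm (norm (w t) * exp (\<sigma> * t)) \<le> norm (KW * (exp (- (2 * pi) * exp t) * exp (\<sigma> * t)))" for t
  proof -
    have "norm (w t) * exp (\<sigma> * t) \<le> KW * exp (- (2 * pi) * exp t) * exp (\<sigma> * t)"
      by (intro mult_right_mono w_bound) auto
    thus ?thesis using KW(1) by (simp add: abs_mult mult.assoc)
  qed
  thus "AE t in lborel. norm (norm (w t) * exp (\<sigma> * t)) \<le> norm (KW * (exp (- (2 * pi) * exp t) * exp (\<sigma> * t)))" by simp
qed

definition "M p = mellin w p"

lemma M_integrable: "Re p > 0 \<Longrightarrow> integrable lborel (\<lambda>t. w t * exp (p * of_real t))"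
  by (intro mellin_integrable w_cont w_integrable)

lemma M_holomorphic: "M holomorphic_on {p. Re p > 0}"
  unfolding M_def[abs_def] by (intro mellin_holomorphic w_cont w_integrable)

text \<open>Two integrations by parts against the radial equation, carried out at once by
  integrating an exact derivative over the whole line.\<close>

lemma M_recurrence:
  assumes p: "Re p > 0"
  shows "of_real ((2 * pi)\<^sup>2) * M (p + 2) = (p\<^sup>2 + p + mu) * M p"
proof -
  define w' where "w' = (\<lambda>t. of_real (exp t) * W1 (exp t))"
  \<comment> \<open>The coefficient 1 + p is the one for which the terms in w' cancel in F', leaving
    only multiples of w.\<close>
  define F where "F = (\<lambda>t. (w' t - (1 + p) * w t) * exp (p * of_real t))"
  define g where "g = (\<lambda>t. of_real ((2 * pi)\<^sup>2) * (w t * exp ((p + 2) * of_real t)) - (p\<^sup>2 + p + mu) * (w t * exp (p * of_real t)))"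
  have dexp: "(exp has_vector_derivative exp t) (at t)" for t :: real
    unfolding has_real_derivative_iff_has_vector_derivative[symmetric] by (rule DERIV_exp)
  have dw: "(w has_vector_derivative w' t) (at t)" for t
    using vector_diff_chain_at[OF dexp[of t] W_deriv[of "exp t"]]
    by (simp add: w_def[abs_def] w'_def o_def scaleR_conv_of_real)
  have dw1: "((\<lambda>t. W1 (exp t)) has_vector_derivative
       of_real (exp t) * ((of_real ((2 * pi)\<^sup>2) - mu / of_real ((exp t)\<^sup>2)) * w t)) (at t)" for t
    using vector_diff_chain_at[OF dexp[of t] W1_deriv[of "exp t"]]
    by (simp add: w_def[abs_def] o_def scaleR_conv_of_real)
  have dce: "((\<lambda>t. complex_of_real (exp t)) has_vector_derivative of_real (exp t)) (at t)" for t
    by (rule has_vector_derivative_of_real) (rule DERIV_exp)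
  have dw': "(w' has_vector_derivative w' t + (of_real ((2 * pi)\<^sup>2 * (exp t)\<^sup>2) - mu) * w t) (at t)" for t
  proof -
    have d: "(w' has_vector_derivative of_real (exp t) * (of_real (exp t) * ((of_real ((2 * pi)\<^sup>2) - mu / of_real ((exp t)\<^sup>2)) * w t))
            + of_real (exp t) * W1 (exp t)) (at t)"
      unfolding w'_def by (intro has_vector_derivative_mult dce dw1)
    have eq: "of_real (exp t) * (of_real (exp t) * ((of_real ((2 * pi)\<^sup>2) - mu / of_real ((exp t)\<^sup>2)) * w t)) =
        (of_real ((2 * pi)\<^sup>2 * (exp t)\<^sup>2) - mu) * w t"
    proof -
      have "complex_of_real (exp t) \<noteq> 0" by simp
      thus ?thesis by (simp add: field_simps power2_eq_square)
    qed
    have wt: "of_real (exp t) * W1 (exp t) = w' t" by (simp add: w'_def)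
    from d show ?thesis unfolding eq wt by (subst add.commute)
  qed
  have dep: "((\<lambda>t. exp (p * of_real t)) has_vector_derivative p * exp (p * of_real t)) (at t)" for t :: real
  proof -
    have "((\<lambda>z. exp (p * z)) has_field_derivative p * exp (p * of_real t)) (at (of_real t))"
      by (auto intro!: derivative_eq_intros)
    from has_vector_derivative_real_field[OF this] show ?thesis by simp
  qed
  have e2: "exp ((p + 2) * complex_of_real t) = of_real ((exp t)\<^sup>2) * exp (p * of_real t)" for t
    unfolding distrib_right exp_add exp_double by (simp add: exp_of_real mult.commute)
  have dF: "(F has_vector_derivative g t) (at t)" for t
  proof -
    have "(F has_vector_derivative (w' t - (1 + p) * w t) * (p * exp (p * of_real t)) +
        ((w' t + (of_real ((2 * pi)\<^sup>2 * (exp t)\<^sup>2) - mu) * w t) - (1 + p) * w' t) * exp (p * of_real t)) (at t)"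
      unfolding F_def
      by (intro has_vector_derivative_mult has_vector_derivative_diff has_vector_derivative_mult_right dw dw' dep)
    moreover have "(w' t - (1 + p) * w t) * (p * exp (p * of_real t)) +
        ((w' t + (of_real ((2 * pi)\<^sup>2 * (exp t)\<^sup>2) - mu) * w t) - (1 + p) * w' t) * exp (p * of_real t) = g t"
      unfolding g_def e2 by (simp add: algebra_simps power2_eq_square)
    ultimately show ?thesis by simp
  qed
  have i1: "integrable lborel (\<lambda>t. w t * exp ((p + 2) * of_real t))" "integrable lborel (\<lambda>t. w t * exp (p * of_real t))"
    using p by (auto intro: M_integrable)
  have "(\<integral>t. g t \<partial>lborel) = 0"
  proof (rule integral_line_derivative_zero[OF dF])
    show "continuous_on UNIV g" unfolding g_def by (intro continuous_intros w_cont)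
    show "integrable lborel g"
      unfolding g_def by (intro Bochner_Integration.integrable_diff integrable_mult_right i1)
    obtain K where K: "\<And>y. y \<ge> 1 \<Longrightarrow> norm (W1 y) \<le> K * exp (- (2 * pi) * y)" "\<And>y. 0 < y \<Longrightarrow> y \<le> 1 \<Longrightarrow> norm (W1 y) \<le> K / y"
      using W1_bounds by blast
    define L where "L = \<bar>K\<bar> + norm (1 + p) * KW"
    have L: "L \<ge> 0" using KW(1) by (simp add: L_def)
    define \<sigma> where "\<sigma> = Re p"
    have normF: "norm (F t) \<le> (norm (w' t) + norm (1 + p) * norm (w t)) * exp (\<sigma> * t)" for t
      unfolding F_def norm_mult \<sigma>_def
      by (intro mult_mono order.trans[OF norm_triangle_ineq4]) (auto simp: norm_mult)
    obtain m :: nat where m: "real m \<ge> \<sigma> + 2" using real_arch_simple by blast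
    show "(F \<longlongrightarrow> 0) at_top"
    proof (rule Lim_null_comparison)
      show "eventually (\<lambda>t. norm (F t) \<le> L * real m ^ m * exp (- t)) at_top"
        using eventually_ge_at_top[of 0]
      proof eventually_elim
        case (elim t)
        have y: "exp t \<ge> 1" using elim by simp
        have ee: "exp (- (2 * pi) * exp t) \<le> exp (- exp t)"
          using mult_right_mono[of 1 "2 * pi" "exp t"] pi_ge_two by simp
        have "norm (w' t) \<le> exp t * (\<bar>K\<bar> * exp (- exp t))"
        proof -
          have "norm (W1 (exp t)) \<le> \<bar>K\<bar> * exp (- exp t)"
            by (rule order.trans[OF K(1)[OF y]]) (intro mult_mono ee, auto)
          thus ?thesis unfolding w'_def norm_mult by simp
        qed
        moreover have "norm (w t) \<le> exp t * (KW * exp (- exp t))"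
        proof -
          have "norm (w t) \<le> 1 * (KW * exp (- exp t))"
            using order.trans[OF w_bound mult_left_mono[OF ee]] KW(1) by simp
          also have "\<dots> \<le> exp t * (KW * exp (- exp t))" using y KW(1) by (intro mult_right_mono) auto
          finally show ?thesis .
        qed
        ultimately have "norm (w' t) + norm (1 + p) * norm (w t) \<le> exp t * (\<bar>K\<bar> * exp (- exp t)) + norm (1 + p) * (exp t * (KW * exp (- exp t)))"
          by (intro add_mono mult_left_mono) auto
        also have "\<dots> = L * (exp t * exp (- exp t))" by (simp add: L_def algebra_simps)
        finally have "norm (F t) \<le> L * (exp t * exp (- exp t)) * exp (\<sigma> * t)"
          using normF[of t] by (meson exp_ge_zero mult_right_mono order_trans)
        also have "\<dots> \<le> L * (exp t * (real m ^ m * (1 / exp t) ^ m)) * exp (\<sigma> * t)"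
          using L by (intro mult_right_mono mult_left_mono exp_minus_le_power) auto
        also have "\<dots> = L * real m ^ m * exp (t - real m * t + \<sigma> * t)"
          by (simp add: exp_add exp_diff exp_of_nat_mult power_divide)
        also have "\<dots> \<le> L * real m ^ m * exp (- t)"
        proof (intro mult_left_mono)
          have "t * (\<sigma> + 2) \<le> t * real m" using m elim by (intro mult_left_mono) auto
          thus "exp (t - real m * t + \<sigma> * t) \<le> exp (- t)" by (simp add: algebra_simps)
        qed (use L in auto)
        finally show ?case .
      qed
      have "((\<lambda>t::real. L * real m ^ m * exp (- t)) \<longlongrightarrow> L * real m ^ m * 0) at_top"
        by (intro tendsto_intros filterlim_compose[OF exp_at_bot] filterlim_uminus_at_bot_at_top)
      thus "((\<lambda>t::real. L * real m ^ m * exp (- t)) \<longlongrightarrow> 0) at_top" by simp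
    qed
    show "(F \<longlongrightarrow> 0) at_bot"
    proof (rule Lim_null_comparison)
      show "eventually (\<lambda>t. norm (F t) \<le> L * exp (\<sigma> * t)) at_bot"
        using eventually_le_at_bot[of 0]
      proof eventually_elim
        case (elim t)
        have "norm (w' t) \<le> exp t * (K / exp t)"
          unfolding w'_def norm_mult using K(2)[of "exp t"] elim by (intro mult_mono) auto
        hence "norm (w' t) \<le> \<bar>K\<bar>" by simp
        moreover have "norm (w t) \<le> KW"
        proof -
          have "KW * exp (- (2 * pi) * exp t) \<le> KW * 1" using KW(1) by (intro mult_left_mono) auto
          thus ?thesis using w_bound[of t] by simp
        qed
        ultimately have "norm (w' t) + norm (1 + p) * norm (w t) \<le> L"
          unfolding L_def by (intro add_mono mult_left_mono) auto
        thus ?case using normF[of t] by (meson exp_ge_zero mult_right_mono order_trans)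
      qed
      have "filterlim (\<lambda>t. \<sigma> * t) at_bot at_bot"
        using p by (intro filterlim_tendsto_pos_mult_at_bot[OF tendsto_const] filterlim_ident) (auto simp: \<sigma>_def)
      hence "((\<lambda>t. L * exp (\<sigma> * t)) \<longlongrightarrow> L * 0) at_bot"
        by (intro tendsto_intros filterlim_compose[OF exp_at_bot])
      thus "((\<lambda>t. L * exp (\<sigma> * t)) \<longlongrightarrow> 0) at_bot" by simp
    qed
  qed
  moreover have "(\<integral>t. g t \<partial>lborel) = of_real ((2 * pi)\<^sup>2) * M (p + 2) - (p\<^sup>2 + p + mu) * M p"
    unfolding g_def M_def mellin_def
    by (subst Bochner_Integration.integral_diff) (auto intro: integrable_mult_right i1)
  ultimately show ?thesis by simp
qed

text \<open>
  A zero of \<open>M\<close> would propagate to \<open>p + 2, p + 4, \<dots>\<close> by the recurrence, but far to the right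
  \<open>M\<close> is dominated by a nonzero multiple of the Gamma function.
\<close>

lemma M_nonzero:
  assumes p: "Re p > 0"
  shows "M p \<noteq> 0"
proof
  assume "M p = 0"
  have zeros: "M (p + of_nat (2 * k)) = 0" for k
  proof (induction k)
    case (Suc k)
    have "of_real ((2 * pi)\<^sup>2) * M (p + of_nat (2 * k) + 2) = 0"
      using M_recurrence[of "p + of_nat (2 * k)"] p Suc by simp
    thus ?case by (simp add: add_ac)
  qed (use \<open>M p = 0\<close> in simp)
  obtain C m where ode: "radial_ode W W1 (2 * pi) mu C m" using W_ode by blast
  interpret R: radial_ode W W1 "2 * pi" mu C m by (rule ode)
  obtain C0 K where C0: "C0 = 0 \<longrightarrow> (\<forall>y>0. W y = 0)"
    and K: "\<And>y. y \<ge> R.T \<Longrightarrow> norm (of_real (exp (2 * pi * y)) * W y - C0) \<le> K / y" using R.asymptotics by blast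
  have C0nz: "C0 \<noteq> 0" using C0 nonzero by (auto simp: W_def)
  \<comment> \<open>The asymptotics hold for y \<ge> \<open>R.T\<close>. Below, the trivial bound by
    KW + |C0| is absorbed into K' / y because \<open>R.T\<close> / y \<ge> 1.\<close>
  define K' where "K' = max \<bar>K\<bar> ((KW + norm C0) * R.T)"
  have K'0: "K' \<ge> 0" by (simp add: K'_def)
  have err: "norm (w t - C0 * of_real (exp (- (2 * pi) * exp t))) \<le> K' * (exp (- (2 * pi) * exp t) * exp (- t))" for t
  proof -
    define y where "y = exp t"
    define E where "E = exp (- (2 * pi) * y)"
    have y: "y > 0" by (simp add: y_def)
    have E: "E > 0" by (simp add: E_def)
    have "norm (W y - C0 * of_real E) \<le> K' / y * E"
    proof (cases "y \<ge> R.T")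
      case True
      have eE: "exp (2 * pi * y) * E = 1" by (simp add: E_def flip: exp_add)
      have "W y - C0 * of_real E = of_real E * (of_real (exp (2 * pi * y)) * W y - C0)"
        using eE by (simp add: algebra_simps) (metis mult.commute mult.left_commute mult_1 of_real_1 of_real_mult)
      hence "norm (W y - C0 * of_real E) = E * norm (of_real (exp (2 * pi * y)) * W y - C0)"
        using E by (simp add: norm_mult)
      also have "\<dots> \<le> E * (K / y)" using E K[OF True] by (intro mult_left_mono) auto
      also have "\<dots> \<le> E * (K' / y)" using E y by (intro mult_left_mono divide_right_mono) (auto simp: K'_def)
      finally show ?thesis by (simp add: mult.commute)
    next
      case False
      have "norm (W y - C0 * of_real E) \<le> norm (W y) + norm C0 * E"
        by (rule order.trans[OF norm_triangle_ineq4]) (use E in \<open>simp add: norm_mult\<close>)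
      also have "\<dots> \<le> (KW + norm C0) * 1 * E" using KW(2)[OF y] by (simp add: E_def algebra_simps)
      also have "\<dots> \<le> (KW + norm C0) * (R.T / y) * E"
        using False y KW(1) E by (intro mult_right_mono mult_left_mono) auto
      also have "\<dots> \<le> K' / y * E"
      proof (intro mult_right_mono)
        have "(KW + norm C0) * R.T / y \<le> K' / y" using y by (intro divide_right_mono) (auto simp: K'_def)
        thus "(KW + norm C0) * (R.T / y) \<le> K' / y" by simp
      qed (use E in auto)
      finally show ?thesis .
    qed
    thus ?thesis by (simp add: w_def y_def E_def exp_minus divide_inverse mult_ac)
  qed
  define \<sigma> where "\<sigma> = Re p"
  \<comment> \<open>By \<open>norm_Gamma_shift_ge\<close> this compares |Gamma(P)| with Gamma(Re P)
    uniformly for all P = p + 2 k.\<close>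
  define c where "c = norm (Gamma p) / Gamma \<sigma>"
  have \<sigma>: "\<sigma> > 0" using p by (simp add: \<sigma>_def)
  have "p \<notin> \<int>\<^sub>\<le>\<^sub>0" using p by (auto elim!: nonpos_Ints_cases)
  hence "Gamma p \<noteq> 0" by (simp add: Gamma_eq_zero_iff)
  hence c: "c > 0" using Gamma_real_pos[OF \<sigma>] by (simp add: c_def)
  \<comment> \<open>If M P = 0, then C0 times the Gamma integral at P equals the integral of the
    error term up to sign. The former has size at least c Gamma(s), the latter at most a constant
    times Gamma(s - 1), and Gamma(s) = (s - 1) Gamma(s - 1); so s would stay bounded although k is
    arbitrary.\<close>
  have main: "norm C0 * c * (\<sigma> + real (2 * k) - 1) \<le> K' * (2 * pi)" if k: "k \<ge> 1" for k
  proof -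
    define P where "P = p + of_nat (2 * k)"
    define s where "s = Re P"
    have s: "s = \<sigma> + real (2 * k)" "s > 1" using k \<sigma> by (auto simp: s_def P_def \<sigma>_def)
    have reP: "Re P > 0" using s by (simp add: s_def)
    define G where "G = (\<lambda>t. complex_of_real (exp (- (2 * pi) * exp t)) * exp (P * of_real t))"
    have iG: "integrable lborel G" unfolding G_def using Gamma_line(1)[OF reP, of "2 * pi"] by simp
    have vG: "(\<integral>t. G t \<partial>lborel) = exp (- P * of_real (ln (2 * pi))) * Gamma P"
      using Gamma_line(2)[OF reP, of "2 * pi"] by (simp add: mellin_def G_def)
    have "0 = (\<integral>t. w t * exp (P * of_real t) \<partial>lborel)" using zeros[of k] by (simp add: P_def M_def mellin_def)
    hence "C0 * (\<integral>t. G t \<partial>lborel) = - (\<integral>t. w t * exp (P * of_real t) - C0 * G t \<partial>lborel)"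
      using iG M_integrable[OF reP] by (subst Bochner_Integration.integral_diff) auto
    hence "norm C0 * norm (\<integral>t. G t \<partial>lborel) = norm (\<integral>t. w t * exp (P * of_real t) - C0 * G t \<partial>lborel)"
      by (metis norm_minus_cancel norm_mult)
    also have "\<dots> \<le> (\<integral>t. K' * (exp (- (2 * pi) * exp t) * exp ((s - 1) * t)) \<partial>lborel)"
    proof (rule Bochner_Integration.integral_norm_bound_integral)
      show "integrable lborel (\<lambda>t. w t * exp (P * of_real t) - C0 * G t)"
        using iG M_integrable[OF reP] by auto
      show "integrable lborel (\<lambda>t. K' * (exp (- (2 * pi) * exp t) * exp ((s - 1) * t)))"
        using s by (intro integrable_mult_right integrable_exp_exp) auto
      fix t
      have "w t * exp (P * of_real t) - C0 * G t = (w t - C0 * of_real (exp (- (2 * pi) * exp t))) * exp (P * of_real t)"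
        by (simp add: G_def algebra_simps)
      hence "norm (w t * exp (P * of_real t) - C0 * G t) \<le> K' * (exp (- (2 * pi) * exp t) * exp (- t)) * exp (s * t)"
        unfolding s_def using err[of t] by (simp add: norm_mult mult_right_mono)
      also have "\<dots> = K' * (exp (- (2 * pi) * exp t) * exp ((s - 1) * t))"
        by (simp add: algebra_simps flip: exp_add)
      finally show "norm (w t * exp (P * of_real t) - C0 * G t) \<le> K' * (exp (- (2 * pi) * exp t) * exp ((s - 1) * t))" .
    qed
    also have "\<dots> = K' * (exp (- (s - 1) * ln (2 * pi)) * Gamma (s - 1))"
      using s(2) by (subst integrable_exp_exp(2)[of "s - 1", symmetric]) auto
    also have "norm (\<integral>t. G t \<partial>lborel) = exp (- s * ln (2 * pi)) * norm (Gamma P)"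
      unfolding vG by (simp add: norm_mult s_def)
    finally have 1: "norm C0 * (exp (- s * ln (2 * pi)) * norm (Gamma P)) \<le> K' * (exp (- (s - 1) * ln (2 * pi)) * Gamma (s - 1))" .
    have e1: "exp (- (s - 1) * ln (2 * pi)) = exp (- s * ln (2 * pi)) * (2 * pi)"
    proof -
      have "- (s - 1) * ln (2 * pi) = - s * ln (2 * pi) + ln (2 * pi)" by (simp add: algebra_simps)
      hence "exp (- (s - 1) * ln (2 * pi)) = exp (- s * ln (2 * pi)) * exp (ln (2 * pi))" by (simp only: exp_add)
      thus ?thesis by (simp only: exp_ln[of "2 * pi"] pi_gt_zero mult_pos_pos zero_less_numeral)
    qed
    have g1: "Gamma s = (s - 1) * Gamma (s - 1)"
    proof -
      have "s - 1 \<notin> \<int>\<^sub>\<le>\<^sub>0" using s(2) by (auto elim!: nonpos_Ints_cases)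
      from Gamma_plus1[OF this] show ?thesis by simp
    qed
    have "c * Gamma s \<le> norm (Gamma P)"
      using norm_Gamma_shift_ge[OF p, of "2 * k"] Gamma_real_pos[OF \<sigma>]
      by (simp add: c_def s P_def \<sigma>_def field_simps)
    hence A: "norm C0 * (exp (- s * ln (2 * pi)) * (c * Gamma s)) \<le> norm C0 * (exp (- s * ln (2 * pi)) * norm (Gamma P))"
      by (intro mult_left_mono) auto
    have "(exp (- s * ln (2 * pi)) * Gamma (s - 1)) * (norm C0 * c * (s - 1)) \<le>
         (exp (- s * ln (2 * pi)) * Gamma (s - 1)) * (K' * (2 * pi))"
      using order.trans[OF A 1] unfolding e1 g1 by (simp only: mult_ac)
    thus ?thesis using s Gamma_real_pos[of "s - 1"] by simp
  qed
  obtain k :: nat where k: "real k > K' * (2 * pi) / (norm C0 * c)" using reals_Archimedean2 by blast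
  have "K' * (2 * pi) < norm C0 * c * real k" using k C0nz c by (simp add: field_simps)
  also have "\<dots> \<le> norm C0 * c * (\<sigma> + real (2 * Suc k) - 1)" using \<sigma> c by (intro mult_left_mono) auto
  also have "\<dots> \<le> K' * (2 * pi)" by (rule main) simp
  finally show False by simp
qed

end

section \<open>Analytic continuation of additive twists\<close>

lemma rapid_add: "rapid g \<Longrightarrow> rapid h \<Longrightarrow> rapid (\<lambda>t. g t + h t)"
  unfolding rapid_def
proof (intro conjI allI)
  assume g: "continuous_on UNIV g \<and> (\<forall>m::nat. \<exists>C. \<forall>t. norm (g t) \<le> C * exp (- real m * \<bar>t\<bar>))"
    and h: "continuous_on UNIV h \<and> (\<forall>m::nat. \<exists>C. \<forall>t. norm (h t) \<le> C * exp (- real m * \<bar>t\<bar>))"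
  show "continuous_on UNIV (\<lambda>t. g t + h t)" using g h by (intro continuous_intros) auto
  fix m :: nat
  obtain C D where C: "\<And>t. norm (g t) \<le> C * exp (- real m * \<bar>t\<bar>)" and D: "\<And>t. norm (h t) \<le> D * exp (- real m * \<bar>t\<bar>)"
    using g h by metis
  have "norm (g t + h t) \<le> (C + D) * exp (- real m * \<bar>t\<bar>)" for t
    using norm_triangle_ineq[of "g t" "h t"] C[of t] D[of t] by (simp add: algebra_simps)
  thus "\<exists>C. \<forall>t. norm (g t + h t) \<le> C * exp (- real m * \<bar>t\<bar>)" by blast
qed

lemma rapid_cmult: "rapid g \<Longrightarrow> rapid (\<lambda>t. c * g t)"
  unfolding rapid_def
proof (intro conjI allI)
  assume g: "continuous_on UNIV g \<and> (\<forall>m::nat. \<exists>C. \<forall>t. norm (g t) \<le> C * exp (- real m * \<bar>t\<bar>))"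
  show "continuous_on UNIV (\<lambda>t. c * g t)" using g by (intro continuous_intros) auto
  fix m :: nat
  obtain C where C: "\<And>t. norm (g t) \<le> C * exp (- real m * \<bar>t\<bar>)" using g by metis
  have "norm (c * g t) \<le> (norm c * C) * exp (- real m * \<bar>t\<bar>)" for t
    unfolding norm_mult mult.assoc by (intro mult_left_mono C) auto
  thus "\<exists>C. \<forall>t. norm (c * g t) \<le> C * exp (- real m * \<bar>t\<bar>)" by blast
qed

lemma of_real_sqrt_conv_powr:
  assumes "n > 0"
  shows "complex_of_real (sqrt (real n)) = of_nat n powr (1 / 2)"
proof -
  have "sqrt (real n) = exp (1 / 2 * ln (real n))"
    using assms by (simp add: powr_half_sqrt[symmetric] powr_def)
  hence "complex_of_real (sqrt (real n)) = exp (of_real (1 / 2 * ln (real n)))" by (simp only: exp_of_real)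
  thus ?thesis using of_nat_powr_conv_exp[OF assms, of "1 / 2"] by simp
qed

lemma mellin_mult_exp: "mellin (\<lambda>t. h t * of_real (exp t)) p = mellin h (p + 1)"
  unfolding mellin_def
  by (intro Bochner_Integration.integral_cong refl) (simp add: distrib_right exp_add exp_of_real)

section \<open>Linear combinations of continued Dirichlet series\<close>

lemma entire_continuation_add:
  "entire_continuation a F \<Longrightarrow> entire_continuation b G \<Longrightarrow> entire_continuation (\<lambda>n. a n + b n) (\<lambda>s. F s + G s)"
  unfolding entire_continuation_def
  by (auto intro!: holomorphic_intros sums_add simp: add_divide_distrib)

lemma entire_continuation_cmult:
  "entire_continuation a F \<Longrightarrow> entire_continuation (\<lambda>n. c * a n) (\<lambda>s. c * F s)"
  unfolding entire_continuation_def
proof (elim conjE, intro conjI allI impI)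
  fix s assume "\<forall>s. 1 < Re s \<longrightarrow> (\<lambda>n. a (Suc n) / of_nat (Suc n) powr s) sums F s" "1 < Re s"
  hence "(\<lambda>n. a (Suc n) / of_nat (Suc n) powr s) sums F s" by blast
  from sums_mult[OF this, of c] show "(\<lambda>n. c * a (Suc n) / of_nat (Suc n) powr s) sums (c * F s)" by simp
qed (intro holomorphic_intros)

lemma entire_continuation_sum:
  assumes "finite S" "\<And>i. i \<in> S \<Longrightarrow> entire_continuation (a i) (F i)"
  shows "entire_continuation (\<lambda>n. \<Sum>i\<in>S. a i n) (\<lambda>s. \<Sum>i\<in>S. F i s)"
  using assms
proof (induction S rule: finite_induct)
  case empty
  show ?case by (simp add: entire_continuation_def)
next
  case (insert i S)
  thus ?case using entire_continuation_add[of "a i" "F i"] by simp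
qed

lemma L_series_eq: "entire_continuation a F \<Longrightarrow> L_series a = F"
  unfolding L_series_def using entire_continuation_unique by blast

context signed_form
begin

text \<open>X j p is the ratio M(p + 2 j + 2) / M(p + 2 j) from the recurrence. Hence
  \<open>Rk\<close> k p equals 1 / M(p) where M is defined by its integral, and it makes sense for
  Re p > -2 k.\<close>

definition "X j p = ((p + of_nat (2 * j))\<^sup>2 + (p + of_nat (2 * j)) + mu) / of_real ((2 * pi)\<^sup>2)"
definition "Rk k p = (\<Prod>j<k. X j p) / M (p + of_nat (2 * k))"

lemma Rk_Suc:
  assumes "Re p + real (2 * k) > 0"
  shows "Rk (Suc k) p = Rk k p"
proof -
  have re: "Re (p + of_nat (2 * k)) > 0" using assms by simp
  have eq: "M (p + of_nat (2 * Suc k)) = X k p * M (p + of_nat (2 * k))"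
    using M_recurrence[OF re] by (simp add: X_def field_simps add_ac)
  have nz: "M (p + of_nat (2 * Suc k)) \<noteq> 0" "M (p + of_nat (2 * k)) \<noteq> 0"
    using assms by (auto intro!: M_nonzero)
  hence "X k p \<noteq> 0" using eq by auto
  thus ?thesis unfolding Rk_def eq by simp
qed

lemma Rk_mono:
  assumes "k \<le> k'" "Re p + real (2 * k) > 0"
  shows "Rk k' p = Rk k p"
  using assms
proof (induction rule: dec_induct)
  case (step n)
  thus ?case by (subst Rk_Suc) auto
qed simp

text \<open>
  The continuation of \<open>1 / M\<close>: any shift that moves \<open>p\<close> into the half plane \<open>Re p > 0\<close> gives the same value.
\<close>

definition "R p = Rk (Suc (nat \<lceil>\<bar>Re p\<bar>\<rceil>)) p"

lemma R_eq:
  assumes "Re p + real (2 * k) > 0"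
  shows "R p = Rk k p"
proof -
  define k' where "k' = Suc (nat \<lceil>\<bar>Re p\<bar>\<rceil>)"
  have "Re p + real (2 * k') > 0" unfolding k'_def by (simp add: algebra_simps) linarith
  hence "Rk (max k k') p = Rk k' p" by (intro Rk_mono) auto
  moreover have "Rk (max k k') p = Rk k p" using assms by (intro Rk_mono) auto
  ultimately show ?thesis by (simp add: R_def k'_def)
qed

lemma R_M: "Re p > 0 \<Longrightarrow> R p * M p = 1"
  using R_eq[of p 0] M_nonzero[of p] by (simp add: Rk_def)

text \<open>On Re p > -2 k the function is a polynomial divided by a zero-free shift of M, and these
  half planes exhaust the plane.\<close>

lemma R_holomorphic: "R holomorphic_on UNIV"
proof -
  have "R holomorphic_on (\<Union>k::nat. {p. Re p > - real (2 * k)})"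
  proof (rule holomorphic_on_UN_open)
    fix k :: nat
    have "M \<circ> (\<lambda>p. p + of_nat (2 * k)) holomorphic_on {p. Re p > - real (2 * k)}"
      by (rule holomorphic_on_compose_gen[OF _ M_holomorphic]) (auto intro!: holomorphic_intros)
    hence "(\<lambda>p. (\<Prod>j<k. X j p) / M (p + of_nat (2 * k))) holomorphic_on {p. Re p > - real (2 * k)}"
      unfolding X_def o_def by (intro holomorphic_intros) (auto intro!: M_nonzero)
    thus "R holomorphic_on {p. Re p > - real (2 * k)}"
    proof (rule holomorphic_transform)
      fix p assume "p \<in> {p. Re p > - real (2 * k)}"
      hence "R p = Rk k p" by (intro R_eq) auto
      thus "(\<Prod>j<k. X j p) / M (p + of_nat (2 * k)) = R p" by (simp add: Rk_def)
    qed
  qed (auto simp: open_halfspace_Re_gt)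
  moreover have "(\<Union>k::nat. {p. Re p > - real (2 * k)}) = UNIV"
  proof -
    have "\<exists>k::nat. - real (2 * k) < Re p" for p
    proof -
      obtain k :: nat where "real k > \<bar>Re p\<bar>" using reals_Archimedean2 by blast
      thus ?thesis by (intro exI[of _ k]) auto
    qed
    thus ?thesis by auto
  qed
  ultimately show ?thesis by simp
qed

text \<open>A shift of t by ln n contributes n^(-p) M(p). Exchanging sum and integral takes
  pointwise absolute convergence, from the polynomial bound against the exponential decay of w, and
  summability of the norms of the integrals, from the last hypothesis.\<close>

lemma mellin_series:
  fixes c :: "nat \<Rightarrow> complex" and p :: complex
  assumes p: "Re p > 0"
    and h: "\<And>t. (\<lambda>k. c k * w (t + ln (real (Suc k)))) sums h t"
    and c: "\<And>k. norm (c k) \<le> C * real (Suc k) ^ B"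
    and sm: "summable (\<lambda>k. norm (c k) / real (Suc k) powr Re p)"
  shows "(\<lambda>k. c k / of_nat (Suc k) powr p * M p) sums mellin h p"
proof -
  define g where "g = (\<lambda>k t. c k * w (t + ln (real (Suc k))) * exp (p * of_real t))"
  define I where "I = (\<integral>t. norm (w t) * exp (Re p * t) \<partial>lborel)"
  have shift: "w (t + ln (real (Suc k))) * exp (p * of_real t) =
      exp (- p * of_real (ln (real (Suc k)))) * ((\<lambda>t. w t * exp (p * of_real t)) (ln (real (Suc k)) + 1 * t))" for k t
    by (simp add: algebra_simps flip: exp_add)
  have int: "integrable lborel (g k)" for k
    unfolding g_def mult.assoc shift
    by (intro integrable_mult_right lborel_integrable_real_affine M_integrable p) auto
  have nint: "(\<integral>t. norm (g k t) \<partial>lborel) = norm (c k) / real (Suc k) powr Re p * I" for k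
  proof -
    define L where "L = ln (real (Suc k))"
    have "I = (\<integral>t. norm (w (L + 1 * t)) * exp (Re p * (L + 1 * t)) \<partial>lborel)"
      unfolding I_def by (subst lborel_integral_real_affine[of 1 _ L]) auto
    also have "\<dots> = (\<integral>t. exp (Re p * L) * (norm (w (t + L)) * exp (Re p * t)) \<partial>lborel)"
      by (intro Bochner_Integration.integral_cong refl) (simp add: algebra_simps exp_add)
    finally have "I = exp (Re p * L) * (\<integral>t. norm (w (t + L)) * exp (Re p * t) \<partial>lborel)" by simp
    hence "(\<integral>t. norm (w (t + L)) * exp (Re p * t) \<partial>lborel) = I / real (Suc k) powr Re p"
      by (simp add: powr_def L_def field_simps)
    thus ?thesis by (simp add: g_def norm_mult mult.assoc L_def)
  qed
  have ptw: "summable (\<lambda>k. norm (g k t))" for t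
  proof -
    have "summable (\<lambda>k. norm (c k * w (t + ln (real (Suc k)))))"
    proof (rule summable_comparison_test)
      show "summable (\<lambda>k. C * KW * (real (Suc k) ^ B * exp (- (2 * pi * exp t) * real (Suc k))))"
        by (intro summable_mult power_exp_decay_sum) auto
      have "norm (c k * w (t + ln (real (Suc k)))) \<le> C * KW * (real (Suc k) ^ B * exp (- (2 * pi * exp t) * real (Suc k)))" for k
      proof -
        have "exp (t + ln (real (Suc k))) = exp t * real (Suc k)" by (simp add: exp_add)
        hence "norm (w (t + ln (real (Suc k)))) \<le> KW * exp (- (2 * pi * exp t) * real (Suc k))"
          using w_bound[of "t + ln (real (Suc k))"] by (simp add: mult_ac)
        hence "norm (c k) * norm (w (t + ln (real (Suc k)))) \<le> (C * real (Suc k) ^ B) * (KW * exp (- (2 * pi * exp t) * real (Suc k)))"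
          by (intro mult_mono c order.trans[OF norm_ge_zero c]) auto
        thus ?thesis by (simp add: norm_mult mult_ac)
      qed
      thus "\<exists>N. \<forall>k\<ge>N. norm (norm (c k * w (t + ln (real (Suc k))))) \<le> C * KW * (real (Suc k) ^ B * exp (- (2 * pi * exp t) * real (Suc k)))"
        by auto
    qed
    from summable_mult2[OF this, of "norm (exp (p * of_real t))"] show ?thesis by (simp add: g_def norm_mult)
  qed
  have "(\<lambda>k. integral\<^sup>L lborel (g k)) sums (\<integral>t. (\<Sum>k. g k t) \<partial>lborel)"
  proof (rule sums_integral[OF int])
    show "AE t in lborel. summable (\<lambda>k. norm (g k t))" using ptw by simp
    show "summable (\<lambda>k. \<integral>t. norm (g k t) \<partial>lborel)" unfolding nint by (rule summable_mult2[OF sm])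
  qed
  moreover have "(\<Sum>k. g k t) = h t * exp (p * of_real t)" for t
    using sums_mult2[OF h[of t], of "exp (p * of_real t)"] by (simp add: g_def sums_iff)
  moreover have "integral\<^sup>L lborel (g k) = c k / of_nat (Suc k) powr p * M p" for k
  proof -
    have "integral\<^sup>L lborel (g k) = c k * mellin (\<lambda>t. w (t + ln (real (Suc k)))) p"
      by (simp add: g_def mellin_def mult.assoc)
    also have "\<dots> = c k * (exp (- p * of_real (ln (real (Suc k)))) * M p)"
      by (simp only: mellin_shift M_def)
    also have "exp (- p * of_real (ln (real (Suc k)))) = 1 / of_nat (Suc k) powr p"
      using of_nat_powr_conv_exp[of "Suc k" p] by (simp add: exp_minus divide_inverse)
    finally show ?thesis by simp
  qed
  ultimately show ?thesis by (simp add: mellin_def)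
qed

section \<open>Additive twists as Mellin transforms along vertical lines\<close>

lemma a_pair:
  assumes "y > 0"
  shows "a (int (Suc k)) y + e * a (- int (Suc k)) y = l (Suc k) / of_real (sqrt (real (Suc k))) * W (real (Suc k) * y)"
  using a_scale[of "Suc k" y 1] a_scale[of "Suc k" y "-1"] assms by (simp add: W_def distrib_left mult_ac)

text \<open>Let A, B be the coefficients of index n and -n, and u, v the values e(n x) and e(-n x).
  As e^2 = 1, (A u + B v) + e (A v + B u) = (A + e B) (u + e v), so combining the lines over x and
  -x leaves only W. The x-derivative reverses the sign of B, hence the minus signs in
  \<open>h2\<close> and \<open>tw2\<close>.\<close>

definition "h1 x t = f (Complex x (exp t)) + e * f (Complex (- x) (exp t))"
definition "h2 x t = partial_x f (Complex x (exp t)) - e * partial_x f (Complex (- x) (exp t))"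
definition "tw1 x n = cis (2 * pi * real n * x) + e * cis (- 2 * pi * real n * x)"
definition "tw2 x n = cis (2 * pi * real n * x) - e * cis (- 2 * pi * real n * x)"

lemma norm_tw: "norm (tw1 x n) \<le> 2" "norm (tw2 x n) \<le> 2"
proof -
  have "norm (tw1 x n) \<le> norm (cis (2 * pi * real n * x)) + norm (e * cis (- 2 * pi * real n * x))"
    unfolding tw1_def by (rule norm_triangle_ineq)
  thus "norm (tw1 x n) \<le> 2" by (simp add: norm_mult norm_e)
  have "norm (tw2 x n) \<le> norm (cis (2 * pi * real n * x)) + norm (e * cis (- 2 * pi * real n * x))"
    unfolding tw2_def by (rule norm_triangle_ineq4)
  thus "norm (tw2 x n) \<le> 2" by (simp add: norm_mult norm_e)
qed

lemma h1_sums: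
  "(\<lambda>k. l (Suc k) / of_real (sqrt (real (Suc k))) * tw1 x (Suc k) * w (t + ln (real (Suc k)))) sums h1 x t"
proof -
  define y where "y = exp t"
  have y: "y > 0" by (simp add: y_def)
  note four = strip_fourier_series[OF smooth periodic y a_0[OF y, unfolded a_def], folded a_def]
  have "(\<lambda>k. (a (int (Suc k)) y * cis (2 * pi * real (Suc k) * x) + a (- int (Suc k)) y * cis (- 2 * pi * real (Suc k) * x)) +
       e * (a (int (Suc k)) y * cis (2 * pi * real (Suc k) * (- x)) + a (- int (Suc k)) y * cis (- 2 * pi * real (Suc k) * (- x))))
       sums h1 x t"
    unfolding h1_def y_def[symmetric] by (intro sums_add sums_mult four)
  moreover have "(a (int (Suc k)) y * cis (2 * pi * real (Suc k) * x) + a (- int (Suc k)) y * cis (- 2 * pi * real (Suc k) * x)) +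
       e * (a (int (Suc k)) y * cis (2 * pi * real (Suc k) * (- x)) + a (- int (Suc k)) y * cis (- 2 * pi * real (Suc k) * (- x))) =
       l (Suc k) / of_real (sqrt (real (Suc k))) * tw1 x (Suc k) * w (t + ln (real (Suc k)))" for k
  proof -
    define A B u v where "A = a (int (Suc k)) y" and "B = a (- int (Suc k)) y"
      and "u = cis (2 * pi * real (Suc k) * x)" and "v = cis (- 2 * pi * real (Suc k) * x)"
    have uv: "cis (2 * pi * real (Suc k) * (- x)) = v" "cis (- 2 * pi * real (Suc k) * (- x)) = u"
      by (simp_all add: u_def v_def)
    have "w (t + ln (real (Suc k))) = W (real (Suc k) * y)" by (simp add: w_def y_def exp_add mult.commute)
    hence "l (Suc k) / of_real (sqrt (real (Suc k))) * tw1 x (Suc k) * w (t + ln (real (Suc k))) = (A + e * B) * (u + e * v)"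
      unfolding A_def B_def a_pair[OF y] by (simp add: tw1_def u_def v_def mult_ac)
    also have "\<dots> = (A * u + B * v) + e * (A * v + B * u)"
      using e_square by (simp add: algebra_simps)
    finally show ?thesis unfolding uv by (simp add: A_def B_def u_def v_def)
  qed
  ultimately show ?thesis by simp
qed

lemma h2_sums:
  "(\<lambda>k. 2 * of_real pi * \<i> * of_nat (Suc k) * (l (Suc k) / of_real (sqrt (real (Suc k)))) * tw2 x (Suc k) * w (t + ln (real (Suc k)))) sums h2 x t"
proof -
  define y where "y = exp t"
  have y: "y > 0" by (simp add: y_def)
  define N where "N = (\<lambda>k. 2 * complex_of_real pi * \<i> * of_nat (Suc k))"
  have sc: "strip_coeff (partial_x f) (int (Suc k)) y = N k * a (int (Suc k)) y"
    "strip_coeff (partial_x f) (- int (Suc k)) y = - N k * a (- int (Suc k)) y" for k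
    using strip_coeff_partial_x[OF smooth periodic y] by (simp_all add: a_def N_def algebra_simps)
  have sc0: "strip_coeff (partial_x f) 0 y = 0"
    using strip_coeff_partial_x[OF smooth periodic y, of 0] by simp
  note four = strip_fourier_series[OF smooth_on_partial_x[OF smooth] periodic_H_partial_x[OF periodic] y sc0, unfolded sc]
  have "(\<lambda>k. (N k * a (int (Suc k)) y * cis (2 * pi * real (Suc k) * x) + - N k * a (- int (Suc k)) y * cis (- 2 * pi * real (Suc k) * x)) -
       e * (N k * a (int (Suc k)) y * cis (2 * pi * real (Suc k) * (- x)) + - N k * a (- int (Suc k)) y * cis (- 2 * pi * real (Suc k) * (- x))))
       sums h2 x t"
    unfolding h2_def y_def[symmetric] by (intro sums_diff sums_mult four)
  moreover have "(N k * a (int (Suc k)) y * cis (2 * pi * real (Suc k) * x) + - N k * a (- int (Suc k)) y * cis (- 2 * pi * real (Suc k) * x)) -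
       e * (N k * a (int (Suc k)) y * cis (2 * pi * real (Suc k) * (- x)) + - N k * a (- int (Suc k)) y * cis (- 2 * pi * real (Suc k) * (- x))) =
       2 * of_real pi * \<i> * of_nat (Suc k) * (l (Suc k) / of_real (sqrt (real (Suc k)))) * tw2 x (Suc k) * w (t + ln (real (Suc k)))" for k
  proof -
    define A B u v where "A = a (int (Suc k)) y" and "B = a (- int (Suc k)) y"
      and "u = cis (2 * pi * real (Suc k) * x)" and "v = cis (- 2 * pi * real (Suc k) * x)"
    have uv: "cis (2 * pi * real (Suc k) * (- x)) = v" "cis (- 2 * pi * real (Suc k) * (- x)) = u"
      by (simp_all add: u_def v_def)
    have "w (t + ln (real (Suc k))) = W (real (Suc k) * y)" by (simp add: w_def y_def exp_add mult.commute)
    hence "2 * of_real pi * \<i> * of_nat (Suc k) * (l (Suc k) / of_real (sqrt (real (Suc k)))) * tw2 x (Suc k) * w (t + ln (real (Suc k)))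
        = N k * (A + e * B) * (u - e * v)"
      unfolding A_def B_def a_pair[OF y] by (simp add: tw2_def u_def v_def N_def mult_ac)
    also have "\<dots> = (N k * A * u + - N k * B * v) - e * (N k * A * v + - N k * B * u)"
    proof -
      have "N k * (A + e * B) * (u - e * v) = N k * (A * u + e * (B * u) - e * (A * v) - (e * e) * (B * v))"
        by (simp add: algebra_simps)
      thus ?thesis unfolding e_square by (simp add: algebra_simps)
    qed
    finally show ?thesis unfolding uv by (simp add: A_def B_def u_def v_def)
  qed
  ultimately show ?thesis by simp
qed

lemma l_coeff_bound: "\<exists>C B. \<forall>k. norm (l (Suc k)) \<le> C * real (Suc k) ^ B"
  using l_poly_bound by (metis One_nat_def Suc_le_mono le0)

text \<open>The coefficients in \<open>h1\<close> carry n^(-1/2), so the exponent s of the Dirichlet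
  series belongs to the argument s - 1/2; multiplying by R removes M.\<close>

lemma twist1_sums:
  assumes s: "Re s > 1"
  shows "(\<lambda>k. l (Suc k) * tw1 x (Suc k) / of_nat (Suc k) powr s) sums (R (s - 1/2) * mellin (h1 x) (s - 1/2))"
proof -
  define c where "c = (\<lambda>k. l (Suc k) / of_real (sqrt (real (Suc k))) * tw1 x (Suc k))"
  obtain C B where CB: "\<And>k. norm (l (Suc k)) \<le> C * real (Suc k) ^ B" using l_coeff_bound by blast
  have cb: "norm (c k) \<le> norm (l (Suc k)) * 2 / sqrt (real (Suc k))" for k
    using norm_tw(1)[of x "Suc k"] by (simp add: c_def norm_mult norm_divide divide_right_mono mult_left_mono)
  have "(\<lambda>k. c k / of_nat (Suc k) powr (s - 1/2) * M (s - 1/2)) sums mellin (h1 x) (s - 1/2)"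
  proof (rule mellin_series)
    show "Re (s - 1/2) > 0" using s by simp
    show "(\<lambda>k. c k * w (t + ln (real (Suc k)))) sums h1 x t" for t unfolding c_def by (rule h1_sums)
    show "norm (c k) \<le> (2 * C) * real (Suc k) ^ B" for k
    proof -
      have "norm (l (Suc k)) * 2 / sqrt (real (Suc k)) \<le> norm (l (Suc k)) * 2 / 1"
        by (intro divide_left_mono) auto
      thus ?thesis using cb[of k] CB[of k] by linarith
    qed
    show "summable (\<lambda>k. norm (c k) / real (Suc k) powr Re (s - 1/2))"
    proof (rule summable_comparison_test)
      show "summable (\<lambda>k. 2 * (norm (l (Suc k)) / real (Suc k) powr Re s))"
        by (intro summable_mult l_abs_summable s)
      have "norm (c k) / real (Suc k) powr Re (s - 1/2) \<le> 2 * (norm (l (Suc k)) / real (Suc k) powr Re s)" for k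
      proof -
        have "sqrt (real (Suc k)) * real (Suc k) powr Re (s - 1/2) = real (Suc k) powr Re s"
          by (simp add: powr_half_sqrt[symmetric] flip: powr_add)
        moreover have "norm (c k) / real (Suc k) powr Re (s - 1/2) \<le> norm (l (Suc k)) * 2 / sqrt (real (Suc k)) / real (Suc k) powr Re (s - 1/2)"
          by (intro divide_right_mono cb) auto
        ultimately show ?thesis by (simp add: mult.commute)
      qed
      thus "\<exists>N. \<forall>k\<ge>N. norm (norm (c k) / real (Suc k) powr Re (s - 1/2)) \<le> 2 * (norm (l (Suc k)) / real (Suc k) powr Re s)" by auto
    qed
  qed
  from sums_mult[OF this, of "R (s - 1/2)"]
  have "(\<lambda>k. R (s - 1/2) * (c k / of_nat (Suc k) powr (s - 1/2) * M (s - 1/2))) sums (R (s - 1/2) * mellin (h1 x) (s - 1/2))" .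
  moreover have "R (s - 1/2) * (c k / of_nat (Suc k) powr (s - 1/2) * M (s - 1/2)) = l (Suc k) * tw1 x (Suc k) / of_nat (Suc k) powr s" for k
  proof -
    have "of_real (sqrt (real (Suc k))) * of_nat (Suc k) powr (s - 1/2) = (of_nat (Suc k) powr s :: complex)"
    proof -
      have "complex_of_real (sqrt (real (Suc k))) = of_nat (Suc k) powr (1/2)"
        by (rule of_real_sqrt_conv_powr) simp
      thus ?thesis by (simp flip: powr_add)
    qed
    moreover have "R (s - 1/2) * (c k / of_nat (Suc k) powr (s - 1/2) * M (s - 1/2)) = (R (s - 1/2) * M (s - 1/2)) * (c k / of_nat (Suc k) powr (s - 1/2))"
      by simp
    ultimately show ?thesis using R_M[of "s - 1/2"] s by (simp add: c_def)
  qed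
  ultimately show ?thesis by simp
qed

text \<open>The x-derivative contributes 2 pi i n: the factor n moves the argument to s + 1/2, and
  the constant is divided out.\<close>

lemma twist2_sums:
  assumes s: "Re s > 1"
  shows "(\<lambda>k. l (Suc k) * tw2 x (Suc k) / of_nat (Suc k) powr s) sums (R (s + 1/2) / (2 * of_real pi * \<i>) * mellin (h2 x) (s + 1/2))"
proof -
  define c where "c = (\<lambda>k. 2 * of_real pi * \<i> * of_nat (Suc k) * (l (Suc k) / of_real (sqrt (real (Suc k)))) * tw2 x (Suc k))"
  obtain C B where CB: "\<And>k. norm (l (Suc k)) \<le> C * real (Suc k) ^ B" using l_coeff_bound by blast
  have cb: "norm (c k) \<le> 4 * pi * (norm (l (Suc k)) * sqrt (real (Suc k)))" for k
  proof -
    have "norm (c k) = 2 * pi * (real (Suc k) / sqrt (real (Suc k))) * norm (l (Suc k)) * norm (tw2 x (Suc k))"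
      unfolding c_def norm_mult norm_divide norm_of_nat norm_of_real by simp
    also have "real (Suc k) / sqrt (real (Suc k)) = sqrt (real (Suc k))" by (rule real_div_sqrt) simp
    also have "2 * pi * sqrt (real (Suc k)) * norm (l (Suc k)) * norm (tw2 x (Suc k)) \<le> 2 * pi * sqrt (real (Suc k)) * norm (l (Suc k)) * 2"
      by (intro mult_left_mono norm_tw) auto
    finally show ?thesis by (simp add: mult_ac)
  qed
  have "(\<lambda>k. c k / of_nat (Suc k) powr (s + 1/2) * M (s + 1/2)) sums mellin (h2 x) (s + 1/2)"
  proof (rule mellin_series)
    show "Re (s + 1/2) > 0" using s by simp
    show "(\<lambda>k. c k * w (t + ln (real (Suc k)))) sums h2 x t" for t unfolding c_def by (rule h2_sums)
    show "norm (c k) \<le> (4 * pi * C) * real (Suc k) ^ Suc B" for k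
    proof -
      have "sqrt (real (Suc k)) \<le> real (Suc k)" by (intro real_le_lsqrt) (auto simp: power2_eq_square)
      hence "norm (l (Suc k)) * sqrt (real (Suc k)) \<le> (C * real (Suc k) ^ B) * real (Suc k)"
        by (intro mult_mono CB order.trans[OF norm_ge_zero CB]) auto
      hence "4 * pi * (norm (l (Suc k)) * sqrt (real (Suc k))) \<le> 4 * pi * ((C * real (Suc k) ^ B) * real (Suc k))"
        by (intro mult_left_mono) auto
      from order.trans[OF cb this] show ?thesis by (simp add: mult_ac)
    qed
    show "summable (\<lambda>k. norm (c k) / real (Suc k) powr Re (s + 1/2))"
    proof (rule summable_comparison_test)
      show "summable (\<lambda>k. 4 * pi * (norm (l (Suc k)) / real (Suc k) powr Re s))"
        by (intro summable_mult l_abs_summable s)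
      have "norm (c k) / real (Suc k) powr Re (s + 1/2) \<le> 4 * pi * (norm (l (Suc k)) / real (Suc k) powr Re s)" for k
      proof -
        have "real (Suc k) powr Re (s + 1/2) = sqrt (real (Suc k)) * real (Suc k) powr Re s"
          by (simp add: powr_half_sqrt[symmetric] powr_add mult.commute)
        moreover have "norm (c k) / real (Suc k) powr Re (s + 1/2) \<le> 4 * pi * (norm (l (Suc k)) * sqrt (real (Suc k))) / real (Suc k) powr Re (s + 1/2)"
          by (intro divide_right_mono cb) auto
        ultimately show ?thesis by simp
      qed
      thus "\<exists>N. \<forall>k\<ge>N. norm (norm (c k) / real (Suc k) powr Re (s + 1/2)) \<le> 4 * pi * (norm (l (Suc k)) / real (Suc k) powr Re s)" by auto
    qed
  qed
  from sums_mult[OF this, of "R (s + 1/2) / (2 * of_real pi * \<i>)"]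
  have "(\<lambda>k. R (s + 1/2) / (2 * of_real pi * \<i>) * (c k / of_nat (Suc k) powr (s + 1/2) * M (s + 1/2))) sums
     (R (s + 1/2) / (2 * of_real pi * \<i>) * mellin (h2 x) (s + 1/2))" .
  moreover have "R (s + 1/2) / (2 * of_real pi * \<i>) * (c k / of_nat (Suc k) powr (s + 1/2) * M (s + 1/2)) = l (Suc k) * tw2 x (Suc k) / of_nat (Suc k) powr s" for k
  proof -
    define r where "r = complex_of_real (sqrt (real (Suc k)))"
    have r0: "r \<noteq> 0" by (simp add: r_def)
    have rr: "of_nat (Suc k) = r * r" unfolding r_def by (simp flip: of_real_mult)
    have "of_nat (Suc k) powr (s + 1/2) = of_nat (Suc k) powr s * r"
    proof -
      have "r = of_nat (Suc k) powr (1/2)"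
        unfolding r_def by (rule of_real_sqrt_conv_powr) simp
      thus ?thesis by (simp only: powr_add)
    qed
    moreover have "c k = 2 * of_real pi * \<i> * (r * (l (Suc k) * tw2 x (Suc k)))"
      unfolding c_def r_def[symmetric] using rr r0 by simp
    moreover have "R (s + 1/2) * M (s + 1/2) = 1" using R_M[of "s + 1/2"] s by simp
    ultimately show ?thesis using r0 by (simp add: field_simps)
  qed
  ultimately show ?thesis by simp
qed

text \<open>At s = 1/2 both Mellin transforms are taken at 0, that is, they integrate
  \<open>h1\<close> against dy/y and \<open>h2\<close> against dy along the line. In
  \<open>F2\<close> the factor exp t stays in the integrand, matching the form of the decay in
  \<open>rapid_lines\<close>.\<close>

definition "F1 x s = R (s - 1/2) * mellin (h1 x) (s - 1/2)"
definition "F2 x s = R (s + 1/2) / (2 * of_real pi * \<i>) * mellin (\<lambda>t. h2 x t * of_real (exp t)) (s - 1/2)"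

lemma rapid_h:
  fixes p :: int and q :: nat
  assumes "coprime p (int q)" "q > 0"
  shows "rapid (h1 (of_int p / real q))" "rapid (\<lambda>t. h2 (of_int p / real q) t * of_real (exp t))"
proof -
  have neg: "coprime (- p) (int q)" using assms by simp
  show "rapid (h1 (of_int p / real q))"
    unfolding h1_def[abs_def] using rapid_lines(1)[OF assms] rapid_lines(1)[OF neg assms(2)]
    by (intro rapid_add rapid_cmult) simp_all
  have "rapid (\<lambda>t. partial_x f (Complex (of_int p / real q) (exp t)) * of_real (exp t) +
      (- e) * (partial_x f (Complex (of_int (- p) / real q) (exp t)) * of_real (exp t)))"
    by (intro rapid_add rapid_cmult rapid_lines assms neg)
  thus "rapid (\<lambda>t. h2 (of_int p / real q) t * of_real (exp t))"
    unfolding h2_def by (simp add: algebra_simps)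
qed

lemma continuation_tw:
  fixes p :: int and q :: nat
  assumes "coprime p (int q)" "q > 0"
  shows "entire_continuation (\<lambda>n. l n * tw1 (of_int p / real q) n) (F1 (of_int p / real q))"
    and "entire_continuation (\<lambda>n. l n * tw2 (of_int p / real q) n) (F2 (of_int p / real q))"
proof -
  have hol: "(\<lambda>s. g (s + c)) holomorphic_on UNIV" if "g holomorphic_on UNIV" for g c
  proof -
    have "(\<lambda>s. s + c) holomorphic_on UNIV" by (intro holomorphic_intros)
    from holomorphic_on_compose_gen[OF this that] show ?thesis by (simp add: o_def)
  qed
  show "entire_continuation (\<lambda>n. l n * tw1 (of_int p / real q) n) (F1 (of_int p / real q))"
    unfolding entire_continuation_def
  proof (intro conjI allI impI)
    show "F1 (of_int p / real q) holomorphic_on UNIV"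
      unfolding F1_def[abs_def]
      using hol[OF R_holomorphic, of "-1/2"] hol[OF rapid_mellin_holomorphic[OF rapid_h(1)[OF assms]], of "-1/2"]
      by (auto intro!: holomorphic_intros)
    show "(\<lambda>n. l (Suc n) * tw1 (of_int p / real q) (Suc n) / of_nat (Suc n) powr s) sums F1 (of_int p / real q) s" if "Re s > 1" for s
      unfolding F1_def by (rule twist1_sums[OF that])
  qed
  show "entire_continuation (\<lambda>n. l n * tw2 (of_int p / real q) n) (F2 (of_int p / real q))"
    unfolding entire_continuation_def
  proof (intro conjI allI impI)
    show "F2 (of_int p / real q) holomorphic_on UNIV"
      unfolding F2_def[abs_def]
      using hol[OF R_holomorphic, of "1/2"] hol[OF rapid_mellin_holomorphic[OF rapid_h(2)[OF assms]], of "-1/2"]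
      by (auto intro!: holomorphic_intros)
    show "(\<lambda>n. l (Suc n) * tw2 (of_int p / real q) (Suc n) / of_nat (Suc n) powr s) sums F2 (of_int p / real q) s" if "Re s > 1" for s
      using twist2_sums[OF that, of "of_int p / real q"] unfolding F2_def mellin_mult_exp by (simp add: add_ac)
  qed
qed

end

section \<open>Sums over Dirichlet characters to a prime modulus\<close>

locale prime_modulus =
  fixes q :: nat
  assumes q: "prime q"
begin

lemma q_gt_1: "q > 1" using q prime_gt_1_nat by blast

lemma coprime_iff: "coprime n (int q) \<longleftrightarrow> \<not> int q dvd n"
proof
  assume c: "coprime n (int q)"
  show "\<not> int q dvd n"
  proof
    assume "int q dvd n"
    from coprime_common_divisor[OF c this dvd_refl] show False using q_gt_1 by simp
  qed
next
  assume "\<not> int q dvd n"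
  hence "coprime (int q) n" using q by (intro prime_imp_coprime) auto
  thus "coprime n (int q)" by (simp add: coprime_commute)
qed

definition "D = {\<xi>. dirichlet_char q \<xi>}"

lemma finite_D: "finite D"
  unfolding D_def using q_gt_1 by (intro finite_dirichlet_chars) auto

context
  fixes \<xi> assumes \<xi>: "\<xi> \<in> D"
begin

lemma char_mult: "\<xi> (m * n) = \<xi> m * \<xi> n" using \<xi> by (simp add: D_def dirichlet_char_def)

lemma char_nonzero_iff: "\<xi> n \<noteq> 0 \<longleftrightarrow> \<not> int q dvd n"
  using \<xi> by (simp add: D_def dirichlet_char_def coprime_iff)

lemma char_1: "\<xi> 1 = 1"
proof -
  have "\<xi> 1 \<noteq> 0" using q_gt_1 by (simp add: char_nonzero_iff)
  thus ?thesis using char_mult[of 1 1] by simp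
qed

lemma char_power: "\<xi> (n ^ k) = \<xi> n ^ k"
  by (induction k) (simp_all add: char_1 char_mult)

lemma char_add: "\<xi> (n + int q * k) = \<xi> n"
proof (induction k rule: int_induct[where k = 0])
  case (step1 i)
  have "\<xi> (n + int q * i + int q) = \<xi> (n + int q * i)" using \<xi> by (simp add: D_def dirichlet_char_def)
  thus ?case using step1 by (simp add: algebra_simps)
next
  case (step2 i)
  have "\<xi> (n + int q * (i - 1) + int q) = \<xi> (n + int q * (i - 1))" using \<xi> by (simp add: D_def dirichlet_char_def)
  thus ?case using step2 by (simp add: algebra_simps)
qed simp

lemma char_cong: "[m = n] (mod int q) \<Longrightarrow> \<xi> m = \<xi> n"
  using char_add by (auto simp: cong_iff_lin)

lemma char_root: "\<not> int q dvd n \<Longrightarrow> \<xi> n ^ (q - 1) = 1"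
proof -
  assume n: "\<not> int q dvd n"
  define m where "m = nat (n mod int q)"
  have m: "int m = n mod int q" using q_gt_1 by (simp add: m_def)
  have "\<not> q dvd m"
  proof
    assume "q dvd m"
    hence "int q dvd n mod int q" by (simp flip: m)
    thus False using n by (simp add: dvd_mod_iff)
  qed
  hence "[m ^ (q - 1) = 1] (mod q)" using q by (intro fermat_theorem) auto
  hence "[int m ^ (q - 1) = 1] (mod int q)" by (metis cong_int_iff of_nat_1 of_nat_power)
  moreover have "[n ^ (q - 1) = int m ^ (q - 1)] (mod int q)"
    by (intro cong_pow) (simp add: m cong_def)
  ultimately have "[n ^ (q - 1) = 1] (mod int q)" using cong_trans by blast
  from char_cong[OF this] show ?thesis by (simp add: char_power char_1)
qed

lemma norm_char: "\<not> int q dvd n \<Longrightarrow> norm (\<xi> n) = 1"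
proof -
  assume "\<not> int q dvd n"
  hence "norm (\<xi> n) ^ (q - 1) = 1 ^ (q - 1)" using char_root[of n] by (simp flip: norm_power)
  thus ?thesis by (rule power_eq_imp_eq_base) (use q_gt_1 in auto)
qed

end

section \<open>Discrete logarithms and the group of characters\<close>

definition "g = (SOME g. residue_primroot q g)"

lemma primroot: "residue_primroot q g"
  unfolding g_def by (rule someI_ex) (use prime_primitive_root_exists[of q] q q_gt_1 in auto)

lemma gen: "bij_betw (\<lambda>i. g ^ i mod q) {..<q - 1} (totatives q)"
  using residue_primroot_is_generator[OF q_gt_1 primroot] q by (simp add: totient_prime)

definition "ind n = (THE i. i < q - 1 \<and> [int g ^ i = n] (mod int q))"

lemma ind_ex1:
  assumes "\<not> int q dvd n"
  shows "\<exists>!i. i < q - 1 \<and> [int g ^ i = n] (mod int q)"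
proof -
  define m where "m = nat (n mod int q)"
  have m: "int m = n mod int q" using q_gt_1 by (simp add: m_def)
  have "m \<in> totatives q"
  proof -
    have "m \<noteq> 0" using assms m by (metis dvd_eq_mod_eq_0 of_nat_0)
    moreover have "int m < int q" unfolding m using q_gt_1 by simp
    hence "m < q" by simp
    ultimately show ?thesis using q by (auto simp: totatives_prime)
  qed
  have eq: "[int g ^ i = n] (mod int q) \<longleftrightarrow> g ^ i mod q = m" for i
  proof -
    have "[int g ^ i = n] (mod int q) \<longleftrightarrow> int (g ^ i mod q) = int m"
      unfolding m cong_def by (simp add: zmod_int)
    thus ?thesis by simp
  qed
  have inj: "inj_on (\<lambda>i. g ^ i mod q) {..<q - 1}" and img: "(\<lambda>i. g ^ i mod q) ` {..<q - 1} = totatives q"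
    using gen by (auto simp: bij_betw_def)
  obtain i where i: "i < q - 1" "g ^ i mod q = m" using img \<open>m \<in> totatives q\<close> by (force simp: image_iff)
  show ?thesis unfolding eq
  proof (rule ex1I[of _ i])
    show "i < q - 1 \<and> g ^ i mod q = m" using i by simp
    show "j = i" if "j < q - 1 \<and> g ^ j mod q = m" for j
      using inj_onD[OF inj, of j i] that i by auto
  qed
qed

lemma ind:
  assumes "\<not> int q dvd n"
  shows "ind n < q - 1" "[int g ^ ind n = n] (mod int q)"
  using theI'[OF ind_ex1[OF assms], folded ind_def] by blast+

lemma g_not_dvd: "\<not> int q dvd int g ^ k"
proof -
  have "coprime q g" using primroot by (simp add: residue_primroot_def)
  have "\<not> q dvd g ^ k"
  proof
    assume "q dvd g ^ k"
    hence "q dvd g" using q prime_dvd_power by blast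
    from coprime_common_divisor[OF \<open>coprime q g\<close> dvd_refl this] show False using q_gt_1 by simp
  qed
  thus ?thesis by (metis int_dvd_int_iff of_nat_power)
qed

lemma ind_unique:
  assumes "i < q - 1" "[int g ^ i = n] (mod int q)"
  shows "ind n = i"
proof -
  have "\<not> int q dvd n" using assms(2) g_not_dvd[of i] by (metis cong_dvd_iff)
  from ind_ex1[OF this] ind[OF this] assms show ?thesis by blast
qed

text \<open>The character that takes the value z at the primitive root; it is one when z is a (q -
  1)-th root of unity.\<close>

definition mk :: "complex \<Rightarrow> int \<Rightarrow> complex" where
  "mk z n = (if int q dvd n then 0 else z ^ ind n)"

lemma pow_cong: "z ^ (q - 1) = 1 \<Longrightarrow> [i = j] (mod (q - 1)) \<Longrightarrow> (z::complex) ^ i = z ^ j"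
proof -
  assume z: "z ^ (q - 1) = 1" and ij: "[i = j] (mod (q - 1))"
  have "z ^ i = z ^ (i mod (q - 1))" for i
    by (metis z mult_div_mod_eq power_add power_mult power_one mult_1)
  thus ?thesis using ij by (metis cong_def)
qed

lemma ind_mult:
  assumes "\<not> int q dvd m" "\<not> int q dvd n"
  shows "[ind (m * n) = ind m + ind n] (mod (q - 1))"
proof -
  define r where "r = (ind m + ind n) mod (q - 1)"
  have r: "r < q - 1" using q_gt_1 by (simp add: r_def)
  have fermat: "[int g ^ (q - 1) = 1] (mod int q)"
    using fermat_theorem[of q g] q g_not_dvd[of 1] by (metis cong_int_iff int_dvd_int_iff of_nat_1 of_nat_power power_one_right)
  have "[int g ^ (ind m + ind n) = int g ^ r] (mod int q)"
  proof -
    have "int g ^ (ind m + ind n) = (int g ^ (q - 1)) ^ ((ind m + ind n) div (q - 1)) * int g ^ r"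
      unfolding r_def power_mult[symmetric] power_add[symmetric] by simp
    also have "[\<dots> = 1 ^ ((ind m + ind n) div (q - 1)) * int g ^ r] (mod int q)"
      by (intro cong_mult cong_pow fermat cong_refl)
    finally show ?thesis by simp
  qed
  moreover have "[int g ^ (ind m + ind n) = m * n] (mod int q)"
    unfolding power_add by (intro cong_mult ind assms)
  ultimately have "[int g ^ r = m * n] (mod int q)" by (metis cong_sym cong_trans)
  from ind_unique[OF r this] show ?thesis by (simp add: r_def cong_def)
qed

lemma mk_D:
  assumes z: "z ^ (q - 1) = 1"
  shows "mk z \<in> D"
proof -
  have z0: "z \<noteq> 0" using z q_gt_1 by (auto simp: power_0_left)
  have "mk z (m * n) = mk z m * mk z n" for m n
  proof (cases "int q dvd m \<or> int q dvd n")
    case True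
    thus ?thesis by (auto simp: mk_def)
  next
    case False
    hence "\<not> int q dvd m * n" using q by (simp add: prime_dvd_mult_iff)
    moreover have "z ^ ind (m * n) = z ^ (ind m + ind n)"
      using False by (intro pow_cong z ind_mult) auto
    ultimately show ?thesis using False by (simp add: mk_def power_add)
  qed
  moreover have "mk z (n + int q) = mk z n" for n
  proof -
    have "ind (n + int q) = ind n" by (simp add: ind_def cong_def)
    thus ?thesis by (simp add: mk_def)
  qed
  moreover have "mk z n \<noteq> 0 \<longleftrightarrow> coprime n (int q)" for n
    using z0 by (simp add: mk_def coprime_iff)
  ultimately show ?thesis unfolding D_def dirichlet_char_def by blast
qed

lemma mk_surj:
  assumes "\<xi> \<in> D"
  shows "\<xi> = mk (\<xi> (int g))" "\<xi> (int g) ^ (q - 1) = 1"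
proof -
  show "\<xi> (int g) ^ (q - 1) = 1" by (rule char_root[OF assms]) (use g_not_dvd[of 1] in simp)
  show "\<xi> = mk (\<xi> (int g))"
  proof
    fix n
    show "\<xi> n = mk (\<xi> (int g)) n"
    proof (cases "int q dvd n")
      case True
      thus ?thesis using char_nonzero_iff[OF assms, of n] by (simp add: mk_def)
    next
      case False
      from char_cong[OF assms ind(2)[OF False]] char_power[OF assms, of "int g" "ind n"]
      show ?thesis using False by (simp add: mk_def)
    qed
  qed
qed

text \<open>Evaluation at the primitive root identifies the characters with the (q - 1)-th roots of
  unity, which turns the sum into a geometric sum of powers with exponent \<open>ind\<close>
  m.\<close>

lemma sum_chars:
  assumes m: "\<not> int q dvd m"
  shows "(\<Sum>\<xi>\<in>D. \<xi> m) = (if [m = 1] (mod int q) then of_nat (q - 1) else 0)"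
proof -
  have q1: "q - 1 > 0" using q_gt_1 by simp
  have "bij_betw (\<lambda>\<xi>. \<xi> (int g)) D {z. z ^ (q - 1) = (1 :: complex)}"
  proof (rule bij_betw_byWitness[where f' = mk])
    show "\<forall>\<xi>\<in>D. mk (\<xi> (int g)) = \<xi>" using mk_surj(1) by metis
    show "(\<lambda>\<xi>. \<xi> (int g)) ` D \<subseteq> {z. z ^ (q - 1) = 1}" using mk_surj(2) by auto
    show "mk ` {z. z ^ (q - 1) = 1} \<subseteq> D" using mk_D by auto
    show "\<forall>z\<in>{z. z ^ (q - 1) = 1}. mk z (int g) = z"
    proof
      fix z :: complex assume "z \<in> {z. z ^ (q - 1) = 1}"
      hence z: "z ^ (q - 1) = 1" by simp
      have nd: "\<not> int q dvd int g" using g_not_dvd[of 1] by simp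
      show "mk z (int g) = z"
      \<comment> \<open>For q = 2 the only index below q - 1 is 0, so g does not have index 1; but
        then z = 1.\<close>
      proof (cases "q = 2")
        case True
        hence "z = 1" using z by simp
        thus ?thesis using nd by (simp add: mk_def)
      next
        case False
        hence "ind (int g) = 1" using q_gt_1 by (intro ind_unique) auto
        thus ?thesis using nd by (simp add: mk_def)
      qed
    qed
  qed
  hence "(\<Sum>z | z ^ (q - 1) = 1. mk z m) = (\<Sum>\<xi>\<in>D. mk (\<xi> (int g)) m)"
    by (rule sum.reindex_bij_betw[symmetric])
  also have "\<dots> = (\<Sum>\<xi>\<in>D. \<xi> m)" using mk_surj(1) by (intro sum.cong refl) metis
  finally have "(\<Sum>\<xi>\<in>D. \<xi> m) = (\<Sum>z | z ^ (q - 1) = 1. z ^ ind m)" using m by (simp add: mk_def)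
  also have "\<dots> = (\<Sum>k<q - 1. cis (2 * pi * real k / real (q - 1)) ^ ind m)"
    by (rule sum.reindex_bij_betw[OF Complex.bij_betw_roots_unity[OF q1], symmetric])
  also have "\<dots> = (\<Sum>k<q - 1. cis (2 * pi * (of_int (int (ind m)) * real k / real (q - 1))))"
    by (simp add: Complex.DeMoivre mult_ac)
  also have "\<dots> = (if int (q - 1) dvd int (ind m) then of_nat (q - 1) else 0)"
    by (rule sum_cis_roots[OF q1])
  also have "int (q - 1) dvd int (ind m) \<longleftrightarrow> ind m = 0"
    unfolding int_dvd_int_iff using ind(1)[OF m] by (auto dest: dvd_imp_le)
  also have "ind m = 0 \<longleftrightarrow> [m = 1] (mod int q)"
  proof
    assume "ind m = 0"
    thus "[m = 1] (mod int q)" using ind(2)[OF m] by (simp add: cong_sym)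
  next
    assume "[m = 1] (mod int q)"
    thus "ind m = 0" using q1 by (intro ind_unique) (auto simp: cong_sym)
  qed
  finally show ?thesis .
qed

text \<open>Conjugation becomes evaluation at an inverse residue, the same one for all characters,
  so that \<open>sum_chars\<close> applies to products with a conjugate.\<close>

lemma char_inverse:
  assumes "\<not> int q dvd n"
  shows "\<exists>n'. \<not> int q dvd n' \<and> [n * n' = 1] (mod int q) \<and> (\<forall>\<xi>\<in>D. cnj (\<xi> n) = \<xi> n')"
proof -
  have "coprime n (int q)" using assms by (simp add: coprime_iff)
  then obtain n' where n': "[n * n' = 1] (mod int q)" using cong_solve_coprime_int by blast
  have nd: "\<not> int q dvd n'"
  proof
    assume "int q dvd n'"
    hence "int q dvd n * n'" by simp
    hence "int q dvd 1" using n' by (metis cong_dvd_iff)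
    thus False using q_gt_1 by simp
  qed
  have "cnj (\<xi> n) = \<xi> n'" if "\<xi> \<in> D" for \<xi>
  proof -
    have "\<xi> n * \<xi> n' = 1" using char_cong[OF that n'] char_mult[OF that] char_1[OF that] by simp
    moreover have "\<xi> n * cnj (\<xi> n) = 1"
      using norm_char[OF that assms] complex_norm_square[of "\<xi> n"] by simp
    ultimately show ?thesis using char_nonzero_iff[OF that, of n] assms by (metis mult_left_cancel)
  qed
  with n' nd show ?thesis by blast
qed

text \<open>Expand the Gauss sum and sum over the characters first: orthogonality leaves only the
  residue k congruent to n.\<close>

lemma sum_gauss:
  "(\<Sum>\<xi>\<in>D. gauss_sum q \<xi> * cnj (\<xi> n)) = (if int q dvd n then 0 else of_nat (q - 1) * cis (2 * pi * (of_int n / real q)))"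
proof (cases "int q dvd n")
  case True
  hence "\<xi> n = 0" if "\<xi> \<in> D" for \<xi> using char_nonzero_iff[OF that, of n] by simp
  hence "(\<Sum>\<xi>\<in>D. gauss_sum q \<xi> * cnj (\<xi> n)) = 0" by (intro sum.neutral) simp
  thus ?thesis using True by simp
next
  case False
  obtain n' where n': "\<not> int q dvd n'" "[n * n' = 1] (mod int q)" "\<And>\<xi>. \<xi> \<in> D \<Longrightarrow> cnj (\<xi> n) = \<xi> n'"
    using char_inverse[OF False] by blast
  define E where "E = (\<lambda>k::nat. exp (2 * of_real pi * \<i> * of_nat k / of_nat q) :: complex)"
  define r where "r = nat (n mod int q)"
  have r: "int r = n mod int q" using q_gt_1 by (simp add: r_def)
  have r1: "r \<in> {1..q - 1}"
  proof -
    have "r \<noteq> 0" using False r by (metis dvd_eq_mod_eq_0 of_nat_0)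
    moreover have "int r < int q" unfolding r using q_gt_1 by simp
    ultimately show ?thesis by auto
  qed
  have "(\<Sum>\<xi>\<in>D. gauss_sum q \<xi> * cnj (\<xi> n)) = (\<Sum>\<xi>\<in>D. \<Sum>k=1..q-1. E k * \<xi> (int k * n'))"
    by (intro sum.cong refl) (simp add: gauss_sum_def E_def n'(3) char_mult sum_distrib_right mult.assoc)
  also have "\<dots> = (\<Sum>k=1..q-1. E k * (\<Sum>\<xi>\<in>D. \<xi> (int k * n')))"
    by (subst sum.swap) (simp add: sum_distrib_left)
  also have "\<dots> = (\<Sum>k=1..q-1. if k = r then E r * of_nat (q - 1) else 0)"
  proof (intro sum.cong refl)
    fix k assume k: "k \<in> {1..q-1}"
    have kd: "\<not> int q dvd int k" using k by (auto dest: dvd_imp_le)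
    hence nd: "\<not> int q dvd int k * n'" using n'(1) q by (simp add: prime_dvd_mult_iff)
    have "[int k * n' = 1] (mod int q) \<longleftrightarrow> k = r"
    proof
      assume "[int k * n' = 1] (mod int q)"
      hence "[int k * n' = n * n'] (mod int q)" using n'(2) by (metis cong_sym cong_trans)
      hence "[int k = n] (mod int q)"
        using n'(1) by (subst (asm) cong_mult_rcancel) (auto simp: coprime_iff)
      hence "int k mod int q = int r" by (simp add: cong_def r)
      moreover have "int k mod int q = int k" using k by (intro mod_pos_pos_trivial) auto
      ultimately show "k = r" by simp
    next
      assume "k = r"
      hence "[int k = n] (mod int q)" by (simp add: r cong_def)
      hence "[int k * n' = n * n'] (mod int q)" by (intro cong_mult cong_refl)
      thus "[int k * n' = 1] (mod int q)" using n'(2) cong_trans by blast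
    qed
    thus "E k * (\<Sum>\<xi>\<in>D. \<xi> (int k * n')) = (if k = r then E r * of_nat (q - 1) else 0)"
      using sum_chars[OF nd] by auto
  qed
  also have "\<dots> = E r * of_nat (q - 1)" using r1 by (simp add: sum.delta)
  also have "E r = cis (2 * pi * (of_int n / real q))"
  proof -
    have "E r = cis (2 * pi * (real r / real q))"
      by (simp add: E_def cis_conv_exp mult_ac)
    also have "real r / real q = of_int n / real q - of_int (n div int q)"
    proof -
      have "real_of_int (int r) = of_int (n - int q * (n div int q))"
        unfolding r by (simp add: minus_mult_div_eq_mod)
      thus ?thesis using q_gt_1 by (simp add: field_simps)
    qed
    also have "cis (2 * pi * (of_int n / real q - of_int (n div int q))) =
        cis (2 * pi * (of_int n / real q)) / cis (2 * pi * of_int (n div int q))"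
      by (simp add: cis_divide algebra_simps)
    also have "cis (2 * pi * of_int (n div int q)) = 1"
      using cis_2pi_eq_1_iff[of "of_int (n div int q)"] by simp
    finally show ?thesis by simp
  qed
  finally show ?thesis using False by simp
qed

section \<open>Primitive characters and parity\<close>

definition "\<chi>0 = (\<lambda>n. if int q dvd n then 0 else 1 :: complex)"

lemma chi0_D: "\<chi>0 \<in> D"
proof -
  have "\<chi>0 = mk 1" by (simp add: \<chi>0_def mk_def fun_eq_iff)
  thus ?thesis using mk_D[of 1] by simp
qed

text \<open>The only proper divisor of a prime is 1, and a character modulo 1 is constantly 1, so
  only the principal character is induced.\<close>

lemma primitive_iff: "primitive_char q \<xi> \<longleftrightarrow> \<xi> \<in> D \<and> \<xi> \<noteq> \<chi>0"
proof
  assume p: "primitive_char q \<xi>"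
  hence D: "\<xi> \<in> D" by (simp add: primitive_char_def D_def)
  have "dirichlet_char 1 (\<lambda>_. 1)" by (simp add: dirichlet_char_def)
  hence "\<not> (\<forall>n. coprime n (int q) \<longrightarrow> \<xi> n = 1)"
    using p q_gt_1 unfolding primitive_char_def by (metis one_dvd)
  hence "\<xi> \<noteq> \<chi>0" by (auto simp: \<chi>0_def coprime_iff)
  with D show "\<xi> \<in> D \<and> \<xi> \<noteq> \<chi>0" ..
next
  assume *: "\<xi> \<in> D \<and> \<xi> \<noteq> \<chi>0"
  have "\<not> (\<exists>\<psi>. dirichlet_char d \<psi> \<and> (\<forall>n. coprime n (int q) \<longrightarrow> \<xi> n = \<psi> n))" if d: "d dvd q" "d < q" for d
  proof
    assume "\<exists>\<psi>. dirichlet_char d \<psi> \<and> (\<forall>n. coprime n (int q) \<longrightarrow> \<xi> n = \<psi> n)"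
    then obtain \<psi> where \<psi>: "dirichlet_char d \<psi>" "\<And>n. coprime n (int q) \<Longrightarrow> \<xi> n = \<psi> n" by blast
    have d1: "d = 1" using d q by (auto simp: prime_nat_iff)
    have per: "\<psi> (n + 1) = \<psi> n" for n using \<psi>(1) by (simp add: d1 dirichlet_char_def)
    have const: "\<psi> n = \<psi> 0" for n
    proof (induction n rule: int_induct[where k = 0])
      case (step1 i)
      thus ?case using per[of i] by simp
    next
      case (step2 i)
      thus ?case using per[of "i - 1"] by simp
    qed simp
    \<comment> \<open>Every integer, even 0, is coprime to 1; multiplicativity at 0 then forces the
      value 1.\<close>
    have "\<psi> 0 \<noteq> 0" using \<psi>(1) by (simp add: d1 dirichlet_char_def)
    moreover have "\<psi> 0 = \<psi> 0 * \<psi> 0"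
    proof -
      have "\<psi> (0 * 0) = \<psi> 0 * \<psi> 0" using \<psi>(1) unfolding dirichlet_char_def by blast
      thus ?thesis by simp
    qed
    ultimately have "\<psi> 0 = 1" by simp
    hence "\<xi> n = \<chi>0 n" for n
      using \<psi>(2)[of n] const[of n] char_nonzero_iff[of \<xi> n] * by (auto simp: \<chi>0_def coprime_iff)
    with * show False by blast
  qed
  thus "primitive_char q \<xi>" using * by (auto simp: primitive_char_def D_def)
qed

lemma gauss_sum_chi0: "gauss_sum q \<chi>0 = - 1"
proof -
  have "gauss_sum q \<chi>0 = (\<Sum>k=1..q-1. cis (2 * pi * (of_int 1 * real k / real q)))"
    unfolding gauss_sum_def
  proof (intro sum.cong refl)
    fix k assume k: "k \<in> {1..q-1}"
    have "\<not> int q dvd int k" using k by (auto dest: dvd_imp_le)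
    thus "exp (2 * of_real pi * \<i> * of_nat k / of_nat q) * \<chi>0 (int k) = cis (2 * pi * (of_int 1 * real k / real q))"
      by (simp add: \<chi>0_def cis_conv_exp mult_ac)
  qed
  also have "\<dots> = (\<Sum>k<q. cis (2 * pi * (of_int 1 * real k / real q))) - 1"
  proof -
    have "{..<q} = insert 0 {1..q-1}" using q_gt_1 by auto
    thus ?thesis by simp
  qed
  also have "(\<Sum>k<q. cis (2 * pi * (of_int 1 * real k / real q))) = 0"
    using q_gt_1 by (subst sum_cis_roots) auto
  finally show ?thesis by simp
qed

lemma char_minus_1: "\<xi> \<in> D \<Longrightarrow> \<xi> (- 1) = 1 \<or> \<xi> (- 1) = - 1"
proof -
  assume "\<xi> \<in> D"
  hence "(\<xi> (- 1))\<^sup>2 = 1" using char_mult[of \<xi> "-1" "-1"] char_1[of \<xi>] by (simp add: power2_eq_square)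
  thus ?thesis by (simp add: power2_eq_1_iff)
qed

text \<open>The factor (1 + c \<xi>(-1)) / 2 selects the parity, and \<xi>(-1) is absorbed by
  replacing n with -n.\<close>

lemma sum_gauss_sign:
  assumes c: "c = 1 \<or> c = - 1"
  shows "(\<Sum>\<xi>\<in>{\<xi>\<in>D. \<xi> (- 1) = c}. gauss_sum q \<xi> * cnj (\<xi> n)) =
     (if int q dvd n then 0 else of_nat (q - 1) / 2 * (cis (2 * pi * (of_int n / real q)) + c * cis (- 2 * pi * (of_int n / real q))))"
proof -
  have "(\<Sum>\<xi>\<in>{\<xi>\<in>D. \<xi> (- 1) = c}. gauss_sum q \<xi> * cnj (\<xi> n)) =
        (\<Sum>\<xi>\<in>D. if \<xi> (- 1) = c then gauss_sum q \<xi> * cnj (\<xi> n) else 0)"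
    using finite_D by (intro sum.inter_filter)
  also have "\<dots> = (\<Sum>\<xi>\<in>D. 1/2 * (gauss_sum q \<xi> * cnj (\<xi> n)) + c/2 * (gauss_sum q \<xi> * cnj (\<xi> (- n))))"
  proof (intro sum.cong refl)
    fix \<xi> assume \<xi>: "\<xi> \<in> D"
    have "\<xi> (- n) = \<xi> (- 1) * \<xi> n" using char_mult[OF \<xi>, of "-1" n] by simp
    thus "(if \<xi> (- 1) = c then gauss_sum q \<xi> * cnj (\<xi> n) else 0) =
       1/2 * (gauss_sum q \<xi> * cnj (\<xi> n)) + c/2 * (gauss_sum q \<xi> * cnj (\<xi> (- n)))"
      using char_minus_1[OF \<xi>] c by auto
  qed
  also have "\<dots> = 1/2 * (\<Sum>\<xi>\<in>D. gauss_sum q \<xi> * cnj (\<xi> n)) + c/2 * (\<Sum>\<xi>\<in>D. gauss_sum q \<xi> * cnj (\<xi> (- n)))"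
    by (simp only: sum.distrib sum_distrib_left)
  finally show ?thesis unfolding sum_gauss by (cases "int q dvd n") (simp_all add: field_simps)
qed

lemma even_chars: "even_primitive_chars q = {\<xi>\<in>D. \<xi> (- 1) = 1} - {\<chi>0}"
  by (auto simp: even_primitive_chars_def primitive_iff)

lemma odd_chars: "odd_primitive_chars q = {\<xi>\<in>D. \<xi> (- 1) = - 1}"
proof -
  have "\<chi>0 (- 1) = 1" using q_gt_1 by (simp add: \<chi>0_def)
  thus ?thesis by (auto simp: odd_primitive_chars_def primitive_iff)
qed

text \<open>The term 1 comes from removing the principal character, whose Gauss sum is -1. For q
  dividing n the cosine expression and this 1 add up to q, which the last term takes away. In this
  form the right-hand side is a combination of three sequences that are continued
  separately.\<close>

lemma sum_even_chars:
  "(\<Sum>\<xi>\<in>even_primitive_chars q. gauss_sum q \<xi> * conj_char \<xi> n) =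
     of_nat (q - 1) / 2 * (cis (2 * pi * (of_int n / real q)) + cis (- 2 * pi * (of_int n / real q)))
     + 1 - (if int q dvd n then of_nat q else 0)"
proof -
  have fin: "finite {\<xi>\<in>D. \<xi> (- 1) = 1}" using finite_D by simp
  have in0: "\<chi>0 \<in> {\<xi>\<in>D. \<xi> (- 1) = 1}" using chi0_D q_gt_1 by (simp add: \<chi>0_def)
  have "(\<Sum>\<xi>\<in>even_primitive_chars q. gauss_sum q \<xi> * conj_char \<xi> n) =
     (\<Sum>\<xi>\<in>{\<xi>\<in>D. \<xi> (- 1) = 1}. gauss_sum q \<xi> * cnj (\<xi> n)) - gauss_sum q \<chi>0 * cnj (\<chi>0 n)"
    unfolding even_chars conj_char_def using fin in0 by (simp add: sum_diff1)
  also have "\<dots> = (if int q dvd n then 0 else of_nat (q - 1) / 2 * (cis (2 * pi * (of_int n / real q)) + cis (- 2 * pi * (of_int n / real q)))) + cnj (\<chi>0 n)"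
    unfolding gauss_sum_chi0 sum_gauss_sign[OF disjI1[OF refl]] by simp
  also have "\<dots> = of_nat (q - 1) / 2 * (cis (2 * pi * (of_int n / real q)) + cis (- 2 * pi * (of_int n / real q)))
     + 1 - (if int q dvd n then of_nat q else 0)"
  proof (cases "int q dvd n")
    case True
    hence "of_int n / real q \<in> \<int>" using q_gt_1 by (auto simp: dvd_def)
    hence "cis (2 * pi * (of_int n / real q)) = 1" "cis (2 * pi * (- (of_int n / real q))) = 1"
      by (auto simp only: cis_2pi_eq_1_iff Ints_minus)
    thus ?thesis using True q_gt_1 by (simp add: \<chi>0_def of_nat_diff field_simps)
  qed (simp add: \<chi>0_def)
  finally show ?thesis .
qed

text \<open>There is nothing to correct: the principal character is even, and the sine vanishes at
  multiples of q.\<close>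

lemma sum_odd_chars:
  "(\<Sum>\<xi>\<in>odd_primitive_chars q. gauss_sum q \<xi> * conj_char \<xi> n) =
     of_nat (q - 1) / 2 * (cis (2 * pi * (of_int n / real q)) - cis (- 2 * pi * (of_int n / real q)))"
proof -
  have "(\<Sum>\<xi>\<in>odd_primitive_chars q. gauss_sum q \<xi> * conj_char \<xi> n) =
     (if int q dvd n then 0 else of_nat (q - 1) / 2 * (cis (2 * pi * (of_int n / real q)) - cis (- 2 * pi * (of_int n / real q))))"
    unfolding odd_chars conj_char_def using sum_gauss_sign[of "-1" n] by simp
  also have "\<dots> = of_nat (q - 1) / 2 * (cis (2 * pi * (of_int n / real q)) - cis (- 2 * pi * (of_int n / real q)))"
  proof (cases "int q dvd n")
    case True
    hence "of_int n / real q \<in> \<int>" using q_gt_1 by (auto simp: dvd_def)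
    hence "cis (2 * pi * (of_int n / real q)) = 1" "cis (2 * pi * (- (of_int n / real q))) = 1"
      by (auto simp only: cis_2pi_eq_1_iff Ints_minus)
    thus ?thesis using True by simp
  qed simp
  finally show ?thesis .
qed

end

section \<open>Asymptotic expansion of the additive twist at the central point\<close>

context hecke_form
begin

text \<open>Taylor's formula with integral remainder. The sign is built into the functions
  \<open>Df\<close>, so that both sides of the axis are expanded over the same interval
  [0, x].\<close>

lemma fx_taylor:
  assumes K: "K > 0" and x: "x \<ge> 0" and y: "y > 0" and \<sigma>: "\<sigma> = 1 \<or> \<sigma> = - 1"
    and bd: "\<And>u. \<bar>u\<bar> \<le> x \<Longrightarrow> norm (fx (j + K) (Complex u y)) \<le> B"
  shows "norm (fx j (Complex (\<sigma> * x) y) - (\<Sum>k<K. of_real ((\<sigma> * x) ^ k / fact k) * fx (j + k) (Complex 0 y))) \<le> B * x ^ K"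
proof -
  define Df where "Df = (\<lambda>k u. of_real (\<sigma> ^ k) * fx (j + k) (Complex (\<sigma> * u) y))"
  have der: "(Df k has_vector_derivative Df (Suc k) u) (at u within {0..x})" for k u
  proof -
    have 1: "((\<lambda>u. \<sigma> * u) has_vector_derivative \<sigma>) (at u)" by (auto intro!: derivative_eq_intros)
    have "((\<lambda>u. fx (j + k) (Complex (\<sigma> * u) y)) has_vector_derivative \<sigma> *\<^sub>R fx (Suc (j + k)) (Complex (\<sigma> * u) y)) (at u)"
      using vector_diff_chain_at[OF 1 has_vector_derivative_x[OF fx_smooth y, of "j + k" "\<sigma> * u"]]
      by (simp add: o_def fx_Suc)
    from has_vector_derivative_mult_right[OF this, of "of_real (\<sigma> ^ k)"]
    have "(Df k has_vector_derivative Df (Suc k) u) (at u)"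
      unfolding Df_def by (simp add: scaleR_conv_of_real mult_ac)
    thus ?thesis by (rule has_vector_derivative_at_within)
  qed
  define i where "i = (\<lambda>u. ((x - u) ^ (K - 1) / fact (K - 1)) *\<^sub>R Df K u)"
  have T: "(i has_integral Df 0 x - (\<Sum>k<K. ((x - 0) ^ k / fact k) *\<^sub>R Df k 0)) {0..x}"
    unfolding i_def by (rule Taylor_has_integral[where Df = Df and f = "Df 0", OF K refl _ x]) (rule der)
  have "norm (Df 0 x - (\<Sum>k<K. ((x - 0) ^ k / fact k) *\<^sub>R Df k 0)) \<le> (x ^ (K - 1) * B) * measure lborel (cbox 0 x)"
  proof (rule has_integral_bound)
    have B: "B \<ge> 0" using order.trans[OF norm_ge_zero bd[of 0]] x by simp
    thus "0 \<le> x ^ (K - 1) * B" using x by simp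
    show "(i has_integral Df 0 x - (\<Sum>k<K. ((x - 0) ^ k / fact k) *\<^sub>R Df k 0)) (cbox 0 x)" using T by simp
    fix u assume "u \<in> cbox 0 x"
    hence u: "0 \<le> u" "u \<le> x" by auto
    have "norm (Df K u) \<le> B"
    proof -
      have "\<bar>\<sigma> * u\<bar> \<le> x" using u \<sigma> by auto
      from bd[OF this] show ?thesis using \<sigma> by (auto simp: Df_def norm_mult norm_power)
    qed
    moreover have "(x - u) ^ (K - 1) / fact (K - 1) \<le> x ^ (K - 1)"
    proof -
      have "(x - u) ^ (K - 1) / fact (K - 1) \<le> (x - u) ^ (K - 1) / 1"
        using u by (intro divide_left_mono) auto
      also have "\<dots> \<le> x ^ (K - 1)" using u by (simp add: power_mono)
      finally show ?thesis .
    qed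
    ultimately show "norm (i u) \<le> x ^ (K - 1) * B"
      unfolding i_def norm_scaleR using u x by (intro mult_mono) auto
  qed
  also have "(x ^ (K - 1) * B) * measure lborel (cbox 0 x) = B * x ^ K"
    using x K by (simp add: power_eq_if mult_ac)
  finally have "norm (Df 0 x - (\<Sum>k<K. ((x - 0) ^ k / fact k) *\<^sub>R Df k 0)) \<le> B * x ^ K" .
  moreover have "(\<Sum>k<K. ((x - 0) ^ k / fact k) *\<^sub>R Df k 0) = (\<Sum>k<K. of_real ((\<sigma> * x) ^ k / fact k) * fx (j + k) (Complex 0 y))"
    by (intro sum.cong refl) (simp add: Df_def scaleR_conv_of_real power_mult_distrib)
  ultimately show ?thesis by (simp add: Df_def)
qed

text \<open>The k-th Taylor coefficient at x = 0, computed formally under the integral sign, of the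
  integral of the j-th x-derivative of f along the vertical line over x with weight y^j
  dy/y.\<close>

definition "moment j k = (\<integral>t. fx (j + k) (Complex 0 (exp t)) * exp (of_nat j * of_real t) \<partial>lborel) / of_real (fact k)"

lemma fx_axis_rapid: "rapid (\<lambda>t. fx k (Complex 0 (exp t)))"
  unfolding rapid_def
proof (intro conjI allI)
  show "continuous_on UNIV (\<lambda>t. fx k (Complex 0 (exp t)))"
    by (intro continuous_on_vertical smooth_on_continuous fx_smooth)
  fix m :: nat
  obtain C where C: "\<And>x t. \<bar>x\<bar> \<le> exp t \<Longrightarrow> norm (fx k (Complex x (exp t))) \<le> C * exp (- real m * \<bar>t\<bar>)"
    using cone_rapid by blast
  show "\<exists>C. \<forall>t. norm (fx k (Complex 0 (exp t))) \<le> C * exp (- real m * \<bar>t\<bar>)" using C[of 0] by auto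
qed

text \<open>The integral runs over y \<ge> x, where the line over x or -x stays inside the cone, so
  the Taylor remainder is O(x^K) with an integrable factor. The moments are integrals over all y >
  0, and the part y < x is again O(x^K) by rapid decay on the axis. The set A is either the open or
  the closed half-line.\<close>

lemma expansion:
  assumes K: "K > 0"
  shows "\<exists>C\<ge>0. \<forall>x \<sigma> A. 0 < x \<longrightarrow> x \<le> 1 \<longrightarrow> \<sigma> = 1 \<or> \<sigma> = - 1 \<longrightarrow>
      {ln x<..} \<subseteq> A \<longrightarrow> A \<subseteq> {ln x..} \<longrightarrow> A \<in> sets borel \<longrightarrow>
      norm ((\<integral>t. indicator A t *\<^sub>R (fx j (Complex (\<sigma> * x) (exp t)) * exp (of_nat j * of_real t)) \<partial>lborel) -
            (\<Sum>k<K. of_real ((\<sigma> * x) ^ k) * moment j k)) \<le> C * x ^ K"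
proof -
  \<comment> \<open>K powers produce x^K, j powers compensate exp(j t), and one more gives
    integrability.\<close>
  define m where "m = K + j + 1"
  have "\<exists>C. \<forall>k. C k \<ge> 0 \<and> (\<forall>x t. \<bar>x\<bar> \<le> exp t \<longrightarrow> norm (fx (j + k) (Complex x (exp t))) \<le> C k * exp (- real m * \<bar>t\<bar>))"
    using cone_rapid[of "j + _" m] by (intro choice) blast
  then obtain C where C: "\<And>k. C k \<ge> 0"
    "\<And>k x t. \<bar>x\<bar> \<le> exp t \<Longrightarrow> norm (fx (j + k) (Complex x (exp t))) \<le> C k * exp (- real m * \<bar>t\<bar>)" by blast
  define E where "E = (\<lambda>t. exp (of_nat j * complex_of_real t))"
  have normE: "norm (E t) = exp (real j * t)" for t by (simp add: E_def)
  have mE: "exp (- real m * \<bar>t\<bar>) * exp (real j * t) \<le> exp (- real (K + 1) * \<bar>t\<bar>)" for t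
  proof -
    have "real j * t \<le> real j * \<bar>t\<bar>" by (intro mult_left_mono) auto
    hence "- real m * \<bar>t\<bar> + real j * t \<le> - real (K + 1) * \<bar>t\<bar>" by (simp add: m_def algebra_simps)
    thus ?thesis unfolding exp_add[symmetric] by simp
  qed
  have mE1: "exp (- real (K + 1) * \<bar>t\<bar>) \<le> exp (- \<bar>t\<bar>)" for t
    by (simp add: algebra_simps)
  define D where "D = C K + (\<Sum>k<K. C k)"
  have D: "D \<ge> 0" unfolding D_def by (intro add_nonneg_nonneg sum_nonneg C)
  define I where "I = (\<integral>t. exp (- \<bar>t\<bar>) \<partial>(lborel :: real measure))"
  have I: "I \<ge> 0" unfolding I_def by (rule Bochner_Integration.integral_nonneg) simp
  have "norm ((\<integral>t. indicator A t *\<^sub>R (fx j (Complex (\<sigma> * x) (exp t)) * E t) \<partial>lborel) -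
            (\<Sum>k<K. of_real ((\<sigma> * x) ^ k) * moment j k)) \<le> (D * I) * x ^ K"
    if x: "0 < x" "x \<le> 1" and \<sigma>: "\<sigma> = 1 \<or> \<sigma> = - 1" and A: "{ln x<..} \<subseteq> A" "A \<subseteq> {ln x..}" "A \<in> sets borel" for x \<sigma> A
  proof -
    define \<phi> where "\<phi> = (\<lambda>t. fx j (Complex (\<sigma> * x) (exp t)) * E t)"
    define S where "S = (\<lambda>t. \<Sum>k<K. of_real ((\<sigma> * x) ^ k / fact k) * (fx (j + k) (Complex 0 (exp t)) * E t))"
    have tA: "x \<le> exp t" if "t \<in> A" for t
    proof -
      have "ln x \<le> t" using A that by auto
      hence "exp (ln x) \<le> exp t" by simp
      thus ?thesis using x by simp
    qed
    have tnA: "exp t \<le> x" if "t \<notin> A" for t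
    proof -
      have "t \<le> ln x" using A that by force
      hence "exp t \<le> exp (ln x)" by simp
      thus ?thesis using x by simp
    qed
    have \<sigma>x: "\<bar>\<sigma> * x\<bar> = x" using \<sigma> x by auto
    have cont\<phi>: "continuous_on UNIV \<phi>"
      unfolding \<phi>_def E_def by (intro continuous_intros continuous_on_vertical smooth_on_continuous fx_smooth)
    have i\<phi>: "integrable lborel (\<lambda>t. indicator A t *\<^sub>R \<phi> t)"
    proof (rule Bochner_Integration.integrable_bound[OF integrable_mult_right[OF integrable_exp_minus_abs, of "C 0"]])
      show "(\<lambda>t. indicator A t *\<^sub>R \<phi> t) \<in> borel_measurable lborel"
        using A(3) borel_measurable_continuous_onI[OF cont\<phi>] by simp
      have "norm (indicator A t *\<^sub>R \<phi> t) \<le> norm (C 0 * exp (- \<bar>t\<bar>))" for t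
      proof (cases "t \<in> A")
        case True
        have "norm (\<phi> t) \<le> C 0 * exp (- real m * \<bar>t\<bar>) * exp (real j * t)"
          unfolding \<phi>_def norm_mult normE using C(2)[of "\<sigma> * x" t 0] tA[OF True] \<sigma>x by (intro mult_right_mono) auto
        also have "\<dots> \<le> C 0 * exp (- \<bar>t\<bar>)"
          unfolding mult.assoc using C(1) by (intro mult_left_mono order.trans[OF mE mE1])
        finally show ?thesis using True C(1)[of 0] by simp
      qed auto
      thus "AE t in lborel. norm (indicator A t *\<^sub>R \<phi> t) \<le> norm (C 0 * exp (- \<bar>t\<bar>))" by simp
    qed
    have iax: "integrable lborel (\<lambda>t. fx (j + k) (Complex 0 (exp t)) * E t)" for k
      unfolding E_def by (rule rapid_mellin_integrable[OF fx_axis_rapid])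
    have iS: "integrable lborel S"
      unfolding S_def by (intro Bochner_Integration.integrable_sum integrable_mult_right iax)
    have vS: "(\<integral>t. S t \<partial>lborel) = (\<Sum>k<K. of_real ((\<sigma> * x) ^ k) * moment j k)"
      unfolding S_def using iax by (subst Bochner_Integration.integral_sum) (auto simp: moment_def E_def)
    have "norm ((\<integral>t. indicator A t *\<^sub>R \<phi> t \<partial>lborel) - (\<integral>t. S t \<partial>lborel)) =
        norm (\<integral>t. indicator A t *\<^sub>R \<phi> t - S t \<partial>lborel)"
      using i\<phi> iS by simp
    also have "\<dots> \<le> (\<integral>t. (D * x ^ K) * exp (- \<bar>t\<bar>) \<partial>lborel)"
    proof (rule Bochner_Integration.integral_norm_bound_integral)
      show "integrable lborel (\<lambda>t. indicator A t *\<^sub>R \<phi> t - S t)" using i\<phi> iS by auto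
      show "integrable lborel (\<lambda>t. (D * x ^ K) * exp (- \<bar>t\<bar>))"
        by (intro integrable_mult_right integrable_exp_minus_abs)
      fix t :: real
      have sm: "(\<Sum>k<K. C k) \<ge> 0" by (intro sum_nonneg C)
      show "norm (indicator A t *\<^sub>R \<phi> t - S t) \<le> (D * x ^ K) * exp (- \<bar>t\<bar>)"
      proof (cases "t \<in> A")
        case True
        have bd: "norm (fx (j + K) (Complex u (exp t))) \<le> C K * exp (- real m * \<bar>t\<bar>)" if "\<bar>u\<bar> \<le> x" for u
          using C(2)[of u t K] tA[OF True] that by simp
        have "\<phi> t - S t = (fx j (Complex (\<sigma> * x) (exp t)) - (\<Sum>k<K. of_real ((\<sigma> * x) ^ k / fact k) * fx (j + k) (Complex 0 (exp t)))) * E t"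
          by (simp add: \<phi>_def S_def left_diff_distrib sum_distrib_right mult.assoc)
        hence "norm (\<phi> t - S t) \<le> (C K * exp (- real m * \<bar>t\<bar>)) * x ^ K * exp (real j * t)"
          unfolding normE[symmetric]
          using fx_taylor[OF K less_imp_le[OF x(1)] exp_gt_zero \<sigma> bd] by (simp only: norm_mult) (intro mult_right_mono, auto)
        also have "\<dots> = C K * x ^ K * (exp (- real m * \<bar>t\<bar>) * exp (real j * t))" by (simp add: mult_ac)
        also have "\<dots> \<le> C K * x ^ K * exp (- \<bar>t\<bar>)"
          using C(1) x by (intro mult_left_mono order.trans[OF mE mE1]) auto
        also have "\<dots> \<le> D * x ^ K * exp (- \<bar>t\<bar>)"
          using sm x by (intro mult_right_mono) (auto simp: D_def)
        finally show ?thesis using True by simp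
      next
        case False
        \<comment> \<open>Here only the Taylor polynomial counts. Since t \<le> 0 and exp t \<le> x,
          the factor exp(-K \<bar>t\<bar>) = (exp t)^K is at most x^K.\<close>
        have et: "exp t \<le> x" by (rule tnA[OF False])
        have t0: "t \<le> 0" using et x by (metis exp_le_one_iff order.trans)
        have "norm (S t) \<le> (\<Sum>k<K. C k * (x ^ K * exp (- \<bar>t\<bar>)))"
          unfolding S_def
        proof (rule sum_norm_le)
          fix k
          have "norm (complex_of_real ((\<sigma> * x) ^ k / fact k) * (fx (j + k) (Complex 0 (exp t)) * E t)) =
              (x ^ k / fact k) * (norm (fx (j + k) (Complex 0 (exp t))) * exp (real j * t))"
            using \<sigma>x by (simp only: norm_mult norm_of_real normE abs_divide power_abs) simp
          also have "\<dots> \<le> 1 * (C k * exp (- real m * \<bar>t\<bar>) * exp (real j * t))"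
          proof (intro mult_mono mult_right_mono)
            have "x ^ k / fact k \<le> 1 / 1" using x by (intro frac_le) (auto simp: power_le_one)
            thus "x ^ k / fact k \<le> 1" by simp
            show "norm (fx (j + k) (Complex 0 (exp t))) \<le> C k * exp (- real m * \<bar>t\<bar>)" using C(2)[of 0 t k] by simp
          qed (use C(1) in auto)
          also have "\<dots> \<le> C k * exp (- real (K + 1) * \<bar>t\<bar>)"
            using C(1) mE[of t] by (simp add: mult.assoc mult_left_mono)
          also have "exp (- real (K + 1) * \<bar>t\<bar>) = exp t ^ K * exp (- \<bar>t\<bar>)"
            using t0 by (simp add: algebra_simps flip: exp_add exp_of_nat_mult)
          also have "C k * (exp t ^ K * exp (- \<bar>t\<bar>)) \<le> C k * (x ^ K * exp (- \<bar>t\<bar>))"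
            using C(1) et by (intro mult_left_mono mult_right_mono power_mono) auto
          finally show "norm (complex_of_real ((\<sigma> * x) ^ k / fact k) * (fx (j + k) (Complex 0 (exp t)) * E t)) \<le> C k * (x ^ K * exp (- \<bar>t\<bar>))" .
        qed
        also have "\<dots> = (\<Sum>k<K. C k) * (x ^ K * exp (- \<bar>t\<bar>))" by (simp only: sum_distrib_right)
        also have "\<dots> \<le> D * (x ^ K * exp (- \<bar>t\<bar>))" using C(1)[of K] x by (intro mult_right_mono) (auto simp: D_def)
        finally show ?thesis using False by (simp add: mult.assoc)
      qed
    qed
    also have "\<dots> = (D * I) * x ^ K" by (simp add: I_def mult_ac)
    finally show ?thesis unfolding vS \<phi>_def .
  qed
  thus ?thesis using D I unfolding E_def by (intro exI[of _ "D * I"]) auto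
qed

end

context signed_form
begin

section \<open>Integrals along the lines over 1/q and -1/q\<close>

definition "J q j \<sigma> = (\<integral>t. fx j (Complex (\<sigma> / real q) (exp t)) * exp (of_nat j * of_real t) \<partial>lborel)"

lemma line_integrable:
  assumes q: "q > 0" and \<sigma>: "\<sigma> = 1 \<or> \<sigma> = - 1" and j: "j = 0 \<or> j = 1"
  shows "integrable lborel (\<lambda>t. fx j (Complex (\<sigma> / real q) (exp t)) * exp (of_nat j * of_real t))"
proof -
  obtain p :: int where p: "\<sigma> = of_int p" "p = 1 \<or> p = - 1" using \<sigma> by (metis of_int_1 of_int_minus)
  have cp: "coprime p (int q)" using p(2) by auto
  show ?thesis
  proof (cases "j = 0")
    case True
    from rapid_mellin_integrable[OF rapid_lines(1)[OF cp q], of 0] show ?thesis using True p(1) by simp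
  next
    case False
    hence "j = 1" using j by simp
    from rapid_mellin_integrable[OF rapid_lines(2)[OF cp q], of 0] show ?thesis using \<open>j = 1\<close> p(1)
      by (simp add: fx_Suc exp_of_real)
  qed
qed

text \<open>\<open>line_inversion\<close> with p = \<sigma>, \<alpha> = -p and \<beta> = 0, read in
  t = ln y. For j = 1 the factor -1 / (q^2 y^2) turns the weight y into minus the weight 1 / (q^2 y)
  of the image point.\<close>

lemma line_reflect:
  assumes q: "q > 0" and \<sigma>: "\<sigma> = 1 \<or> \<sigma> = - 1" and j: "j = 0 \<or> j = 1"
  shows "fx j (Complex (\<sigma> / real q) (exp t)) * exp (of_nat j * of_real t) =
     (- 1) ^ j * (fx j (Complex (- \<sigma> / real q) (exp (- 2 * ln (real q) - t))) * exp (of_nat j * of_real (- 2 * ln (real q) - t)))"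
proof -
  obtain p :: int where p: "\<sigma> = of_int p" "p = 1 \<or> p = - 1" using \<sigma> by (metis of_int_1 of_int_minus)
  have det: "(- p) * p + 0 * int q = - 1" using p(2) by auto
  define t' where "t' = - 2 * ln (real q) - t"
  have q2: "exp (- 2 * ln (real q)) = 1 / real q ^ 2"
    using q by (simp add: exp_minus exp_double divide_inverse)
  have y': "1 / (real q ^ 2 * exp t) = exp t'"
    unfolding t'_def exp_diff q2 by simp
  have y2: "1 / (real q ^ 2 * exp t ^ 2) * exp t = exp t'"
    unfolding y'[symmetric] by (simp add: power2_eq_square)
  show ?thesis
  proof (cases "j = 0")
    case True
    thus ?thesis using line_inversion(1)[OF det q exp_gt_zero, of t] p(1) by (simp add: y' t'_def)
  next
    case False
    hence j1: "j = 1" using j by simp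
    have "fx 1 (Complex (\<sigma> / real q) (exp t)) * of_real (exp t) =
       - of_real (1 / (real q ^ 2 * exp t ^ 2)) * partial_x f (Complex (of_int (- p) / real q) (exp t')) * of_real (exp t)"
      using line_inversion(2)[OF det q exp_gt_zero, of t] p(1) unfolding y' by (simp add: fx_Suc)
    also have "\<dots> = - (of_real (1 / (real q ^ 2 * exp t ^ 2) * exp t) * partial_x f (Complex (of_int (- p) / real q) (exp t')))"
      by (simp only: of_real_mult mult_ac mult_minus_left mult_minus_right)
    also have "\<dots> = - (fx 1 (Complex (- \<sigma> / real q) (exp t')) * of_real (exp t'))"
      unfolding y2 using p(1) by (simp add: fx_Suc mult.commute)
    finally have eq: "fx 1 (Complex (\<sigma> / real q) (exp t)) * of_real (exp t) =
        - (fx 1 (Complex (- \<sigma> / real q) (exp t')) * of_real (exp t'))" .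
    have ex: "exp (of_nat 1 * complex_of_real r) = of_real (exp r)" for r by (simp add: exp_of_real)
    show ?thesis unfolding j1 ex t'_def[symmetric] power_one_right eq by (simp only: mult_minus1)
  qed
qed

lemma J_reflect:
  assumes q: "q > 0" and \<sigma>: "\<sigma> = 1 \<or> \<sigma> = - 1" and j: "j = 0 \<or> j = 1"
  shows "J q j \<sigma> = (- 1) ^ j * J q j (- \<sigma>)"
proof -
  define g where "g = (\<lambda>t. fx j (Complex (- \<sigma> / real q) (exp t)) * exp (of_nat j * complex_of_real t))"
  have "J q j \<sigma> = (\<integral>t. (- 1) ^ j * g (- 2 * ln (real q) - t) \<partial>lborel)"
    unfolding J_def g_def by (intro Bochner_Integration.integral_cong refl line_reflect assms)
  also have "\<dots> = (- 1) ^ j * (\<integral>t. g t \<partial>lborel)"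
    using integral_reflect_line[of g "- 2 * ln (real q)"] by simp
  finally show ?thesis by (simp add: g_def J_def)
qed

text \<open>The fixed point of the reflection is t = -ln q, that is y = 1/q. The half below it is
  folded onto the upper half of the line over -1/q; the end point is kept on one side only.\<close>

lemma J_split:
  assumes q: "q > 0" and j: "j = 0 \<or> j = 1"
  shows "J q j 1 =
     (\<integral>t. indicator {ln (1 / real q)..} t *\<^sub>R (fx j (Complex (1 * (1 / real q)) (exp t)) * exp (of_nat j * of_real t)) \<partial>lborel) +
     (- 1) ^ j * (\<integral>t. indicator {ln (1 / real q)<..} t *\<^sub>R (fx j (Complex ((- 1) * (1 / real q)) (exp t)) * exp (of_nat j * of_real t)) \<partial>lborel)"
proof -
  define L where "L = ln (1 / real q)"
  have L: "2 * L = - 2 * ln (real q)" using q by (simp add: L_def ln_div)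
  define g where "g = (\<lambda>\<sigma> t. fx j (Complex (\<sigma> / real q) (exp t)) * exp (of_nat j * complex_of_real t))"
  have ig: "integrable lborel (g 1)" unfolding g_def by (intro line_integrable q j) auto
  have "(\<integral>t. g 1 t \<partial>lborel) = (\<integral>t. indicator {L..} t *\<^sub>R g 1 t + indicator {..<L} t *\<^sub>R g 1 t \<partial>lborel)"
    by (intro Bochner_Integration.integral_cong refl) (auto simp: indicator_def)
  also have "\<dots> = (\<integral>t. indicator {L..} t *\<^sub>R g 1 t \<partial>lborel) + (\<integral>t. indicator {..<L} t *\<^sub>R g 1 t \<partial>lborel)"
    using ig by (intro Bochner_Integration.integral_add integrable_mult_indicator) auto
  also have "(\<integral>t. indicator {..<L} t *\<^sub>R g 1 t \<partial>lborel) = (\<integral>t. (\<lambda>t. (- 1) ^ j * (indicator {L<..} t *\<^sub>R g (- 1) t)) (2 * L - t) \<partial>lborel)"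
  proof (intro Bochner_Integration.integral_cong refl)
    fix t
    have "g 1 t = (- 1) ^ j * g (- 1) (2 * L - t)"
      unfolding L g_def using line_reflect[OF q _ j, of 1 t] by simp
    thus "indicator {..<L} t *\<^sub>R g 1 t = (- 1) ^ j * (indicator {L<..} (2 * L - t) *\<^sub>R g (- 1) (2 * L - t))"
      by (auto simp: indicator_def)
  qed
  also have "\<dots> = (- 1) ^ j * (\<integral>t. indicator {L<..} t *\<^sub>R g (- 1) t \<partial>lborel)"
    by (subst integral_reflect_line) (simp only: integral_mult_right_zero)
  finally show ?thesis by (simp add: J_def g_def L_def)
qed

text \<open>Add the expansions of the two half-lines at x = 1/q and x = -1/q. Their signs combine to
  1 + (-1)^(j + k), so for k = 0 and j = 0 the moment is counted twice.\<close>

lemma J_expansion: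
  assumes K: "K > 0" and j: "j = 0 \<or> j = 1"
  shows "\<exists>C\<ge>0. \<forall>q>0. norm (J q j 1 - (\<Sum>k<K. (1 + (- 1) ^ (j + k)) * moment j k * of_real ((1 / real q) ^ k))) \<le> C * (1 / real q) ^ K"
proof -
  obtain C where C: "C \<ge> 0" "\<And>x \<sigma> A. 0 < x \<Longrightarrow> x \<le> 1 \<Longrightarrow> \<sigma> = 1 \<or> \<sigma> = - 1 \<Longrightarrow>
      {ln x<..} \<subseteq> A \<Longrightarrow> A \<subseteq> {ln x..} \<Longrightarrow> A \<in> sets borel \<Longrightarrow>
      norm ((\<integral>t. indicator A t *\<^sub>R (fx j (Complex (\<sigma> * x) (exp t)) * exp (of_nat j * of_real t)) \<partial>lborel) -
            (\<Sum>k<K. of_real ((\<sigma> * x) ^ k) * moment j k)) \<le> C * x ^ K"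
    using expansion[OF K, of j] by blast
  have "norm (J q j 1 - (\<Sum>k<K. (1 + (- 1) ^ (j + k)) * moment j k * of_real ((1 / real q) ^ k))) \<le> (2 * C) * (1 / real q) ^ K"
    if q: "q > 0" for q
  proof -
    define x where "x = 1 / real q"
    have x: "0 < x" "x \<le> 1" using q by (auto simp: x_def)
    define P Q where "P = (\<integral>t. indicator {ln x..} t *\<^sub>R (fx j (Complex (1 * x) (exp t)) * exp (of_nat j * of_real t)) \<partial>lborel)"
      and "Q = (\<integral>t. indicator {ln x<..} t *\<^sub>R (fx j (Complex ((- 1) * x) (exp t)) * exp (of_nat j * of_real t)) \<partial>lborel)"
    have P: "norm (P - (\<Sum>k<K. of_real ((1 * x) ^ k) * moment j k)) \<le> C * x ^ K"
      unfolding P_def by (rule C(2)) (use x in auto)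
    have Q: "norm (Q - (\<Sum>k<K. of_real (((- 1) * x) ^ k) * moment j k)) \<le> C * x ^ K"
      unfolding Q_def by (rule C(2)) (use x in auto)
    have JPQ: "J q j 1 = P + (- 1) ^ j * Q" using J_split[OF q j] by (simp add: P_def Q_def x_def)
    have "J q j 1 - (\<Sum>k<K. (1 + (- 1) ^ (j + k)) * moment j k * of_real (x ^ k)) =
        (P - (\<Sum>k<K. of_real ((1 * x) ^ k) * moment j k)) + (- 1) ^ j * (Q - (\<Sum>k<K. of_real (((- 1) * x) ^ k) * moment j k))"
    proof -
      have "(\<Sum>k<K. (1 + (- 1) ^ (j + k)) * moment j k * of_real (x ^ k)) =
         (\<Sum>k<K. of_real ((1 * x) ^ k) * moment j k + (- 1) ^ j * (of_real (((- 1) * x) ^ k) * moment j k))"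
      proof (intro sum.cong refl)
        fix k
        have "complex_of_real (((- 1) * x) ^ k) = (- 1) ^ k * of_real (x ^ k)" by (subst power_mult_distrib) simp
        thus "(1 + (- 1) ^ (j + k)) * moment j k * of_real (x ^ k) = of_real ((1 * x) ^ k) * moment j k + (- 1) ^ j * (of_real (((- 1) * x) ^ k) * moment j k)"
          by (simp only: power_add mult_1) (simp add: algebra_simps)
      qed
      thus ?thesis unfolding JPQ by (simp add: sum.distrib sum_distrib_left algebra_simps)
    qed
    also have "norm \<dots> \<le> C * x ^ K + C * x ^ K"
      using P Q by (intro norm_triangle_le add_mono) (auto simp: norm_mult norm_power)
    finally show ?thesis by (simp add: x_def)
  qed
  thus ?thesis using C(1) by (intro exI[of _ "2 * C"]) auto
qed

text \<open>Inversion makes the integrals over 1/q and -1/q equal for j = 0 and opposite for j = 1.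
  With the signs in \<open>h1\<close> and \<open>h2\<close>, both cases yield the same factor 1 + e,
  which vanishes for e = -1.\<close>

lemma F1_half: "q > 0 \<Longrightarrow> F1 (1 / real q) (1 / 2) = R 0 * ((1 + e) * J q 0 1)"
proof -
  assume q: "q > 0"
  have "mellin (h1 (1 / real q)) 0 = J q 0 1 + e * J q 0 (- 1)"
    using line_integrable[OF q, of 1 0] line_integrable[OF q, of "-1" 0]
    by (simp add: mellin_def h1_def J_def)
  also have "J q 0 (- 1) = J q 0 1" using J_reflect[OF q, of 1 0] by simp
  finally show ?thesis by (simp add: F1_def algebra_simps)
qed

lemma F2_half: "q > 0 \<Longrightarrow> F2 (1 / real q) (1 / 2) = R 1 / (2 * of_real pi * \<i>) * ((1 + e) * J q 1 1)"
proof -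
  assume q: "q > 0"
  have "mellin (\<lambda>t. h2 (1 / real q) t * of_real (exp t)) 0 =
      (\<integral>t. fx 1 (Complex (1 / real q) (exp t)) * exp (of_nat 1 * of_real t) - e * (fx 1 (Complex (- 1 / real q) (exp t)) * exp (of_nat 1 * of_real t)) \<partial>lborel)"
    unfolding mellin_def h2_def
    by (intro Bochner_Integration.integral_cong refl) (simp add: fx_Suc exp_of_real algebra_simps)
  also have "\<dots> = J q 1 1 - e * J q 1 (- 1)"
    unfolding J_def using line_integrable[OF q, of 1 1] line_integrable[OF q, of "-1" 1]
    by (subst Bochner_Integration.integral_diff) auto
  also have "J q 1 (- 1) = - J q 1 1" using J_reflect[OF q, of 1 1] by simp
  finally show ?thesis by (simp add: F2_def algebra_simps)
qed

lemma F1_0_half: "F1 0 (1 / 2) = R 0 * ((1 + e) * moment 0 0)"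
proof -
  have "mellin (h1 0) 0 = (\<integral>t. (1 + e) * f (Complex 0 (exp t)) \<partial>lborel)"
    unfolding mellin_def h1_def by (intro Bochner_Integration.integral_cong refl) (simp add: algebra_simps)
  thus ?thesis by (simp add: F1_def moment_def)
qed

text \<open>The map z \<mapsto> -1/z reverses the imaginary axis and makes the integrand odd in
  t.\<close>

lemma F2_0_half: "F2 0 (1 / 2) = 0"
proof -
  define \<theta> where "\<theta> = (\<lambda>t. partial_x f (Complex 0 (exp t)) * of_real (exp t))"
  have odd: "\<theta> t = - \<theta> (0 - t)" for t
  proof -
    have "partial_x f (Complex (of_int 0 / real 1) (exp t)) =
         - of_real (1 / (real 1 ^ 2 * exp t ^ 2)) * partial_x f (Complex (of_int 0 / real 1) (1 / (real 1 ^ 2 * exp t)))"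
      by (rule line_inversion(2)[where \<beta> = "- 1"]) auto
    thus ?thesis by (simp add: \<theta>_def exp_minus field_simps power2_eq_square)
  qed
  have "(\<integral>t. \<theta> t \<partial>lborel) = (\<integral>t. - \<theta> (0 - t) \<partial>lborel)" by (subst odd) simp
  also have "\<dots> = - (\<integral>t. \<theta> t \<partial>lborel)" using integral_reflect_line[of \<theta> 0] by simp
  finally have 0: "(\<integral>t. \<theta> t \<partial>lborel) = 0" by simp
  have "mellin (\<lambda>t. h2 0 t * of_real (exp t)) 0 = (\<integral>t. (1 - e) * \<theta> t \<partial>lborel)"
    unfolding mellin_def h2_def \<theta>_def by (intro Bochner_Integration.integral_cong refl) (simp add: algebra_simps)
  also have "\<dots> = 0" using 0 by simp
  finally show ?thesis by (simp add: F2_def)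
qed

end

section \<open>The moments of twisted central values\<close>

lemma has_sum_multiples:
  fixes v :: "nat \<Rightarrow> complex"
  assumes q: "q > 0" and v: "((\<lambda>m. v (q * m)) has_sum S) {1..}"
  shows "((\<lambda>n. if q dvd n then v n else 0) has_sum S) {1..}"
proof -
  have inj: "inj_on ((*) q) {1..}" using q by (auto simp: inj_on_def)
  have "(v has_sum S) ((*) q ` {1..})"
    using v has_sum_reindex[OF inj, of v S] by (simp add: o_def)
  moreover have "(v has_sum S) ((*) q ` {1..}) \<longleftrightarrow> ((\<lambda>n. if q dvd n then v n else 0) has_sum S) {1..}"
  proof (rule has_sum_cong_neutral)
    fix n assume "n \<in> {1..} - (*) q ` {1..}"
    hence n: "n \<ge> 1" "n \<notin> (*) q ` {1..}" by auto
    have "\<not> q dvd n"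
    proof
      assume "q dvd n"
      then obtain r where r: "n = q * r" by (elim dvdE)
      have "r \<ge> 1" using r n(1) by (cases r) auto
      thus False using n(2) r by auto
    qed
    thus "(if q dvd n then v n else 0) = 0" by simp
  next
    fix n assume "n \<in> (*) q ` {1..} - {1..}"
    thus "v n = 0" using q by auto
  qed auto
  ultimately show ?thesis by blast
qed

lemma sums_imp_has_sum_from_1:
  fixes v :: "nat \<Rightarrow> complex"
  assumes "(\<lambda>n. v (Suc n)) sums S" "summable (\<lambda>n. norm (v (Suc n)))"
  shows "(v has_sum S) {1..}"
proof -
  have "((\<lambda>n. v (Suc n)) has_sum S) UNIV" using assms by (intro norm_summable_imp_has_sum)
  moreover have "range Suc = {1..}" by (auto simp: image_iff Suc_le_eq gr0_conv_Suc)
  ultimately show ?thesis using has_sum_reindex[of Suc UNIV v S] by (simp add: o_def)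
qed

lemma has_sum_from_1_imp_sums:
  fixes v :: "nat \<Rightarrow> complex"
  assumes "(v has_sum S) {1..}"
  shows "(\<lambda>n. v (Suc n)) sums S"
proof -
  have "range Suc = {1..}" by (auto simp: image_iff Suc_le_eq gr0_conv_Suc)
  hence "((\<lambda>n. v (Suc n)) has_sum S) UNIV" using assms has_sum_reindex[of Suc UNIV v S] by (simp add: o_def)
  thus ?thesis by (rule has_sum_imp_sums)
qed

text \<open>Finite Fourier inversion. It writes a twist by any function of period q, such as a
  character, as a combination of the additive twists already continued.\<close>

lemma periodic_finite_fourier:
  fixes \<psi> :: "int \<Rightarrow> complex"
  assumes q: "q > 0" and per: "\<And>n. \<psi> (n + int q) = \<psi> n"
  shows "\<psi> n = (\<Sum>b<q. (\<Sum>m<q. \<psi> (int m) * cis (- 2 * pi * (real b * real m / real q))) / of_nat q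
               * cis (2 * pi * (of_int n * real b / real q)))"
proof -
  have per': "\<psi> (n + int q * k) = \<psi> n" for n k
  proof (induction k rule: int_induct[where k = 0])
    case (step1 i)
    thus ?case using per[of "n + int q * i"] by (simp add: algebra_simps)
  next
    case (step2 i)
    thus ?case using per[of "n + int q * (i - 1)"] by (simp add: algebra_simps)
  qed simp
  define r where "r = nat (n mod int q)"
  have r: "int r = n mod int q" "r < q"
  proof -
    show "int r = n mod int q" using q by (simp add: r_def)
    hence "int r < int q" using q by simp
    thus "r < q" by simp
  qed
  have \<psi>r: "\<psi> (int r) = \<psi> n"
    using per'[of "int r" "n div int q"] r(1) by simp
  have "(\<Sum>b<q. (\<Sum>m<q. \<psi> (int m) * cis (- 2 * pi * (real b * real m / real q))) / of_nat q
               * cis (2 * pi * (of_int n * real b / real q))) =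
        (\<Sum>b<q. \<Sum>m<q. \<psi> (int m) / of_nat q * cis (2 * pi * (of_int (n - int m) * real b / real q)))"
  proof (intro sum.cong refl)
    fix b
    have "cis (- 2 * pi * (real b * real m / real q)) * cis (2 * pi * (of_int n * real b / real q)) =
        cis (2 * pi * (of_int (n - int m) * real b / real q))" for m
      unfolding cis_mult by (rule arg_cong[of _ _ cis]) (simp add: algebra_simps diff_divide_distrib)
    thus "(\<Sum>m<q. \<psi> (int m) * cis (- 2 * pi * (real b * real m / real q))) / of_nat q * cis (2 * pi * (of_int n * real b / real q)) =
        (\<Sum>m<q. \<psi> (int m) / of_nat q * cis (2 * pi * (of_int (n - int m) * real b / real q)))"
      by (simp add: sum_divide_distrib sum_distrib_right mult.assoc)
  qed
  also have "\<dots> = (\<Sum>m<q. \<psi> (int m) / of_nat q * (\<Sum>b<q. cis (2 * pi * (of_int (n - int m) * real b / real q))))"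
    by (subst sum.swap) (simp only: sum_distrib_left)
  also have "\<dots> = (\<Sum>m<q. if m = r then \<psi> (int r) else 0)"
  proof (intro sum.cong refl)
    fix m assume m: "m \<in> {..<q}"
    have "int q dvd n - int m \<longleftrightarrow> m = r"
    proof -
      have "int q dvd n - int m \<longleftrightarrow> n mod int q = int m mod int q" by (simp add: mod_eq_dvd_iff)
      also have "int m mod int q = int m" using m by simp
      also have "n mod int q = int m \<longleftrightarrow> m = r" using r(1) by auto
      finally show ?thesis .
    qed
    thus "\<psi> (int m) / of_nat q * (\<Sum>b<q. cis (2 * pi * (of_int (n - int m) * real b / real q))) = (if m = r then \<psi> (int r) else 0)"
      using sum_cis_roots[OF q, of "n - int m"] q by auto
  qed
  also have "\<dots> = \<psi> n" using r(2) \<psi>r by (simp add: sum.delta)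
  finally show ?thesis ..
qed

text \<open>With x = 1/q one has (q - 1) / (2 q^(1/2)) = q^(1/2) (1 - x) / 2. Multiplying the series
  by 1 - x replaces its coefficients by the differences \<open>\<beta>\<close> k -
  \<open>\<beta>\<close> (k - 1); the leftover top term joins the error.\<close>

lemma half_power_expansion:
  fixes \<beta> :: "nat \<Rightarrow> complex" and q :: nat
  assumes \<beta>0: "\<beta> 0 = 0" and q: "q > 0"
    and E: "norm (E - (\<Sum>k=1..n. \<beta> k * of_real ((1 / real q) ^ k))) \<le> C * (1 / real q) ^ Suc n"
  shows "norm ((of_nat q - 1) / (2 * of_real (sqrt (real q))) * E -
            (\<Sum>k=1..n. (\<beta> k - \<beta> (k - 1)) / 2 * of_real (sqrt (real q) * (1 / real q) ^ k)))
           \<le> (C + norm (\<beta> n)) * (sqrt (real q) * (1 / real q) ^ Suc n)"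
proof -
  define r where "r = sqrt (real q)"
  define x where "x = 1 / real q"
  have r: "r > 0" "r * r = real q" using q by (auto simp: r_def)
  define c where "c = (of_nat q - 1) / (2 * complex_of_real r)"
  have c1: "c = (of_real r - of_real (r * x)) / 2"
  proof -
    have "(of_nat q - 1) / (2 * complex_of_real r) = of_real ((real q - 1) / (2 * r))" by simp
    also have "(real q - 1) / (2 * r) = (r - r * x) / 2"
    proof -
      have "r * x = 1 / r" unfolding x_def using r q by (simp add: field_simps)
      thus ?thesis using r by (simp add: field_simps)
    qed
    finally show ?thesis by (simp add: c_def)
  qed
  have alg: "c * (\<Sum>k=1..n. \<beta> k * of_real (x ^ k)) =
      (\<Sum>k=1..n. (\<beta> k - \<beta> (k - 1)) / 2 * of_real (r * x ^ k)) - \<beta> n / 2 * of_real (r * x ^ Suc n)"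
  proof (induction n)
    case 0
    thus ?case by (simp add: \<beta>0)
  next
    case (Suc n)
    have "c * (\<Sum>k=1..Suc n. \<beta> k * of_real (x ^ k)) = c * (\<Sum>k=1..n. \<beta> k * of_real (x ^ k)) + c * (\<beta> (Suc n) * of_real (x ^ Suc n))"
      by (simp add: algebra_simps)
    thus ?case unfolding Suc by (simp add: c1 field_simps)
  qed
  have nc: "norm c \<le> r"
  proof -
    have "norm c = \<bar>(r - r * x) / 2\<bar>" unfolding c1 by (metis norm_of_real of_real_diff of_real_divide of_real_numeral)
    also have "\<dots> \<le> r"
    proof -
      have "0 \<le> x" "x \<le> 1" using q by (simp_all add: x_def)
      hence "0 \<le> r * x" "r * x \<le> r * 1" using r(1) by (simp_all only: mult_left_mono mult_nonneg_nonneg less_imp_le)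
      thus ?thesis using r by auto
    qed
    finally show ?thesis .
  qed
  have "c * E - (\<Sum>k=1..n. (\<beta> k - \<beta> (k - 1)) / 2 * of_real (r * x ^ k)) =
      c * (E - (\<Sum>k=1..n. \<beta> k * of_real (x ^ k))) - \<beta> n / 2 * of_real (r * x ^ Suc n)"
    unfolding right_diff_distrib alg by simp
  also have "norm \<dots> \<le> norm (c * (E - (\<Sum>k=1..n. \<beta> k * of_real (x ^ k)))) + norm (\<beta> n / 2 * of_real (r * x ^ Suc n))"
    by (rule norm_triangle_ineq4)
  also have "norm (c * (E - (\<Sum>k=1..n. \<beta> k * of_real (x ^ k)))) \<le> r * (C * x ^ Suc n)"
    unfolding norm_mult using E nc r by (intro mult_mono) (auto simp: x_def)
  also have "norm (\<beta> n / 2 * of_real (r * x ^ Suc n)) \<le> norm (\<beta> n) * (r * x ^ Suc n)"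
  proof -
    have "norm (\<beta> n / 2 * of_real (r * x ^ Suc n)) = norm (\<beta> n) / 2 * (r * x ^ Suc n)"
      using r by (simp add: norm_mult norm_divide x_def norm_power)
    also have "\<dots> \<le> norm (\<beta> n) * (r * x ^ Suc n)" using r by (intro mult_right_mono) (auto simp: x_def)
    finally show ?thesis .
  qed
  also have "r * (C * x ^ Suc n) + norm (\<beta> n) * (r * x ^ Suc n) = (C + norm (\<beta> n)) * (r * x ^ Suc n)"
    by (simp only: ring_distribs mult.left_commute)
  finally show ?thesis by (simp only: c_def r_def x_def add_mono order_refl)
qed

lemma half_power_conv:
  assumes "q > 0" "k \<ge> 1"
  shows "sqrt (real q) * (1 / real q) ^ k = real q powr (- real (2 * k - 1) / 2)"
proof -
  have "real q powr (- real (2 * k - 1) / 2) = real q powr (1 / 2 - real k)"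
    using assms by (simp add: of_nat_diff diff_divide_distrib)
  also have "\<dots> = real q powr (1 / 2) / real q powr real k" by (rule powr_diff)
  also have "\<dots> = sqrt (real q) * (1 / real q) ^ k"
    using assms by (simp add: powr_half_sqrt powr_realpow power_divide)
  finally show ?thesis ..
qed

lemma sum_odd_terms:
  fixes g :: "nat \<Rightarrow> complex"
  shows "(\<Sum>m=1..N. if odd m then g m else 0) = (\<Sum>k=1..(N + 1) div 2. g (2 * k - 1))"
proof (induction N)
  case (Suc N)
  show ?case
  proof (cases "even N")
    case True
    hence "(Suc N + 1) div 2 = Suc ((N + 1) div 2)" "2 * Suc ((N + 1) div 2) - 1 = Suc N" by (auto elim!: evenE)
    thus ?thesis using Suc True by simp
  next
    case False
    hence "(Suc N + 1) div 2 = (N + 1) div 2" by (auto elim!: oddE)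
    thus ?thesis using Suc False by simp
  qed
qed simp

text \<open>Translation into powers of q^(-1/2). The coefficients are chosen before N and E, so one
  sequence serves every length of the expansion.\<close>

lemma half_power_expansion_powr:
  fixes \<beta> :: "nat \<Rightarrow> complex"
  assumes \<beta>0: "\<beta> 0 = 0"
  shows "\<exists>c. \<forall>N. \<forall>C\<ge>0. \<forall>q>0. \<forall>E.
      norm (E - (\<Sum>k=1..(N + 1) div 2. \<beta> k * of_real ((1 / real q) ^ k))) \<le> C * (1 / real q) ^ Suc ((N + 1) div 2) \<longrightarrow>
      norm ((of_nat q - 1) / (2 * of_real (sqrt (real q))) * E - (\<Sum>n=1..N. c n * of_real (real q powr (- real n / 2))))
        \<le> (C + norm (\<beta> ((N + 1) div 2))) * real q powr (- (real N + 1) / 2)"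
proof -
  \<comment> \<open>The power q^(1/2) q^(-k) is q^(-m/2) with m = 2 k - 1, so only odd m
    occur.\<close>
  define c where "c = (\<lambda>m. if odd m then (\<beta> ((m + 1) div 2) - \<beta> ((m + 1) div 2 - 1)) / 2 else 0)"
  have "norm ((of_nat q - 1) / (2 * of_real (sqrt (real q))) * E - (\<Sum>n=1..N. c n * of_real (real q powr (- real n / 2))))
        \<le> (C + norm (\<beta> ((N + 1) div 2))) * real q powr (- (real N + 1) / 2)"
    if C: "C \<ge> 0" and q: "q > 0"
      and E: "norm (E - (\<Sum>k=1..(N + 1) div 2. \<beta> k * of_real ((1 / real q) ^ k))) \<le> C * (1 / real q) ^ Suc ((N + 1) div 2)"
    for N C q E
  proof -
    define n where "n = (N + 1) div 2"
    have "(\<Sum>m=1..N. c m * of_real (real q powr (- real m / 2))) =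
        (\<Sum>m=1..N. if odd m then (\<beta> ((m + 1) div 2) - \<beta> ((m + 1) div 2 - 1)) / 2 * of_real (real q powr (- real m / 2)) else 0)"
      by (intro sum.cong refl) (simp add: c_def)
    also have "\<dots> = (\<Sum>k=1..n. (\<beta> ((2 * k - 1 + 1) div 2) - \<beta> ((2 * k - 1 + 1) div 2 - 1)) / 2 * of_real (real q powr (- real (2 * k - 1) / 2)))"
      unfolding n_def by (rule sum_odd_terms)
    also have "\<dots> = (\<Sum>k=1..n. (\<beta> k - \<beta> (k - 1)) / 2 * of_real (sqrt (real q) * (1 / real q) ^ k))"
    proof (intro sum.cong refl)
      fix k assume "k \<in> {1..n}"
      hence k: "k \<ge> 1" by simp
      hence "(2 * k - 1 + 1) div 2 = k" by simp
      thus "(\<beta> ((2 * k - 1 + 1) div 2) - \<beta> ((2 * k - 1 + 1) div 2 - 1)) / 2 * of_real (real q powr (- real (2 * k - 1) / 2)) =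
         (\<beta> k - \<beta> (k - 1)) / 2 * of_real (sqrt (real q) * (1 / real q) ^ k)"
        unfolding half_power_conv[OF q k] by simp
    qed
    finally have "norm ((of_nat q - 1) / (2 * of_real (sqrt (real q))) * E - (\<Sum>m=1..N. c m * of_real (real q powr (- real m / 2))))
       \<le> (C + norm (\<beta> n)) * (sqrt (real q) * (1 / real q) ^ Suc n)"
      using half_power_expansion[OF \<beta>0 q E] by (simp add: n_def)
    also have "sqrt (real q) * (1 / real q) ^ Suc n \<le> real q powr (- (real N + 1) / 2)"
    proof -
      \<comment> \<open>The remainder is of order q^(-(2 n + 1)/2); as n rounds N / 2 up, this is at
        most q^(-(N + 1)/2).\<close>
      have "N \<le> 2 * n" unfolding n_def by presburger
      hence "real N \<le> real (2 * n)" by (simp only: of_nat_le_iff)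
      have "sqrt (real q) * (1 / real q) ^ Suc n = real q powr (- real (2 * Suc n - 1) / 2)"
        by (rule half_power_conv[OF q]) simp
      also have "\<dots> \<le> real q powr (- (real N + 1) / 2)"
        using q \<open>real N \<le> real (2 * n)\<close> by (intro powr_mono divide_right_mono) auto
      finally show ?thesis .
    qed
    hence "(C + norm (\<beta> n)) * (sqrt (real q) * (1 / real q) ^ Suc n) \<le> (C + norm (\<beta> n)) * real q powr (- (real N + 1) / 2)"
      using C by (intro mult_left_mono) auto
    finally show ?thesis by (simp add: n_def)
  qed
  thus ?thesis by blast
qed

context hecke_form
begin

text \<open>If a_1 + a_{-1} vanishes identically, then a_1 - a_{-1} = 2 a_1, which is not
  identically zero.\<close>

lemma exists_sign: "\<exists>e. signed_form f e"
proof (cases "\<exists>y>0. a 1 y + 1 * a (- 1) y \<noteq> 0")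
  case True
  hence "signed_form f 1" by (intro signed_form.intro hecke_form_axioms signed_form_axioms.intro) auto
  thus ?thesis by blast
next
  case False
  obtain s y where s: "\<bar>s\<bar> = 1" "y > 0" "a s y \<noteq> 0" using nonzero_sign by blast
  have z: "a 1 y + a (- 1) y = 0" using False s by auto
  have "s = 1 \<or> s = - 1" using s by auto
  hence "a 1 y \<noteq> 0" using s z by (auto simp: add_eq_0_iff)
  moreover have "a 1 y + - 1 * a (- 1) y = 2 * a 1 y" using z by (simp add: add_eq_0_iff)
  ultimately have "a 1 y + - 1 * a (- 1) y \<noteq> 0" by simp
  hence "signed_form f (- 1)"
    using s by (intro signed_form.intro hecke_form_axioms signed_form_axioms.intro) auto
  thus ?thesis by blast
qed

text \<open>Insert l(q m) = l(q) l(m) - l(m/q) into the sum over multiples of q: the first part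
  gives q^(-s) l(q) L(s), the second -q^(-2 s) L(s). Unordered sums make the reindexing by multiples
  legitimate.\<close>

lemma multiples_continuation:
  assumes q: "prime q" and L: "entire_continuation l L"
  shows "entire_continuation (\<lambda>n. if q dvd n then l n else 0)
     (\<lambda>s. of_nat q powr (- s) * (l q - of_nat q powr (- s)) * L s)"
  unfolding entire_continuation_def
proof (intro conjI allI impI)
  have q0: "q > 0" using q prime_gt_0_nat by blast
  have "L holomorphic_on UNIV" using L by (simp add: entire_continuation_def)
  thus "(\<lambda>s. of_nat q powr (- s) * (l q - of_nat q powr (- s)) * L s) holomorphic_on UNIV"
    using q0 by (intro holomorphic_intros) auto
  fix s :: complex assume s: "Re s > 1"
  define Q where "Q = of_nat q powr (- s)"
  define v where "v = (\<lambda>n. l n / of_nat n powr s)"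
  have vs: "(\<lambda>n. v (Suc n)) sums L s" using L s unfolding v_def entire_continuation_def by blast
  have "summable (\<lambda>n. norm (v (Suc n)))"
  proof -
    have "norm (v (Suc n)) = norm (l (Suc n)) / real (Suc n) powr Re s" for n
      unfolding v_def norm_divide by (subst norm_of_nat_powr) auto
    thus ?thesis using l_abs_summable[OF s] by (simp only:)
  qed
  with vs have H0: "(v has_sum L s) {1..}" by (intro sums_imp_has_sum_from_1)
  have mul: "of_nat (q * m) powr s = of_nat q powr s * (of_nat m powr s :: complex)" for m
  proof (cases "m = 0")
    case False
    thus ?thesis using q0
      by (subst (1 2 3) of_nat_powr_conv_exp) (auto simp: ln_mult ring_distribs simp flip: exp_add)
  qed simp
  have Qi: "1 / of_nat q powr s = Q" by (simp add: Q_def powr_minus divide_inverse)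
  define u where "u = (\<lambda>m. if q dvd m then l (m div q) / of_nat m powr s else 0)"
  have "((\<lambda>m. l (q * m div q) / of_nat (q * m) powr s) has_sum (Q * L s)) {1..}"
  proof -
    have "((\<lambda>m. Q * v m) has_sum (Q * L s)) {1..}" by (rule has_sum_cmult_right[OF H0])
    moreover have "l (q * m div q) / of_nat (q * m) powr s = Q * v m" for m
      unfolding mul v_def Qi[symmetric] using q0 by simp
    ultimately show ?thesis by simp
  qed
  from has_sum_multiples[OF q0 this] have H1: "(u has_sum (Q * L s)) {1..}" by (simp add: u_def)
  have "((\<lambda>m. Q * (l q * v m + - u m)) has_sum (Q * (l q * L s + - (Q * L s)))) {1..}"
    using H1 by (intro has_sum_cmult_right has_sum_add H0) (simp only: has_sum_uminus minus_minus)
  hence "((\<lambda>m. Q * (l q * v m - u m)) has_sum (Q * (l q * L s - Q * L s))) {1..}"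
    by (simp only: add_uminus_conv_diff)
  moreover have "Q * (l q * v m - u m) = v (q * m)" if "m \<in> {1..}" for m
  proof -
    have "l (q * m) = l q * l m - (if q dvd m then l (m div q) else 0)"
      using hecke_mult[OF q, of m] that by (simp add: algebra_simps)
    hence "v (q * m) = (l q * l m - (if q dvd m then l (m div q) else 0)) / of_nat m powr s * Q"
      unfolding v_def mul Qi[symmetric] by simp
    also have "\<dots> = Q * (l q * v m - u m)"
      unfolding v_def u_def by (cases "q dvd m") (simp_all add: diff_divide_distrib)
    finally show ?thesis ..
  qed
  ultimately have "((\<lambda>m. v (q * m)) has_sum (Q * (l q * L s - Q * L s))) {1..}"
    using has_sum_cong[of "{1..}" "\<lambda>m. Q * (l q * v m - u m)" "\<lambda>m. v (q * m)"] by simp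
  from has_sum_from_1_imp_sums[OF has_sum_multiples[OF q0 this]]
  have "(\<lambda>n. if q dvd Suc n then v (Suc n) else 0) sums (Q * (l q * L s - Q * L s))" .
  moreover have "(if q dvd Suc n then v (Suc n) else 0) = (if q dvd Suc n then l (Suc n) else 0) / of_nat (Suc n) powr s" for n
    by (simp add: v_def)
  ultimately show "(\<lambda>n. (if q dvd Suc n then l (Suc n) else 0) / of_nat (Suc n) powr s) sums
      (of_nat q powr (- s) * (l q - of_nat q powr (- s)) * L s)"
    by (simp only: Q_def[symmetric]) (simp add: algebra_simps)
qed

end

context signed_form
begin

section \<open>Continuation of twists by periodic functions\<close>

lemma continuation_cis:
  fixes p :: int and q :: nat
  assumes "coprime p (int q)" "q > 0"
  shows "\<exists>F. entire_continuation (\<lambda>n. l n * cis (2 * pi * real n * (of_int p / real q))) F"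
proof -
  define x where "x = of_int p / real q"
  have "entire_continuation (\<lambda>n. 1/2 * (l n * tw1 x n + l n * tw2 x n)) (\<lambda>s. 1/2 * (F1 x s + F2 x s))"
    unfolding x_def by (intro entire_continuation_cmult entire_continuation_add continuation_tw assms)
  moreover have "1/2 * (l n * tw1 x n + l n * tw2 x n) = l n * cis (2 * pi * real n * x)" for n
    by (simp add: tw1_def tw2_def algebra_simps)
  ultimately show ?thesis unfolding x_def by auto
qed

lemma continuation_l: "\<exists>F. entire_continuation l F"
  using continuation_cis[of 0 1] by simp

lemma continuation_L_form: "entire_continuation l (L_form f)"
proof -
  obtain F where F: "entire_continuation l F" using continuation_l by blast
  have "L_form f = F" using L_series_eq[OF F] by (simp add: L_form_def fun_eq_iff)
  thus ?thesis using F by simp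
qed

lemma continuation_periodic:
  fixes \<psi> :: "int \<Rightarrow> complex"
  assumes q: "prime q" and per: "\<And>n. \<psi> (n + int q) = \<psi> n"
  shows "\<exists>F. entire_continuation (\<lambda>n. l n * \<psi> (int n)) F"
proof -
  have q0: "q > 0" using q prime_gt_0_nat by blast
  have "\<exists>F. entire_continuation (\<lambda>n. l n * cis (2 * pi * real n * (of_int (int b) / real q))) F" if b: "b < q" for b
  proof (cases "b = 0")
    case True
    thus ?thesis using continuation_l by simp
  next
    case False
    have "\<not> q dvd b" using b False by (auto dest: dvd_imp_le)
    hence "coprime q b" using q by (intro prime_imp_coprime) auto
    hence "coprime (int b) (int q)" by (simp add: coprime_commute)
    from continuation_cis[OF this q0] show ?thesis .
  qed
  hence "\<forall>b\<in>{..<q}. \<exists>F. entire_continuation (\<lambda>n. l n * cis (2 * pi * real n * (of_int (int b) / real q))) F" by simp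
  from bchoice[OF this] obtain F where
    F: "\<And>b. b \<in> {..<q} \<Longrightarrow> entire_continuation (\<lambda>n. l n * cis (2 * pi * real n * (of_int (int b) / real q))) (F b)"
    by blast
  define c where "c = (\<lambda>b. (\<Sum>m<q. \<psi> (int m) * cis (- 2 * pi * (real b * real m / real q))) / of_nat q)"
  have "entire_continuation (\<lambda>n. \<Sum>b<q. c b * (l n * cis (2 * pi * real n * (of_int (int b) / real q)))) (\<lambda>s. \<Sum>b<q. c b * F b s)"
    by (intro entire_continuation_sum entire_continuation_cmult F) auto
  moreover have "(\<Sum>b<q. c b * (l n * cis (2 * pi * real n * (of_int (int b) / real q)))) = l n * \<psi> (int n)" for n
  proof -
    have "\<psi> (int n) = (\<Sum>b<q. c b * cis (2 * pi * (of_int (int n) * real b / real q)))"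
      unfolding c_def by (rule periodic_finite_fourier[where \<psi> = \<psi>, OF q0 per])
    thus ?thesis by (simp add: sum_distrib_left mult_ac)
  qed
  ultimately show ?thesis by auto
qed

text \<open>The values at 1/2 of the series with 2 cos(2 pi n / q) and 2 i sin(2 pi n / q), named
  independently of the sign e.\<close>

definition "cos_twist q = L_series (\<lambda>n. l n * (cis (2 * pi * real n * (1 / real q)) + cis (- 2 * pi * real n * (1 / real q)))) (1 / 2)"
definition "sin_twist q = L_series (\<lambda>n. l n * (cis (2 * pi * real n * (1 / real q)) - cis (- 2 * pi * real n * (1 / real q)))) (1 / 2)"

lemma twist_continuations:
  assumes "q > 0"
  shows "L_series (\<lambda>n. l n * tw1 (1 / real q) n) = F1 (1 / real q)" "L_series (\<lambda>n. l n * tw2 (1 / real q) n) = F2 (1 / real q)"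
  using L_series_eq[OF continuation_tw(1)[of 1 q]] L_series_eq[OF continuation_tw(2)[of 1 q]] assms by simp_all

text \<open>The constant term of the cosine twist is split off as 4 L(1/2, f): the expansion starts
  with 2 R(0) times twice the zeroth moment, while L(1/2, f) is R(0) times that moment. The sine
  twist starts with 1 + (-1)^1 = 0 and has no constant term.\<close>

lemma twist_expansion:
  "\<exists>\<beta> \<beta>'. \<beta> 0 = 0 \<and> \<beta>' 0 = 0 \<and> (\<forall>n. \<exists>C\<ge>0. \<forall>q>0.
     norm (cos_twist q - 4 * L_form f (1 / 2) - (\<Sum>k=1..n. \<beta> k * of_real ((1 / real q) ^ k))) \<le> C * (1 / real q) ^ Suc n \<and>
     norm (sin_twist q - (\<Sum>k=1..n. \<beta>' k * of_real ((1 / real q) ^ k))) \<le> C * (1 / real q) ^ Suc n)"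
proof (cases "e = 1")
  case True
  have e2: "1 + e = 2" by (subst True) simp
  have t1: "tw1 x n = cis (2 * pi * real n * x) + cis (- 2 * pi * real n * x)" for x n
    unfolding tw1_def by (subst True) simp
  have t2: "tw2 x n = cis (2 * pi * real n * x) - cis (- 2 * pi * real n * x)" for x n
    unfolding tw2_def by (subst True) simp
  have cos: "cos_twist q = R 0 * (2 * J q 0 1)" if "q > 0" for q
    unfolding cos_twist_def t1[symmetric] twist_continuations[OF that] F1_half[OF that] e2 ..
  have sin: "sin_twist q = R 1 / (2 * of_real pi * \<i>) * (2 * J q 1 1)" if "q > 0" for q
    unfolding sin_twist_def t2[symmetric] twist_continuations[OF that] F2_half[OF that] e2 ..
  have L: "L_form f (1 / 2) = R 0 * moment 0 0"
  proof -
    have "entire_continuation (\<lambda>n. 1/2 * (l n * tw1 (of_int 0 / real 1) n)) (\<lambda>s. 1/2 * F1 (of_int 0 / real 1) s)"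
      by (intro entire_continuation_cmult continuation_tw) auto
    hence "entire_continuation l (\<lambda>s. 1/2 * F1 0 s)" by (simp add: t1)
    hence "L_form f (1 / 2) = 1/2 * F1 0 (1 / 2)" by (simp add: L_form_def L_series_eq)
    thus ?thesis unfolding F1_0_half e2 by simp
  qed
  define \<beta> where "\<beta> = (\<lambda>k::nat. if k = 0 then 0 else 2 * R 0 * (1 + (- 1) ^ k) * moment 0 k)"
  define \<beta>' where "\<beta>' = (\<lambda>k::nat. R 1 / (2 * of_real pi * \<i>) * 2 * (1 + (- 1) ^ (1 + k)) * moment 1 k)"
  have "\<exists>C\<ge>0. \<forall>q>0.
     norm (cos_twist q - 4 * L_form f (1 / 2) - (\<Sum>k=1..n. \<beta> k * of_real ((1 / real q) ^ k))) \<le> C * (1 / real q) ^ Suc n \<and>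
     norm (sin_twist q - (\<Sum>k=1..n. \<beta>' k * of_real ((1 / real q) ^ k))) \<le> C * (1 / real q) ^ Suc n" for n
  proof -
    obtain C0 where C0: "C0 \<ge> 0" "\<And>q. q > 0 \<Longrightarrow> norm (J q 0 1 - (\<Sum>k<Suc n. (1 + (- 1) ^ (0 + k)) * moment 0 k * of_real ((1 / real q) ^ k))) \<le> C0 * (1 / real q) ^ Suc n"
      using J_expansion[of "Suc n" 0] by auto
    obtain C1 where C1: "C1 \<ge> 0" "\<And>q. q > 0 \<Longrightarrow> norm (J q 1 1 - (\<Sum>k<Suc n. (1 + (- 1) ^ (1 + k)) * moment 1 k * of_real ((1 / real q) ^ k))) \<le> C1 * (1 / real q) ^ Suc n"
      using J_expansion[of "Suc n" 1] by auto
    define K where "K = max (norm (2 * R 0) * C0) (norm (R 1 / (2 * of_real pi * \<i>) * 2) * C1)"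
    have K: "K \<ge> 0" using C0(1) by (simp add: K_def le_max_iff_disj)
    have split: "(\<Sum>k<Suc n. h k) = h 0 + (\<Sum>k=1..n. h k)" for h :: "nat \<Rightarrow> complex"
      by (simp add: lessThan_Suc_atMost atMost_atLeast0 sum.atLeast_Suc_atMost)
    have "norm (cos_twist q - 4 * L_form f (1 / 2) - (\<Sum>k=1..n. \<beta> k * of_real ((1 / real q) ^ k))) \<le> K * (1 / real q) ^ Suc n \<and>
     norm (sin_twist q - (\<Sum>k=1..n. \<beta>' k * of_real ((1 / real q) ^ k))) \<le> K * (1 / real q) ^ Suc n" if q: "q > 0" for q
    proof
      have "cos_twist q - 4 * L_form f (1 / 2) - (\<Sum>k=1..n. \<beta> k * of_real ((1 / real q) ^ k)) =
         2 * R 0 * (J q 0 1 - (\<Sum>k<Suc n. (1 + (- 1) ^ (0 + k)) * moment 0 k * of_real ((1 / real q) ^ k)))"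
      proof -
        have "(\<Sum>k=1..n. \<beta> k * of_real ((1 / real q) ^ k)) = 2 * R 0 * (\<Sum>k=1..n. (1 + (- 1) ^ (0 + k)) * moment 0 k * of_real ((1 / real q) ^ k))"
          unfolding sum_distrib_left by (intro sum.cong refl) (auto simp: \<beta>_def)
        thus ?thesis unfolding split cos[OF q] L by (simp add: algebra_simps)
      qed
      hence "norm (cos_twist q - 4 * L_form f (1 / 2) - (\<Sum>k=1..n. \<beta> k * of_real ((1 / real q) ^ k))) \<le> norm (2 * R 0) * (C0 * (1 / real q) ^ Suc n)"
        using C0(2)[OF q] by (simp only: norm_mult) (intro mult_left_mono, auto)
      also have "\<dots> \<le> K * (1 / real q) ^ Suc n" unfolding mult.assoc[symmetric] by (intro mult_right_mono) (auto simp: K_def)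
      finally show "norm (cos_twist q - 4 * L_form f (1 / 2) - (\<Sum>k=1..n. \<beta> k * of_real ((1 / real q) ^ k))) \<le> K * (1 / real q) ^ Suc n" .
      define c where "c = R 1 / (2 * of_real pi * \<i>) * 2"
      have "sin_twist q - (\<Sum>k=1..n. \<beta>' k * of_real ((1 / real q) ^ k)) =
         c * (J q 1 1 - (\<Sum>k<Suc n. (1 + (- 1) ^ (1 + k)) * moment 1 k * of_real ((1 / real q) ^ k)))"
      proof -
        have "(\<Sum>k=1..n. \<beta>' k * of_real ((1 / real q) ^ k)) = c * (\<Sum>k=1..n. (1 + (- 1) ^ (1 + k)) * moment 1 k * of_real ((1 / real q) ^ k))"
          unfolding sum_distrib_left by (intro sum.cong refl) (simp add: \<beta>'_def c_def mult.assoc)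
        moreover have "sin_twist q = c * J q 1 1" unfolding sin[OF q] c_def by simp
        ultimately show ?thesis unfolding split by (simp add: right_diff_distrib)
      qed
      hence "norm (sin_twist q - (\<Sum>k=1..n. \<beta>' k * of_real ((1 / real q) ^ k))) \<le> norm c * (C1 * (1 / real q) ^ Suc n)"
        using C1(2)[OF q] by (simp only: norm_mult) (intro mult_left_mono, auto)
      also have "\<dots> \<le> K * (1 / real q) ^ Suc n" unfolding mult.assoc[symmetric] by (intro mult_right_mono) (auto simp: K_def c_def)
      finally show "norm (sin_twist q - (\<Sum>k=1..n. \<beta>' k * of_real ((1 / real q) ^ k))) \<le> K * (1 / real q) ^ Suc n" .
    qed
    thus ?thesis using K by blast
  qed
  moreover have "\<beta> 0 = 0" "\<beta>' 0 = 0" by (simp_all add: \<beta>_def \<beta>'_def)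
  ultimately show ?thesis by blast
next
  case False
  \<comment> \<open>Now \<open>tw1\<close> is the sine twist and \<open>tw2\<close> the cosine
    twist. All values at 1/2 vanish, through 1 + e = 0 for the twists and through
    \<open>F2_0_half\<close> for L(1/2, f), so zero coefficients suffice.\<close>
  hence e1: "e = - 1" using e by auto
  have e2: "1 + e = 0" by (subst e1) simp
  have t1: "tw1 x n = cis (2 * pi * real n * x) - cis (- 2 * pi * real n * x)" for x n
    unfolding tw1_def by (subst e1) simp
  have t2: "tw2 x n = cis (2 * pi * real n * x) + cis (- 2 * pi * real n * x)" for x n
    unfolding tw2_def by (subst e1) simp
  have "cos_twist q = 0" if "q > 0" for q
    unfolding cos_twist_def t2[symmetric] twist_continuations[OF that] F2_half[OF that] e2 by simp
  moreover have "sin_twist q = 0" if "q > 0" for q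
    unfolding sin_twist_def t1[symmetric] twist_continuations[OF that] F1_half[OF that] e2 by simp
  moreover have "L_form f (1 / 2) = 0"
  proof -
    have "entire_continuation (\<lambda>n. 1/2 * (l n * tw2 (of_int 0 / real 1) n)) (\<lambda>s. 1/2 * F2 (of_int 0 / real 1) s)"
      by (intro entire_continuation_cmult continuation_tw) auto
    hence "entire_continuation l (\<lambda>s. 1/2 * F2 0 s)" by (simp add: t2)
    hence "L_form f (1 / 2) = 1/2 * F2 0 (1 / 2)" by (simp add: L_form_def L_series_eq)
    thus ?thesis using F2_0_half by simp
  qed
  ultimately show ?thesis
    by (intro exI[of _ "\<lambda>_. 0"] conjI allI exI[of _ 0]) auto
qed

lemma twist_sum_continuation:
  assumes q: "prime q" and S: "finite S" "\<And>\<xi>. \<xi> \<in> S \<Longrightarrow> dirichlet_char q \<xi>"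
  shows "entire_continuation (\<lambda>n. l n * (\<Sum>\<xi>\<in>S. gauss_sum q \<xi> * conj_char \<xi> (int n)))
     (\<lambda>s. \<Sum>\<xi>\<in>S. gauss_sum q \<xi> * L_twist f (conj_char \<xi>) s)"
proof -
  have "entire_continuation (\<lambda>n. l n * conj_char \<xi> (int n)) (L_twist f (conj_char \<xi>))" if "\<xi> \<in> S" for \<xi>
  proof -
    have "conj_char \<xi> (n + int q) = conj_char \<xi> n" for n
      using S(2)[OF that] by (simp add: conj_char_def dirichlet_char_def)
    from continuation_periodic[where \<psi> = "conj_char \<xi>", OF q this] obtain F where F: "entire_continuation (\<lambda>n. l n * conj_char \<xi> (int n)) F" by blast
    have "L_twist f (conj_char \<xi>) = F" using L_series_eq[OF F] by (simp add: L_twist_def fun_eq_iff)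
    thus ?thesis using F by simp
  qed
  hence "entire_continuation (\<lambda>n. \<Sum>\<xi>\<in>S. gauss_sum q \<xi> * (l n * conj_char \<xi> (int n)))
     (\<lambda>s. \<Sum>\<xi>\<in>S. gauss_sum q \<xi> * L_twist f (conj_char \<xi>) s)"
    by (intro entire_continuation_sum S entire_continuation_cmult)
  thus ?thesis by (simp add: sum_distrib_left mult_ac)
qed

lemma twist_continuation_exists:
  assumes "q > 0"
  shows "\<exists>F. entire_continuation (\<lambda>n. l n * (cis (2 * pi * real n * (1 / real q)) + cis (- 2 * pi * real n * (1 / real q)))) F"
    and "\<exists>F. entire_continuation (\<lambda>n. l n * (cis (2 * pi * real n * (1 / real q)) - cis (- 2 * pi * real n * (1 / real q)))) F"
proof -
  obtain F where F: "entire_continuation (\<lambda>n. l n * cis (2 * pi * real n * (of_int 1 / real q))) F"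
    using continuation_cis[of 1 q] assms by auto
  obtain G where G: "entire_continuation (\<lambda>n. l n * cis (2 * pi * real n * (of_int (- 1) / real q))) G"
    using continuation_cis[of "- 1" q] assms by auto
  show "\<exists>F. entire_continuation (\<lambda>n. l n * (cis (2 * pi * real n * (1 / real q)) + cis (- 2 * pi * real n * (1 / real q)))) F"
    using entire_continuation_add[OF F G] by (auto simp: algebra_simps)
  show "\<exists>F. entire_continuation (\<lambda>n. l n * (cis (2 * pi * real n * (1 / real q)) - cis (- 2 * pi * real n * (1 / real q)))) F"
    using entire_continuation_add[OF F entire_continuation_cmult[OF G, of "- 1"]] by (auto simp: algebra_simps)
qed

text \<open>The term 1 in \<open>sum_even_chars\<close> contributes L(1/2, f). The multiples of q
  contribute -q (l(q) / q^(1/2) - 1/q) L(1/2, f), hence a second L(1/2, f) and, after division by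
  q^(1/2), the term -l(q) L(1/2, f). Comparing continuations is legitimate because they are
  unique.\<close>

lemma even_moment:
  assumes q: "prime q"
  shows "(\<Sum>\<xi>\<in>even_primitive_chars q. gauss_sum q \<xi> / of_real (sqrt (real q)) * L_twist f (conj_char \<xi>) (1 / 2)) =
     (of_nat q - 1) / (2 * of_real (sqrt (real q))) * cos_twist q + 2 * L_form f (1 / 2) / of_real (sqrt (real q))
      - l q * L_form f (1 / 2)"
proof -
  interpret P: prime_modulus q by unfold_locales (rule q)
  have q0: "q > 0" using P.q_gt_1 by simp
  define r where "r = complex_of_real (sqrt (real q))"
  have r: "r \<noteq> 0" "r * r = of_nat q" using q0 by (auto simp: r_def simp flip: of_real_mult)
  obtain F where F: "entire_continuation (\<lambda>n. l n * (cis (2 * pi * real n * (1 / real q)) + cis (- 2 * pi * real n * (1 / real q)))) F"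
    using twist_continuation_exists(1)[OF q0] by blast
  have Fc: "F (1 / 2) = cos_twist q" using L_series_eq[OF F] by (simp add: cos_twist_def)
  define G where "G = (\<lambda>s. of_nat q powr (- s) * (l q - of_nat q powr (- s)) * L_form f s)"
  have G: "entire_continuation (\<lambda>n. if q dvd n then l n else 0) G"
    unfolding G_def by (rule multiples_continuation[OF q continuation_L_form])
  have Gh: "G (1 / 2) = (l q / r - 1 / of_nat q) * L_form f (1 / 2)"
  proof -
    have "of_nat q powr (- (1 / 2)) = 1 / r"
      unfolding r_def of_real_sqrt_conv_powr[OF q0] powr_minus by (rule inverse_eq_divide)
    hence "G (1 / 2) = 1 / r * (l q - 1 / r) * L_form f (1 / 2)" by (simp only: G_def)
    also have "1 / r * (l q - 1 / r) = l q / r - 1 / of_nat q"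
      unfolding r(2)[symmetric] by (simp add: right_diff_distrib)
    finally show ?thesis .
  qed
  have "entire_continuation (\<lambda>n. l n * (\<Sum>\<xi>\<in>even_primitive_chars q. gauss_sum q \<xi> * conj_char \<xi> (int n)))
     (\<lambda>s. \<Sum>\<xi>\<in>even_primitive_chars q. gauss_sum q \<xi> * L_twist f (conj_char \<xi>) s)"
  proof (rule twist_sum_continuation[OF q])
    show "finite (even_primitive_chars q)" unfolding P.even_chars using P.finite_D by simp
    show "dirichlet_char q \<xi>" if "\<xi> \<in> even_primitive_chars q" for \<xi>
      using that by (simp add: even_primitive_chars_def primitive_char_def)
  qed
  moreover have "(\<lambda>n. l n * (\<Sum>\<xi>\<in>even_primitive_chars q. gauss_sum q \<xi> * conj_char \<xi> (int n))) =
     (\<lambda>n. (of_nat (q - 1) / 2 * (l n * (cis (2 * pi * real n * (1 / real q)) + cis (- 2 * pi * real n * (1 / real q)))) + l n) +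
        (- of_nat q) * (if q dvd n then l n else 0))"
    unfolding P.sum_even_chars by (auto simp: fun_eq_iff algebra_simps)
  moreover have "entire_continuation (\<lambda>n. (of_nat (q - 1) / 2 * (l n * (cis (2 * pi * real n * (1 / real q)) + cis (- 2 * pi * real n * (1 / real q)))) + l n) +
        (- of_nat q) * (if q dvd n then l n else 0)) (\<lambda>s. (of_nat (q - 1) / 2 * F s + L_form f s) + (- of_nat q) * G s)"
    by (intro entire_continuation_add entire_continuation_cmult F G continuation_L_form)
  ultimately have "(\<lambda>s. \<Sum>\<xi>\<in>even_primitive_chars q. gauss_sum q \<xi> * L_twist f (conj_char \<xi>) s) =
      (\<lambda>s. (of_nat (q - 1) / 2 * F s + L_form f s) + (- of_nat q) * G s)"
    by (simp only: entire_continuation_unique)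
  from fun_cong[OF this, of "1 / 2"]
  have *: "(\<Sum>\<xi>\<in>even_primitive_chars q. gauss_sum q \<xi> * L_twist f (conj_char \<xi>) (1 / 2)) =
     of_nat (q - 1) / 2 * cos_twist q + L_form f (1 / 2) - of_nat q * ((l q / r - 1 / of_nat q) * L_form f (1 / 2))"
    by (simp add: Fc Gh)
  have "(\<Sum>\<xi>\<in>even_primitive_chars q. gauss_sum q \<xi> / r * L_twist f (conj_char \<xi>) (1 / 2)) =
     (\<Sum>\<xi>\<in>even_primitive_chars q. gauss_sum q \<xi> * L_twist f (conj_char \<xi>) (1 / 2)) / r"
    by (simp add: sum_divide_distrib)
  also have "\<dots> = (of_nat q - 1) / (2 * r) * cos_twist q + 2 * L_form f (1 / 2) / r - l q * L_form f (1 / 2)"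
  proof -
    have "of_nat q * ((l q / r - 1 / of_nat q) * L_form f (1 / 2)) = (r * l q - 1) * L_form f (1 / 2)"
    proof -
      have "of_nat q * (l q / r - 1 / of_nat q) = r * l q - 1"
        using r q0 by (simp add: right_diff_distrib flip: r(2))
      thus ?thesis by (metis mult.assoc)
    qed
    moreover have "of_nat (q - 1) = (of_nat q - 1 :: complex)" using q0 by (simp add: of_nat_diff)
    moreover have "(c / 2 * x + y - (r * z - 1) * y) / r = c / (2 * r) * x + 2 * y / r - z * y" for c x y z
      using r(1) by (simp add: field_simps)
    ultimately show ?thesis unfolding * by (simp only:)
  qed
  finally show ?thesis by (simp add: r_def)
qed

lemma odd_moment:
  assumes q: "prime q"
  shows "(\<Sum>\<xi>\<in>odd_primitive_chars q. gauss_sum q \<xi> / of_real (sqrt (real q)) * L_twist f (conj_char \<xi>) (1 / 2)) =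
     (of_nat q - 1) / (2 * of_real (sqrt (real q))) * sin_twist q"
proof -
  interpret P: prime_modulus q by unfold_locales (rule q)
  have q0: "q > 0" using P.q_gt_1 by simp
  define r where "r = complex_of_real (sqrt (real q))"
  have r: "r \<noteq> 0" using q0 by (auto simp: r_def)
  obtain F where F: "entire_continuation (\<lambda>n. l n * (cis (2 * pi * real n * (1 / real q)) - cis (- 2 * pi * real n * (1 / real q)))) F"
    using twist_continuation_exists(2)[OF q0] by blast
  have Fc: "F (1 / 2) = sin_twist q" using L_series_eq[OF F] by (simp add: sin_twist_def)
  have "entire_continuation (\<lambda>n. l n * (\<Sum>\<xi>\<in>odd_primitive_chars q. gauss_sum q \<xi> * conj_char \<xi> (int n)))
     (\<lambda>s. \<Sum>\<xi>\<in>odd_primitive_chars q. gauss_sum q \<xi> * L_twist f (conj_char \<xi>) s)"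
  proof (rule twist_sum_continuation[OF q])
    show "finite (odd_primitive_chars q)" unfolding P.odd_chars using P.finite_D by simp
    show "dirichlet_char q \<xi>" if "\<xi> \<in> odd_primitive_chars q" for \<xi>
      using that by (simp add: odd_primitive_chars_def primitive_char_def)
  qed
  moreover have "(\<lambda>n. l n * (\<Sum>\<xi>\<in>odd_primitive_chars q. gauss_sum q \<xi> * conj_char \<xi> (int n))) =
     (\<lambda>n. of_nat (q - 1) / 2 * (l n * (cis (2 * pi * real n * (1 / real q)) - cis (- 2 * pi * real n * (1 / real q)))))"
    unfolding P.sum_odd_chars by (auto simp: fun_eq_iff algebra_simps)
  moreover have "entire_continuation (\<lambda>n. of_nat (q - 1) / 2 * (l n * (cis (2 * pi * real n * (1 / real q)) - cis (- 2 * pi * real n * (1 / real q)))))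
      (\<lambda>s. of_nat (q - 1) / 2 * F s)"
    by (intro entire_continuation_cmult F)
  ultimately have "(\<lambda>s. \<Sum>\<xi>\<in>odd_primitive_chars q. gauss_sum q \<xi> * L_twist f (conj_char \<xi>) s) = (\<lambda>s. of_nat (q - 1) / 2 * F s)"
    by (simp only: entire_continuation_unique)
  from fun_cong[OF this, of "1 / 2"]
  have *: "(\<Sum>\<xi>\<in>odd_primitive_chars q. gauss_sum q \<xi> * L_twist f (conj_char \<xi>) (1 / 2)) = of_nat (q - 1) / 2 * sin_twist q"
    by (simp add: Fc)
  have "(\<Sum>\<xi>\<in>odd_primitive_chars q. gauss_sum q \<xi> / r * L_twist f (conj_char \<xi>) (1 / 2)) =
     (\<Sum>\<xi>\<in>odd_primitive_chars q. gauss_sum q \<xi> * L_twist f (conj_char \<xi>) (1 / 2)) / r"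
    by (simp add: sum_divide_distrib)
  also have "\<dots> = (of_nat q - 1) / (2 * r) * sin_twist q"
    unfolding * using q0 by (simp add: of_nat_diff)
  finally show ?thesis by (simp add: r_def)
qed

end

theorem theorem1p2:
  fixes f :: "complex \<Rightarrow> complex"
  assumes "hecke_maass_cusp_form f"
  shows "\<exists>c c' :: nat \<Rightarrow> complex. \<forall>N::nat. N \<ge> 1 \<longrightarrow>
    (\<exists>C::real. \<forall>q::nat. prime q \<and> odd q \<longrightarrow>
      norm ((\<Sum>\<xi>\<in>even_primitive_chars q.
               gauss_sum q \<xi> / of_real (sqrt (real q)) * L_twist f (conj_char \<xi>) (1/2))
            - (2 * L_form f (1/2) * of_real (sqrt (real q))
               - hecke_eigenvalue f q * L_form f (1/2)
               + (\<Sum>n = 1..N. c n * of_real (real q powr (- real n / 2)))))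
        \<le> C * real q powr (- (real N + 1) / 2) \<and>
      norm ((\<Sum>\<xi>\<in>odd_primitive_chars q.
               gauss_sum q \<xi> / of_real (sqrt (real q)) * L_twist f (conj_char \<xi>) (1/2))
            - (\<Sum>n = 1..N. c' n * of_real (real q powr (- real n / 2))))
        \<le> C * real q powr (- (real N + 1) / 2))"
proof -
  interpret hecke_form f by unfold_locales (rule assms)
  obtain e where "signed_form f e" using exists_sign by blast
  then interpret signed_form f e .
  obtain \<beta> \<beta>' where \<beta>: "\<beta> 0 = 0" "\<beta>' 0 = 0" and ex: "\<And>n. \<exists>C\<ge>0. \<forall>q>0.
     norm (cos_twist q - 4 * L_form f (1 / 2) - (\<Sum>k=1..n. \<beta> k * of_real ((1 / real q) ^ k))) \<le> C * (1 / real q) ^ Suc n \<and>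
     norm (sin_twist q - (\<Sum>k=1..n. \<beta>' k * of_real ((1 / real q) ^ k))) \<le> C * (1 / real q) ^ Suc n"
    using twist_expansion by blast
  obtain c where c: "\<And>N C q E. C \<ge> 0 \<Longrightarrow> q > 0 \<Longrightarrow>
      norm (E - (\<Sum>k=1..(N + 1) div 2. \<beta> k * of_real ((1 / real q) ^ k))) \<le> C * (1 / real q) ^ Suc ((N + 1) div 2) \<Longrightarrow>
      norm ((of_nat q - 1) / (2 * of_real (sqrt (real q))) * E - (\<Sum>n=1..N. c n * of_real (real q powr (- real n / 2))))
        \<le> (C + norm (\<beta> ((N + 1) div 2))) * real q powr (- (real N + 1) / 2)"
    using half_power_expansion_powr[of \<beta>, OF \<beta>(1)] by blast
  obtain c' where c': "\<And>N C q E. C \<ge> 0 \<Longrightarrow> q > 0 \<Longrightarrow>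
      norm (E - (\<Sum>k=1..(N + 1) div 2. \<beta>' k * of_real ((1 / real q) ^ k))) \<le> C * (1 / real q) ^ Suc ((N + 1) div 2) \<Longrightarrow>
      norm ((of_nat q - 1) / (2 * of_real (sqrt (real q))) * E - (\<Sum>n=1..N. c' n * of_real (real q powr (- real n / 2))))
        \<le> (C + norm (\<beta>' ((N + 1) div 2))) * real q powr (- (real N + 1) / 2)"
    using half_power_expansion_powr[of \<beta>', OF \<beta>(2)] by blast
  show ?thesis
  proof (rule exI[of _ c], rule exI[of _ c'], intro allI impI)
    fix N :: nat
    define n where "n = (N + 1) div 2"
    obtain C where C: "C \<ge> 0"
      "\<And>q. q > 0 \<Longrightarrow> norm (cos_twist q - 4 * L_form f (1 / 2) - (\<Sum>k=1..n. \<beta> k * of_real ((1 / real q) ^ k))) \<le> C * (1 / real q) ^ Suc n"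
      "\<And>q. q > 0 \<Longrightarrow> norm (sin_twist q - (\<Sum>k=1..n. \<beta>' k * of_real ((1 / real q) ^ k))) \<le> C * (1 / real q) ^ Suc n"
      using ex[of n] by blast
    define D where "D = C + norm (\<beta> n) + norm (\<beta>' n)"
    show "\<exists>C::real. \<forall>q::nat. prime q \<and> odd q \<longrightarrow>
      norm ((\<Sum>\<xi>\<in>even_primitive_chars q.
               gauss_sum q \<xi> / of_real (sqrt (real q)) * L_twist f (conj_char \<xi>) (1/2))
            - (2 * L_form f (1/2) * of_real (sqrt (real q))
               - hecke_eigenvalue f q * L_form f (1/2)
               + (\<Sum>n = 1..N. c n * of_real (real q powr (- real n / 2)))))
        \<le> C * real q powr (- (real N + 1) / 2) \<and>
      norm ((\<Sum>\<xi>\<in>odd_primitive_chars q.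
               gauss_sum q \<xi> / of_real (sqrt (real q)) * L_twist f (conj_char \<xi>) (1/2))
            - (\<Sum>n = 1..N. c' n * of_real (real q powr (- real n / 2))))
        \<le> C * real q powr (- (real N + 1) / 2)"
    proof (intro exI[of _ D] allI impI conjI)
      fix q :: nat assume "prime q \<and> odd q"
      hence q: "prime q" by simp
      have q0: "q > 0" using q prime_gt_0_nat by blast
      define r where "r = complex_of_real (sqrt (real q))"
      have r: "r \<noteq> 0" "r * r = of_nat q" using q0 by (auto simp: r_def simp flip: of_real_mult)
      define L where "L = L_form f (1 / 2)"
      define S where "S = (\<Sum>n = 1..N. c n * complex_of_real (real q powr (- real n / 2)))"
      have "(\<Sum>\<xi>\<in>even_primitive_chars q.
               gauss_sum q \<xi> / of_real (sqrt (real q)) * L_twist f (conj_char \<xi>) (1/2))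
            - (2 * L_form f (1/2) * of_real (sqrt (real q)) - l q * L_form f (1/2) + S) =
          (of_nat q - 1) / (2 * r) * (cos_twist q - 4 * L) - S"
      proof -
        \<comment> \<open>Splitting 4 L off the cosine twist yields 2 L r - 2 L / r, and the second
          part cancels the 2 L / r of \<open>even_moment\<close>.\<close>
        have "(r * r - 1) / (2 * r) * cos_twist q + 2 * L / r - l q * L - (2 * L * r - l q * L + S) =
          (r * r - 1) / (2 * r) * (cos_twist q - 4 * L) - S"
          using r(1) by (simp add: field_simps)
        thus ?thesis unfolding even_moment[OF q] r(2) by (simp only: L_def r_def)
      qed
      moreover have "norm ((of_nat q - 1) / (2 * r) * (cos_twist q - 4 * L) - S)
          \<le> (C + norm (\<beta> n)) * real q powr (- (real N + 1) / 2)"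
        unfolding r_def L_def n_def S_def by (rule c[OF C(1) q0]) (use C(2)[OF q0] in \<open>simp only: n_def\<close>)
      moreover have "(C + norm (\<beta> n)) * real q powr (- (real N + 1) / 2) \<le> D * real q powr (- (real N + 1) / 2)"
        by (intro mult_right_mono) (auto simp: D_def)
      ultimately show "norm ((\<Sum>\<xi>\<in>even_primitive_chars q.
               gauss_sum q \<xi> / of_real (sqrt (real q)) * L_twist f (conj_char \<xi>) (1/2))
            - (2 * L_form f (1/2) * of_real (sqrt (real q))
               - hecke_eigenvalue f q * L_form f (1/2)
               + (\<Sum>n = 1..N. c n * of_real (real q powr (- real n / 2)))))
        \<le> D * real q powr (- (real N + 1) / 2)"
        unfolding S_def[symmetric] by (simp only: order.trans)
      have "norm ((of_nat q - 1) / (2 * r) * sin_twist q - (\<Sum>n=1..N. c' n * of_real (real q powr (- real n / 2))))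
          \<le> (C + norm (\<beta>' n)) * real q powr (- (real N + 1) / 2)"
        unfolding r_def n_def by (rule c'[OF C(1) q0]) (use C(3)[OF q0] in \<open>simp only: n_def\<close>)
      also have "\<dots> \<le> D * real q powr (- (real N + 1) / 2)"
        by (intro mult_right_mono) (auto simp: D_def)
      finally show "norm ((\<Sum>\<xi>\<in>odd_primitive_chars q.
               gauss_sum q \<xi> / of_real (sqrt (real q)) * L_twist f (conj_char \<xi>) (1/2))
            - (\<Sum>n = 1..N. c' n * of_real (real q powr (- real n / 2))))
        \<le> D * real q powr (- (real N + 1) / 2)"
        unfolding odd_moment[OF q] by (simp only: r_def)
    qed
  qed
qed

end
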